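(* Let $\varphi\in\mathcal{C}$, $K,L\in\mathcal{K}_o^n$, $1\leq j\leq n$ and $T\in SL(n)$. Then $$\Phi_{\varphi,n-j}(TK,TL)=\Phi_{\varphi,n-j}(K,L).$$
   Context: $\mathcal{K}_o^n$ is the class of all compact convex subsets of $\mathbb{R}^n$ containing the origin in their interior. $h_K(x)=\sup_{y\in K}\langle x,y\rangle$ is the support function of $K$. $\mathcal{C}$ is the class of all increasing convex functions $\varphi:[0,\infty)\to[0,\infty)$ with $\varphi(0)=0$ and $\varphi(1)=1$. $SL(n)$ is the group of real linear transformations of $\mathbb{R}^n$ with determinant $1$. $G_{n,j}$ is the Grassmannian of $j$-dimensional linear subspaces of $\mathbb{R}^n$, $\nu_{n,j}$ its Haar (rotation-invariant) probability measure, $K|\xi$ the orthogonal projection of $K$ onto $\xi\in G_{n,j}$, $\mathrm{vol}_j$ the $j$-dimensional volume, and $\omega_i$ the volume of the Euclidean unit ball of $\mathbb{R}^i$. Orlicz mixed volume: for $\xi\in G_{n,j}$ and compact convex sets $A,B\subset\xi$ containing the origin in their interior relative to $\xi$, $$V_\varphi^{(j)}(A,B)=\frac1j\int_{\mathbb{S}^{n-1}\cap\xi}\varphi\left(\frac{h_B(u)}{h_A(u)}\right)h_A(u)\,dS_\xi(A,u),$$ where $S_\xi(A,\cdot)$ is the surface area measure of $A$ as a convex body in $\xi\cong\mathbb{R}^j$ (for $j=1$ it is the counting measure on the two unit vectors of $\xi$). Orlicz mixed affine quermassintegrals: for $K,L\in\mathcal{K}_o^n$, $\varphi\in\mathcal{C}$,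 $1\le j\le n$, $$\Phi_{\varphi,n-j}(K,L)=\frac{\omega_n}{\omega_j}\left(\int_{G_{n,j}}V_\varphi^{(j)}(K|\xi,L|\xi)\,\mathrm{vol}_j(K|\xi)^{-n-1}\,d\nu_{n,j}(\xi)\right)^{-1/n}.$$ If the integral vanishes, this is read as $+\infty$. *)

theory Defs
  imports "HOL-Analysis.Analysis" "HOL-Probability.Probability_Measure"
begin

definition origin_bodies :: "'a::euclidean_space set set" where
  "origin_bodies = {K. compact K \<and> convex K \<and> 0 \<in> interior K}"

(* Functions [0,\<infinity>) \<rightarrow> [0,\<infinity>) are represented by functions on the reals whose values
   at negative arguments are irrelevant; "increasing" is meant in the weak sense. *)
definition orlicz_functions :: "(real \<Rightarrow> real) set" where
  "orlicz_functions = {\<phi>. \<phi> ` {0..} \<subseteq> {0..} \<and> mono_on {0..} \<phi> \<and> convex_on {0..} \<phi>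
      \<and> \<phi> 0 = 0 \<and> \<phi> 1 = 1}"

definition special_linear :: "(real^'n \<Rightarrow> real^'n) set" where
  "special_linear = {T. linear T \<and> det (matrix T) = 1}"

definition rotations :: "(real^'n \<Rightarrow> real^'n) set" where
  "rotations = {\<rho>. orthogonal_transformation \<rho> \<and> det (matrix \<rho>) = 1}"

definition support_fun :: "'a::euclidean_space set \<Rightarrow> 'a \<Rightarrow> real" where
  "support_fun K x = (SUP y\<in>K. x \<bullet> y)"

(* On a subspace the nearest-point map is the orthogonal projection. *)
definition body_proj :: "'a::euclidean_space set \<Rightarrow> 'a set \<Rightarrow> 'a set" where
  "body_proj K \<xi> = closest_point \<xi> ` K"

(* Lebesgue measure of a linear subspace, in coordinates with respect to an orthonormal
   basis (cf. lborel_def). By rotation invariance the choice of the basis is immaterial. *)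
definition lborel_on :: "'a::euclidean_space set \<Rightarrow> 'a measure" where
  "lborel_on \<xi> =
    (let B = SOME B. B \<subseteq> \<xi> \<and> pairwise orthogonal B \<and> (\<forall>b\<in>B. norm b = 1) \<and> span B = \<xi>
     in distr (\<Pi>\<^sub>M b\<in>B. lborel) borel (\<lambda>f. \<Sum>b\<in>B. f b *\<^sub>R b))"

(* s-dimensional Hausdorff outer measure, normalized so that it agrees with Lebesgue outer
   measure on s-dimensional subspaces. The empty set is treated separately because 0 ^ 0 = 1;
   for s = 0 this yields the counting measure. *)
definition hausdorff_outer :: "nat \<Rightarrow> 'a::metric_space set \<Rightarrow> ennreal" where
  "hausdorff_outer s A =
    (SUP \<delta>\<in>{0<..}. INF U\<in>{U :: nat \<Rightarrow> 'a set. A \<subseteq> (\<Union>i. U i) \<and>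
                                  (\<forall>i. bounded (U i) \<and> diameter (U i) \<le> \<delta>)}.
       \<Sum>i. if U i = {} then 0
            else ennreal (unit_ball_vol (real s) * (diameter (U i) / 2) ^ s))"

(* Points of the boundary of A relative to \<xi> (for A with non-empty interior in \<xi>)
   at which some u \<in> \<omega> is an outer normal vector. *)
definition reverse_spherical_image :: "'a::euclidean_space set \<Rightarrow> 'a set \<Rightarrow> 'a set" where
  "reverse_spherical_image A \<omega> = {x \<in> rel_frontier A. \<exists>u\<in>\<omega>. u \<bullet> x = support_fun A u}"

definition surface_area_measure :: "'a::euclidean_space set \<Rightarrow> 'a set \<Rightarrow> 'a measure" where
  "surface_area_measure \<xi> A =
    measure_of (sphere 0 1 \<inter> \<xi>) (sets (restrict_space borel (sphere 0 1 \<inter> \<xi>)))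
      (\<lambda>\<omega>. hausdorff_outer (dim \<xi> - 1) (reverse_spherical_image A \<omega>))"

definition orlicz_mixed_volume ::
    "(real \<Rightarrow> real) \<Rightarrow> 'a::euclidean_space set \<Rightarrow> 'a set \<Rightarrow> 'a set \<Rightarrow> ennreal" where
  "orlicz_mixed_volume \<phi> \<xi> A B =
    ennreal (1 / real (dim \<xi>)) *
    (\<integral>\<^sup>+ u. ennreal (\<phi> (support_fun B u / support_fun A u) * support_fun A u)
       \<partial>surface_area_measure \<xi> A)"

definition grassmannian :: "nat \<Rightarrow> (real^'n) set set" where
  "grassmannian j = {\<xi>. subspace \<xi> \<and> dim \<xi> = j}"

(* The Borel sets for the usual topology of the Grassmannian, which is the one induced by
   identifying a subspace with the matrix of the orthogonal projection onto it. *)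
definition grassmannian_borel :: "nat \<Rightarrow> (real^'n) set measure" where
  "grassmannian_borel j =
    vimage_algebra (grassmannian j) (\<lambda>\<xi>. matrix (closest_point \<xi>)) (borel :: (real^'n^'n) measure)"

(* The unique rotation-invariant Borel probability measure, for j \<le> CARD('n). *)
definition grassmannian_haar :: "nat \<Rightarrow> (real^'n) set measure" where
  "grassmannian_haar j =
    (THE \<nu>. prob_space \<nu> \<and> sets \<nu> = sets (grassmannian_borel j) \<and>
       (\<forall>\<rho>\<in>rotations. distr \<nu> \<nu> ((`) \<rho>) = \<nu>))"

(* The quantity with index n - j, where n = CARD('n). The integrand is non-negative,
   so the integral is taken in [0,\<infinity>]. *)
definition orlicz_affine_quermass ::
    "(real \<Rightarrow> real) \<Rightarrow> nat \<Rightarrow> (real^'n) set \<Rightarrow> (real^'n) set \<Rightarrow> ennreal" where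
  "orlicz_affine_quermass \<phi> j K L =
    (let n = real CARD('n);
         I = (\<integral>\<^sup>+ \<xi>. orlicz_mixed_volume \<phi> \<xi> (body_proj K \<xi>) (body_proj L \<xi>) *
                ennreal (measure (lborel_on \<xi>) (body_proj K \<xi>) powr (- n - 1))
                \<partial>grassmannian_haar j)
     in if I = 0 then \<infinity>
        else ennreal (unit_ball_vol n / unit_ball_vol (real j) * enn2real I powr (- 1 / n)))"

end

theory Submission
  imports Defs
begin

text \<open>
  Let \<open>n\<close> be the dimension of the space and \<open>T\<close> a linear map of determinant 1 with adjoint \<open>T'\<close>. For
  a \<open>j\<close>-dimensional subspace \<open>V\<close> let \<open>F K L V\<close> be the integrand in the definition of the
  quermassintegral, and let \<open>D V\<close> be the factor by which \<open>T'\<close> multiplies \<open>j\<close>-dimensional volume on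
  \<open>V\<close>. The theorem results from two transformation rules with the same factor \<open>(1 / D V) ^ n\<close>.

  The first rule is \<open>F (T ` K) (T ` L) V = (1 / D V) ^ n * F K L (T' ` V)\<close>. Let \<open>g\<close> be the map \<open>T\<close>,
  restricted to \<open>T' ` V\<close> and followed by the projection onto \<open>V\<close>. The projection of \<open>T ` K\<close> onto \<open>V\<close>
  is the image of the projection of \<open>K\<close> onto \<open>T' ` V\<close> under \<open>g\<close> (\<open>body_proj_linear_image\<close>). As \<open>g\<close> is the
  adjoint of \<open>T'\<close> as a map from \<open>V\<close> to \<open>T' ` V\<close>, it has the same volume factor \<open>D V\<close>
  (\<open>vol_factor_projected_adjoint\<close>). The Orlicz mixed volume scales under linear maps exactly as volume does
  (\<open>orlicz_mixed_volume_linear_image\<close>), so \<open>F\<close> is multiplied by \<open>D V * D V powr (- n - 1)\<close>.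

  The scaling of the mixed volume is seen on the boundary of a convex body \<open>A\<close>. Boundary points with more than
  one normal are null for Hausdorff measure (\<open>singular_null\<close>). Near a point with a unique normal \<open>u\<close> the
  boundary is almost flat, and \<open>g\<close> multiplies its area by the volume factor of \<open>g\<close> on the hyperplane
  orthogonal to \<open>u\<close>, which is the volume factor of \<open>g\<close> times the length of the normal \<open>u'\<close> of \<open>g ` A\<close>
  with \<open>u' \<bullet> g y = u \<bullet> y\<close> for all \<open>y\<close> (\<open>local_image_estimate\<close>). Support functions have the same values at
  \<open>u\<close> and \<open>u'\<close>; normalizing \<open>u'\<close> divides the integrand by its length, which cancels. Covering arguments
  give an inequality, and the inverse of \<open>g\<close> gives the converse.

  The second rule is that \<open>(1 / D V) ^ n\<close> is the Jacobian of \<open>V \<mapsto> T' ` V\<close> for the rotation-invariant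
  measure (\<open>grassmannian_change_of_variables\<close>). This measure is unique because it is uniformly distributed,
  and it is the distribution of the span of \<open>j\<close> random vectors (\<open>grassmannian_haar_eq\<close>). For the span of a
  frame the claim reduces to linear substitutions in the space of matrices (\<open>frame_integrand_integral\<close>).

  Since the integral of a nonnegative function is the supremum of integrals of simple functions, the two rules
  show first that the integral for \<open>K\<close> and \<open>L\<close> is at most the one for \<open>T ` K\<close> and \<open>T ` L\<close>
  (\<open>quermass_integral_linear_image_le\<close>). The inverse of \<open>T\<close> has determinant 1 as well, whence equality.
\<close>


section \<open>Translation-invariant measures on a subspace\<close>

lemma borel_measurable_indicator_cball[measurable]:
  "indicator (cball a r) \<in> borel_measurable (borel :: 'a::metric_space measure)"
  by (rule borel_measurable_indicator) simp

text \<open>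
  These properties determine a measure up to a constant factor. Finiteness on balls provides the
  sigma-finiteness that Fubini's theorem asks for.
\<close>

definition invariant_on :: "'a::euclidean_space set \<Rightarrow> 'a measure \<Rightarrow> bool" where
  "invariant_on V \<mu> \<longleftrightarrow> sets \<mu> = sets borel \<and> emeasure \<mu> (- V) = 0
     \<and> (\<forall>v\<in>V. \<forall>f\<in>borel_measurable borel. (\<integral>\<^sup>+x. f (v + x) \<partial>\<mu> :: ennreal) = (\<integral>\<^sup>+x. f x \<partial>\<mu>))
     \<and> (\<forall>r. emeasure \<mu> (cball 0 r) < \<infinity>)"

lemma invariant_onD:
  assumes "invariant_on V \<mu>"
  shows "sets \<mu> = sets borel" "space \<mu> = UNIV" "emeasure \<mu> (- V) = 0"
    "\<And>v f. v \<in> V \<Longrightarrow> f \<in> borel_measurable borel \<Longrightarrow> (\<integral>\<^sup>+x. f (v + x) \<partial>\<mu> :: ennreal) = (\<integral>\<^sup>+x. f x \<partial>\<mu>)"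
    "\<And>r. emeasure \<mu> (cball 0 r) < \<infinity>"
  using assms sets_eq_imp_space_eq[of \<mu> borel] by (auto simp: invariant_on_def)

lemma borel_subspace: "subspace V \<Longrightarrow> V \<in> sets borel"
  for V :: "'a::euclidean_space set"
  by (simp add: borel_closed closed_subspace)

lemma invariant_on_AE:
  assumes "invariant_on V \<mu>" "subspace V"
  shows "AE x in \<mu>. x \<in> V"
  by (rule AE_I[of _ _ "- V"])
    (use invariant_onD[OF assms(1)] borel_subspace[OF assms(2)] in auto)

lemma sigma_finite_invariant_on:
  assumes "invariant_on V \<mu>"
  shows "sigma_finite_measure \<mu>"
proof
  show "\<exists>A. countable A \<and> A \<subseteq> sets \<mu> \<and> \<Union> A = space \<mu> \<and> (\<forall>a\<in>A. emeasure \<mu> a \<noteq> \<infinity>)"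
  proof (rule exI[of _ "range (\<lambda>n::nat. cball 0 (real n))"], intro conjI)
    show "\<Union> (range (\<lambda>n::nat. cball (0::'a) (real n))) = space \<mu>"
      using invariant_onD(2)[OF assms] real_arch_simple by fastforce
  qed (use invariant_onD[OF assms] in \<open>auto simp: less_top\<close>)
qed

text \<open>
  The double integral of \<open>q y * f (y + x)\<close>, where \<open>q\<close> is the indicator of
  the unit ball, is computed in two ways: translating in \<open>x\<close> gives the left-hand side,
  while translating in \<open>y\<close> and using the symmetry of \<open>q\<close> gives the
  right-hand side. In this form the proportionality of the two measures needs no division.
\<close>

lemma invariant_on_unique:
  fixes f :: "'a::euclidean_space \<Rightarrow> ennreal"
  assumes V: "subspace V" and \<mu>: "invariant_on V \<mu>" and \<nu>: "invariant_on V \<nu>"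
    and f[measurable]: "f \<in> borel_measurable borel"
  shows "emeasure \<mu> (cball 0 1) * (\<integral>\<^sup>+x. f x \<partial>\<nu>) = emeasure \<nu> (cball 0 1) * (\<integral>\<^sup>+x. f x \<partial>\<mu>)"
proof -
  note [measurable_cong] = invariant_onD(1)[OF \<mu>] invariant_onD(1)[OF \<nu>]
  interpret m: sigma_finite_measure \<mu> by (rule sigma_finite_invariant_on[OF \<mu>])
  interpret n: sigma_finite_measure \<nu> by (rule sigma_finite_invariant_on[OF \<nu>])
  interpret mn: pair_sigma_finite \<mu> \<nu> ..
  interpret nm: pair_sigma_finite \<nu> \<mu> ..
  define q :: "'a \<Rightarrow> ennreal" where "q = indicator (cball 0 1)"
  have [measurable]: "q \<in> borel_measurable borel" by (simp add: q_def borel_measurable_indicator_cball)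
  have q_minus: "q (- x) = q x" for x by (simp add: q_def indicator_def)
  have "emeasure \<mu> (cball 0 1) * (\<integral>\<^sup>+x. f x \<partial>\<nu>) = (\<integral>\<^sup>+y. q y * (\<integral>\<^sup>+x. f x \<partial>\<nu>) \<partial>\<mu>)"
    by (subst nn_integral_multc) (auto simp: q_def nn_integral_indicator[of "cball 0 1" \<mu>] invariant_onD(1)[OF \<mu>] intro!: borel_measurable_indicator)
  also have "\<dots> = (\<integral>\<^sup>+y. (\<integral>\<^sup>+x. q y * f (y + x) \<partial>\<nu>) \<partial>\<mu>)"
    using invariant_on_AE[OF \<mu> V]
    by (intro nn_integral_cong_AE) (auto simp: nn_integral_cmult invariant_onD(4)[OF \<nu> _ f])
  also have "\<dots> = (\<integral>\<^sup>+x. (\<integral>\<^sup>+y. q y * f (y + x) \<partial>\<mu>) \<partial>\<nu>)"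
    by (rule nm.Fubini') measurable
  also have "\<dots> = (\<integral>\<^sup>+x. (\<integral>\<^sup>+y. q (y - x) * f y \<partial>\<mu>) \<partial>\<nu>)"
  proof (intro nn_integral_cong_AE, use invariant_on_AE[OF \<nu> V] in eventually_elim)
    fix x assume "x \<in> V"
    from invariant_onD(4)[OF \<mu> this, of "\<lambda>y. q (y - x) * f y"]
    show "(\<integral>\<^sup>+y. q y * f (y + x) \<partial>\<mu>) = (\<integral>\<^sup>+y. q (y - x) * f y \<partial>\<mu>)"
      by (simp add: add.commute)
  qed
  also have "\<dots> = (\<integral>\<^sup>+y. (\<integral>\<^sup>+x. q (y - x) * f y \<partial>\<nu>) \<partial>\<mu>)"
    by (rule mn.Fubini') measurable
  also have "\<dots> = (\<integral>\<^sup>+y. emeasure \<nu> (cball 0 1) * f y \<partial>\<mu>)"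
  proof (intro nn_integral_cong_AE, use invariant_on_AE[OF \<mu> V] in eventually_elim)
    fix y assume "y \<in> V"
    then have "- y \<in> V" using V by (simp add: subspace_neg)
    have "(\<integral>\<^sup>+x. q (y - x) * f y \<partial>\<nu>) = (\<integral>\<^sup>+x. q (- y + x) \<partial>\<nu>) * f y"
      by (subst nn_integral_multc) (auto simp: q_minus[of "y - _", symmetric])
    also have "\<dots> = (\<integral>\<^sup>+x. q x \<partial>\<nu>) * f y"
      by (subst invariant_onD(4)[OF \<nu> \<open>- y \<in> V\<close>]) auto
    also have "(\<integral>\<^sup>+x. q x \<partial>\<nu>) = emeasure \<nu> (cball 0 1)"
      by (simp add: q_def invariant_onD(1)[OF \<nu>])
    finally show "(\<integral>\<^sup>+x. q (y - x) * f y \<partial>\<nu>) = emeasure \<nu> (cball 0 1) * f y" .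
  qed
  finally show ?thesis by (simp add: nn_integral_cmult)
qed


section \<open>Lebesgue measure on a subspace\<close>

definition orthonormal_basis_of :: "'a::euclidean_space set \<Rightarrow> 'a set \<Rightarrow> bool" where
  "orthonormal_basis_of V B \<longleftrightarrow> B \<subseteq> V \<and> pairwise orthogonal B \<and> (\<forall>b\<in>B. norm b = 1) \<and> span B = V"

definition coord_measure :: "'a::euclidean_space set \<Rightarrow> 'a measure" where
  "coord_measure B = distr (\<Pi>\<^sub>M b\<in>B. lborel) borel (\<lambda>f. \<Sum>b\<in>B. f b *\<^sub>R b)"

lemma orthonormal_basis_ofD:
  assumes "orthonormal_basis_of V B"
  shows "finite B" "independent B" "card B = dim V" "subspace V" "B \<subseteq> V" "span B = V"
    "\<And>b. b \<in> B \<Longrightarrow> norm b = 1" "\<And>b. b \<in> B \<Longrightarrow> b \<bullet> b = 1"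
    "\<And>a b. a \<in> B \<Longrightarrow> b \<in> B \<Longrightarrow> a \<noteq> b \<Longrightarrow> a \<bullet> b = 0"
proof -
  have *: "B \<subseteq> V" "pairwise orthogonal B" "\<forall>b\<in>B. norm b = 1" "span B = V"
    using assms by (auto simp: orthonormal_basis_of_def)
  show "independent B"
    using * by (intro pairwise_orthogonal_independent) auto
  then show "finite B" "card B = dim V"
    using * independent_imp_finite by (auto simp: dim_span_eq_card_independent[symmetric])
  show "subspace V" using * subspace_span by metis
  show "B \<subseteq> V" "span B = V" "\<And>b. b \<in> B \<Longrightarrow> norm b = 1" using * by auto
  then show "b \<bullet> b = 1" if "b \<in> B" for b
    using that by (simp add: norm_eq_1)
  show "a \<bullet> b = 0" if "a \<in> B" "b \<in> B" "a \<noteq> b" for a b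
    using * that by (auto simp: pairwise_def orthogonal_def)
qed

lemma orthonormal_basis_of_exists:
  assumes "subspace V"
  obtains B where "orthonormal_basis_of V B"
  by (rule orthonormal_basis_subspace[OF assms]) (auto simp: orthonormal_basis_of_def intro: that)

lemma orthonormal_basis_of_expand:
  assumes "orthonormal_basis_of V B" "v \<in> V"
  shows "v = (\<Sum>b\<in>B. (v \<bullet> b) *\<^sub>R b)"
proof -
  have "v \<in> span B" using assms orthonormal_basis_ofD(6) by blast
  then obtain u where u: "v = (\<Sum>b\<in>B. u b *\<^sub>R b)"
    using orthonormal_basis_ofD(1)[OF assms(1)] by (auto simp: span_finite)
  have "v \<bullet> b = u b" if "b \<in> B" for b
  proof -
    have "v \<bullet> b = (\<Sum>c\<in>B. if c = b then u b else 0)"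
      unfolding u inner_sum_left
      using orthonormal_basis_ofD(8,9)[OF assms(1)] that by (intro sum.cong) auto
    then show ?thesis using that orthonormal_basis_ofD(1)[OF assms(1)] by simp
  qed
  then show ?thesis using u by simp
qed

lemma nn_integral_coord_measure:
  assumes [measurable]: "f \<in> borel_measurable borel"
  shows "(\<integral>\<^sup>+x. f x \<partial>coord_measure B) = (\<integral>\<^sup>+g. f (\<Sum>b\<in>B. g b *\<^sub>R b) \<partial>(\<Pi>\<^sub>M b\<in>B. lborel))"
  unfolding coord_measure_def by (subst nn_integral_distr) auto

lemma sets_coord_measure[simp, measurable_cong]: "sets (coord_measure B) = sets borel"
  and space_coord_measure[simp]: "space (coord_measure B) = UNIV"
  by (auto simp: coord_measure_def)

lemma norm_coord_sum:
  assumes "orthonormal_basis_of V B"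
  shows "norm (\<Sum>b\<in>B. g b *\<^sub>R b) = sqrt (\<Sum>b\<in>B. (g b)\<^sup>2)"
proof -
  note D = orthonormal_basis_ofD[OF assms]
  have "(norm (\<Sum>b\<in>B. g b *\<^sub>R b))\<^sup>2 = (\<Sum>b\<in>B. (norm (g b *\<^sub>R b))\<^sup>2)"
    using D by (intro norm_sum_Pythagorean) (auto simp: pairwise_def orthogonal_def)
  also have "\<dots> = (\<Sum>b\<in>B. (g b)\<^sup>2)"
    using D by (intro sum.cong) auto
  finally show ?thesis
    by (metis norm_ge_zero real_sqrt_unique)
qed

lemma emeasure_coord_measure_cball:
  assumes "orthonormal_basis_of V B" "r > 0"
  shows "emeasure (coord_measure B) (cball 0 r) = ennreal (unit_ball_vol (dim V) * r ^ dim V)"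
proof -
  note D = orthonormal_basis_ofD[OF assms(1)]
  have "emeasure (coord_measure B) (cball 0 r) =
     emeasure (\<Pi>\<^sub>M b\<in>B. lborel) ((\<lambda>f. \<Sum>b\<in>B. f b *\<^sub>R b) -` cball 0 r \<inter> space (\<Pi>\<^sub>M b\<in>B. lborel))"
    unfolding coord_measure_def by (rule emeasure_distr) auto
  also have "(\<lambda>f. \<Sum>b\<in>B. f b *\<^sub>R b) -` cball 0 r \<inter> space (\<Pi>\<^sub>M b\<in>B. lborel) =
      {f. sqrt (\<Sum>i\<in>B. (f i)\<^sup>2) \<le> r} \<inter> space (Pi\<^sub>M B (\<lambda>_. lborel))"
    by (auto simp: norm_coord_sum[OF assms(1)])
  finally show ?thesis using emeasure_cball_aux[OF D(1) assms(2)] D(3) by simp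
qed

lemma PiM_lborel_translate:
  assumes "finite B" and f[measurable]: "f \<in> borel_measurable (Pi\<^sub>M B (\<lambda>_. lborel :: real measure))"
  shows "(\<integral>\<^sup>+g. f (\<lambda>b\<in>B. c b + g b) \<partial>(\<Pi>\<^sub>M b\<in>B. lborel)) = (\<integral>\<^sup>+g. f g \<partial>(\<Pi>\<^sub>M b\<in>B. lborel) :: ennreal)"
proof -
  interpret product_sigma_finite "\<lambda>_. lborel :: real measure" by standard
  have m: "(\<lambda>g. \<lambda>b\<in>B. c b + g b) \<in> Pi\<^sub>M B (\<lambda>_. lborel) \<rightarrow>\<^sub>M Pi\<^sub>M B (\<lambda>_. lborel)"
    by (rule measurable_restrict) measurable
  have "distr (Pi\<^sub>M B (\<lambda>_. lborel)) (Pi\<^sub>M B (\<lambda>_. lborel)) (\<lambda>g. \<lambda>b\<in>B. c b + g b) = Pi\<^sub>M B (\<lambda>_. lborel)"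
  proof (rule PiM_eqI[OF assms(1)])
    fix A :: "'a \<Rightarrow> real set" assume A: "\<And>i. i \<in> B \<Longrightarrow> A i \<in> sets lborel"
    have "emeasure (distr (Pi\<^sub>M B (\<lambda>_. lborel)) (Pi\<^sub>M B (\<lambda>_. lborel)) (\<lambda>g. \<lambda>b\<in>B. c b + g b)) (Pi\<^sub>E B A)
       = emeasure (Pi\<^sub>M B (\<lambda>_. lborel)) ((\<lambda>g. \<lambda>b\<in>B. c b + g b) -` Pi\<^sub>E B A \<inter> space (Pi\<^sub>M B (\<lambda>_. lborel)))"
      by (rule emeasure_distr[OF m]) (use A assms in \<open>auto intro!: sets_PiM_I_finite\<close>)
    also have "(\<lambda>g. \<lambda>b\<in>B. c b + g b) -` Pi\<^sub>E B A \<inter> space (Pi\<^sub>M B (\<lambda>_. lborel))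
        = Pi\<^sub>E B (\<lambda>b. (+) (c b) -` A b)"
      by (auto simp: space_PiM PiE_iff extensional_def)
    also have "emeasure (Pi\<^sub>M B (\<lambda>_. lborel)) \<dots> = (\<Prod>b\<in>B. emeasure lborel ((+) (c b) -` A b))"
      by (rule emeasure_PiM) (use A assms in \<open>auto intro!: measurable_sets_borel[of _ borel]\<close>)
    also have "\<dots> = (\<Prod>b\<in>B. emeasure lborel (A b))"
    proof (rule prod.cong[OF refl])
      fix b assume "b \<in> B"
      then have "emeasure (distr lborel borel ((+) (c b))) (A b) = emeasure lborel ((+) (c b) -` A b)"
        using A by (subst emeasure_distr) auto
      then show "emeasure lborel ((+) (c b) -` A b) = emeasure lborel (A b)"
        by (simp add: lborel_distr_plus)
    qed
    finally show "emeasure (distr (Pi\<^sub>M B (\<lambda>_. lborel)) (Pi\<^sub>M B (\<lambda>_. lborel)) (\<lambda>g. \<lambda>b\<in>B. c b + g b)) (Pi\<^sub>E B A)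
       = (\<Prod>b\<in>B. emeasure lborel (A b))" .
  qed simp
  from arg_cong[OF this, of "\<lambda>M. nn_integral M f"] show ?thesis
    by (subst (asm) nn_integral_distr[OF m]) auto
qed

lemma invariant_on_coord_measure:
  assumes "orthonormal_basis_of V B"
  shows "invariant_on V (coord_measure B)"
  unfolding invariant_on_def
proof (intro conjI ballI allI)
  note D = orthonormal_basis_ofD[OF assms]
  have V: "V \<in> sets borel" by (rule borel_subspace[OF D(4)])
  have "emeasure (coord_measure B) (- V) = emeasure (\<Pi>\<^sub>M b\<in>B. lborel)
     ((\<lambda>f. \<Sum>b\<in>B. f b *\<^sub>R b) -` (- V) \<inter> space (\<Pi>\<^sub>M b\<in>B. lborel))"
    unfolding coord_measure_def using V by (intro emeasure_distr) auto
  also have "(\<lambda>f. \<Sum>b\<in>B. f b *\<^sub>R b) -` (- V) = {}"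
    using D by (auto intro!: subspace_sum subspace_scale)
  finally show "emeasure (coord_measure B) (- V) = 0" by simp
  show "emeasure (coord_measure B) (cball 0 r) < \<infinity>" for r
  proof -
    have "emeasure (coord_measure B) (cball 0 r) \<le> emeasure (coord_measure B) (cball 0 (max r 1))"
      by (intro emeasure_mono) auto
    also have "\<dots> < \<infinity>" by (subst emeasure_coord_measure_cball[OF assms]) auto
    finally show ?thesis .
  qed
  fix v and f :: "'a \<Rightarrow> ennreal" assume v: "v \<in> V" and f[measurable]: "f \<in> borel_measurable borel"
  have "(\<integral>\<^sup>+x. f (v + x) \<partial>coord_measure B) = (\<integral>\<^sup>+g. f (v + (\<Sum>b\<in>B. g b *\<^sub>R b)) \<partial>(\<Pi>\<^sub>M b\<in>B. lborel))"
    by (rule nn_integral_coord_measure) measurable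
  also have "\<dots> = (\<integral>\<^sup>+g. f (\<Sum>b\<in>B. (\<lambda>b\<in>B. (v \<bullet> b) + g b) b *\<^sub>R b) \<partial>(\<Pi>\<^sub>M b\<in>B. lborel))"
  proof -
    have "v + (\<Sum>b\<in>B. g b *\<^sub>R b) = (\<Sum>b\<in>B. (\<lambda>b\<in>B. (v \<bullet> b) + g b) b *\<^sub>R b)" for g
    proof -
      have "(\<Sum>b\<in>B. (\<lambda>b\<in>B. (v \<bullet> b) + g b) b *\<^sub>R b) = (\<Sum>b\<in>B. (v \<bullet> b) *\<^sub>R b) + (\<Sum>b\<in>B. g b *\<^sub>R b)"
        by (simp add: scaleR_add_left sum.distrib)
      then show ?thesis using orthonormal_basis_of_expand[OF assms v] by simp
    qed
    then show ?thesis by simp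
  qed
  also have "\<dots> = (\<integral>\<^sup>+g. f (\<Sum>b\<in>B. g b *\<^sub>R b) \<partial>(\<Pi>\<^sub>M b\<in>B. lborel))"
    by (rule PiM_lborel_translate[OF D(1)]) measurable
  finally show "(\<integral>\<^sup>+x. f (v + x) \<partial>coord_measure B) = (\<integral>\<^sup>+x. f x \<partial>coord_measure B)"
    by (simp add: nn_integral_coord_measure)
qed simp

lemma ennreal_cancel_pos:
  fixes x y :: ennreal
  assumes "ennreal b * x = ennreal b * y" "b > 0"
  shows "x = y"
  using assms by (metis ennreal_mult_cancel_left ennreal_eq_0_iff ennreal_neq_top not_less)

text \<open>
  Both measures are translation invariant and give the unit ball the same positive finite mass.
\<close>

lemma coord_measure_basis_independent:
  assumes "orthonormal_basis_of V B" "orthonormal_basis_of V C"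
  shows "coord_measure B = coord_measure C"
proof (rule measure_eqI)
  fix X assume "X \<in> sets (coord_measure B)"
  then have X: "X \<in> sets borel" by simp
  from invariant_on_unique[OF orthonormal_basis_ofD(4)[OF assms(1)]
      invariant_on_coord_measure[OF assms(1)] invariant_on_coord_measure[OF assms(2)], of "indicator X"] X
  show "emeasure (coord_measure B) X = emeasure (coord_measure C) X"
    by (simp add: emeasure_coord_measure_cball[OF assms(1)] emeasure_coord_measure_cball[OF assms(2)])
      (metis ennreal_cancel_pos of_nat_0_le_iff unit_ball_vol_pos)
qed simp

lemma lborel_on_eq:
  assumes "orthonormal_basis_of V B"
  shows "lborel_on V = coord_measure B"
proof -
  let ?P = "\<lambda>B. B \<subseteq> V \<and> pairwise orthogonal B \<and> (\<forall>b\<in>B. norm b = 1) \<and> span B = V"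
  have "?P (SOME B. ?P B)"
    by (rule someI[of ?P B]) (use assms in \<open>auto simp: orthonormal_basis_of_def\<close>)
  then have "orthonormal_basis_of V (SOME B. ?P B)"
    unfolding orthonormal_basis_of_def by simp
  from coord_measure_basis_independent[OF this assms] show ?thesis
    unfolding lborel_on_def Let_def coord_measure_def .
qed

lemma invariant_on_lborel_on: "subspace V \<Longrightarrow> invariant_on V (lborel_on V)"
  by (metis lborel_on_eq orthonormal_basis_of_exists invariant_on_coord_measure)

lemma sets_lborel_on[simp, measurable_cong]: "sets (lborel_on V) = sets borel"
  and space_lborel_on[simp]: "space (lborel_on V) = UNIV"
  by (auto simp: lborel_on_def Let_def)

lemma emeasure_lborel_on_cball:
  assumes "subspace V" "r > 0"
  shows "emeasure (lborel_on V) (cball 0 r) = ennreal (unit_ball_vol (dim V) * r ^ dim V)"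
  by (metis assms lborel_on_eq orthonormal_basis_of_exists emeasure_coord_measure_cball)

lemma AE_lborel_on: "subspace V \<Longrightarrow> AE x in lborel_on V. x \<in> V"
  by (rule invariant_on_AE[OF invariant_on_lborel_on])

lemma invariant_on_lborel_on_unique:
  assumes "subspace V" "invariant_on V \<nu>" "f \<in> borel_measurable borel"
  shows "ennreal (unit_ball_vol (dim V)) * (\<integral>\<^sup>+x. f x \<partial>\<nu>)
       = emeasure \<nu> (cball 0 1) * (\<integral>\<^sup>+x. f x \<partial>lborel_on V)"
  using invariant_on_unique[OF assms(1) invariant_on_lborel_on[OF assms(1)] assms(2,3)]
  by (simp add: emeasure_lborel_on_cball[OF assms(1)])

lemma lborel_on_UNIV: "lborel_on (UNIV :: 'a::euclidean_space set) = lborel"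
proof -
  have "orthonormal_basis_of UNIV (Basis :: 'a set)"
    by (auto simp: orthonormal_basis_of_def pairwise_def orthogonal_def inner_Basis)
  from lborel_on_eq[OF this] show ?thesis
    unfolding coord_measure_def by (simp only: lborel_eq[where 'a='a, symmetric])
qed

lemma sigma_finite_lborel_on: "subspace V \<Longrightarrow> sigma_finite_measure (lborel_on V)"
  by (rule sigma_finite_invariant_on[OF invariant_on_lborel_on])

lemma orthonormal_basis_of_Un:
  assumes "orthonormal_basis_of V B" "orthonormal_basis_of W C" "\<And>v w. v \<in> V \<Longrightarrow> w \<in> W \<Longrightarrow> v \<bullet> w = 0"
  shows "orthonormal_basis_of {v + w |v w. v \<in> V \<and> w \<in> W} (B \<union> C)" "B \<inter> C = {}"
proof -
  note D = orthonormal_basis_ofD[OF assms(1)] and E = orthonormal_basis_ofD[OF assms(2)]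
  show "B \<inter> C = {}"
    using D(5,8) E(5) assms(3) by (metis disjoint_iff subsetD zero_neq_one)
  have "span (B \<union> C) = {v + w |v w. v \<in> V \<and> w \<in> W}"
    unfolding span_Un D(6) E(6) by auto
  then show "orthonormal_basis_of {v + w |v w. v \<in> V \<and> w \<in> W} (B \<union> C)"
    unfolding orthonormal_basis_of_def
  proof (intro conjI)
    show "pairwise orthogonal (B \<union> C)"
      unfolding pairwise_def orthogonal_def
    proof (intro ballI impI)
      fix x y assume "x \<in> B \<union> C" "y \<in> B \<union> C" "x \<noteq> y"
      moreover have "x \<bullet> y = 0" if "x \<in> B" "y \<in> C" for x y
        using that D(5) E(5) assms(3) by blast
      ultimately show "x \<bullet> y = 0"
        using D(9) E(9) by (metis Un_iff inner_commute)
    qed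
    show "\<forall>b\<in>B \<union> C. norm b = 1" using D(7) E(7) by blast
    show "B \<union> C \<subseteq> {v + w |v w. v \<in> V \<and> w \<in> W}"
      using span_superset[of "B \<union> C"] \<open>span (B \<union> C) = _\<close> by simp
  qed
qed

text \<open>
  The union of orthonormal bases of two orthogonal subspaces is an orthonormal basis of their sum,
  so this is Fubini's theorem in coordinates.
\<close>

lemma nn_integral_lborel_on_sum:
  assumes V: "subspace V" and W: "subspace W" and orth: "\<And>v w. v \<in> V \<Longrightarrow> w \<in> W \<Longrightarrow> v \<bullet> w = 0"
    and f[measurable]: "f \<in> borel_measurable borel"
  shows "(\<integral>\<^sup>+x. f x \<partial>lborel_on {v + w |v w. v \<in> V \<and> w \<in> W})
       = (\<integral>\<^sup>+v. (\<integral>\<^sup>+w. f (v + w) \<partial>lborel_on W) \<partial>lborel_on V)"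
proof -
  obtain B where B: "orthonormal_basis_of V B" using V by (rule orthonormal_basis_of_exists)
  obtain C where C: "orthonormal_basis_of W C" using W by (rule orthonormal_basis_of_exists)
  note U = orthonormal_basis_of_Un[OF B C orth]
  have fin: "finite B" "finite C" using B C orthonormal_basis_ofD by blast+
  interpret product_sigma_finite "\<lambda>_. lborel :: real measure" by standard
  have s: "sigma_finite_measure (coord_measure C)"
    using C sigma_finite_invariant_on invariant_on_coord_measure by blast
  have [measurable]: "(\<lambda>v. \<integral>\<^sup>+w. f (v + w) \<partial>coord_measure C) \<in> borel_measurable borel"
    by (rule sigma_finite_measure.borel_measurable_nn_integral[OF s]) measurable
  have "(\<integral>\<^sup>+x. f x \<partial>coord_measure (B \<union> C))
      = (\<integral>\<^sup>+x. \<integral>\<^sup>+y. f (\<Sum>b\<in>B \<union> C. merge B C (x, y) b *\<^sub>R b) \<partial>(\<Pi>\<^sub>M b\<in>C. lborel) \<partial>(\<Pi>\<^sub>M b\<in>B. lborel))"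
    by (simp add: nn_integral_coord_measure product_nn_integral_fold[OF U(2) fin])
  also have "\<dots> = (\<integral>\<^sup>+x. \<integral>\<^sup>+y. f ((\<Sum>b\<in>B. x b *\<^sub>R b) + (\<Sum>b\<in>C. y b *\<^sub>R b)) \<partial>(\<Pi>\<^sub>M b\<in>C. lborel) \<partial>(\<Pi>\<^sub>M b\<in>B. lborel))"
  proof -
    have "(\<Sum>b\<in>B \<union> C. merge B C (x, y) b *\<^sub>R b) = (\<Sum>b\<in>B. x b *\<^sub>R b) + (\<Sum>b\<in>C. y b *\<^sub>R b)" for x y
    proof -
      have "(\<Sum>b\<in>B. merge B C (x, y) b *\<^sub>R b) = (\<Sum>b\<in>B. x b *\<^sub>R b)"
        by (intro sum.cong) (auto simp: merge_def)
      moreover have "(\<Sum>b\<in>C. merge B C (x, y) b *\<^sub>R b) = (\<Sum>b\<in>C. y b *\<^sub>R b)"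
        using U(2) by (intro sum.cong) (auto simp: merge_def)
      ultimately show ?thesis by (simp add: sum.union_disjoint[OF fin U(2)])
    qed
    then show ?thesis by simp
  qed
  also have "\<dots> = (\<integral>\<^sup>+x. \<integral>\<^sup>+w. f ((\<Sum>b\<in>B. x b *\<^sub>R b) + w) \<partial>coord_measure C \<partial>(\<Pi>\<^sub>M b\<in>B. lborel))"
    by (simp add: nn_integral_coord_measure)
  also have "\<dots> = (\<integral>\<^sup>+v. (\<integral>\<^sup>+w. f (v + w) \<partial>coord_measure C) \<partial>coord_measure B)"
    by (rule nn_integral_coord_measure[symmetric]) measurable
  finally show ?thesis by (simp add: lborel_on_eq[OF B] lborel_on_eq[OF C] lborel_on_eq[OF U(1)])
qed

lemma nn_integral_lborel_on_line:
  assumes u: "norm u = 1" and f[measurable]: "f \<in> borel_measurable borel"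
  shows "(\<integral>\<^sup>+x. f x \<partial>lborel_on (span {u})) = (\<integral>\<^sup>+t. f (t *\<^sub>R u) \<partial>lborel)"
proof -
  have B: "orthonormal_basis_of (span {u}) {u}"
    using u by (auto simp: orthonormal_basis_of_def span_base)
  interpret product_sigma_finite "\<lambda>_. lborel :: real measure" by standard
  show ?thesis
    by (simp add: lborel_on_eq[OF B] nn_integral_coord_measure product_nn_integral_singleton[of "\<lambda>t. f (t *\<^sub>R u)"])
qed


section \<open>The volume factor of a linear map on a subspace\<close>

text \<open>
  A linear map that is injective on \<open>V\<close> multiplies volume of dimension \<open>dim
  V\<close> by a constant. The constant is read off from the unit ball of \<open>g ` V\<close> and
  its preimage in \<open>V\<close>.
\<close>

definition vol_factor :: "'a::euclidean_space set \<Rightarrow> ('a \<Rightarrow> 'b::euclidean_space) \<Rightarrow> real" where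
  "vol_factor V g = unit_ball_vol (dim V) / measure (lborel_on V) {x\<in>V. norm (g x) \<le> 1}"

lemma vol_factor_cong: "(\<And>x. x \<in> V \<Longrightarrow> g x = h x) \<Longrightarrow> vol_factor V g = vol_factor V h"
  unfolding vol_factor_def by (metis (mono_tags, lifting) Collect_cong)

lemma vol_factor_isometry:
  assumes "subspace V" "\<And>x. x \<in> V \<Longrightarrow> norm (g x) = norm x"
  shows "vol_factor V g = 1"
proof -
  have "{x\<in>V. norm (g x) \<le> 1} = V \<inter> cball 0 1" using assms by auto
  moreover have "emeasure (lborel_on V) (V \<inter> cball 0 1) = emeasure (lborel_on V) (cball 0 1)"
    using AE_lborel_on[OF assms(1)] borel_subspace[OF assms(1)] by (intro emeasure_eq_AE) auto
  ultimately have "measure (lborel_on V) {x\<in>V. norm (g x) \<le> 1} = unit_ball_vol (dim V)"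
    using assms(1) by (simp add: measure_def emeasure_lborel_on_cball less_imp_le)
  then show ?thesis by (simp add: vol_factor_def unit_ball_vol_pos less_imp_neq[symmetric])
qed

lemma linear_inj_on_iff:
  assumes "linear g" "subspace V"
  shows "inj_on g V \<longleftrightarrow> (\<forall>x\<in>V. g x = 0 \<longrightarrow> x = 0)"
  using assms linear_injective_on_subspace_0 by blast

lemma linear_inj_on_bounded_below:
  fixes g :: "'a::euclidean_space \<Rightarrow> 'b::euclidean_space"
  assumes "linear g" "subspace V" "inj_on g V"
  obtains e where "e > 0" "\<And>x. x \<in> V \<Longrightarrow> e * norm x \<le> norm (g x)"
  using injective_imp_isometric[OF closed_subspace[OF assms(2)] assms(2), of g] assms
    linear_inj_on_iff[OF assms(1,2)] linear_conv_bounded_linear by blast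

lemma borel_linear: "linear g \<Longrightarrow> g \<in> borel_measurable borel"
  for g :: "'a::euclidean_space \<Rightarrow> 'b::euclidean_space"
  by (simp add: borel_measurable_continuous_onI linear_continuous_on linear_linear)

text \<open>
  The image of Lebesgue measure on \<open>V\<close> under \<open>g\<close> is a
  translation-invariant measure on \<open>g ` V\<close>, hence a multiple of Lebesgue measure; the
  unit ball determines the multiple.
\<close>

lemma
  fixes g :: "'a::euclidean_space \<Rightarrow> 'b::euclidean_space"
  assumes g: "linear g" and V: "subspace V" and inj: "inj_on g V"
  shows vol_factor_pos: "0 < vol_factor V g"
    and nn_integral_vol_factor: "\<And>f. f \<in> borel_measurable borel \<Longrightarrow>
      (\<integral>\<^sup>+y. f y \<partial>lborel_on (g ` V)) = ennreal (vol_factor V g) * (\<integral>\<^sup>+x. f (g x) \<partial>lborel_on V)"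
proof -
  note [measurable] = borel_linear[OF g] borel_subspace[OF V]
  \<comment> \<open>the lower bound \<open>e\<close> makes the preimage of the unit ball bounded, the upper bound
    \<open>K\<close> makes it contain a ball\<close>
  obtain e where e: "e > 0" "\<And>x. x \<in> V \<Longrightarrow> e * norm x \<le> norm (g x)"
    using linear_inj_on_bounded_below[OF g V inj] by blast
  obtain K where K: "K > 0" "\<And>x. norm (g x) \<le> norm x * K"
    using g linear_conv_bounded_linear bounded_linear.pos_bounded by blast
  define S where "S = {x\<in>V. norm (g x) \<le> 1}"
  have S[measurable]: "S \<in> sets borel" unfolding S_def by measurable
  have gV: "subspace (g ` V)" by (rule linear_subspace_image[OF g V])
  have dim: "dim (g ` V) = dim V"
    using g inj V by (metis dim_image_eq span_eq_iff)
  have fin: "emeasure (lborel_on V) {x\<in>V. norm (g x) \<le> r} < \<infinity>" for r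
  proof -
    have "{x\<in>V. norm (g x) \<le> r} \<subseteq> cball 0 (r / e)"
      using e by (auto simp: field_simps) (metis dual_order.trans mult.commute)
    then have "emeasure (lborel_on V) {x\<in>V. norm (g x) \<le> r} \<le> emeasure (lborel_on V) (cball 0 (r / e))"
      by (intro emeasure_mono) auto
    then show ?thesis
      using invariant_onD(5)[OF invariant_on_lborel_on[OF V]] order_le_less_trans by blast
  qed
  have "ennreal (unit_ball_vol (dim V) * (1 / K) ^ dim V) = emeasure (lborel_on V) (cball 0 (1 / K))"
    using K by (simp add: emeasure_lborel_on_cball[OF V])
  also have "\<dots> = emeasure (lborel_on V) (V \<inter> cball 0 (1 / K))"
    using AE_lborel_on[OF V] by (intro emeasure_eq_AE) auto
  also have "\<dots> \<le> emeasure (lborel_on V) S"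
  proof (intro emeasure_mono subsetI)
    fix x assume x: "x \<in> V \<inter> cball 0 (1 / K)"
    then have "norm x * K \<le> 1" using K(1) by (simp add: field_simps)
    then show "x \<in> S" using x K(2)[of x] by (simp add: S_def)
  qed auto
  finally have "emeasure (lborel_on V) S > 0"
    using K by (auto simp: unit_ball_vol_pos elim!: less_le_trans[rotated])
  then have mS: "measure (lborel_on V) S > 0" "emeasure (lborel_on V) S = ennreal (measure (lborel_on V) S)"
    using fin[of 1] by (auto simp: S_def measure_def enn2real_positive_iff less_top)
  show pos: "0 < vol_factor V g" using mS by (simp add: vol_factor_def S_def)
  define \<nu> where "\<nu> = distr (lborel_on V) borel g"
  have [simp, measurable_cong]: "sets \<nu> = sets borel" by (simp add: \<nu>_def)
  have int: "(\<integral>\<^sup>+y. f y \<partial>\<nu>) = (\<integral>\<^sup>+x. f (g x) \<partial>lborel_on V)" if "f \<in> borel_measurable borel" for f :: "'b \<Rightarrow> ennreal"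
    unfolding \<nu>_def using that by (intro nn_integral_distr) auto
  have em: "emeasure \<nu> A = emeasure (lborel_on V) {x\<in>V. g x \<in> A}" if "A \<in> sets borel" for A
  proof -
    note [measurable] = that
    have "emeasure \<nu> A = emeasure (lborel_on V) (g -` A)"
      unfolding \<nu>_def using that by (subst emeasure_distr) auto
    also have "\<dots> = emeasure (lborel_on V) {x\<in>V. g x \<in> A}"
    proof (rule emeasure_eq_AE)
      show "AE x in lborel_on V. (x \<in> g -` A) = (x \<in> {x \<in> V. g x \<in> A})"
        using AE_lborel_on[OF V] by eventually_elim auto
      show "g -` A \<in> sets (lborel_on V)" using measurable_sets_borel[OF borel_linear[OF g] that] by simp
    qed measurable
    finally show ?thesis .
  qed
  have inv: "invariant_on (g ` V) \<nu>"
    unfolding invariant_on_def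
  proof (intro conjI ballI allI)
    have "{x\<in>V. g x \<in> - (g ` V)} = {}" by auto
    moreover have "- (g ` V) \<in> sets borel" using borel_subspace[OF gV] by simp
    ultimately show "emeasure \<nu> (- (g ` V)) = 0" by (simp only: em emeasure_empty)
    show "emeasure \<nu> (cball 0 r) < \<infinity>" for r
      using fin[of r] by (subst em) auto
    fix w and f :: "'b \<Rightarrow> ennreal" assume w: "w \<in> g ` V" and f[measurable]: "f \<in> borel_measurable borel"
    then obtain v where v: "v \<in> V" "w = g v" by auto
    have "(\<integral>\<^sup>+y. f (w + y) \<partial>\<nu>) = (\<integral>\<^sup>+x. f (g (v + x)) \<partial>lborel_on V)"
      using v by (subst int) (auto simp: linear_add[OF g])
    also have "\<dots> = (\<integral>\<^sup>+x. f (g x) \<partial>lborel_on V)"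
      by (rule invariant_onD(4)[OF invariant_on_lborel_on[OF V] v(1)]) measurable
    finally show "(\<integral>\<^sup>+y. f (w + y) \<partial>\<nu>) = (\<integral>\<^sup>+y. f y \<partial>\<nu>)" by (simp add: int)
  qed simp
  fix f :: "'b \<Rightarrow> ennreal" assume f: "f \<in> borel_measurable borel"
  have "ennreal (unit_ball_vol (dim V)) * (\<integral>\<^sup>+x. f (g x) \<partial>lborel_on V)
      = ennreal (measure (lborel_on V) S) * (\<integral>\<^sup>+y. f y \<partial>lborel_on (g ` V))"
    using invariant_on_lborel_on_unique[OF gV inv f] em[of "cball 0 1"] mS
    by (simp add: int[OF f] dim S_def)
  also have "ennreal (unit_ball_vol (dim V)) = ennreal (measure (lborel_on V) S) * ennreal (vol_factor V g)"
    using mS by (subst ennreal_mult[symmetric]) (auto simp: vol_factor_def S_def less_imp_le)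
  finally show "(\<integral>\<^sup>+y. f y \<partial>lborel_on (g ` V)) = ennreal (vol_factor V g) * (\<integral>\<^sup>+x. f (g x) \<partial>lborel_on V)"
    using ennreal_cancel_pos[OF _ mS(1)] by (simp add: mult.assoc)
qed

text \<open>
  The indicator of the unit ball as a test function determines the constant in a change of variables
  formula.
\<close>

lemma vol_factor_eqI:
  fixes g :: "'a::euclidean_space \<Rightarrow> 'b::euclidean_space"
  assumes g: "linear g" and V: "subspace V" and inj: "inj_on g V" and c: "c \<ge> 0"
    and eq: "\<And>f. f \<in> borel_measurable borel \<Longrightarrow>
      (\<integral>\<^sup>+y. f y \<partial>lborel_on (g ` V)) = ennreal c * (\<integral>\<^sup>+x. f (g x) \<partial>lborel_on V)"
  shows "vol_factor V g = c"
proof -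
  have gV: "subspace (g ` V)" by (rule linear_subspace_image[OF g V])
  let ?f = "indicator (cball 0 1) :: 'b \<Rightarrow> ennreal"
  let ?b = "unit_ball_vol (dim (g ` V))"
  have f: "(\<integral>\<^sup>+y. ?f y \<partial>lborel_on (g ` V)) = ennreal ?b"
    by (simp add: emeasure_lborel_on_cball[OF gV])
  have b: "?b > 0" by (simp add: unit_ball_vol_pos)
  let ?I = "\<integral>\<^sup>+x. ?f (g x) \<partial>lborel_on V"
  have 1: "ennreal (vol_factor V g) * ?I = ennreal ?b"
    using nn_integral_vol_factor[OF g V inj, of ?f] f borel_measurable_indicator_cball by simp
  have 2: "ennreal c * ?I = ennreal ?b" using eq[of ?f] f borel_measurable_indicator_cball by simp
  have "?I \<noteq> \<infinity>"
  proof
    assume "?I = \<infinity>"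
    then show False using 1 vol_factor_pos[OF g V inj] by (simp add: ennreal_mult_top)
  qed
  then obtain i where i: "i \<ge> 0" "?I = ennreal i" by (cases "?I") auto
  have "vol_factor V g * i = ?b" "c * i = ?b"
    using 1 2 i c b vol_factor_pos[OF g V inj] by (simp_all add: ennreal_mult[symmetric])
  moreover have "i \<noteq> 0" using b calculation by (metis mult_zero_right less_irrefl)
  ultimately show ?thesis by (metis mult_right_cancel)
qed

lemma vol_factor_compose:
  fixes g :: "'a::euclidean_space \<Rightarrow> 'b::euclidean_space" and h :: "'b \<Rightarrow> 'c::euclidean_space"
  assumes g: "linear g" and h: "linear h" and V: "subspace V" and inj: "inj_on g V" "inj_on h (g ` V)"
  shows "vol_factor V (\<lambda>x. h (g x)) = vol_factor (g ` V) h * vol_factor V g"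
proof (rule vol_factor_eqI)
  have gV: "subspace (g ` V)" by (rule linear_subspace_image[OF g V])
  note [measurable] = borel_linear[OF g] borel_linear[OF h]
  show "linear (\<lambda>x. h (g x))" using linear_compose[OF g h] by (simp add: o_def)
  show "inj_on (\<lambda>x. h (g x)) V" using comp_inj_on[OF inj] by (simp add: o_def)
  fix f :: "'c \<Rightarrow> ennreal" assume [measurable]: "f \<in> borel_measurable borel"
  have "(\<integral>\<^sup>+y. f y \<partial>lborel_on (h ` g ` V)) = ennreal (vol_factor (g ` V) h) * (\<integral>\<^sup>+x. f (h x) \<partial>lborel_on (g ` V))"
    by (rule nn_integral_vol_factor[OF h gV inj(2)]) auto
  also have "(\<integral>\<^sup>+x. f (h x) \<partial>lborel_on (g ` V)) = ennreal (vol_factor V g) * (\<integral>\<^sup>+x. f (h (g x)) \<partial>lborel_on V)"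
    by (rule nn_integral_vol_factor[OF g V inj(1)]) auto
  finally show "(\<integral>\<^sup>+y. f y \<partial>lborel_on ((\<lambda>x. h (g x)) ` V))
     = ennreal (vol_factor (g ` V) h * vol_factor V g) * (\<integral>\<^sup>+x. f (h (g x)) \<partial>lborel_on V)"
    using vol_factor_pos[OF g V inj(1)] vol_factor_pos[OF h gV inj(2)]
    by (simp add: ennreal_mult image_image mult.assoc)
qed (use V vol_factor_pos[OF g V inj(1)] vol_factor_pos[OF h _ inj(2)] linear_subspace_image[OF g V] in \<open>auto intro!: less_imp_le\<close>)


section \<open>Orthogonal projections onto subspaces\<close>

lemma closest_point_subspace:
  fixes S :: "'a::euclidean_space set"
  assumes S: "subspace S"
  shows closest_point_mem: "closest_point S x \<in> S"
    and closest_point_orthogonal: "y \<in> S \<Longrightarrow> (x - closest_point S x) \<bullet> y = 0"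
proof -
  have cl: "closed S" "S \<noteq> {}" "convex S"
    using S closed_subspace subspace_imp_convex subspace_0 by auto
  show mem: "closest_point S x \<in> S" by (rule closest_point_in_set[OF cl(1,2)])
  assume y: "y \<in> S"
  have "(x - closest_point S x) \<bullet> y \<le> 0"
    using closest_point_dot[OF cl(3,1), of "closest_point S x + y" x] mem y S by (simp add: subspace_add)
  moreover have "(x - closest_point S x) \<bullet> (- y) \<le> 0"
    using closest_point_dot[OF cl(3,1), of "closest_point S x - y" x] mem y S by (simp add: subspace_diff)
  ultimately show "(x - closest_point S x) \<bullet> y = 0" by simp
qed

lemma closest_point_eqI:
  fixes S :: "'a::euclidean_space set"
  assumes S: "subspace S" and z: "z \<in> S" "\<And>y. y \<in> S \<Longrightarrow> (x - z) \<bullet> y = 0"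
  shows "closest_point S x = z"
proof -
  let ?p = "closest_point S x"
  have "z - ?p \<in> S" using S z(1) closest_point_mem[OF S] by (simp add: subspace_diff)
  then have "(x - z) \<bullet> (z - ?p) = 0" "(x - ?p) \<bullet> (z - ?p) = 0"
    using z(2) closest_point_orthogonal[OF S] by auto
  then have "(z - ?p) \<bullet> (z - ?p) = 0" by (simp add: inner_diff_left)
  then show ?thesis by simp
qed

lemma closest_point_id: "subspace S \<Longrightarrow> x \<in> S \<Longrightarrow> closest_point S x = x"
  for S :: "'a::euclidean_space set"
  by (rule closest_point_eqI) auto

lemma linear_closest_point:
  fixes S :: "'a::euclidean_space set"
  assumes S: "subspace S"
  shows "linear (closest_point S)"
proof (rule linearI)
  show "closest_point S (x + y) = closest_point S x + closest_point S y" for x y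
    using closest_point_orthogonal[OF S, of _ x] closest_point_orthogonal[OF S, of _ y] S
    by (intro closest_point_eqI) (auto simp: subspace_add closest_point_mem add_diff_add inner_add_left)
  show "closest_point S (c *\<^sub>R x) = c *\<^sub>R closest_point S x" for c x
    using closest_point_orthogonal[OF S, of _ x] S
    by (intro closest_point_eqI)
      (auto simp: subspace_scale closest_point_mem scaleR_diff_right[symmetric])
qed

lemma closest_point_inner:
  fixes S :: "'a::euclidean_space set"
  assumes S: "subspace S" and y: "y \<in> S"
  shows "closest_point S x \<bullet> y = x \<bullet> y" "y \<bullet> closest_point S x = y \<bullet> x"
proof -
  show "closest_point S x \<bullet> y = x \<bullet> y"
    using closest_point_orthogonal[OF S y, of x] by (simp add: inner_diff_left)
  then show "y \<bullet> closest_point S x = y \<bullet> x" by (simp add: inner_commute)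
qed

lemma closest_point_self_adjoint:
  fixes S :: "'a::euclidean_space set"
  assumes S: "subspace S"
  shows "closest_point S x \<bullet> y = x \<bullet> closest_point S y"
  by (metis S closest_point_inner closest_point_mem)

lemma closest_point_orthogonal_transformation:
  fixes S :: "'a::euclidean_space set" and R :: "'a \<Rightarrow> 'a"
  assumes R: "orthogonal_transformation R" and S: "subspace S"
  shows "closest_point (R ` S) (R x) = R (closest_point S x)"
proof -
  have lin: "linear R" using R by (simp add: orthogonal_transformation_def)
  show ?thesis
  proof (rule closest_point_eqI)
    show "subspace (R ` S)" by (rule linear_subspace_image[OF lin S])
    show "R (closest_point S x) \<in> R ` S" using closest_point_mem[OF S] by blast
    fix y assume "y \<in> R ` S"
    then obtain z where z: "z \<in> S" "y = R z" by auto
    show "(R x - R (closest_point S x)) \<bullet> y = 0"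
      using closest_point_orthogonal[OF S z(1)] R
      by (simp add: z linear_diff[OF lin, symmetric] orthogonal_transformation_def)
  qed
qed

definition orth_compl :: "'a::euclidean_space set \<Rightarrow> 'a set" where
  "orth_compl S = {y. \<forall>x\<in>S. x \<bullet> y = 0}"

lemma subspace_orth_compl: "subspace (orth_compl S)"
  by (auto simp: orth_compl_def subspace_def inner_add_right)

lemma orth_complD: "y \<in> orth_compl S \<Longrightarrow> x \<in> S \<Longrightarrow> x \<bullet> y = 0"
  by (auto simp: orth_compl_def)

lemma minus_closest_point_orth_compl: "subspace S \<Longrightarrow> x - closest_point S x \<in> orth_compl S"
proof -
  assume "subspace S"
  then have "y \<bullet> (x - closest_point S x) = 0" if "y \<in> S" for y
    using closest_point_orthogonal[of S y x] that by (simp add: inner_commute)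
  then show ?thesis by (simp add: orth_compl_def)
qed

lemma closest_point_orth_compl: "subspace S \<Longrightarrow> y \<in> orth_compl S \<Longrightarrow> closest_point S y = 0"
  by (rule closest_point_eqI) (auto simp: orth_compl_def subspace_0 inner_commute)

lemma orth_compl_sum:
  assumes "subspace S"
  shows "{v + w |v w. v \<in> S \<and> w \<in> orth_compl S} = UNIV"
proof (intro equalityI subsetI UNIV_I)
  fix x
  have "x = closest_point S x + (x - closest_point S x)" by simp
  then show "x \<in> {v + w |v w. v \<in> S \<and> w \<in> orth_compl S}"
    using closest_point_mem[OF assms] minus_closest_point_orth_compl[OF assms] by blast
qed

lemma dim_orth_compl:
  fixes S :: "'a::euclidean_space set"
  assumes "subspace S" shows "dim (orth_compl S) + dim S = DIM('a)"
  using dim_subspace_orthogonal_to_vectors[OF assms subspace_UNIV]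
  by (simp add: orth_compl_def orthogonal_def)

text \<open>
  Isometries between the subspaces and between their orthogonal complements are glued together.
\<close>

lemma orthogonal_transformation_between_subspaces:
  fixes S S' :: "'a::euclidean_space set"
  assumes S: "subspace S" and S': "subspace S'" and d: "dim S = dim S'"
  obtains R where "orthogonal_transformation R" "R ` S = S'" "R ` orth_compl S = orth_compl S'"
proof -
  obtain f where f: "linear f" "f ` S = S'" "\<And>x. x \<in> S \<Longrightarrow> norm (f x) = norm x"
    using isometry_subspaces[OF S S' d] by blast
  have d': "dim (orth_compl S) = dim (orth_compl S')"
    using dim_orth_compl[OF S] dim_orth_compl[OF S'] d by simp
  obtain f' where f': "linear f'" "f' ` orth_compl S = orth_compl S'"
     "\<And>x. x \<in> orth_compl S \<Longrightarrow> norm (f' x) = norm x"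
    using isometry_subspaces[OF subspace_orth_compl subspace_orth_compl d'] by blast
  define R where "R x = f (closest_point S x) + f' (x - closest_point S x)" for x
  note cp = linear_closest_point[OF S]
  have lin: "linear R"
    by (rule linearI)
      (simp_all add: R_def linear_add[OF cp] linear_add[OF f(1)] linear_add[OF f'(1)] linear_diff[OF f'(1)]
        linear_cmul[OF cp] linear_cmul[OF f(1)] linear_cmul[OF f'(1)] algebra_simps)
  have norm: "norm (R x) = norm x" for x
  proof -
    let ?p = "closest_point S x"
    have "f ?p \<bullet> f' (x - ?p) = 0"
      using f(2) f'(2) closest_point_mem[OF S] minus_closest_point_orth_compl[OF S]
      by (intro orth_complD[of _ S']) blast+
    then have "(norm (R x))\<^sup>2 = (norm (f ?p))\<^sup>2 + (norm (f' (x - ?p)))\<^sup>2"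
      unfolding R_def by (intro norm_add_Pythagorean) (simp add: orthogonal_def)
    also have "\<dots> = (norm ?p)\<^sup>2 + (norm (x - ?p))\<^sup>2"
      using f(3) f'(3) closest_point_mem[OF S] minus_closest_point_orth_compl[OF S] by simp
    also have "\<dots> = (norm (?p + (x - ?p)))\<^sup>2"
      using closest_point_orthogonal[OF S closest_point_mem[OF S]]
      by (intro norm_add_Pythagorean[symmetric]) (simp add: orthogonal_def inner_commute)
    finally show ?thesis by simp
  qed
  have "R x = f x" if "x \<in> S" for x
    using that closest_point_id[OF S] linear_0[OF f'(1)] by (simp add: R_def)
  then have 1: "R ` S = S'" using f(2) by (metis image_cong)
  have "R x = f' x" if "x \<in> orth_compl S" for x
    using that closest_point_orth_compl[OF S] linear_0[OF f(1)] by (simp add: R_def)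
  then have "R ` orth_compl S = orth_compl S'" using f'(2) by (metis image_cong)
  then show ?thesis using that[of R] lin norm 1 by (auto simp: orthogonal_transformation)
qed


section \<open>Volume factors and hyperplanes\<close>

lemma hyperplane_in_subspace:
  fixes V :: "'a::euclidean_space set"
  assumes V: "subspace V" and u: "u \<in> V" "norm u = 1"
  shows "subspace {x\<in>V. x \<bullet> u = 0}"
    and "{v + w |v w. v \<in> {x\<in>V. x \<bullet> u = 0} \<and> w \<in> span {u}} = V"
    and "dim {x\<in>V. x \<bullet> u = 0} + 1 = dim V"
proof -
  let ?M = "{x\<in>V. x \<bullet> u = 0}"
  show M: "subspace ?M" using V by (auto simp: subspace_def inner_add_left)
  show eq: "{v + w |v w. v \<in> ?M \<and> w \<in> span {u}} = V"
  proof (intro equalityI subsetI)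
    fix x assume x: "x \<in> V"
    have "x - (x \<bullet> u) *\<^sub>R u \<in> ?M"
      using x u V by (auto simp: subspace_diff subspace_scale inner_diff_left dot_square_norm)
    moreover have "(x \<bullet> u) *\<^sub>R u \<in> span {u}" by (simp add: span_base span_scale)
    moreover have "x = (x - (x \<bullet> u) *\<^sub>R u) + (x \<bullet> u) *\<^sub>R u" by simp
    ultimately show "x \<in> {v + w |v w. v \<in> ?M \<and> w \<in> span {u}}" by blast
  qed (use u V in \<open>auto simp: span_singleton subspace_add subspace_scale\<close>)
  obtain B where B: "orthonormal_basis_of ?M B" using M by (rule orthonormal_basis_of_exists)
  have C: "orthonormal_basis_of (span {u}) {u}"
    using u by (auto simp: orthonormal_basis_of_def span_base)
  have orth: "v \<bullet> w = 0" if "v \<in> ?M" "w \<in> span {u}" for v w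
    using that by (auto simp: span_singleton)
  note U = orthonormal_basis_of_Un[OF B C orth, unfolded eq]
  have "dim V = card (B \<union> {u})" using orthonormal_basis_ofD(3)[OF U(1)] by simp
  also have "\<dots> = card B + 1" using U(2) orthonormal_basis_ofD(1)[OF B] by (subst card_Un_disjoint) auto
  finally show "dim ?M + 1 = dim V" using orthonormal_basis_ofD(3)[OF B] by simp
qed

lemma nn_integral_lborel_on_hyperplane:
  fixes V :: "'a::euclidean_space set"
  assumes V: "subspace V" and u: "u \<in> V" "norm u = 1" and f[measurable]: "f \<in> borel_measurable borel"
  shows "(\<integral>\<^sup>+x. f x \<partial>lborel_on V) = (\<integral>\<^sup>+v. (\<integral>\<^sup>+t. f (v + t *\<^sub>R u) \<partial>lborel) \<partial>lborel_on {x\<in>V. x \<bullet> u = 0})"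
proof -
  have orth: "v \<bullet> w = 0" if "v \<in> {x\<in>V. x \<bullet> u = 0}" "w \<in> span {u}" for v w
    using that by (auto simp: span_singleton)
  show ?thesis
    using nn_integral_lborel_on_sum[OF hyperplane_in_subspace(1)[OF V u] subspace_span[of "{u}"] orth f]
    unfolding hyperplane_in_subspace(2)[OF V u]
    by (simp add: nn_integral_lborel_on_line[OF u(2)])
qed

text \<open>
  With respect to the hyperplane orthogonal to \<open>u\<close> and the line through
  \<open>u\<close>, the map \<open>g\<close> is block triangular: it maps that hyperplane of
  \<open>V\<close> onto the hyperplane of \<open>g ` V\<close> orthogonal to \<open>u'\<close> and
  multiplies the component along \<open>u\<close> by \<open>g u \<bullet> u'\<close>. The
  off-diagonal part is a shear, which Fubini's theorem and translation invariance remove.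
\<close>

lemma vol_factor_hyperplane:
  fixes g :: "'a::euclidean_space \<Rightarrow> 'b::euclidean_space"
  assumes g: "linear g" and V: "subspace V" and inj: "inj_on g V"
    and u: "u \<in> V" "norm u = 1" and u': "u' \<in> g ` V" "norm u' = 1"
    and orth: "\<And>x. x \<in> V \<Longrightarrow> x \<bullet> u = 0 \<Longrightarrow> g x \<bullet> u' = 0"
  shows "vol_factor V g = vol_factor {x\<in>V. x \<bullet> u = 0} g * \<bar>g u \<bullet> u'\<bar>"
proof (rule vol_factor_eqI[OF g V inj])
  let ?M = "{x\<in>V. x \<bullet> u = 0}" and ?M' = "{y\<in>g ` V. y \<bullet> u' = 0}"
  define a where "a = g u \<bullet> u'"
  note M = hyperplane_in_subspace(1)[OF V u]
  have gV: "subspace (g ` V)" by (rule linear_subspace_image[OF g V])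
  have decomp: "x - (x \<bullet> u) *\<^sub>R u \<in> ?M" if "x \<in> V" for x
    using that u V by (auto simp: subspace_diff subspace_scale inner_diff_left dot_square_norm)
  have gxu: "g x \<bullet> u' = (x \<bullet> u) * a" if "x \<in> V" for x
  proof -
    have "g (x - (x \<bullet> u) *\<^sub>R u) \<bullet> u' = 0" using orth decomp[OF that] by auto
    then show ?thesis by (simp add: linear_diff[OF g] linear_cmul[OF g] inner_diff_left a_def)
  qed
  have a: "a \<noteq> 0"
  proof
    assume "a = 0"
    obtain x where x: "x \<in> V" "u' = g x" using u'(1) by auto
    have "u' \<bullet> u' = 0" using gxu[OF x(1)] x(2) \<open>a = 0\<close> by simp
    then show False using u'(2) by simp
  qed
  have M': "g ` ?M = ?M'"
  proof (intro equalityI subsetI)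
    fix y assume "y \<in> ?M'"
    then obtain x where "x \<in> V" "y = g x" "g x \<bullet> u' = 0" by auto
    then show "y \<in> g ` ?M" using gxu[of x] a by auto
  qed (use orth in auto)
  have injM: "inj_on g ?M" using inj by (rule inj_on_subset) auto
  show "0 \<le> vol_factor ?M g * \<bar>g u \<bullet> u'\<bar>" using vol_factor_pos[OF g M injM] by simp
  \<comment> \<open>\<open>m\<close> is the vector of the shear\<close>
  obtain m where m: "m \<in> ?M" "g u = g m + a *\<^sub>R u'"
  proof -
    have "g u \<in> g ` V" using u(1) by blast
    then have "g u - a *\<^sub>R u' \<in> g ` V" using u'(1) gV by (simp add: subspace_diff subspace_scale)
    moreover have "(g u - a *\<^sub>R u') \<bullet> u' = 0"
      using u'(2) by (simp add: inner_diff_left dot_square_norm a_def)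
    ultimately have "g u - a *\<^sub>R u' \<in> ?M'" by simp
    then have "g u - a *\<^sub>R u' \<in> g ` ?M" unfolding M' .
    then obtain m where m2: "g u - a *\<^sub>R u' = g m" and m1: "m \<in> ?M" by (rule imageE)
    have "g u = g m + a *\<^sub>R u'" unfolding m2[symmetric] by simp
    then show ?thesis by (rule that[OF m1])
  qed
  fix f :: "'b \<Rightarrow> ennreal" assume f[measurable]: "f \<in> borel_measurable borel"
  note [measurable] = borel_linear[OF g]
  have s: "sigma_finite_measure (lborel_on ?M)" by (rule sigma_finite_lborel_on[OF M])
  interpret pair_sigma_finite "lborel_on ?M" "lborel :: real measure"
    using s by (simp add: pair_sigma_finite_def lborel.sigma_finite_measure_axioms)
  have "(\<integral>\<^sup>+y. f y \<partial>lborel_on (g ` V)) = (\<integral>\<^sup>+w. (\<integral>\<^sup>+t. f (w + t *\<^sub>R u') \<partial>lborel) \<partial>lborel_on (g ` ?M))"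
    unfolding M' by (rule nn_integral_lborel_on_hyperplane[OF gV u' f])
  also have "\<dots> = ennreal (vol_factor ?M g) * (\<integral>\<^sup>+v. (\<integral>\<^sup>+t. f (g v + t *\<^sub>R u') \<partial>lborel) \<partial>lborel_on ?M)"
    by (rule nn_integral_vol_factor[OF g M injM]) measurable
  also have "(\<integral>\<^sup>+v. (\<integral>\<^sup>+t. f (g v + t *\<^sub>R u') \<partial>lborel) \<partial>lborel_on ?M)
     = (\<integral>\<^sup>+v. ennreal \<bar>a\<bar> * (\<integral>\<^sup>+t. f (g v + (t * a) *\<^sub>R u') \<partial>lborel) \<partial>lborel_on ?M)"
    by (intro nn_integral_cong, subst nn_integral_real_affine[OF _ a, of _ 0]) (auto simp: mult.commute)
  also have "\<dots> = ennreal \<bar>a\<bar> * (\<integral>\<^sup>+v. (\<integral>\<^sup>+t. f (g v + (t * a) *\<^sub>R u') \<partial>lborel) \<partial>lborel_on ?M)"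
    by (rule nn_integral_cmult) measurable
  also have "(\<integral>\<^sup>+v. (\<integral>\<^sup>+t. f (g v + (t * a) *\<^sub>R u') \<partial>lborel) \<partial>lborel_on ?M)
      = (\<integral>\<^sup>+t. (\<integral>\<^sup>+v. f (g v + (t * a) *\<^sub>R u') \<partial>lborel_on ?M) \<partial>lborel)"
    by (rule Fubini'[symmetric]) measurable
  also have "\<dots> = (\<integral>\<^sup>+t. (\<integral>\<^sup>+v. f (g v + t *\<^sub>R g u) \<partial>lborel_on ?M) \<partial>lborel)"
  proof (rule nn_integral_cong)
    fix t :: real
    have "t *\<^sub>R m \<in> ?M" using m(1) M subspace_scale by blast
    from invariant_onD(4)[OF invariant_on_lborel_on[OF M] this, of "\<lambda>v. f (g v + (t * a) *\<^sub>R u')"]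
    show "(\<integral>\<^sup>+v. f (g v + (t * a) *\<^sub>R u') \<partial>lborel_on ?M) = (\<integral>\<^sup>+v. f (g v + t *\<^sub>R g u) \<partial>lborel_on ?M)"
      by (simp add: m(2) linear_add[OF g] linear_cmul[OF g] scaleR_add_right algebra_simps)
  qed
  also have "\<dots> = (\<integral>\<^sup>+v. (\<integral>\<^sup>+t. f (g (v + t *\<^sub>R u)) \<partial>lborel) \<partial>lborel_on ?M)"
    by (subst Fubini') (auto simp: linear_add[OF g] linear_cmul[OF g])
  also have "\<dots> = (\<integral>\<^sup>+x. f (g x) \<partial>lborel_on V)"
    by (rule nn_integral_lborel_on_hyperplane[OF V u, symmetric]) measurable
  finally show "(\<integral>\<^sup>+y. f y \<partial>lborel_on (g ` V))
      = ennreal (vol_factor ?M g * \<bar>g u \<bullet> u'\<bar>) * (\<integral>\<^sup>+x. f (g x) \<partial>lborel_on V)"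
    using vol_factor_pos[OF g M injM] by (simp add: ennreal_mult a_def mult.assoc)
qed


section \<open>Volume factors and determinants\<close>

lemma prod_Basis_vec:
  fixes F :: "('a::euclidean_space^'n) \<Rightarrow> real"
  shows "prod F Basis = (\<Prod>i\<in>UNIV. \<Prod>b\<in>Basis. F (axis i b))"
proof -
  have inj: "inj_on (\<lambda>(i, b). axis i b :: 'a^'n) (UNIV \<times> Basis)"
    by (auto simp: inj_on_def axis_eq_axis nonzero_Basis)
  have eq: "Basis = (\<lambda>(i, b). axis i b :: 'a^'n) ` (UNIV \<times> Basis)"
    by (auto simp: Basis_vec_def)
  have "prod F Basis = (\<Prod>(i, b)\<in>UNIV \<times> Basis. F (axis i b))"
    unfolding eq prod.reindex[OF inj] by (simp add: case_prod_beta)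
  then show ?thesis by (simp add: prod.cartesian_product)
qed

lemma borel_measurable_vecI:
  fixes f :: "'b \<Rightarrow> 'a::euclidean_space^'n"
  assumes "\<And>i. (\<lambda>x. f x $ i) \<in> borel_measurable M"
  shows "f \<in> borel_measurable M"
proof (subst borel_measurable_euclidean_space, intro ballI)
  fix b :: "'a^'n" assume "b \<in> Basis"
  then obtain i c where "b = axis i c" by (auto simp: Basis_vec_def)
  then have "(\<lambda>x. f x \<bullet> b) = (\<lambda>x. f x $ i \<bullet> c)" by (simp add: inner_axis)
  then show "(\<lambda>x. f x \<bullet> b) \<in> borel_measurable M" using assms by simp
qed

lemma lborel_vec_eq:
  "(lborel :: ('a::euclidean_space^'n) measure) = distr (\<Pi>\<^sub>M i\<in>UNIV. lborel) borel (\<lambda>f. \<chi> i. f i)"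
proof (rule lborel_eqI)
  interpret product_sigma_finite "\<lambda>i::'n. lborel :: 'a measure" by standard
  have m[measurable]: "(\<lambda>f. \<chi> i. f i :: 'a^'n) \<in> (\<Pi>\<^sub>M i\<in>UNIV. lborel) \<rightarrow>\<^sub>M borel"
    by (rule borel_measurable_vecI) simp
  fix l u :: "'a^'n" assume le: "\<And>b. b \<in> Basis \<Longrightarrow> l \<bullet> b \<le> u \<bullet> b"
  have le': "l $ i \<bullet> c \<le> u $ i \<bullet> c" if "c \<in> Basis" for i c
  proof -
    have "axis i c \<in> (Basis :: ('a^'n) set)" using that by (auto simp: Basis_vec_def)
    from le[OF this] show ?thesis by (simp add: inner_axis)
  qed
  have "emeasure (distr (\<Pi>\<^sub>M i\<in>UNIV. lborel) borel (\<lambda>f. \<chi> i. f i)) (box l u)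
      = emeasure (\<Pi>\<^sub>M i\<in>UNIV. lborel) ((\<lambda>f. \<chi> i. f i) -` box l u \<inter> space (\<Pi>\<^sub>M i\<in>UNIV. lborel))"
    by (rule emeasure_distr) auto
  also have "(\<lambda>f. \<chi> i. f i) -` box l u \<inter> space (\<Pi>\<^sub>M i\<in>UNIV. lborel) = (\<Pi>\<^sub>E i\<in>UNIV. box (l $ i) (u $ i))"
    by (auto simp: space_PiM PiE_iff mem_box Basis_vec_def inner_axis)
  also have "emeasure (\<Pi>\<^sub>M i\<in>UNIV. lborel) \<dots> = (\<Prod>i\<in>UNIV. emeasure lborel (box (l $ i) (u $ i)))"
    by (rule emeasure_PiM) auto
  also have "\<dots> = (\<Prod>i\<in>UNIV. ennreal (\<Prod>c\<in>Basis. (u $ i - l $ i) \<bullet> c))"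
    using le' by (intro prod.cong refl emeasure_lborel_box) auto
  also have "\<dots> = ennreal (\<Prod>i\<in>UNIV. \<Prod>c\<in>Basis. (u $ i - l $ i) \<bullet> c)"
    using le' by (intro prod_ennreal prod_nonneg) (auto simp: inner_diff_left)
  also have "(\<Prod>i\<in>UNIV. \<Prod>c\<in>Basis. (u $ i - l $ i) \<bullet> c) = (\<Prod>b\<in>Basis. (u - l) \<bullet> b)"
    by (simp add: prod_Basis_vec inner_axis)
  finally show "emeasure (distr (\<Pi>\<^sub>M i\<in>UNIV. lborel) borel (\<lambda>f. \<chi> i. f i)) (box l u)
     = (\<Prod>b\<in>Basis. (u - l) \<bullet> b)" .
qed simp

lemma borel_measurable_vec_nth[measurable]:
  "(\<lambda>x. x $ i) \<in> borel_measurable (borel :: ('a::euclidean_space^'n) measure)"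
  by (intro borel_measurable_continuous_onI continuous_intros)

lemma emeasure_lborel_vec:
  fixes S :: "'n::finite \<Rightarrow> 'a::euclidean_space set"
  assumes S: "\<And>i. S i \<in> sets borel"
  shows "emeasure lborel {x :: 'a^'n. \<forall>i. x $ i \<in> S i} = (\<Prod>i\<in>UNIV. emeasure lborel (S i))"
    and sets_vec_rectangle: "{x :: 'a^'n. \<forall>i. x $ i \<in> S i} \<in> sets borel"
proof -
  interpret product_sigma_finite "\<lambda>i::'n. lborel :: 'a measure" by standard
  note [measurable] = S
  show s: "{x :: 'a^'n. \<forall>i. x $ i \<in> S i} \<in> sets borel" by measurable
  have m: "(\<lambda>f. \<chi> i. f i :: 'a^'n) \<in> (\<Pi>\<^sub>M i\<in>UNIV. lborel) \<rightarrow>\<^sub>M borel"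
    by (rule borel_measurable_vecI) simp
  have "emeasure lborel {x :: 'a^'n. \<forall>i. x $ i \<in> S i} = emeasure (\<Pi>\<^sub>M i\<in>UNIV. lborel)
      ((\<lambda>f. \<chi> i. f i) -` {x :: 'a^'n. \<forall>i. x $ i \<in> S i} \<inter> space (\<Pi>\<^sub>M i\<in>UNIV. lborel))"
    unfolding lborel_vec_eq[where 'a='a and 'n='n] by (rule emeasure_distr[OF m s])
  also have "(\<lambda>f. \<chi> i. f i) -` {x :: 'a^'n. \<forall>i. x $ i \<in> S i} \<inter> space (\<Pi>\<^sub>M i\<in>UNIV. lborel) = (\<Pi>\<^sub>E i\<in>UNIV. S i)"
    by (auto simp: space_PiM PiE_iff)
  also have "emeasure (\<Pi>\<^sub>M i\<in>UNIV. lborel) \<dots> = (\<Prod>i\<in>UNIV. emeasure lborel (S i))"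
    using S by (intro emeasure_PiM) auto
  finally show "emeasure lborel {x :: 'a^'n. \<forall>i. x $ i \<in> S i} = (\<Prod>i\<in>UNIV. emeasure lborel (S i))" .
qed

lemma nn_integral_lborel_linear:
  fixes f :: "'a::euclidean_space \<Rightarrow> 'a"
  assumes f: "linear f" "inj f" and h: "h \<in> borel_measurable borel"
  shows "(\<integral>\<^sup>+x. h x \<partial>lborel) = ennreal (vol_factor UNIV f) * (\<integral>\<^sup>+x. h (f x) \<partial>lborel)"
  using nn_integral_vol_factor[OF f(1) subspace_UNIV f(2) h] linear_inj_imp_surj[OF f]
  by (simp add: lborel_on_UNIV)

lemma vol_factor_UNIV_eqI:
  fixes f :: "'a::euclidean_space \<Rightarrow> 'a"
  assumes f: "linear f" "inj f" and Q: "Q \<in> sets borel" "emeasure lborel Q = ennreal q" "0 < q"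
    and fQ: "emeasure lborel (f ` Q) = ennreal (c * q)" "0 \<le> c"
  shows "vol_factor UNIV f = c"
proof -
  obtain g where g: "linear g" "\<And>x. g (f x) = x" "\<And>x. f (g x) = x"
    using linear_injective_isomorphism[OF f(1,2)] by blast
  have eq: "f ` Q = g -` Q"
  proof (intro equalityI subsetI)
    fix y assume "y \<in> g -` Q"
    then show "y \<in> f ` Q" using g(3)[of y] by (metis image_eqI vimageE)
  qed (use g(2) in auto)
  have m: "f ` Q \<in> sets borel" unfolding eq using measurable_sets_borel[OF borel_linear[OF g(1)] Q(1)] by simp
  have "ennreal (c * q) = (\<integral>\<^sup>+x. indicator (f ` Q) x \<partial>lborel)" using fQ m by simp
  also have "\<dots> = ennreal (vol_factor UNIV f) * (\<integral>\<^sup>+x. indicator (f ` Q) (f x) \<partial>lborel)"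
    by (rule nn_integral_lborel_linear[OF f]) (use m in simp)
  also have "(\<integral>\<^sup>+x. indicator (f ` Q) (f x) \<partial>lborel) = (\<integral>\<^sup>+x. indicator Q x \<partial>lborel)"
    using f(2) by (simp add: indicator_def inj_image_mem_iff)
  also have "\<dots> = ennreal q" using Q by simp
  finally have "c * q = vol_factor UNIV f * q"
    using Q(3) fQ(2) vol_factor_pos[OF f(1) subspace_UNIV f(2)] by (simp add: ennreal_mult[symmetric])
  then show ?thesis using Q(3) by simp
qed

lemma vol_factor_UNIV_compose:
  fixes f g :: "'a::euclidean_space \<Rightarrow> 'a"
  assumes "linear f" "inj f" "linear g" "inj g"
  shows "vol_factor UNIV (f \<circ> g) = vol_factor UNIV f * vol_factor UNIV g"
  using vol_factor_compose[OF assms(3,1) subspace_UNIV assms(4)] assms(2)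
  by (simp add: o_def linear_inj_imp_surj[OF assms(3,4)])

lemma emeasure_lborel_scaled_unit:
  fixes c :: real
  shows "emeasure lborel ((*) c ` {0..1}) = ennreal \<bar>c\<bar>"
  by (cases "0 \<le> c") (simp_all add: image_mult_atLeastAtMost_if)

text \<open>
  Both sides are multiplicative, so it suffices to consider elementary maps. A coordinate scaling is
  tested on the unit cube and a transposition is an isometry. For the shear \<open>f\<close> that
  adds one coordinate to another, let \<open>d\<close> double the coordinate that \<open>f\<close>
  changes. Then \<open>d \<circ> f = f \<circ> (f \<circ> d)\<close>, and cancelling the factors of
  \<open>d\<close> and one factor of \<open>f\<close> shows that both sides are 1.
\<close>

theorem vol_factor_UNIV_det:
  fixes f :: "real^'n \<Rightarrow> real^'n"
  assumes "linear f" "inj f"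
  shows "vol_factor UNIV f = \<bar>det (matrix f)\<bar>"
proof -
  have "inj f \<longrightarrow> vol_factor UNIV f = \<bar>det (matrix f)\<bar>"
  proof (rule induct_linear_elementary[OF assms(1)])
    fix f g :: "real^'n \<Rightarrow> real^'n"
    assume lin: "linear f" "linear g"
      and IH: "inj f \<longrightarrow> vol_factor UNIV f = \<bar>det (matrix f)\<bar>" "inj g \<longrightarrow> vol_factor UNIV g = \<bar>det (matrix g)\<bar>"
    show "inj (f \<circ> g) \<longrightarrow> vol_factor UNIV (f \<circ> g) = \<bar>det (matrix (f \<circ> g))\<bar>"
    proof
      assume fg: "inj (f \<circ> g)"
      then have g: "inj g" by (rule inj_on_imageI2)
      then have "surj g" using lin linear_inj_imp_surj by blast
      have f: "inj f"
      proof (rule injI)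
        fix x y assume "f x = f y"
        moreover obtain x' y' where "x = g x'" "y = g y'" using \<open>surj g\<close> by (meson surjD)
        ultimately show "x = y" using injD[OF fg, of x' y'] by simp
      qed
      show "vol_factor UNIV (f \<circ> g) = \<bar>det (matrix (f \<circ> g))\<bar>"
        using IH f g lin by (simp add: vol_factor_UNIV_compose matrix_compose det_mul abs_mult)
    qed
  next
    fix f :: "real^'n \<Rightarrow> real^'n" and i assume "linear f" "\<And>x. f x $ i = 0"
    then show "inj f \<longrightarrow> vol_factor UNIV f = \<bar>det (matrix f)\<bar>"
      using linear_inj_imp_surj[of f] by (metis surjD vec_component zero_neq_one)
  next
    fix c :: "'n \<Rightarrow> real"
    let ?f = "\<lambda>x::real^'n. \<chi> i. c i * x $ i"
    have lin: "linear ?f" by (rule linearI) (auto simp: vec_eq_iff algebra_simps)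
    have det: "det (matrix ?f) = (\<Prod>i\<in>UNIV. c i)"
      by (subst det_diagonal) (auto simp: matrix_def axis_def)
    show "inj ?f \<longrightarrow> vol_factor UNIV ?f = \<bar>det (matrix ?f)\<bar>"
    proof
      assume inj: "inj ?f"
      let ?Q = "{x::real^'n. \<forall>i. x $ i \<in> {0..1}}"
      have img: "?f ` ?Q = {y. \<forall>i. y $ i \<in> (*) (c i) ` {0..1}}"
      proof (intro equalityI subsetI)
        fix y assume "y \<in> {y. \<forall>i. y $ i \<in> (*) (c i) ` {0..1}}"
        then have "\<forall>i. \<exists>t. t \<in> {0..1} \<and> y $ i = c i * t" by fast
        then obtain t where t: "\<And>i. t i \<in> {0..1} \<and> y $ i = c i * t i" by metis
        then show "y \<in> ?f ` ?Q" by (intro image_eqI[of _ _ "\<chi> i. t i"]) (auto simp: vec_eq_iff)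
      qed auto
      have cl: "closed ((*) (c i) ` {0..1::real})" for i
        by (intro compact_imp_closed compact_continuous_image continuous_intros) auto
      have Q: "emeasure lborel ?Q = (\<Prod>i\<in>(UNIV::'n set). emeasure lborel {0..1::real})"
        by (rule emeasure_lborel_vec) simp
      have fQ: "emeasure lborel (?f ` ?Q) = (\<Prod>i\<in>(UNIV::'n set). emeasure lborel ((*) (c i) ` {0..1}))"
        unfolding img by (rule emeasure_lborel_vec) (use cl in simp)
      show "vol_factor UNIV ?f = \<bar>det (matrix ?f)\<bar>"
        by (rule vol_factor_UNIV_eqI[OF lin inj, of ?Q 1])
          (use sets_vec_rectangle[of "\<lambda>_::'n. {0..1::real}"] Q fQ in
            \<open>simp_all add: emeasure_lborel_scaled_unit det prod_ennreal abs_prod prod_nonneg\<close>)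
    qed
  next
    fix m n :: 'n assume "m \<noteq> n"
    let ?f = "\<lambda>x::real^'n. \<chi> i. x $ Transposition.transpose m n i"
    have lin: "linear ?f" by (rule linearI) (auto simp: vec_eq_iff)
    have "(\<Sum>i\<in>UNIV. (x $ Transposition.transpose m n i)\<^sup>2) = (\<Sum>i\<in>UNIV. (x $ i)\<^sup>2)" for x :: "real^'n"
      by (rule sum.reindex_bij_betw[of "Transposition.transpose m n" UNIV UNIV "\<lambda>i. (x $ i)\<^sup>2"])
        (simp add: bij_is_inj)
    then have "norm (?f x) = norm x" for x by (simp add: norm_vec_def L2_set_def)
    then have o: "orthogonal_transformation ?f" using lin by (simp add: orthogonal_transformation)
    have "vol_factor UNIV ?f = 1" using o by (intro vol_factor_isometry) (auto simp: orthogonal_transformation)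
    then show "inj ?f \<longrightarrow> vol_factor UNIV ?f = \<bar>det (matrix ?f)\<bar>" using orthogonal_transformation_det[OF o] by simp
  next
    fix m n :: 'n assume mn: "m \<noteq> n"
    let ?f = "\<lambda>x::real^'n. \<chi> i. if i = m then x $ m + x $ n else x $ i"
    let ?d = "\<lambda>x::real^'n. \<chi> i. if i = m then 2 * x $ m else x $ i"
    have f: "linear ?f" and d: "linear ?d" by (rule linearI; auto simp: vec_eq_iff algebra_simps)+
    have injf: "inj ?f"
    proof (rule injI)
      fix x y assume eq: "?f x = ?f y"
      then have "?f x $ i = ?f y $ i" for i by simp
      from this[of n] this show "x = y" using mn by (auto simp: vec_eq_iff) (metis add_right_cancel)
    qed
    have injd: "inj ?d"
      by (rule injI) (auto simp: vec_eq_iff split: if_splits)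
    have comm: "?d \<circ> ?f = ?f \<circ> (?f \<circ> ?d)"
      using mn by (auto simp: fun_eq_iff vec_eq_iff)
    have "vol_factor UNIV ?d * vol_factor UNIV ?f = vol_factor UNIV ?f * (vol_factor UNIV ?f * vol_factor UNIV ?d)"
      using arg_cong[OF comm, of "vol_factor UNIV"] f d injf injd
      by (simp add: vol_factor_UNIV_compose linear_compose inj_compose)
    then have 1: "vol_factor UNIV ?f = 1"
      using vol_factor_pos[OF f subspace_UNIV injf] vol_factor_pos[OF d subspace_UNIV injd] by simp
    have "det (matrix ?d) * det (matrix ?f) = det (matrix ?f) * (det (matrix ?f) * det (matrix ?d))"
      using arg_cong[OF comm, of "\<lambda>f. det (matrix f)"] f d
      by (simp add: matrix_compose linear_compose det_mul)
    then have "det (matrix ?f) = 1"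
      using det_nz_iff_inj[OF f] det_nz_iff_inj[OF d] injf injd by simp
    with 1 show "inj ?f \<longrightarrow> vol_factor UNIV ?f = \<bar>det (matrix ?f)\<bar>" by simp
  qed
  then show ?thesis using assms by simp
qed

text \<open>
  By Fubini's theorem along \<open>V\<close> and its orthogonal complement, on which
  \<open>B\<close> is the identity, the volume factor of \<open>B\<close> on the whole space is the
  one on \<open>V\<close>.
\<close>

lemma vol_factor_block:
  fixes B :: "real^'n \<Rightarrow> real^'n"
  assumes B: "linear B" and V: "subspace V" and inj: "inj_on B V" and BV: "B ` V \<subseteq> V"
    and id: "\<And>y. y \<in> orth_compl V \<Longrightarrow> B y = y"
  shows "vol_factor V B = \<bar>det (matrix B)\<bar>"
proof -
  have BV': "B ` V = V"
  proof (rule subspace_dim_equal[OF linear_subspace_image[OF B V] V BV])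
    show "dim V \<le> dim (B ` V)" using B inj V by (metis dim_image_eq span_eq_iff order_refl)
  qed
  have injB: "inj B"
    unfolding linear_injective_0[OF B]
  proof (intro allI impI)
    fix x assume "B x = 0"
    let ?p = "closest_point V x"
    have "B x = B ?p + (x - ?p)"
      using id[OF minus_closest_point_orth_compl[OF V, of x]] by (simp add: linear_diff[OF B] algebra_simps)
    moreover have "B ?p \<in> V" using BV closest_point_mem[OF V] by blast
    moreover have "B ?p \<bullet> (x - ?p) = 0"
      using orth_complD[OF minus_closest_point_orth_compl[OF V] \<open>B ?p \<in> V\<close>] by simp
    ultimately have "B ?p + (x - ?p) = 0" "B ?p \<bullet> (x - ?p) = 0" using \<open>B x = 0\<close> by auto
    then have "B ?p = - (x - ?p)" unfolding eq_neg_iff_add_eq_0 by simp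
    with \<open>B ?p \<bullet> (x - ?p) = 0\<close> have xp: "x - ?p = 0" by (metis inner_eq_zero_iff inner_minus_left neg_equal_0_iff_equal)
    with \<open>B ?p = - (x - ?p)\<close> have "B ?p = 0" by simp
    with xp show "x = 0" using inj closest_point_mem[OF V, of x] linear_inj_on_iff[OF B V] by auto
  qed
  have "vol_factor UNIV B = vol_factor V B"
  proof (rule vol_factor_eqI[OF B subspace_UNIV injB])
    show "0 \<le> vol_factor V B" using vol_factor_pos[OF B V inj] by simp
    fix f :: "real^'n \<Rightarrow> ennreal" assume f[measurable]: "f \<in> borel_measurable borel"
    note [measurable] = borel_linear[OF B]
    let ?W = "orth_compl V"
    have s: "sigma_finite_measure (lborel_on ?W)" by (rule sigma_finite_lborel_on[OF subspace_orth_compl])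
    then have [measurable]: "(\<lambda>v. \<integral>\<^sup>+w. f (v + w) \<partial>lborel_on ?W) \<in> borel_measurable borel"
      by (rule sigma_finite_measure.borel_measurable_nn_integral) measurable
    have sum: "(\<integral>\<^sup>+x. h x \<partial>lborel_on UNIV) = (\<integral>\<^sup>+v. (\<integral>\<^sup>+w. h (v + w) \<partial>lborel_on ?W) \<partial>lborel_on V)"
      if "h \<in> borel_measurable borel" for h :: "real^'n \<Rightarrow> ennreal"
      using nn_integral_lborel_on_sum[OF V subspace_orth_compl[of V] _ that] orth_complD[of _ V]
      unfolding orth_compl_sum[OF V] by blast
    have "(\<integral>\<^sup>+y. f y \<partial>lborel_on (range B)) = (\<integral>\<^sup>+v. (\<integral>\<^sup>+w. f (v + w) \<partial>lborel_on ?W) \<partial>lborel_on (B ` V))"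
      unfolding BV' linear_inj_imp_surj[OF B injB] by (rule sum) auto
    also have "\<dots> = ennreal (vol_factor V B) * (\<integral>\<^sup>+v. (\<integral>\<^sup>+w. f (B v + w) \<partial>lborel_on ?W) \<partial>lborel_on V)"
      by (rule nn_integral_vol_factor[OF B V inj]) measurable
    also have "(\<integral>\<^sup>+v. (\<integral>\<^sup>+w. f (B v + w) \<partial>lborel_on ?W) \<partial>lborel_on V)
        = (\<integral>\<^sup>+v. (\<integral>\<^sup>+w. f (B (v + w)) \<partial>lborel_on ?W) \<partial>lborel_on V)"
    proof (rule nn_integral_cong, rule nn_integral_cong_AE)
      fix v show "AE w in lborel_on ?W. f (B v + w) = f (B (v + w))"
        using AE_lborel_on[OF subspace_orth_compl] by eventually_elim (simp add: linear_add[OF B] id)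
    qed
    also have "\<dots> = (\<integral>\<^sup>+x. f (B x) \<partial>lborel_on UNIV)"
      by (rule sum[symmetric]) auto
    finally show "(\<integral>\<^sup>+y. f y \<partial>lborel_on (range B)) = ennreal (vol_factor V B) * (\<integral>\<^sup>+x. f (B x) \<partial>lborel_on UNIV)" .
  qed
  then show ?thesis using vol_factor_UNIV_det[OF B injB] by simp
qed


section \<open>Hausdorff measure\<close>

definition hausdorff_gauge :: "nat \<Rightarrow> 'a::metric_space set \<Rightarrow> ennreal" where
  "hausdorff_gauge s U = (if U = {} then 0 else ennreal (unit_ball_vol (real s) * (diameter U / 2) ^ s))"

definition fine_cover :: "real \<Rightarrow> 'a::metric_space set \<Rightarrow> (nat \<Rightarrow> 'a set) set" where
  "fine_cover \<delta> A = {U. A \<subseteq> (\<Union>i. U i) \<and> (\<forall>i. bounded (U i) \<and> diameter (U i) \<le> \<delta>)}"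

definition hausdorff_pre :: "nat \<Rightarrow> real \<Rightarrow> 'a::metric_space set \<Rightarrow> ennreal" where
  "hausdorff_pre s \<delta> A = (INF U\<in>fine_cover \<delta> A. \<Sum>i. hausdorff_gauge s (U i))"

lemma hausdorff_outer_eq: "hausdorff_outer s A = (SUP \<delta>\<in>{0<..}. hausdorff_pre s \<delta> A)"
  unfolding hausdorff_outer_def hausdorff_pre_def fine_cover_def hausdorff_gauge_def ..

lemma hausdorff_pre_le_outer: "0 < \<delta> \<Longrightarrow> hausdorff_pre s \<delta> A \<le> hausdorff_outer s A"
  unfolding hausdorff_outer_eq by (rule SUP_upper) simp

lemma hausdorff_outer_leI: "(\<And>\<delta>. 0 < \<delta> \<Longrightarrow> hausdorff_pre s \<delta> A \<le> c) \<Longrightarrow> hausdorff_outer s A \<le> c"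
  unfolding hausdorff_outer_eq by (rule SUP_least) simp

lemma hausdorff_pre_le: "U \<in> fine_cover \<delta> A \<Longrightarrow> hausdorff_pre s \<delta> A \<le> (\<Sum>i. hausdorff_gauge s (U i))"
  unfolding hausdorff_pre_def by (rule INF_lower)

lemma hausdorff_pre_antimono: "\<delta> \<le> \<delta>' \<Longrightarrow> hausdorff_pre s \<delta>' A \<le> hausdorff_pre s \<delta> A"
  unfolding hausdorff_pre_def by (rule INF_superset_mono) (auto simp: fine_cover_def intro: order_trans)

lemma hausdorff_pre_mono: "A \<subseteq> B \<Longrightarrow> hausdorff_pre s \<delta> A \<le> hausdorff_pre s \<delta> B"
  unfolding hausdorff_pre_def by (rule INF_superset_mono) (auto simp: fine_cover_def)

lemma hausdorff_outer_mono: "A \<subseteq> B \<Longrightarrow> hausdorff_outer s A \<le> hausdorff_outer s B"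
  by (meson hausdorff_outer_leI hausdorff_pre_le_outer hausdorff_pre_mono order_trans)

lemma hausdorff_outer_empty[simp]: "hausdorff_outer s {} = 0"
proof -
  have "hausdorff_pre s \<delta> ({} :: 'a set) \<le> 0" if "0 < \<delta>" for \<delta>
    using hausdorff_pre_le[of "\<lambda>_. {}" \<delta> "{}" s] that by (simp add: fine_cover_def hausdorff_gauge_def)
  then have "hausdorff_outer s ({} :: 'a set) \<le> 0" by (rule hausdorff_outer_leI)
  then show ?thesis by simp
qed

lemma hausdorff_pre_UN_le: "hausdorff_pre s \<delta> (\<Union>i. A i) \<le> (\<Sum>i. hausdorff_pre s \<delta> (A i))"
proof (rule ennreal_le_epsilon)
  fix e :: real assume fin: "(\<Sum>i. hausdorff_pre s \<delta> (A i)) < top" and e: "0 < e"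
  have "\<exists>U\<in>fine_cover \<delta> (A i). (\<Sum>j. hausdorff_gauge s (U j)) \<le> hausdorff_pre s \<delta> (A i) + ennreal (e * (1/2)^Suc i)" for i
  proof -
    have "hausdorff_pre s \<delta> (A i) < top"
      using fin ennreal_suminf_lessD by blast
    moreover have "0 < ennreal (e * (1/2)^Suc i)"
      using e by simp
    ultimately have "hausdorff_pre s \<delta> (A i) < hausdorff_pre s \<delta> (A i) + ennreal (e * (1/2)^Suc i)"
      using ennreal_add_left_cancel_less[of "hausdorff_pre s \<delta> (A i)" 0 "ennreal (e * (1/2)^Suc i)"]
      by (auto simp del: ennreal_add_left_cancel_less)
    from this[unfolded hausdorff_pre_def INF_less_iff] show ?thesis
      unfolding hausdorff_pre_def by (meson less_imp_le)
  qed
  then obtain U where U: "\<And>i. U i \<in> fine_cover \<delta> (A i)"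
    "\<And>i. (\<Sum>j. hausdorff_gauge s (U i j)) \<le> hausdorff_pre s \<delta> (A i) + ennreal (e * (1/2)^Suc i)"
    by metis
  define V where "V n = (case prod_decode n of (i, j) \<Rightarrow> U i j)" for n
  have "V \<in> fine_cover \<delta> (\<Union>i. A i)"
    unfolding fine_cover_def
  proof (intro CollectI conjI allI subsetI)
    fix x assume "x \<in> (\<Union>i. A i)"
    then obtain i j where "x \<in> U i j" using U(1) by (fastforce simp: fine_cover_def)
    then have "x \<in> V (prod_encode (i, j))" by (simp add: V_def)
    then show "x \<in> (\<Union>n. V n)" by blast
  next
    show "bounded (V n)" "diameter (V n) \<le> \<delta>" for n
      using U(1) by (auto simp: V_def fine_cover_def split: prod.split)
  qed
  then have "hausdorff_pre s \<delta> (\<Union>i. A i) \<le> (\<Sum>n. hausdorff_gauge s (V n))" by (rule hausdorff_pre_le)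
  also have "\<dots> = (\<Sum>n. (\<lambda>(i, j). hausdorff_gauge s (U i j)) (prod_decode n))"
    by (simp add: V_def case_prod_beta)
  also have "\<dots> = (\<Sum>i. \<Sum>j. hausdorff_gauge s (U i j))"
    by (rule suminf_ennreal_2dimen) simp
  also have "\<dots> \<le> (\<Sum>i. hausdorff_pre s \<delta> (A i) + ennreal (e * (1/2)^Suc i))"
    by (intro suminf_le U(2)) auto
  also have "\<dots> = (\<Sum>i. hausdorff_pre s \<delta> (A i)) + (\<Sum>i. ennreal (e * (1/2)^Suc i))"
    by (rule suminf_add[symmetric]) auto
  also have "(\<Sum>i. ennreal (e * (1/2)^Suc i)) = ennreal e"
    using e sums_mult[OF power_half_series, of e] by (intro suminf_ennreal_eq) auto
  finally show "hausdorff_pre s \<delta> (\<Union>i. A i) \<le> (\<Sum>i. hausdorff_pre s \<delta> (A i)) + ennreal e" .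
qed

lemma hausdorff_outer_UN_le: "hausdorff_outer s (\<Union>i. A i) \<le> (\<Sum>i. hausdorff_outer s (A i))"
proof (rule hausdorff_outer_leI)
  fix \<delta> :: real assume "0 < \<delta>"
  have "hausdorff_pre s \<delta> (\<Union>i. A i) \<le> (\<Sum>i. hausdorff_pre s \<delta> (A i))" by (rule hausdorff_pre_UN_le)
  also have "\<dots> \<le> (\<Sum>i. hausdorff_outer s (A i))"
    using \<open>0 < \<delta>\<close> by (intro suminf_le hausdorff_pre_le_outer) auto
  finally show "hausdorff_pre s \<delta> (\<Union>i. A i) \<le> (\<Sum>i. hausdorff_outer s (A i))" .
qed

lemma outer_measure_space_hausdorff: "outer_measure_space UNIV (hausdorff_outer s)"
  unfolding outer_measure_space_def positive_def increasing_def countably_subadditive_def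
  by (auto intro: hausdorff_outer_mono hausdorff_outer_UN_le)

lemma hausdorff_outer_Un_le: "hausdorff_outer s (A \<union> B) \<le> hausdorff_outer s A + hausdorff_outer s B"
proof -
  let ?F = "\<lambda>n::nat. if n = 0 then A else if n = 1 then B else {}"
  have "A \<union> B = (\<Union>n. ?F n)"
  proof (intro equalityI subsetI)
    fix x assume "x \<in> A \<union> B"
    then have "x \<in> ?F 0 \<or> x \<in> ?F 1" by auto
    then show "x \<in> (\<Union>n. ?F n)" by blast
  qed (auto split: if_splits)
  then have "hausdorff_outer s (A \<union> B) \<le> (\<Sum>n. hausdorff_outer s (?F n))"
    using hausdorff_outer_UN_le[of s ?F] by simp
  also have "\<dots> = (\<Sum>n\<in>{0, 1}. hausdorff_outer s (?F n))"
    by (rule suminf_finite) auto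
  finally show ?thesis by simp
qed

lemma hausdorff_outer_null_UN:
  "countable I \<Longrightarrow> (\<And>i. i \<in> I \<Longrightarrow> hausdorff_outer s (A i) = 0) \<Longrightarrow> hausdorff_outer s (\<Union>i\<in>I. A i) = 0"
proof (cases "I = {}")
  case False
  assume "countable I" and 0: "\<And>i. i \<in> I \<Longrightarrow> hausdorff_outer s (A i) = 0"
  have "(\<Union>i\<in>I. A i) = (\<Union>n. A (from_nat_into I n))"
    by (metis (no_types) UN_simps(10) range_from_nat_into[OF False \<open>countable I\<close>])
  moreover have "hausdorff_outer s (\<Union>n. A (from_nat_into I n)) \<le> (\<Sum>n. hausdorff_outer s (A (from_nat_into I n)))"
    by (rule hausdorff_outer_UN_le)
  ultimately show ?thesis using 0 from_nat_into[OF False] by simp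
qed simp

text \<open>
  A set of diameter less than \<open>d\<close> cannot meet both \<open>A\<close> and
  \<open>B\<close>, so a fine cover of the union splits into a cover of \<open>A\<close> and one of
  \<open>B\<close>.
\<close>

lemma hausdorff_outer_separated:
  assumes d: "0 < d" and sep: "\<And>x y. x \<in> A \<Longrightarrow> y \<in> B \<Longrightarrow> d \<le> dist x y"
  shows "hausdorff_outer s A + hausdorff_outer s B \<le> hausdorff_outer s (A \<union> B)"
proof -
  have *: "hausdorff_pre s \<delta> A + hausdorff_pre s \<delta> B \<le> hausdorff_pre s \<delta> (A \<union> B)" if \<delta>: "0 < \<delta>" "\<delta> < d" for \<delta>
    unfolding hausdorff_pre_def[of s \<delta> "A \<union> B"]
  proof (rule INF_greatest)
    fix U assume U: "U \<in> fine_cover \<delta> (A \<union> B)"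
    define V where "V i = (if U i \<inter> A = {} then {} else U i)" for i
    define W where "W i = (if U i \<inter> A = {} then U i else {})" for i
    have V: "V \<in> fine_cover \<delta> A"
      using U \<delta>(1) by (fastforce simp: fine_cover_def V_def)
    have "B \<subseteq> (\<Union>i. W i)"
    proof
      fix y assume y: "y \<in> B"
      then obtain i where i: "y \<in> U i" using U by (auto simp: fine_cover_def)
      have "U i \<inter> A = {}"
      proof (rule ccontr)
        assume "U i \<inter> A \<noteq> {}"
        then obtain x where "x \<in> U i" "x \<in> A" by blast
        then have "dist x y \<le> diameter (U i)"
          using i U by (intro diameter_bounded_bound) (auto simp: fine_cover_def)
        also have "\<dots> \<le> \<delta>" using U by (auto simp: fine_cover_def)
        finally show False using sep[OF \<open>x \<in> A\<close> y] \<delta> by simp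
      qed
      then show "y \<in> (\<Union>i. W i)" using i by (auto simp: W_def)
    qed
    then have W: "W \<in> fine_cover \<delta> B"
      using U \<delta>(1) by (auto simp: fine_cover_def W_def)
    have "hausdorff_pre s \<delta> A + hausdorff_pre s \<delta> B
        \<le> (\<Sum>i. hausdorff_gauge s (V i)) + (\<Sum>i. hausdorff_gauge s (W i))"
      using V W by (intro add_mono hausdorff_pre_le)
    also have "\<dots> = (\<Sum>i. hausdorff_gauge s (V i) + hausdorff_gauge s (W i))"
      by (rule suminf_add) auto
    also have "\<dots> = (\<Sum>i. hausdorff_gauge s (U i))"
      by (intro arg_cong[where f=suminf] ext) (auto simp: V_def W_def hausdorff_gauge_def)
    finally show "hausdorff_pre s \<delta> A + hausdorff_pre s \<delta> B \<le> (\<Sum>i. hausdorff_gauge s (U i))" .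
  qed
  have **: "hausdorff_pre s \<delta>1 A + hausdorff_pre s \<delta>2 B \<le> hausdorff_outer s (A \<union> B)"
    if "0 < \<delta>1" "0 < \<delta>2" for \<delta>1 \<delta>2
  proof -
    define \<delta> where "\<delta> = min (min \<delta>1 \<delta>2) (d / 2)"
    have \<delta>: "0 < \<delta>" "\<delta> < d" "\<delta> \<le> \<delta>1" "\<delta> \<le> \<delta>2" using that d by (auto simp: \<delta>_def min_def)
    have "hausdorff_pre s \<delta>1 A + hausdorff_pre s \<delta>2 B \<le> hausdorff_pre s \<delta> A + hausdorff_pre s \<delta> B"
      using \<delta> by (intro add_mono hausdorff_pre_antimono)
    also have "\<dots> \<le> hausdorff_pre s \<delta> (A \<union> B)" by (rule *[OF \<delta>(1,2)])
    also have "\<dots> \<le> hausdorff_outer s (A \<union> B)" by (rule hausdorff_pre_le_outer[OF \<delta>(1)])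
    finally show ?thesis .
  qed
  have ne: "{0<..} \<noteq> ({} :: real set)" by (metis greaterThan_iff empty_iff zero_less_one)
  have "hausdorff_outer s A + hausdorff_pre s \<delta>2 B \<le> hausdorff_outer s (A \<union> B)" if "0 < \<delta>2" for \<delta>2
    unfolding hausdorff_outer_eq[of s A] ennreal_SUP_add_left[OF ne, symmetric]
    by (rule SUP_least) (use that ** in auto)
  then have "(SUP \<delta>2\<in>{0<..}. hausdorff_pre s \<delta>2 B + hausdorff_outer s A) \<le> hausdorff_outer s (A \<union> B)"
    by (intro SUP_least) (auto simp: add.commute)
  then show ?thesis
    unfolding ennreal_SUP_add_left[OF ne] by (simp add: hausdorff_outer_eq[of s B] add.commute)
qed

lemma sum_upto_even_odd: "(\<Sum>i<2 * N. f i) = (\<Sum>i<N. f (2 * i) + f (2 * i + 1))"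
  for f :: "nat \<Rightarrow> 'a::comm_monoid_add"
  by (induction N) (auto simp: algebra_simps)

lemma suminf_tail_small_ennreal:
  fixes f :: "nat \<Rightarrow> ennreal"
  assumes fin: "(\<Sum>i. f i) < top" and e: "0 < e"
  obtains k where "(\<Sum>i. f (i + k)) \<le> ennreal e"
proof -
  define r where "r i = enn2real (f i)" for i
  have f: "f i = ennreal (r i)" for i
    using fin ennreal_suminf_lessD[of f top i] by (simp add: r_def)
  have r: "0 \<le> r i" for i by (simp add: r_def)
  have s: "summable r"
    using fin by (intro summable_suminf_not_top) (auto simp: f r)
  obtain k where "norm (\<Sum>i. r (i + k)) < e"
    using suminf_exist_split[OF e s] by blast
  moreover have "(\<Sum>i. f (i + k)) = ennreal (\<Sum>i. r (i + k))"
    unfolding f using s r by (intro suminf_ennreal2) (auto simp: summable_iff_shift)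
  ultimately show ?thesis using that[of k] by (simp add: ennreal_leI)
qed

text \<open>
  Caratheodory's argument for metric outer measures. The sets \<open>D k\<close> of points of
  \<open>T\<close> at distance at least \<open>1 / (k + 1)\<close> from \<open>C\<close> are
  separated from \<open>C\<close>. The points of \<open>T - C\<close> outside \<open>D k\<close> lie
  in the annuli \<open>R i\<close> with \<open>k \<le> i\<close>. Annuli whose indices have the same
  parity are separated from one another; hence the outer measures of all annuli have a finite sum,
  whose tails are small.
\<close>

lemma hausdorff_outer_closed_measurable:
  assumes C: "closed C"
  shows "hausdorff_outer s (T \<inter> C) + hausdorff_outer s (T - C) \<le> hausdorff_outer s T"
proof (cases "C = {} \<or> hausdorff_outer s T = top")
  case True
  then show ?thesis by auto
next
  case False
  then have C0: "C \<noteq> {}" and fin: "hausdorff_outer s T < top" by (auto simp: less_top)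
  let ?H = "hausdorff_outer s"
  define D where "D k = {x\<in>T. 1 / real (Suc k) \<le> infdist x C}" for k :: nat
  define R where "R k = {x\<in>T. 1 / real (Suc (Suc k)) \<le> infdist x C \<and> infdist x C < 1 / real (Suc k)}" for k :: nat
  have inD: "?H (T \<inter> C) + ?H (D k) \<le> ?H T" for k
  proof -
    have "?H (T \<inter> C) + ?H (D k) \<le> ?H (T \<inter> C \<union> D k)"
    proof (rule hausdorff_outer_separated[of "1 / real (Suc k)"])
      fix x y assume x: "x \<in> T \<inter> C" and y: "y \<in> D k"
      have "infdist y C \<le> dist y x" using x by (intro infdist_le) auto
      then show "1 / real (Suc k) \<le> dist x y" using y by (auto simp: D_def dist_commute)
    qed simp
    also have "\<dots> \<le> ?H T" by (rule hausdorff_outer_mono) (auto simp: D_def)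
    finally show ?thesis .
  qed
  have parity: "(\<Sum>i<N. ?H (R (2 * i + p))) \<le> ?H (\<Union>i<N. R (2 * i + p))" for N p
  proof (induction N)
    case (Suc N)
    show ?case
    proof (cases "N = 0")
      case False
      have "(\<Sum>i<Suc N. ?H (R (2 * i + p))) \<le> ?H (\<Union>i<N. R (2 * i + p)) + ?H (R (2 * N + p))"
        using Suc.IH by (simp add: add_right_mono)
      also have "\<dots> \<le> ?H ((\<Union>i<N. R (2 * i + p)) \<union> R (2 * N + p))"
      proof (rule hausdorff_outer_separated[of "1 / real (2 * N + p) - 1 / real (2 * N + p + 1)"])
        show "0 < 1 / real (2 * N + p) - 1 / real (2 * N + p + 1)"
          using False by (simp add: frac_less2)
        fix x y assume "x \<in> (\<Union>i<N. R (2 * i + p))" and y: "y \<in> R (2 * N + p)"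
        then obtain i where i: "i < N" "x \<in> R (2 * i + p)" by auto
        have "1 / real (2 * N + p) \<le> 1 / real (Suc (Suc (2 * i + p)))"
          using i(1) False by (intro divide_left_mono) auto
        also have "\<dots> \<le> infdist x C" using i(2) by (simp add: R_def)
        finally have "1 / real (2 * N + p) \<le> infdist x C" .
        moreover have "infdist y C < 1 / real (2 * N + p + 1)" using y by (simp add: R_def add.commute)
        moreover have "\<bar>infdist x C - infdist y C\<bar> \<le> dist x y" by (rule infdist_triangle_abs)
        ultimately show "1 / real (2 * N + p) - 1 / real (2 * N + p + 1) \<le> dist x y" by linarith
      qed
      also have "(\<Union>i<N. R (2 * i + p)) \<union> R (2 * N + p) = (\<Union>i<Suc N. R (2 * i + p))"
        by (auto simp: lessThan_Suc)
      finally show ?thesis .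
    qed (simp add: lessThan_Suc)
  qed simp
  have "(\<Sum>i<n. ?H (R i)) \<le> ?H T + ?H T" for n
  proof -
    have "(\<Sum>i<n. ?H (R i)) \<le> (\<Sum>i<2 * n. ?H (R i))" by (rule sum_mono2) auto
    also have "\<dots> = (\<Sum>i<n. ?H (R (2 * i + 0))) + (\<Sum>i<n. ?H (R (2 * i + 1)))"
      by (simp add: sum_upto_even_odd sum.distrib)
    also have "\<dots> \<le> ?H T + ?H T"
      by (intro add_mono order_trans[OF parity] hausdorff_outer_mono) (auto simp: R_def)
    finally show ?thesis .
  qed
  then have "(\<Sum>i. ?H (R i)) \<le> ?H T + ?H T" by (intro suminf_le_const) auto
  also have "\<dots> < top" using fin by simp
  finally have finR: "(\<Sum>i. ?H (R i)) < top" .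
  show ?thesis
  proof (rule ennreal_le_epsilon)
    fix e :: real assume "0 < e"
    then obtain k where k: "(\<Sum>i. ?H (R (i + k))) \<le> ennreal e"
      using suminf_tail_small_ennreal[OF finR] by metis
    have "T - C \<subseteq> D k \<union> (\<Union>i. R (i + k))"
    proof
      fix x assume x: "x \<in> T - C"
      then have pos: "0 < infdist x C"
        using in_closed_iff_infdist_zero[OF C C0] infdist_nonneg[of x C] by (auto simp: less_le)
      show "x \<in> D k \<union> (\<Union>i. R (i + k))"
      proof (cases "x \<in> D k")
        case False
        define n where "n = (LEAST n. 1 / real (Suc n) \<le> infdist x C)"
        have "\<exists>n. 1 / real (Suc n) \<le> infdist x C"
          using reals_Archimedean[OF pos] by (auto simp: inverse_eq_divide intro: less_imp_le)
        then have n: "1 / real (Suc n) \<le> infdist x C" unfolding n_def by (rule LeastI_ex)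
        have lt: "infdist x C < 1 / real (Suc m)" if "m < n" for m
          using not_less_Least[of m "\<lambda>n. 1 / real (Suc n) \<le> infdist x C"] that n_def by auto
        have "k < n"
        proof (rule ccontr)
          assume "\<not> k < n"
          then have "1 / real (Suc k) \<le> 1 / real (Suc n)" by (intro divide_left_mono) auto
          then show False using False n x by (auto simp: D_def)
        qed
        then obtain i where i: "n = Suc (i + k)" by (metis add.commute less_natE)
        have "x \<in> R (i + k)"
          using n lt[of "i + k"] i x by (auto simp: R_def)
        then show ?thesis by blast
      qed simp
    qed
    then have "?H (T - C) \<le> ?H (D k) + ?H (\<Union>i. R (i + k))"
      by (meson hausdorff_outer_Un_le hausdorff_outer_mono order_trans)
    also have "?H (\<Union>i. R (i + k)) \<le> (\<Sum>i. ?H (R (i + k)))" by (rule hausdorff_outer_UN_le)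
    also note k
    finally have "?H (T - C) \<le> ?H (D k) + ennreal e" by simp
    then have "?H (T \<inter> C) + ?H (T - C) \<le> ?H (T \<inter> C) + ?H (D k) + ennreal e"
      by (simp add: add_left_mono add.assoc)
    also have "\<dots> \<le> ?H T + ennreal e" by (intro add_right_mono inD)
    finally show "?H (T \<inter> C) + ?H (T - C) \<le> ?H T + ennreal e" .
  qed
qed

definition hausdorff_measure :: "nat \<Rightarrow> 'a::metric_space measure" where
  "hausdorff_measure s = measure_of UNIV (sets borel) (hausdorff_outer s)"

lemma sets_hausdorff_measure[simp, measurable_cong]: "sets (hausdorff_measure s) = sets borel"
  unfolding hausdorff_measure_def
  by (metis sets.sets_measure_of_eq sets_measure_of_conv space_borel sets.space_closed)

lemma space_hausdorff_measure[simp]: "space (hausdorff_measure s) = UNIV"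
  by (simp add: hausdorff_measure_def space_measure_of_conv)

text \<open>
  The Caratheodory measurable sets form a sigma-algebra that contains the closed sets, hence all
  Borel sets, and the outer measure is countably additive on it.
\<close>

lemma emeasure_hausdorff_measure:
  assumes "X \<in> sets borel"
  shows "emeasure (hausdorff_measure s) X = hausdorff_outer s X"
proof -
  let ?H = "hausdorff_outer s :: 'a set \<Rightarrow> ennreal"
  let ?L = "lambda_system UNIV UNIV ?H"
  interpret P: sigma_algebra UNIV "UNIV :: 'a set set" using sigma_algebra_Pow[of UNIV] by simp
  have ms: "measure_space UNIV ?L ?H"
    by (rule P.caratheodory_lemma[OF outer_measure_space_hausdorff])
  then interpret L: sigma_algebra UNIV ?L by (simp add: measure_space_def)
  have "C \<in> ?L" if "closed C" for C
    unfolding P.lambda_system_eq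
    by (auto intro!: antisym hausdorff_outer_closed_measurable[OF that])
      (metis Int_Diff_Un hausdorff_outer_Un_le)
  then have "sigma_sets UNIV (Collect closed) \<subseteq> ?L"
    by (intro L.sigma_sets_subset) auto
  then have sub: "sets borel \<subseteq> ?L" by (simp add: borel_eq_closed)
  have "countably_additive (sets borel) ?H"
    unfolding countably_additive_def
  proof (intro allI impI)
    fix A :: "nat \<Rightarrow> 'a set" assume A: "range A \<subseteq> sets borel" "disjoint_family A" "\<Union> (range A) \<in> sets borel"
    then have "range A \<subseteq> ?L" "\<Union> (range A) \<in> ?L" using sub by auto
    then show "(\<Sum>i. ?H (A i)) = ?H (\<Union> (range A))"
      using ms A(2) unfolding measure_space_def countably_additive_def by blast
  qed
  then show ?thesis
    using assms unfolding hausdorff_measure_def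
    by (intro emeasure_measure_of_sigma) (auto simp: positive_def sets.sigma_algebra_axioms[of borel, simplified])
qed

lemma hausdorff_gauge_mono:
  assumes "A \<noteq> {} \<Longrightarrow> B \<noteq> {}" "A \<noteq> {} \<Longrightarrow> diameter A \<le> L * diameter B" "0 \<le> L" "bounded A" "bounded B"
  shows "hausdorff_gauge s A \<le> ennreal (L ^ s) * hausdorff_gauge s B"
proof (cases "A = {}")
  case False
  have "(diameter A / 2) ^ s \<le> (L * diameter B / 2) ^ s"
    using assms False diameter_ge_0[OF assms(4)] by (intro power_mono) auto
  also have "\<dots> = L ^ s * (diameter B / 2) ^ s" by (simp add: power_mult_distrib[symmetric])
  finally have "unit_ball_vol (real s) * (diameter A / 2) ^ s \<le> L ^ s * (unit_ball_vol (real s) * (diameter B / 2) ^ s)"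
    using unit_ball_vol_pos[of "real s"] by (simp add: mult.left_commute)
  then show ?thesis
    using False assms unit_ball_vol_pos[of "real s"] diameter_ge_0[OF assms(5)]
    by (simp add: hausdorff_gauge_def ennreal_mult[symmetric] ennreal_leI)
qed (simp add: hausdorff_gauge_def)

lemma ennreal_le_mult_INF:
  assumes "0 < c" "\<And>i. i \<in> I \<Longrightarrow> a \<le> ennreal c * f i"
  shows "a \<le> ennreal c * (INF i\<in>I. f i)"
proof -
  have c: "ennreal c * ennreal (1 / c) = 1" using assms(1) by (simp add: ennreal_mult[symmetric])
  have "ennreal (1 / c) * a \<le> (INF i\<in>I. f i)"
  proof (rule INF_greatest)
    fix i assume "i \<in> I"
    from mult_left_mono[OF assms(2)[OF this], of "ennreal (1 / c)"]
    have "ennreal (1 / c) * a \<le> (ennreal c * ennreal (1 / c)) * f i" by (simp add: ac_simps)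
    then show "ennreal (1 / c) * a \<le> f i" by (simp add: c)
  qed
  from mult_left_mono[OF this, of "ennreal c"]
  have "(ennreal c * ennreal (1 / c)) * a \<le> ennreal c * (INF i\<in>I. f i)" by (simp add: mult.assoc)
  then show ?thesis by (simp add: c)
qed

text \<open>
  The images of the sets of a cover have diameters that are at most \<open>L\<close> times larger.
  Both the gauge and the fineness of the cover are adjusted accordingly.
\<close>

lemma hausdorff_outer_lipschitz:
  fixes f :: "'a::euclidean_space \<Rightarrow> 'b::euclidean_space"
  assumes L: "0 < L" and lip: "\<And>x y. x \<in> X \<Longrightarrow> y \<in> X \<Longrightarrow> dist (f x) (f y) \<le> L * dist x y"
  shows "hausdorff_outer s (f ` X) \<le> ennreal (L ^ s) * hausdorff_outer s X"
proof (rule hausdorff_outer_leI)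
  fix \<delta> :: real assume \<delta>: "0 < \<delta>"
  have "hausdorff_pre s \<delta> (f ` X) \<le> ennreal (L ^ s) * hausdorff_pre s (\<delta> / L) X"
    unfolding hausdorff_pre_def[of s "\<delta> / L"]
  proof (rule ennreal_le_mult_INF)
      fix U assume U: "U \<in> fine_cover (\<delta> / L) X"
      define V where "V i = f ` (U i \<inter> X)" for i
      have d: "diameter (V i) \<le> L * diameter (U i)" for i
      proof (rule diameter_le)
        have "bounded (U i)" using U by (auto simp: fine_cover_def)
        then show "V i \<noteq> {} \<or> 0 \<le> L * diameter (U i)" using L diameter_ge_0 by (metis less_imp_le mult_nonneg_nonneg)
        fix x y assume "x \<in> V i" "y \<in> V i"
        then obtain a b where ab: "a \<in> U i" "b \<in> U i" "a \<in> X" "b \<in> X" "x = f a" "y = f b" by (auto simp: V_def)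
        then have "dist x y \<le> L * dist a b" using lip by simp
        also have "\<dots> \<le> L * diameter (U i)"
          using ab U L by (intro mult_left_mono diameter_bounded_bound) (auto simp: fine_cover_def)
        finally show "norm (x - y) \<le> L * diameter (U i)" by (simp add: dist_norm)
      qed
      have b: "bounded (V i)" for i
      proof (cases "U i \<inter> X = {}")
        case False
        then obtain a where a: "a \<in> U i" "a \<in> X" by blast
        show ?thesis
        proof (rule bounded_subset[of "cball (f a) (L * diameter (U i))"])
          show "V i \<subseteq> cball (f a) (L * diameter (U i))"
          proof
            fix y assume "y \<in> V i"
            then obtain b where b: "b \<in> U i" "b \<in> X" "y = f b" by (auto simp: V_def)
            have "dist (f a) y \<le> L * dist a b" using lip a b by simp
            also have "\<dots> \<le> L * diameter (U i)"
              using a b U L by (intro mult_left_mono diameter_bounded_bound) (auto simp: fine_cover_def)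
            finally show "y \<in> cball (f a) (L * diameter (U i))" by simp
          qed
        qed simp
      qed (simp add: V_def)
      have "V \<in> fine_cover \<delta> (f ` X)"
        unfolding fine_cover_def
      proof (intro CollectI conjI allI b)
        show "f ` X \<subseteq> (\<Union>i. V i)" using U by (fastforce simp: fine_cover_def V_def)
        fix i
        have "L * diameter (U i) \<le> \<delta>" using U L by (auto simp: fine_cover_def field_simps)
        then show "diameter (V i) \<le> \<delta>" using d[of i] by simp
      qed
      then have "hausdorff_pre s \<delta> (f ` X) \<le> (\<Sum>i. hausdorff_gauge s (V i))" by (rule hausdorff_pre_le)
      also have "\<dots> \<le> (\<Sum>i. ennreal (L ^ s) * hausdorff_gauge s (U i))"
        using L U d b by (intro suminf_le hausdorff_gauge_mono) (auto simp: V_def fine_cover_def)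
      finally show "hausdorff_pre s \<delta> (f ` X) \<le> ennreal (L ^ s) * (\<Sum>i. hausdorff_gauge s (U i))" by simp
  qed (use L in simp)
  also have "\<dots> \<le> ennreal (L ^ s) * hausdorff_outer s X"
    using L \<delta> by (intro mult_left_mono hausdorff_pre_le_outer) auto
  finally show "hausdorff_pre s \<delta> (f ` X) \<le> ennreal (L ^ s) * hausdorff_outer s X" .
qed

lemma hausdorff_outer_contraction:
  fixes f :: "'a::euclidean_space \<Rightarrow> 'b::euclidean_space"
  assumes "\<And>x y. x \<in> X \<Longrightarrow> y \<in> X \<Longrightarrow> dist (f x) (f y) \<le> dist x y"
  shows "hausdorff_outer s (f ` X) \<le> hausdorff_outer s X"
  using hausdorff_outer_lipschitz[of 1 X f s] assms by simp

text \<open>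
  The hull is the intersection, over finer and finer almost optimal covers, of the unions of the
  closures of their sets. Taking closures does not change diameters.
\<close>

lemma hausdorff_outer_borel_hull:
  fixes X :: "'a::euclidean_space set"
  obtains Y where "Y \<in> sets borel" "X \<subseteq> Y" "hausdorff_outer s Y = hausdorff_outer s X"
proof (cases "hausdorff_outer s X = top")
  case True
  then have "hausdorff_outer s (UNIV :: 'a set) = hausdorff_outer s X"
    using hausdorff_outer_mono[of X UNIV s] by (simp add: top_unique)
  then show ?thesis using that[of UNIV] by simp
next
  case False
  let ?H = "hausdorff_outer s"
  have "\<exists>U\<in>fine_cover (1 / real (Suc m)) X. (\<Sum>j. hausdorff_gauge s (U j)) \<le> ?H X + ennreal (1 / real (Suc m))" for m
  proof -
    have "hausdorff_pre s (1 / real (Suc m)) X \<le> ?H X" by (rule hausdorff_pre_le_outer) simp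
    also have "\<dots> < ?H X + ennreal (1 / real (Suc m))"
      using False ennreal_add_left_cancel_less[of "?H X" 0 "ennreal (1 / real (Suc m))"]
      by (auto simp del: ennreal_add_left_cancel_less)
    finally show ?thesis unfolding hausdorff_pre_def INF_less_iff by (meson less_imp_le)
  qed
  then obtain U where U: "\<And>m. U m \<in> fine_cover (1 / real (Suc m)) X"
    "\<And>m. (\<Sum>j. hausdorff_gauge s (U m j)) \<le> ?H X + ennreal (1 / real (Suc m))" by metis
  define Y where "Y = (\<Inter>m. \<Union>i. closure (U m i))"
  have "Y \<in> sets borel" unfolding Y_def by (intro sets.countable_INT sets.countable_UN) auto
  moreover have XY: "X \<subseteq> Y"
  proof
    fix x assume "x \<in> X"
    then have "\<exists>i. x \<in> U m i" for m using U(1)[of m] by (auto simp: fine_cover_def)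
    then have "\<exists>i. x \<in> closure (U m i)" for m by (metis closure_subset subsetD)
    then show "x \<in> Y" unfolding Y_def by simp
  qed
  moreover have "?H Y \<le> ?H X"
  proof (rule hausdorff_outer_leI)
    fix \<delta> :: real assume \<delta>: "0 < \<delta>"
    show "hausdorff_pre s \<delta> Y \<le> ?H X"
    proof (rule ennreal_le_epsilon)
      fix e :: real assume "0 < e"
      then obtain m where m: "1 / real (Suc m) < min \<delta> e"
        using \<delta> reals_Archimedean[of "min \<delta> e"] by (auto simp: inverse_eq_divide)
      have cov: "(\<lambda>i. closure (U m i)) \<in> fine_cover (1 / real (Suc m)) Y"
        using U(1)[of m] by (auto simp: fine_cover_def Y_def diameter_closure bounded_closure)
      have "hausdorff_pre s \<delta> Y \<le> hausdorff_pre s (1 / real (Suc m)) Y"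
        using m by (intro hausdorff_pre_antimono) simp
      also have "\<dots> \<le> (\<Sum>i. hausdorff_gauge s (closure (U m i)))" by (rule hausdorff_pre_le[OF cov])
      also have "\<dots> = (\<Sum>i. hausdorff_gauge s (U m i))"
      proof -
        have "bounded (U m i)" for i using U(1)[of m] by (simp add: fine_cover_def)
        then have "hausdorff_gauge s (closure (U m i)) = hausdorff_gauge s (U m i)" for i
          by (simp add: hausdorff_gauge_def diameter_closure)
        then show ?thesis by simp
      qed
      also have "\<dots> \<le> ?H X + ennreal (1 / real (Suc m))" by (rule U(2))
      also have "\<dots> \<le> ?H X + ennreal e" using m by (intro add_left_mono ennreal_leI) simp
      finally show "hausdorff_pre s \<delta> Y \<le> ?H X + ennreal e" .
    qed
  qed
  ultimately show ?thesis using that[of Y] hausdorff_outer_mono[OF XY, of s] by (simp add: antisym)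
qed


section \<open>Hausdorff measure on a subspace\<close>

lemma hausdorff_pre_finite_cover:
  assumes K: "finite K" and cov: "A \<subseteq> (\<Union>k\<in>K. U k)" and \<delta>: "0 \<le> \<delta>"
    and U: "\<And>k. k \<in> K \<Longrightarrow> bounded (U k) \<and> diameter (U k) \<le> \<delta>"
  shows "hausdorff_pre s \<delta> A \<le> (\<Sum>k\<in>K. hausdorff_gauge s (U k))"
proof -
  obtain h where h: "bij_betw h {0..<card K} K" using ex_bij_betw_nat_finite[OF K] by blast
  define V where "V i = (if i < card K then U (h i) else {})" for i
  have hK: "h i \<in> K" if "i < card K" for i using h that by (auto simp: bij_betw_def)
  have "V \<in> fine_cover \<delta> A"
    unfolding fine_cover_def
  proof (intro CollectI conjI allI subsetI)
    fix x assume "x \<in> A"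
    then obtain k where "k \<in> K" "x \<in> U k" using cov by blast
    moreover have "k \<in> h ` {0..<card K}" using h \<open>k \<in> K\<close> by (simp add: bij_betw_def)
    ultimately obtain i where "i < card K" "x \<in> U (h i)" by auto
    then show "x \<in> (\<Union>i. V i)" by (auto simp: V_def)
  qed (use hK U \<delta> in \<open>auto simp: V_def\<close>)
  then have "hausdorff_pre s \<delta> A \<le> (\<Sum>i. hausdorff_gauge s (V i))" by (rule hausdorff_pre_le)
  also have "\<dots> = (\<Sum>i\<in>{0..<card K}. hausdorff_gauge s (V i))"
    by (rule suminf_finite) (auto simp: V_def hausdorff_gauge_def)
  also have "\<dots> = (\<Sum>i\<in>{0..<card K}. hausdorff_gauge s (U (h i)))"
    by (rule sum.cong) (auto simp: V_def)
  also have "\<dots> = (\<Sum>k\<in>K. hausdorff_gauge s (U k))"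
    using h by (rule sum.reindex_bij_betw)
  finally show ?thesis .
qed

text \<open>
  In orthonormal coordinates the ball is covered by at most \<open>((2 * r + 2) * N) ^ d\<close>
  cubes of side \<open>1 / N\<close>, each of diameter at most \<open>d / N\<close>. For \<open>s =
  d\<close> the bound does not depend on \<open>N\<close>, and for \<open>d < s\<close> it tends to
  0.
\<close>

lemma hausdorff_pre_subspace_ball:
  fixes M :: "'a::euclidean_space set"
  assumes M: "subspace M" and N: "0 < N" and r: "0 \<le> r"
  defines "d \<equiv> dim M"
  shows "hausdorff_pre s (d / real N) (cball 0 r \<inter> M)
    \<le> ennreal (unit_ball_vol (real s) * ((2 * r + 2) ^ d * (real d / 2) ^ s) * (real N ^ d / real N ^ s))"
proof -
  obtain B where B: "orthonormal_basis_of M B" using M by (rule orthonormal_basis_of_exists)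
  note D = orthonormal_basis_ofD[OF B]
  define K where "K = (\<Pi>\<^sub>E b\<in>B. {..nat \<lceil>2 * r * N\<rceil>})"
  define U where "U k = {x\<in>M. \<forall>b\<in>B. real (k b) / N \<le> x \<bullet> b + r \<and> x \<bullet> b + r \<le> (real (k b) + 1) / N}" for k :: "'a \<Rightarrow> nat"
  have fK: "finite K" unfolding K_def using D(1) by (intro finite_PiE) auto
  have cK: "card K = (nat \<lceil>2 * r * N\<rceil> + 1) ^ d"
    unfolding K_def using D(1,3) by (simp add: card_PiE d_def)
  have cov: "cball 0 r \<inter> M \<subseteq> (\<Union>k\<in>K. U k)"
  proof
    fix x assume x: "x \<in> cball 0 r \<inter> M"
    define k where "k = (\<lambda>b\<in>B. nat \<lfloor>(x \<bullet> b + r) * N\<rfloor>)"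
    have xb: "0 \<le> x \<bullet> b + r \<and> x \<bullet> b + r \<le> 2 * r" if "b \<in> B" for b
    proof -
      have "\<bar>x \<bullet> b\<bar> \<le> norm x * norm b" by (rule Cauchy_Schwarz_ineq2)
      then have "\<bar>x \<bullet> b\<bar> \<le> r" using x D(7)[OF that] by simp
      then show ?thesis by (simp add: abs_le_iff)
    qed
    have nn: "0 \<le> (x \<bullet> b + r) * N" if "b \<in> B" for b using xb[OF that] by simp
    have "k \<in> K"
    proof -
      have "nat \<lfloor>(x \<bullet> b + r) * N\<rfloor> \<le> nat \<lceil>2 * r * N\<rceil>" if "b \<in> B" for b
      proof -
        have "(x \<bullet> b + r) * N \<le> 2 * r * N" using xb[OF that] by (intro mult_right_mono) auto
        then show ?thesis by linarith
      qed
      then show ?thesis by (auto simp: K_def k_def)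
    qed
    moreover have "x \<in> U k"
    proof -
      have "real (k b) \<le> (x \<bullet> b + r) * N \<and> (x \<bullet> b + r) * N \<le> real (k b) + 1" if "b \<in> B" for b
        using that nn[OF that] by (simp add: k_def)
      then show ?thesis using x N by (auto simp: U_def field_simps)
    qed
    ultimately show "x \<in> (\<Union>k\<in>K. U k)" by blast
  qed
  have dist: "norm (x - y) \<le> d / real N" if "x \<in> U k" "y \<in> U k" for x y k
  proof -
    have xy: "x - y \<in> M" using that M by (auto simp: U_def subspace_diff)
    have "norm (x - y) = norm (\<Sum>b\<in>B. ((x - y) \<bullet> b) *\<^sub>R b)"
      using orthonormal_basis_of_expand[OF B xy] by simp
    also have "\<dots> \<le> (\<Sum>b\<in>B. norm (((x - y) \<bullet> b) *\<^sub>R b))" by (rule norm_sum)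
    also have "\<dots> = (\<Sum>b\<in>B. \<bar>x \<bullet> b - y \<bullet> b\<bar>)" using D(7) by (intro sum.cong) (auto simp: inner_diff_left)
    also have "\<dots> \<le> (\<Sum>b\<in>B. 1 / real N)"
    proof (rule sum_mono)
      fix b assume "b \<in> B"
      then have "real (k b) / N \<le> x \<bullet> b + r" "x \<bullet> b + r \<le> (real (k b) + 1) / N"
        "real (k b) / N \<le> y \<bullet> b + r" "y \<bullet> b + r \<le> (real (k b) + 1) / N" using that by (auto simp: U_def)
      then show "\<bar>x \<bullet> b - y \<bullet> b\<bar> \<le> 1 / real N" by (simp add: add_divide_distrib abs_le_iff)
    qed
    finally show ?thesis using D(3) by (simp add: d_def)
  qed
  have bU: "bounded (U k)" for k
  proof (cases "U k = {}")
    case False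
    then obtain a where "a \<in> U k" by blast
    then have "U k \<subseteq> cball a (d / real N)" using dist by (auto simp: dist_norm norm_minus_commute)
    then show ?thesis by (rule bounded_subset[rotated]) simp
  qed simp
  have dU: "diameter (U k) \<le> d / real N" for k
    using dist by (intro diameter_le) auto
  have "hausdorff_pre s (d / real N) (cball 0 r \<inter> M) \<le> (\<Sum>k\<in>K. hausdorff_gauge s (U k))"
    by (rule hausdorff_pre_finite_cover[OF fK cov]) (use bU dU in auto)
  also have "\<dots> \<le> (\<Sum>k\<in>K. ennreal (unit_ball_vol (real s) * (d / real N / 2) ^ s))"
    using dU diameter_ge_0[OF bU] unit_ball_vol_pos[of "real s"]
    by (intro sum_mono) (auto simp: hausdorff_gauge_def intro!: ennreal_leI mult_left_mono power_mono divide_right_mono)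
  also have "\<dots> = ennreal ((nat \<lceil>2 * r * N\<rceil> + 1) ^ d * (unit_ball_vol (real s) * (d / real N / 2) ^ s))"
    using unit_ball_vol_pos[of "real s"] by (simp add: cK ennreal_mult ennreal_of_nat_eq_real_of_nat[symmetric] of_nat_power[symmetric] del: of_nat_power)
  also have "\<dots> \<le> ennreal (((2 * r + 2) * N) ^ d * (unit_ball_vol (real s) * (d / real N / 2) ^ s))"
  proof (intro ennreal_leI mult_right_mono)
    have "real (nat \<lceil>2 * r * N\<rceil>) \<le> 2 * r * N + 1"
      using r by (simp add: ceiling_correct of_nat_nat)
    moreover have "1 \<le> real N" using N by simp
    ultimately have "real (nat \<lceil>2 * r * N\<rceil> + 1) \<le> (2 * r + 2) * N" by (simp add: algebra_simps)
    then have "real (nat \<lceil>2 * r * N\<rceil> + 1) ^ d \<le> ((2 * r + 2) * N) ^ d" by (intro power_mono) auto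
    then show "real ((nat \<lceil>2 * r * N\<rceil> + 1) ^ d) \<le> ((2 * r + 2) * N) ^ d" by simp
  qed (use unit_ball_vol_pos[of "real s"] in auto)
  also have "((2 * r + 2) * N) ^ d * (unit_ball_vol (real s) * (d / real N / 2) ^ s)
      = unit_ball_vol (real s) * ((2 * r + 2) ^ d * (real d / 2) ^ s) * (real N ^ d / real N ^ s)"
    by (simp add: power_mult_distrib power_divide mult_ac)
  finally show ?thesis .
qed

lemma hausdorff_outer_ball_subspace_finite:
  fixes M :: "'a::euclidean_space set"
  assumes M: "subspace M"
  shows "hausdorff_outer (dim M) (cball 0 r \<inter> M) < \<infinity>"
proof (cases "0 \<le> r")
  case r: True
  let ?d = "dim M"
  let ?C = "unit_ball_vol (real ?d) * ((2 * r + 2) ^ ?d * (real ?d / 2) ^ ?d)"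
  have "hausdorff_outer ?d (cball 0 r \<inter> M) \<le> ennreal ?C"
  proof (rule hausdorff_outer_leI)
    fix \<delta> :: real assume \<delta>: "0 < \<delta>"
    obtain N :: nat where N: "?d / \<delta> < N" using reals_Archimedean2 by blast
    then have "0 < real N" using \<delta> by (metis divide_nonneg_pos le_less_trans of_nat_0_le_iff)
    then have "hausdorff_pre ?d \<delta> (cball 0 r \<inter> M) \<le> hausdorff_pre ?d (?d / real N) (cball 0 r \<inter> M)"
      using N \<delta> by (intro hausdorff_pre_antimono) (auto simp: field_simps)
    also have "\<dots> \<le> ennreal ?C"
      using hausdorff_pre_subspace_ball[OF M _ r, of N ?d] \<open>0 < real N\<close> by simp
    finally show "hausdorff_pre ?d \<delta> (cball 0 r \<inter> M) \<le> ennreal ?C" .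
  qed
  then show ?thesis using le_less_trans by fastforce
qed simp

lemma hausdorff_outer_lower_dim:
  fixes M :: "'a::euclidean_space set"
  assumes M: "subspace M" and s: "dim M < s"
  shows "hausdorff_outer s M = 0"
proof -
  let ?d = "dim M"
  have "hausdorff_outer s (cball 0 (real n) \<inter> M) = 0" for n
  proof -
    let ?C = "unit_ball_vol (real s) * ((2 * real n + 2) ^ ?d * (real ?d / 2) ^ s)"
    have C: "0 \<le> ?C" using unit_ball_vol_pos[of "real s"] by simp
    have "hausdorff_outer s (cball 0 (real n) \<inter> M) \<le> 0"
    proof (rule hausdorff_outer_leI, rule ennreal_le_epsilon)
      fix \<delta> e :: real assume \<delta>: "0 < \<delta>" and e: "0 < e"
      obtain N :: nat where N: "max (?d / \<delta>) (?C / e) < N" using reals_Archimedean2 by blast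
      have "0 \<le> ?d / \<delta>" using \<delta> by simp
      then have N0: "0 < real N" using N by linarith
      then have "hausdorff_pre s \<delta> (cball 0 (real n) \<inter> M) \<le> hausdorff_pre s (?d / real N) (cball 0 (real n) \<inter> M)"
        using N \<delta> by (intro hausdorff_pre_antimono) (auto simp: field_simps)
      also have "\<dots> \<le> ennreal (?C * (real N ^ ?d / real N ^ s))"
        using hausdorff_pre_subspace_ball[OF M, of N "real n" s] N0 by simp
      also have "\<dots> \<le> ennreal e"
      proof (rule ennreal_leI)
        have "real N ^ Suc ?d \<le> real N ^ s"
          using N0 s by (intro power_increasing) auto
        then have "real N ^ ?d / real N ^ s \<le> 1 / real N"
          using N0 by (simp add: field_simps)
        then have "?C * (real N ^ ?d / real N ^ s) \<le> ?C * (1 / real N)" by (rule mult_left_mono[OF _ C])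
        also have "\<dots> \<le> e" using N N0 e by (simp add: field_simps)
        finally show "?C * (real N ^ ?d / real N ^ s) \<le> e" .
      qed
      finally show "hausdorff_pre s \<delta> (cball 0 (real n) \<inter> M) \<le> 0 + ennreal e" by simp
    qed
    then show ?thesis by simp
  qed
  moreover have "M = (\<Union>n. cball 0 (real n) \<inter> M)" using real_arch_simple by fastforce
  ultimately show ?thesis
    using hausdorff_outer_null_UN[of UNIV s "\<lambda>n. cball 0 (real n) \<inter> M"] by simp
qed

lemma hausdorff_outer_translate:
  fixes X :: "'a::euclidean_space set"
  shows "hausdorff_outer s ((+) v ` X) = hausdorff_outer s X"
proof (rule antisym)
  show "hausdorff_outer s ((+) v ` X) \<le> hausdorff_outer s X"
    by (rule hausdorff_outer_contraction) simp
  have "hausdorff_outer s ((\<lambda>x. x - v) ` (+) v ` X) \<le> hausdorff_outer s ((+) v ` X)"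
    by (rule hausdorff_outer_contraction) (simp add: dist_norm)
  then show "hausdorff_outer s X \<le> hausdorff_outer s ((+) v ` X)" by (simp add: image_image)
qed

lemma emeasure_hausdorff_restricted:
  assumes [measurable]: "M \<in> sets borel" "X \<in> sets borel"
  shows "emeasure (density (hausdorff_measure s) (indicator M)) X = hausdorff_outer s (X \<inter> M)"
proof -
  have "emeasure (density (hausdorff_measure s) (indicator M)) X = emeasure (hausdorff_measure s) (X \<inter> M)"
    by (subst emeasure_density) (auto simp: indicator_inter_arith[symmetric] Int_commute mult.commute)
  then show ?thesis by (simp add: emeasure_hausdorff_measure)
qed

lemma invariant_on_hausdorff:
  fixes M :: "'a::euclidean_space set"
  assumes M: "subspace M"
  shows "invariant_on M (density (hausdorff_measure (dim M)) (indicator M))"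
proof -
  let ?H = "hausdorff_outer (dim M)"
  define \<nu> where "\<nu> = density (hausdorff_measure (dim M)) (indicator M)"
  note [measurable] = borel_subspace[OF M]
  have [simp, measurable_cong]: "sets \<nu> = sets borel" and [simp]: "space \<nu> = UNIV" by (simp_all add: \<nu>_def)
  have em: "emeasure \<nu> X = ?H (X \<inter> M)" if "X \<in> sets borel" for X
    unfolding \<nu>_def by (rule emeasure_hausdorff_restricted[OF borel_subspace[OF M] that])
  have "invariant_on M \<nu>"
    unfolding invariant_on_def
  proof (intro conjI allI ballI)
    show "emeasure \<nu> (- M) = 0" by (subst em) auto
    show "emeasure \<nu> (cball 0 r) < \<infinity>" for r
      using hausdorff_outer_ball_subspace_finite[OF M] by (subst em) auto
    fix v and f :: "'a \<Rightarrow> ennreal" assume v: "v \<in> M" and f: "f \<in> borel_measurable borel"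
    have "distr \<nu> borel ((+) v) = \<nu>"
    proof (rule measure_eqI)
      fix X assume "X \<in> sets (distr \<nu> borel ((+) v))"
      then have X: "X \<in> sets borel" by simp
      have "emeasure (distr \<nu> borel ((+) v)) X = ?H ((+) v -` X \<inter> M)"
        using X measurable_sets_borel[of "(+) v" borel X] by (subst emeasure_distr) (auto simp: em)
      also have "\<dots> = ?H ((+) v ` ((+) v -` X \<inter> M))" by (rule hausdorff_outer_translate[symmetric])
      also have "(+) v ` ((+) v -` X \<inter> M) = X \<inter> M"
      proof (intro equalityI subsetI)
        fix y assume "y \<in> X \<inter> M"
        then show "y \<in> (+) v ` ((+) v -` X \<inter> M)"
          using v M by (intro image_eqI[of _ _ "y - v"]) (auto simp: subspace_diff)
      qed (use v M in \<open>auto simp: subspace_add\<close>)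
      finally show "emeasure (distr \<nu> borel ((+) v)) X = emeasure \<nu> X" using X by (simp add: em)
    qed simp
    then have "integral\<^sup>N (distr \<nu> borel ((+) v)) f = integral\<^sup>N \<nu> f" by simp
    then show "(\<integral>\<^sup>+x. f (v + x) \<partial>\<nu>) = (\<integral>\<^sup>+x. f x \<partial>\<nu>)"
      using f by (subst (asm) nn_integral_distr) auto
  qed simp
  then show ?thesis by (simp add: \<nu>_def)
qed

text \<open>
  Hausdorff measure on \<open>M\<close> is translation invariant, hence proportional to Lebesgue
  measure. The constant of proportionality, which equals 1 by the isodiametric inequality, is kept
  in the form of the Hausdorff measure of the unit ball; it cancels later.
\<close>

lemma hausdorff_outer_eq_lborel_on:
  fixes M :: "'a::euclidean_space set"
  assumes M: "subspace M" and X: "X \<in> sets borel" "X \<subseteq> M"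
  shows "ennreal (unit_ball_vol (dim M)) * hausdorff_outer (dim M) X
       = hausdorff_outer (dim M) (cball 0 1 \<inter> M) * emeasure (lborel_on M) X"
proof -
  define \<nu> where "\<nu> = density (hausdorff_measure (dim M)) (indicator M)"
  note [measurable] = borel_subspace[OF M]
  have em: "emeasure \<nu> X = hausdorff_outer (dim M) (X \<inter> M)" if "X \<in> sets borel" for X
    unfolding \<nu>_def by (rule emeasure_hausdorff_restricted[OF borel_subspace[OF M] that])
  have "(indicator X :: 'a \<Rightarrow> ennreal) \<in> borel_measurable borel" using X(1) by simp
  from invariant_on_lborel_on_unique[OF M invariant_on_hausdorff[OF M] this]
  have "ennreal (unit_ball_vol (dim M)) * integral\<^sup>N \<nu> (indicator X)
      = emeasure \<nu> (cball 0 1) * integral\<^sup>N (lborel_on M) (indicator X)"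
    by (simp only: \<nu>_def)
  moreover have "integral\<^sup>N \<nu> (indicator X) = emeasure \<nu> X"
    using X(1) by (intro nn_integral_indicator) (simp add: \<nu>_def)
  ultimately show ?thesis using X em[of X] em[of "cball 0 1"] by (simp add: Int_absorb2)
qed

text \<open>
  For Borel sets this follows from the change of variables for Lebesgue measure, because an isometry
  from \<open>M\<close> to \<open>g ` M\<close> compares the constants of proportionality of
  Hausdorff measure on the two subspaces. An arbitrary set is replaced by a Borel hull.
\<close>

lemma hausdorff_outer_linear_image_le:
  fixes g :: "'a::euclidean_space \<Rightarrow> 'b::euclidean_space"
  assumes g: "linear g" and M: "subspace M" and inj: "inj_on g M" and X: "X \<subseteq> M"
  shows "hausdorff_outer (dim M) (g ` X) \<le> ennreal (vol_factor M g) * hausdorff_outer (dim M) X"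
proof -
  let ?H = "\<lambda>X. hausdorff_outer (dim M) X"
  let ?H' = "\<lambda>X. hausdorff_outer (dim M) X"
  have gM: "subspace (g ` M)" by (rule linear_subspace_image[OF g M])
  have dim: "dim (g ` M) = dim M"
    using g inj M by (metis dim_image_eq span_eq_iff)
  obtain h where h: "linear h" "\<And>x. x \<in> M \<Longrightarrow> h (g x) = x"
    using linear_inj_on_left_inverse[OF g, of M] inj M by (metis span_eq_iff)
  obtain Y0 where Y0: "Y0 \<in> sets borel" "X \<subseteq> Y0" "?H Y0 = ?H X"
    by (rule hausdorff_outer_borel_hull)
  define Y where "Y = Y0 \<inter> M"
  note [measurable] = borel_subspace[OF M] borel_subspace[OF gM] Y0(1) borel_linear[OF g] borel_linear[OF h(1)]
  have Y: "Y \<in> sets borel" "Y \<subseteq> M" unfolding Y_def by auto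
  have "?H Y \<le> ?H Y0" by (rule hausdorff_outer_mono) (auto simp: Y_def)
  then have HY: "?H Y \<le> ?H X" using Y0(3) by simp
  have gY_eq: "g ` Y = g ` M \<inter> h -` Y" using h(2) Y(2) by force
  have gY: "g ` Y \<in> sets borel"
    unfolding gY_eq using measurable_sets_borel[OF borel_linear[OF h(1)] Y(1)] borel_subspace[OF gM] by auto
  obtain f where f: "linear f" "f ` M = g ` M" "\<And>x. x \<in> M \<Longrightarrow> norm (f x) = norm x"
    using isometry_subspaces[OF M gM] dim by metis
  have "cball 0 1 \<inter> g ` M \<subseteq> f ` (cball 0 1 \<inter> M)" using f(2,3) by fastforce
  then have "?H' (cball 0 1 \<inter> g ` M) \<le> ?H' (f ` (cball 0 1 \<inter> M))" by (rule hausdorff_outer_mono)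
  also have "\<dots> \<le> ?H (cball 0 1 \<inter> M)"
    by (rule hausdorff_outer_contraction)
      (simp add: dist_norm linear_diff[OF f(1), symmetric] f(3) subspace_diff[OF M])
  finally have ball: "?H' (cball 0 1 \<inter> g ` M) \<le> ?H (cball 0 1 \<inter> M)" .
  have "emeasure (lborel_on (g ` M)) (g ` Y) = (\<integral>\<^sup>+y. indicator (g ` Y) y \<partial>lborel_on (g ` M))"
    using gY by simp
  also have "\<dots> = ennreal (vol_factor M g) * (\<integral>\<^sup>+x. indicator (g ` Y) (g x) \<partial>lborel_on M)"
    using gY by (intro nn_integral_vol_factor[OF g M inj]) simp
  also have "(\<integral>\<^sup>+x. indicator (g ` Y) (g x) \<partial>lborel_on M) = (\<integral>\<^sup>+x. indicator Y x \<partial>lborel_on M)"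
  proof (intro nn_integral_cong_AE, use AE_lborel_on[OF M] in eventually_elim)
    fix x assume "x \<in> M"
    then have "g x \<in> g ` Y \<longleftrightarrow> x \<in> Y" using inj_on_image_mem_iff[OF inj _ Y(2)] by blast
    then show "indicator (g ` Y) (g x) = (indicator Y x :: ennreal)" by (simp add: indicator_def)
  qed
  finally have vol: "emeasure (lborel_on (g ` M)) (g ` Y) = ennreal (vol_factor M g) * emeasure (lborel_on M) Y"
    using Y by simp
  have "ennreal (unit_ball_vol (dim M)) * ?H' (g ` Y) = ?H' (cball 0 1 \<inter> g ` M) * emeasure (lborel_on (g ` M)) (g ` Y)"
    using hausdorff_outer_eq_lborel_on[OF gM gY] Y(2) by (simp add: dim image_mono)
  also have "\<dots> \<le> ?H (cball 0 1 \<inter> M) * (ennreal (vol_factor M g) * emeasure (lborel_on M) Y)"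
    unfolding vol by (intro mult_right_mono ball) auto
  also have "\<dots> = ennreal (unit_ball_vol (dim M)) * (ennreal (vol_factor M g) * ?H Y)"
    using hausdorff_outer_eq_lborel_on[OF M Y] by (simp add: mult.left_commute)
  finally have "?H' (g ` Y) \<le> ennreal (vol_factor M g) * ?H Y"
    using unit_ball_vol_pos[of "dim M"]
    by (subst (asm) ennreal_mult_le_mult_iff) (auto simp: less_imp_neq[symmetric])
  moreover have "?H' (g ` X) \<le> ?H' (g ` Y)"
    using Y0(2) X by (intro hausdorff_outer_mono) (auto simp: Y_def)
  moreover have "ennreal (vol_factor M g) * ?H Y \<le> ennreal (vol_factor M g) * ?H X"
    by (rule mult_left_mono[OF HY]) simp
  ultimately show ?thesis by (meson order_trans)
qed


section \<open>Support functions and outer normals\<close>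

lemma support_fun_eqI:
  assumes "x \<in> A" "\<And>y. y \<in> A \<Longrightarrow> u \<bullet> y \<le> u \<bullet> x"
  shows "support_fun A u = u \<bullet> x"
  unfolding support_fun_def by (rule cSup_eq_maximum) (use assms in auto)

lemma support_fun_attained:
  assumes "compact A" "A \<noteq> {}"
  obtains x where "x \<in> A" "support_fun A u = u \<bullet> x" "\<And>y. y \<in> A \<Longrightarrow> u \<bullet> y \<le> u \<bullet> x"
proof -
  have "continuous_on A (\<lambda>y. u \<bullet> y)" by (intro continuous_intros)
  from continuous_attains_sup[OF assms this]
  obtain x where "x \<in> A" "\<forall>y\<in>A. u \<bullet> y \<le> u \<bullet> x" by blast
  then show ?thesis by (intro that[of x] support_fun_eqI) auto
qed

lemma support_fun_ge:
  assumes "compact A" "y \<in> A"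
  shows "u \<bullet> y \<le> support_fun A u"
proof -
  have "A \<noteq> {}" using assms(2) by blast
  then obtain x where "x \<in> A" "support_fun A u = u \<bullet> x" "\<And>y. y \<in> A \<Longrightarrow> u \<bullet> y \<le> u \<bullet> x"
    using support_fun_attained[OF assms(1), of u] by blast
  then show ?thesis using assms(2) by simp
qed

lemma support_fun_scale:
  assumes "compact A" "A \<noteq> {}" "0 \<le> c"
  shows "support_fun A (c *\<^sub>R u) = c * support_fun A u"
proof -
  obtain x where "x \<in> A" "support_fun A u = u \<bullet> x" "\<And>y. y \<in> A \<Longrightarrow> u \<bullet> y \<le> u \<bullet> x"
    using support_fun_attained[OF assms(1,2)] by blast
  then show ?thesis using support_fun_eqI[of x A "c *\<^sub>R u"] assms(3) by (simp add: mult_left_mono)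
qed

lemma continuous_support_fun:
  assumes "compact A" "A \<noteq> {}"
  shows "continuous_on UNIV (support_fun A)"
proof -
  obtain K where K: "K > 0" "\<And>x. x \<in> A \<Longrightarrow> norm x \<le> K"
    using compact_imp_bounded[OF assms(1)] bounded_pos by blast
  have le: "support_fun A u - support_fun A v \<le> K * dist u v" for u v
  proof -
    obtain x where x: "x \<in> A" "support_fun A u = u \<bullet> x"
      using support_fun_attained[OF assms] by blast
    have "support_fun A u - support_fun A v \<le> (u - v) \<bullet> x"
      using support_fun_ge[OF assms(1) x(1), of v] x(2) by (simp add: inner_diff_left)
    also have "\<dots> \<le> norm (u - v) * norm x" by (rule norm_cauchy_schwarz)
    also have "\<dots> \<le> K * dist u v" using K(2)[OF x(1)] unfolding dist_norm by (subst mult.commute) (intro mult_right_mono, auto)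
    finally show ?thesis .
  qed
  have "K-lipschitz_on UNIV (support_fun A)"
  proof (rule lipschitz_onI)
    show "dist (support_fun A u) (support_fun A v) \<le> K * dist u v" for u v
      using le[of u v] le[of v u] by (simp add: dist_real_def abs_le_iff dist_commute)
  qed (use K(1) in simp)
  then show ?thesis by (rule lipschitz_on_continuous_on)
qed

lemma borel_measurable_support_fun:
  "compact A \<Longrightarrow> A \<noteq> {} \<Longrightarrow> support_fun A \<in> borel_measurable borel"
  by (rule borel_measurable_continuous_onI[OF continuous_support_fun])

abbreviation unit_sphere :: "'a::euclidean_space set \<Rightarrow> 'a set" where
  "unit_sphere V \<equiv> sphere 0 1 \<inter> V"

definition outer_normal :: "'a::euclidean_space set \<Rightarrow> 'a \<Rightarrow> 'a \<Rightarrow> bool" where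
  "outer_normal A x u \<longleftrightarrow> (\<forall>y\<in>A. u \<bullet> y \<le> u \<bullet> x)"

definition contact_set :: "'a::euclidean_space set \<Rightarrow> 'a set \<Rightarrow> 'a set" where
  "contact_set A W = {x\<in>A. \<exists>u\<in>W. outer_normal A x u}"

text \<open>
  For \<open>A\<close> inside the subspace \<open>V\<close>, only the normals in \<open>V\<close>
  are of interest.
\<close>

definition smooth_points :: "'a::euclidean_space set \<Rightarrow> 'a set \<Rightarrow> 'a set" where
  "smooth_points V A = {x\<in>A. \<exists>!u. u \<in> unit_sphere V \<and> outer_normal A x u}"

definition singular_points :: "'a::euclidean_space set \<Rightarrow> 'a set \<Rightarrow> 'a set" where
  "singular_points V A = {x\<in>A. \<exists>u\<in>unit_sphere V. \<exists>v\<in>unit_sphere V. u \<noteq> v \<and> outer_normal A x u \<and> outer_normal A x v}"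

text \<open>
  Off the smooth points the value is a fixed unit vector of \<open>V\<close>, so that the map takes
  its values in the unit sphere of \<open>V\<close> everywhere.
\<close>

definition gauss_map :: "'a::euclidean_space set \<Rightarrow> 'a set \<Rightarrow> 'a \<Rightarrow> 'a" where
  "gauss_map V A x = (if x \<in> smooth_points V A then (THE u. u \<in> unit_sphere V \<and> outer_normal A x u)
     else (SOME u. u \<in> unit_sphere V))"

lemma gauss_map_smooth:
  assumes "x \<in> smooth_points V A"
  shows "gauss_map V A x \<in> unit_sphere V" "outer_normal A x (gauss_map V A x)"
    "\<And>u. u \<in> unit_sphere V \<Longrightarrow> outer_normal A x u \<Longrightarrow> gauss_map V A x = u"
proof -
  have ex: "\<exists>!u. u \<in> unit_sphere V \<and> outer_normal A x u" using assms by (simp add: smooth_points_def)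
  have "gauss_map V A x = (THE u. u \<in> unit_sphere V \<and> outer_normal A x u)"
    using assms by (simp add: gauss_map_def)
  then have "gauss_map V A x \<in> unit_sphere V \<and> outer_normal A x (gauss_map V A x)"
    using theI'[OF ex] by simp
  then show "gauss_map V A x \<in> unit_sphere V" "outer_normal A x (gauss_map V A x)"
    "\<And>u. u \<in> unit_sphere V \<Longrightarrow> outer_normal A x u \<Longrightarrow> gauss_map V A x = u"
    using ex by blast+
qed

lemma contact_set_diff_singular:
  assumes "W \<subseteq> unit_sphere V"
  shows "contact_set A W - singular_points V A = {x \<in> smooth_points V A. gauss_map V A x \<in> W}"
proof (intro equalityI subsetI)
  fix x assume x: "x \<in> contact_set A W - singular_points V A"
  then obtain u where u: "u \<in> W" "outer_normal A x u" "x \<in> A" by (auto simp: contact_set_def)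
  have "v = u" if "v \<in> unit_sphere V" "outer_normal A x v" for v
    using x u that assms unfolding singular_points_def by blast
  then have s: "x \<in> smooth_points V A" using u assms unfolding smooth_points_def by blast
  then show "x \<in> {x \<in> smooth_points V A. gauss_map V A x \<in> W}"
    using gauss_map_smooth(3)[OF s subsetD[OF assms u(1)] u(2)] u(1) by simp
next
  fix x assume "x \<in> {x \<in> smooth_points V A. gauss_map V A x \<in> W}"
  then have s: "x \<in> smooth_points V A" "gauss_map V A x \<in> W" by auto
  then have "x \<in> contact_set A W"
    using gauss_map_smooth(2)[OF s(1)] by (auto simp: contact_set_def smooth_points_def)
  moreover have "x \<notin> singular_points V A"
    using s(1) unfolding singular_points_def smooth_points_def by blast
  ultimately show "x \<in> contact_set A W - singular_points V A" by blast
qed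

lemma smooth_points_eq: "smooth_points V A = contact_set A (unit_sphere V) - singular_points V A"
  using contact_set_diff_singular[OF order_refl, of A V] gauss_map_smooth(1) by blast

lemma closed_outer_normal_pairs: "closed {p. outer_normal A (fst p) (snd p)}"
proof -
  have "{p. outer_normal A (fst p) (snd p)} = (\<Inter>y\<in>A. {p. snd p \<bullet> y \<le> snd p \<bullet> fst p})"
    by (auto simp: outer_normal_def)
  moreover have "closed {p::'a \<times> 'a. snd p \<bullet> y \<le> snd p \<bullet> fst p}" for y
    by (intro closed_Collect_le continuous_intros)
  ultimately show ?thesis by auto
qed

lemma compact_contact_set:
  assumes A: "compact A" and W: "compact W"
  shows "compact (contact_set A W)"
proof -
  have "compact (A \<times> W \<inter> {p. outer_normal A (fst p) (snd p)})"
    by (intro compact_Int_closed compact_Times A W closed_outer_normal_pairs)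
  then have "compact (fst ` (A \<times> W \<inter> {p. outer_normal A (fst p) (snd p)}))"
    by (rule compact_continuous_image[rotated]) (intro continuous_intros)
  also have "fst ` (A \<times> W \<inter> {p. outer_normal A (fst p) (snd p)}) = contact_set A W"
    by (force simp: contact_set_def)
  finally show ?thesis .
qed

lemma compact_unit_sphere: "subspace V \<Longrightarrow> compact (unit_sphere V)"
  by (intro compact_Int_closed compact_sphere closed_subspace)

text \<open>
  A point is singular iff, for some \<open>k\<close>, it has two normals at distance at least
  \<open>1 / (k + 1)\<close>. For each \<open>k\<close> these points form a projection of a compact
  set.
\<close>

lemma borel_singular_points:
  assumes A: "compact A" and V: "subspace V"
  shows "singular_points V A \<in> sets borel"
proof -
  let ?S = "unit_sphere V"
  define C where "C k = A \<times> ?S \<times> ?S \<inter> {p. outer_normal A (fst p) (fst (snd p)) \<and> outer_normal A (fst p) (snd (snd p))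
      \<and> 1 / real (Suc k) \<le> dist (fst (snd p)) (snd (snd p))}" for k
  have "compact (fst ` C k)" for k
  proof (rule compact_continuous_image)
    have 1: "closed {p::'a\<times>'a\<times>'a. outer_normal A (fst p) (fst (snd p))}"
      using continuous_closed_vimage[OF closed_outer_normal_pairs[of A], of "\<lambda>p::'a\<times>'a\<times>'a. (fst p, fst (snd p))"]
      by (auto simp: vimage_def intro!: continuous_intros)
    have 2: "closed {p::'a\<times>'a\<times>'a. outer_normal A (fst p) (snd (snd p))}"
      using continuous_closed_vimage[OF closed_outer_normal_pairs[of A], of "\<lambda>p::'a\<times>'a\<times>'a. (fst p, snd (snd p))"]
      by (auto simp: vimage_def intro!: continuous_intros)
    have 3: "closed {p::'a\<times>'a\<times>'a. 1 / real (Suc k) \<le> dist (fst (snd p)) (snd (snd p))}"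
      by (intro closed_Collect_le continuous_intros)
    show "compact (C k)"
      unfolding C_def
      by (intro compact_Int_closed compact_Times A compact_unit_sphere V closed_Collect_conj 1 2 3)
  qed (intro continuous_intros)
  then have "(\<Union>k. fst ` C k) \<in> sets borel"
    by (intro sets.countable_UN) (auto intro!: borel_closed compact_imp_closed)
  moreover have "singular_points V A = (\<Union>k. fst ` C k)"
  proof (intro equalityI subsetI)
    fix x assume "x \<in> singular_points V A"
    then obtain u v where uv: "x \<in> A" "u \<in> ?S" "v \<in> ?S" "u \<noteq> v" "outer_normal A x u" "outer_normal A x v"
      by (auto simp: singular_points_def)
    then have "0 < dist u v" by simp
    then obtain k where "inverse (real (Suc k)) < dist u v" using reals_Archimedean by blast
    then have "(x, u, v) \<in> C k" using uv by (auto simp: C_def inverse_eq_divide)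
    then show "x \<in> (\<Union>k. fst ` C k)" by force
  next
    fix x assume "x \<in> (\<Union>k. fst ` C k)"
    then obtain k u v where "(x, u, v) \<in> C k" by auto
    then have "x \<in> A" "u \<in> ?S" "v \<in> ?S" "outer_normal A x u" "outer_normal A x v" "1 / real (Suc k) \<le> dist u v"
      by (auto simp: C_def)
    moreover have "0 < 1 / real (Suc k)" by simp
    ultimately have "u \<noteq> v" by (metis dist_self not_less)
    then show "x \<in> singular_points V A"
      using \<open>x \<in> A\<close> \<open>u \<in> ?S\<close> \<open>v \<in> ?S\<close> \<open>outer_normal A x u\<close> \<open>outer_normal A x v\<close>
      unfolding singular_points_def by blast
  qed
  ultimately show ?thesis by simp
qed


section \<open>Convex bodies in a subspace\<close>

text \<open>
  A convex body of the subspace \<open>V\<close> with the origin in its relative interior. The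
  parameter \<open>s\<close> is the dimension of the boundary.
\<close>

locale body_in_subspace =
  fixes V A :: "'a::euclidean_space set" and r :: real and s :: nat
  assumes V: "subspace V" and dim_V: "dim V = Suc s" and A_V: "A \<subseteq> V" and compact_A: "compact A"
    and convex_A: "convex A" and r_pos: "0 < r" and ball_A: "cball 0 r \<inter> V \<subseteq> A"
begin

lemma zero_in_A: "0 \<in> A"
  using ball_A r_pos subspace_0[OF V] by auto

lemma scaled_unit_in_A: "u \<in> unit_sphere V \<Longrightarrow> r *\<^sub>R u \<in> A"
  using ball_A r_pos subspace_scale[OF V] by auto

lemma unit_sphere_nonempty: "unit_sphere V \<noteq> {}"
proof -
  obtain B where B: "orthonormal_basis_of V B" using V by (rule orthonormal_basis_of_exists)
  have "B \<noteq> {}" using orthonormal_basis_ofD(3)[OF B] dim_V by (metis card.empty nat.distinct(1))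
  then show ?thesis using orthonormal_basis_ofD(5,7)[OF B] by fastforce
qed

lemma outer_normal_inner_ge:
  assumes "u \<in> unit_sphere V" "outer_normal A x u"
  shows "r \<le> u \<bullet> x"
  using assms scaled_unit_in_A[OF assms(1)] by (auto simp: outer_normal_def dot_square_norm)

lemma gauss_map_in: "gauss_map V A x \<in> unit_sphere V"
proof (cases "x \<in> smooth_points V A")
  case False
  have "(SOME u. u \<in> unit_sphere V) \<in> unit_sphere V"
    using unit_sphere_nonempty by (metis all_not_in_conv someI)
  then show ?thesis using False unfolding gauss_map_def by simp
qed (rule gauss_map_smooth(1))

text \<open>
  A point of \<open>A\<close> with an outer normal \<open>u\<close> in \<open>V\<close> is a
  relative boundary point, since moving it in direction \<open>u\<close> leaves \<open>A\<close> but
  not the affine hull of \<open>A\<close>.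
\<close>

lemma reverse_spherical_image_eq:
  assumes W: "W \<subseteq> unit_sphere V"
  shows "reverse_spherical_image A W = contact_set A W"
proof (intro equalityI subsetI)
  fix x assume "x \<in> reverse_spherical_image A W"
  then obtain u where u: "x \<in> rel_frontier A" "u \<in> W" "u \<bullet> x = support_fun A u"
    by (auto simp: reverse_spherical_image_def)
  then have "x \<in> A" using compact_A by (auto simp: rel_frontier_def compact_imp_closed)
  then show "x \<in> contact_set A W"
    using u support_fun_ge[OF compact_A, of _ u] by (auto simp: contact_set_def outer_normal_def intro!: bexI[of _ u])
next
  fix x assume "x \<in> contact_set A W"
  then obtain u where u: "x \<in> A" "u \<in> W" "outer_normal A x u" by (auto simp: contact_set_def)
  then have uS: "u \<in> unit_sphere V" using W by blast
  have "x \<notin> rel_interior A"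
  proof
    assume "x \<in> rel_interior A"
    then obtain e where e: "0 < e" "cball x e \<inter> affine hull A \<subseteq> A" by (auto simp: mem_rel_interior_cball)
    have "x + e *\<^sub>R u = x + (e / r) *\<^sub>R (r *\<^sub>R u)" using r_pos by simp
    also have "\<dots> \<in> span A"
      using u(1) scaled_unit_in_A[OF uS] by (intro span_add span_scale span_base)
    finally have "x + e *\<^sub>R u \<in> affine hull A"
      using affine_hull_span_0[of A] hull_inc[OF zero_in_A, of affine] by simp
    moreover have "x + e *\<^sub>R u \<in> cball x e" using e uS by (simp add: dist_norm)
    ultimately have "x + e *\<^sub>R u \<in> A" using e by blast
    then have "u \<bullet> (x + e *\<^sub>R u) \<le> u \<bullet> x" using u(3) by (auto simp: outer_normal_def)
    then show False using e uS by (simp add: inner_add_right dot_square_norm)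
  qed
  then have "x \<in> rel_frontier A" using u(1) compact_A by (simp add: rel_frontier_def compact_imp_closed)
  moreover have "u \<bullet> x = support_fun A u"
    using support_fun_eqI[OF u(1), of u] u(3) by (simp add: outer_normal_def)
  ultimately show "x \<in> reverse_spherical_image A W" using u(2) by (auto simp: reverse_spherical_image_def)
qed

lemma borel_smooth_points: "smooth_points V A \<in> sets borel"
  unfolding smooth_points_eq
  by (intro sets.Diff borel_singular_points compact_A V borel_closed compact_imp_closed compact_contact_set compact_unit_sphere)

text \<open>
  Apart from the points with the default value, the preimage of a closed set \<open>C\<close>
  consists of the points with a normal in \<open>C\<close>, which form a compact set, without the
  singular points.
\<close>

lemma gauss_map_measurable: "gauss_map V A \<in> borel_measurable borel"
proof -
  define u0 where "u0 = (SOME u. u \<in> unit_sphere V)"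
  have closed: "gauss_map V A -` C \<in> sets borel" if C: "closed C" for C
  proof -
    have "gauss_map V A -` C = {x \<in> smooth_points V A. gauss_map V A x \<in> C \<inter> unit_sphere V} \<union>
       (if u0 \<in> C then - smooth_points V A else {})"
      using gauss_map_in by (auto simp: gauss_map_def u0_def split: if_splits)
    also have "{x \<in> smooth_points V A. gauss_map V A x \<in> C \<inter> unit_sphere V}
        = contact_set A (C \<inter> unit_sphere V) - singular_points V A"
      by (rule contact_set_diff_singular[symmetric]) blast
    also have "(contact_set A (C \<inter> unit_sphere V) - singular_points V A) \<union>
       (if u0 \<in> C then - smooth_points V A else {}) \<in> sets borel"
    proof (rule sets.Un)
      have "compact (C \<inter> unit_sphere V)"
        using C compact_unit_sphere[OF V] by (rule closed_Int_compact)
      then have "closed (contact_set A (C \<inter> unit_sphere V))"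
        using compact_contact_set[OF compact_A] compact_imp_closed by blast
      then show "contact_set A (C \<inter> unit_sphere V) - singular_points V A \<in> sets borel"
        by (intro sets.Diff[OF borel_closed borel_singular_points] compact_A V)
      show "(if u0 \<in> C then - smooth_points V A else {}) \<in> sets borel"
        using borel_smooth_points by auto
    qed
    finally show ?thesis .
  qed
  have "gauss_map V A \<in> measurable borel (sigma UNIV (Collect closed))"
    by (rule measurable_sigma_sets[OF sets_measure_of]) (auto simp: closed)
  then show ?thesis by (simp add: borel_eq_closed[where 'a='a] measurable_cong_sets)
qed

text \<open>
  If \<open>u\<close> and \<open>v\<close> are distinct unit normals of \<open>A\<close> at
  \<open>x\<close>, then \<open>x\<close> is the point of \<open>A\<close> nearest to every point of
  the sector of all \<open>x + l1 *\<^sub>R u + l2 *\<^sub>R v\<close> with positive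
  \<open>l1\<close> and \<open>l2\<close>. This sector is two-dimensional and therefore meets one of
  countably many affine flats of codimension two in \<open>V\<close>. So the singular points lie in
  the union of the images of countably many flats of dimension less than \<open>s\<close> under the
  nearest-point map, which is a contraction.
\<close>

lemma singular_null: "hausdorff_outer s (singular_points V A) = 0"
proof -
  obtain D :: "('a \<times> 'a \<times> real \<times> real) set" where D: "countable D" "\<And>X. open X \<Longrightarrow> X \<noteq> {} \<Longrightarrow> \<exists>d\<in>D. d \<in> X"
    using countable_dense_setE by blast
  \<comment> \<open>the flats are given by two linear equations with parameters in a countable dense set;
    \<open>kernel\<close> is the direction space of a flat, and \<open>D'\<close> selects the
    parameters with independent equations\<close>
  define kernel where "kernel a b = {y\<in>V. y \<bullet> a = 0 \<and> y \<bullet> b = 0}" for a b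
  define flat where "flat d = (case d of (a, b, q1, q2) \<Rightarrow> {y\<in>V. y \<bullet> a = q1 \<and> y \<bullet> b = q2})" for d
  define D' where "D' = {d\<in>D. case d of (a, b, q1, q2) \<Rightarrow> dim (kernel a b) + 2 \<le> dim V}"
  have ker: "subspace (kernel a b)" for a b
    using V by (auto simp: kernel_def subspace_def inner_add_left)
  have null: "hausdorff_outer s (closest_point A ` flat d) = 0" if d: "d \<in> D'" for d
  proof -
    obtain a b q1 q2 where d_eq: "d = (a, b, q1, q2)" by (metis prod_cases4)
    have "hausdorff_outer s (flat d) = 0"
    proof (cases "flat d = {}")
      case False
      then obtain y0 where y0: "y0 \<in> flat d" by blast
      have "flat d \<subseteq> (+) y0 ` kernel a b"
      proof
        fix y assume "y \<in> flat d"
        then have "y - y0 \<in> kernel a b"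
          using y0 V by (auto simp: flat_def d_eq kernel_def subspace_diff inner_diff_left)
        then show "y \<in> (+) y0 ` kernel a b" by (intro image_eqI[of _ _ "y - y0"]) auto
      qed
      then have "hausdorff_outer s (flat d) \<le> hausdorff_outer s (kernel a b)"
        by (metis hausdorff_outer_mono hausdorff_outer_translate)
      also have "\<dots> = 0"
        using d by (intro hausdorff_outer_lower_dim[OF ker]) (auto simp: D'_def d_eq dim_V)
      finally show ?thesis by simp
    qed simp
    moreover have "hausdorff_outer s (closest_point A ` flat d) \<le> hausdorff_outer s (flat d)"
      using closest_point_lipschitz[OF convex_A compact_imp_closed[OF compact_A]] zero_in_A
      by (intro hausdorff_outer_contraction) blast
    ultimately show ?thesis by simp
  qed
  have "singular_points V A \<subseteq> (\<Union>d\<in>D'. closest_point A ` flat d)"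
  proof
    fix x assume "x \<in> singular_points V A"
    then obtain u v where uv: "x \<in> A" "u \<in> unit_sphere V" "v \<in> unit_sphere V" "u \<noteq> v"
        "outer_normal A x u" "outer_normal A x v"
      by (auto simp: singular_points_def)
    have nuv: "u \<bullet> u = 1" "v \<bullet> v = 1" "u \<in> V" "v \<in> V" using uv by (auto simp: dot_square_norm)
    define c where "c = u \<bullet> v"
    have "(u - v) \<bullet> (u - v) > 0" using uv(4) by simp
    then have c1: "c < 1" using nuv by (simp add: inner_diff_left inner_diff_right inner_commute c_def)
    have "u + v \<noteq> 0"
    proof
      assume "u + v = 0"
      then have "(u + v) \<bullet> x = 0" by simp
      then show False
        using outer_normal_inner_ge[OF uv(2,5)] outer_normal_inner_ge[OF uv(3,6)] r_pos by (simp add: inner_add_left)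
    qed
    then have "(u + v) \<bullet> (u + v) > 0" by simp
    then have c2: "- 1 < c" using nuv by (simp add: inner_add_left inner_add_right inner_commute c_def)
    have c3: "0 < (1 + c) * (1 - c)" using c1 c2 by simp
    \<comment> \<open>open conditions on the parameters which say, by Cramer's rule, that the flat meets the
      sector; they hold for the equations with normals \<open>u\<close> and \<open>v\<close> of
      the flat through \<open>x + u + v\<close>\<close>
    define O1 where "O1 = {p :: 'a \<times> 'a \<times> real \<times> real.
       0 < (u \<bullet> fst p) * (v \<bullet> fst (snd p)) - (v \<bullet> fst p) * (u \<bullet> fst (snd p))}"
    define O2 where "O2 = {p :: 'a \<times> 'a \<times> real \<times> real.
       0 < (fst (snd (snd p)) - x \<bullet> fst p) * (v \<bullet> fst (snd p)) - (snd (snd (snd p)) - x \<bullet> fst (snd p)) * (v \<bullet> fst p)}"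
    define O3 where "O3 = {p :: 'a \<times> 'a \<times> real \<times> real.
       0 < (u \<bullet> fst p) * (snd (snd (snd p)) - x \<bullet> fst (snd p)) - (u \<bullet> fst (snd p)) * (fst (snd (snd p)) - x \<bullet> fst p)}"
    have "open (O1 \<inter> O2 \<inter> O3)"
      unfolding O1_def O2_def O3_def by (intro open_Int open_Collect_less continuous_intros)
    moreover have "(u, v, x \<bullet> u + 1 + c, x \<bullet> v + c + 1) \<in> O1 \<inter> O2 \<inter> O3"
      using nuv c3 by (simp add: O1_def O2_def O3_def c_def[symmetric] inner_commute[of v u] algebra_simps)
    ultimately obtain d where d: "d \<in> D" "d \<in> O1 \<inter> O2 \<inter> O3" using D(2) by blast
    obtain a b q1 q2 where d_eq: "d = (a, b, q1, q2)" by (metis prod_cases4)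
    define \<Delta> where "\<Delta> = (u \<bullet> a) * (v \<bullet> b) - (v \<bullet> a) * (u \<bullet> b)"
    define l1 where "l1 = ((q1 - x \<bullet> a) * (v \<bullet> b) - (q2 - x \<bullet> b) * (v \<bullet> a)) / \<Delta>"
    define l2 where "l2 = ((u \<bullet> a) * (q2 - x \<bullet> b) - (u \<bullet> b) * (q1 - x \<bullet> a)) / \<Delta>"
    have \<Delta>: "0 < \<Delta>" using d(2) by (simp add: d_eq O1_def \<Delta>_def)
    moreover have "0 < l1" "0 < l2"
      using d(2) \<Delta> unfolding l1_def l2_def by (intro divide_pos_pos; simp add: d_eq O2_def O3_def)+
    ultimately have pos: "0 < \<Delta>" "0 < l1" "0 < l2" by auto
    have q1: "l1 * \<Delta> = (q1 - x \<bullet> a) * (v \<bullet> b) - (q2 - x \<bullet> b) * (v \<bullet> a)"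
      and q2: "l2 * \<Delta> = (u \<bullet> a) * (q2 - x \<bullet> b) - (u \<bullet> b) * (q1 - x \<bullet> a)"
      using \<Delta> by (simp_all add: l1_def l2_def)
    define y where "y = x + l1 *\<^sub>R u + l2 *\<^sub>R v"
    have "y \<in> V" using nuv uv(1) A_V V by (auto simp: y_def intro!: subspace_add subspace_scale)
    moreover have "y \<bullet> a = q1"
    proof -
      have "(l1 * (u \<bullet> a) + l2 * (v \<bullet> a)) * \<Delta> = (l1 * \<Delta>) * (u \<bullet> a) + (l2 * \<Delta>) * (v \<bullet> a)"
        by (simp add: algebra_simps)
      also have "\<dots> = (q1 - x \<bullet> a) * \<Delta>" unfolding q1 q2 by (simp add: \<Delta>_def algebra_simps)
      finally have "l1 * (u \<bullet> a) + l2 * (v \<bullet> a) = q1 - x \<bullet> a" using pos(1) by simp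
      then show ?thesis using pos(1) by (simp add: y_def inner_add_left)
    qed
    moreover have "y \<bullet> b = q2"
    proof -
      have "(l1 * (u \<bullet> b) + l2 * (v \<bullet> b)) * \<Delta> = (l1 * \<Delta>) * (u \<bullet> b) + (l2 * \<Delta>) * (v \<bullet> b)"
        by (simp add: algebra_simps)
      also have "\<dots> = (q2 - x \<bullet> b) * \<Delta>" unfolding q1 q2 by (simp add: \<Delta>_def algebra_simps)
      finally have "l1 * (u \<bullet> b) + l2 * (v \<bullet> b) = q2 - x \<bullet> b" using pos(1) by simp
      then show ?thesis using pos(1) by (simp add: y_def inner_add_left)
    qed
    ultimately have y_flat: "y \<in> flat d" by (simp add: flat_def d_eq)
    have "x = closest_point A y"
    proof (rule closest_point_unique[OF convex_A compact_imp_closed[OF compact_A] uv(1)], intro ballI)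
      fix z assume z: "z \<in> A"
      have "u \<bullet> z \<le> u \<bullet> x" "v \<bullet> z \<le> v \<bullet> x" using uv(5,6) z by (auto simp: outer_normal_def)
      then have "0 \<le> (y - x) \<bullet> (x - z)"
        using pos by (simp add: y_def inner_add_left inner_diff_right add_mono mult_left_mono)
      then have "(y - x) \<bullet> (y - x) \<le> ((y - x) + (x - z)) \<bullet> ((y - x) + (x - z))"
        using inner_ge_zero[of "x - z"]
        unfolding inner_add_left inner_add_right by (simp add: inner_commute)
      then show "dist y x \<le> dist y z" unfolding dist_norm norm_le by simp
    qed
    then have x_img: "x \<in> closest_point A ` flat d" using y_flat by blast
    have "dim (kernel a b) + 2 \<le> dim V"
    proof -
      let ?W = "span {u, v}"
      have ind: "\<alpha> = 0 \<and> \<beta> = 0" if "\<alpha> * (u \<bullet> a) + \<beta> * (v \<bullet> a) = 0" "\<alpha> * (u \<bullet> b) + \<beta> * (v \<bullet> b) = 0" for \<alpha> \<beta>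
      proof -
        have "\<alpha> * \<Delta> = (\<alpha> * (u \<bullet> a) + \<beta> * (v \<bullet> a)) * (v \<bullet> b) - (\<alpha> * (u \<bullet> b) + \<beta> * (v \<bullet> b)) * (v \<bullet> a)"
          "\<beta> * \<Delta> = (\<alpha> * (u \<bullet> b) + \<beta> * (v \<bullet> b)) * (u \<bullet> a) - (\<alpha> * (u \<bullet> a) + \<beta> * (v \<bullet> a)) * (u \<bullet> b)"
          by (simp_all add: \<Delta>_def algebra_simps)
        then have "\<alpha> * \<Delta> = 0" "\<beta> * \<Delta> = 0" unfolding that by simp_all
        then show ?thesis using pos(1) by simp
      qed
      have "u \<notin> span {v}"
      proof
        assume "u \<in> span {v}"
        then obtain k where "u = k *\<^sub>R v" by (auto simp: span_singleton)
        then have "\<Delta> = 0" by (simp add: \<Delta>_def)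
        then show False using pos(1) by simp
      qed
      moreover have "v \<noteq> 0" using nuv by auto
      ultimately have "independent {u, v}" using uv(4) by (simp add: independent_insert)
      then have dimW: "dim ?W = 2" using uv(4) by (simp add: dim_eq_card_independent)
      have "kernel a b \<inter> ?W = {0}"
      proof (intro equalityI subsetI)
        fix w assume w: "w \<in> kernel a b \<inter> ?W"
        then obtain \<alpha> \<beta> where w_eq: "w = \<alpha> *\<^sub>R u + \<beta> *\<^sub>R v"
          by (auto simp: span_insert span_singleton algebra_simps)
        then show "w \<in> {0}" using w ind[of \<alpha> \<beta>] by (auto simp: kernel_def inner_add_left)
      qed (use subspace_0[OF ker] span_0 in auto)
      then have dims: "dim {y + w |y w. y \<in> kernel a b \<and> w \<in> ?W} = dim (kernel a b) + 2"
        using dim_sums_Int[OF ker[of a b] subspace_span[of "{u, v}"]] dimW by simp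
      have W: "?W \<subseteq> V" using nuv V by (intro span_minimal) auto
      have "{y + w |y w. y \<in> kernel a b \<and> w \<in> ?W} \<subseteq> V"
      proof
        fix z assume "z \<in> {y + w |y w. y \<in> kernel a b \<and> w \<in> ?W}"
        then obtain y w where "z = y + w" "y \<in> V" "w \<in> ?W" by (auto simp: kernel_def)
        then show "z \<in> V" using W V by (auto intro: subspace_add)
      qed
      from dim_subset[OF this] show ?thesis unfolding dims .
    qed
    then have "d \<in> D'" using d(1) by (simp add: D'_def d_eq)
    then show "x \<in> (\<Union>d\<in>D'. closest_point A ` flat d)" using x_img by blast
  qed
  moreover have "hausdorff_outer s (\<Union>d\<in>D'. closest_point A ` flat d) = 0"
    using D(1) null by (intro hausdorff_outer_null_UN countable_subset[OF _ D(1)]) (auto simp: D'_def)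
  ultimately show ?thesis by (metis hausdorff_outer_mono le_zero_eq)
qed

text \<open>
  Since singular points are null, the set function in the definition of the surface area measure is
  the image of Hausdorff measure on the smooth points under the Gauss map. In particular it is
  countably additive.
\<close>

lemma nn_integral_surface_area_measure:
  assumes f[measurable]: "f \<in> borel_measurable borel"
  shows "(\<integral>\<^sup>+u. f u \<partial>surface_area_measure V A)
    = (\<integral>\<^sup>+x. f (gauss_map V A x) * indicator (smooth_points V A) x \<partial>hausdorff_measure s)"
proof -
  let ?S = "unit_sphere V" and ?G = "smooth_points V A" and ?n = "gauss_map V A"
  let ?B = "restrict_space borel ?S"
  define \<mu> where "\<mu> = density (hausdorff_measure s) (indicator ?G)"
  note [measurable] = borel_smooth_points gauss_map_measurable
  have S: "?S \<in> sets borel" using compact_unit_sphere[OF V] by (simp add: borel_closed compact_imp_closed)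
  have [simp]: "sets \<mu> = sets borel" "space \<mu> = UNIV" by (simp_all add: \<mu>_def)
  have n: "?n \<in> measurable \<mu> ?B"
    using gauss_map_in gauss_map_measurable by (intro measurable_restrict_space2) (auto simp: measurable_cong_sets[of \<mu> borel])
  have em: "hausdorff_outer s (reverse_spherical_image A W) = emeasure (distr \<mu> ?B ?n) W"
    if W: "W \<in> sets ?B" for W
  proof -
    have WS: "W \<subseteq> ?S" and Wb: "W \<in> sets borel"
      using W S by (auto simp: sets_restrict_space_iff)
    let ?P = "{x \<in> ?G. ?n x \<in> W}"
    have P: "?P \<in> sets borel" using Wb by measurable
    have "emeasure (distr \<mu> ?B ?n) W = emeasure \<mu> (?n -` W)"
      using W n by (subst emeasure_distr) auto
    also have "\<dots> = emeasure (hausdorff_measure s) ?P"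
    proof -
      have m: "?n -` W \<in> sets borel" using measurable_sets_borel[OF gauss_map_measurable Wb] by simp
      then have "emeasure \<mu> (?n -` W) = (\<integral>\<^sup>+x. indicator ?G x * indicator (?n -` W) x \<partial>hausdorff_measure s)"
        unfolding \<mu>_def by (subst emeasure_density) auto
      also have "\<dots> = (\<integral>\<^sup>+x. indicator ?P x \<partial>hausdorff_measure s)"
        by (intro nn_integral_cong) (auto simp: indicator_def)
      finally show ?thesis using P by simp
    qed
    also have "\<dots> = hausdorff_outer s ?P" by (rule emeasure_hausdorff_measure[OF P])
    also have "\<dots> = hausdorff_outer s (contact_set A W)"
    proof (rule antisym)
      show "hausdorff_outer s ?P \<le> hausdorff_outer s (contact_set A W)"
        unfolding contact_set_diff_singular[OF WS, symmetric] by (rule hausdorff_outer_mono) blast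
      have "hausdorff_outer s (contact_set A W) \<le> hausdorff_outer s (?P \<union> singular_points V A)"
        unfolding contact_set_diff_singular[OF WS, symmetric] by (rule hausdorff_outer_mono) blast
      also have "\<dots> \<le> hausdorff_outer s ?P + hausdorff_outer s (singular_points V A)"
        by (rule hausdorff_outer_Un_le)
      finally show "hausdorff_outer s (contact_set A W) \<le> hausdorff_outer s ?P" by (simp add: singular_null)
    qed
    finally show ?thesis by (simp add: reverse_spherical_image_eq[OF WS])
  qed
  have sp: "space ?B = ?S" by (simp add: space_restrict_space)
  have "surface_area_measure V A = measure_of ?S (sets ?B) (emeasure (distr \<mu> ?B ?n))"
    unfolding surface_area_measure_def dim_V diff_Suc_1
  proof (rule measure_of_eq)
    show "sets ?B \<subseteq> Pow ?S" using sets.space_closed[of ?B] sp by simp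
    fix W assume "W \<in> sigma_sets ?S (sets ?B)"
    then have "W \<in> sets ?B" using sets.sigma_sets_eq[of ?B] sp by simp
    then show "hausdorff_outer s (reverse_spherical_image A W) = emeasure (distr \<mu> ?B ?n) W" by (rule em)
  qed
  also have "\<dots> = distr \<mu> ?B ?n"
    using measure_of_of_measure[of "distr \<mu> ?B ?n"] by (simp add: sp)
  finally have "(\<integral>\<^sup>+u. f u \<partial>surface_area_measure V A) = (\<integral>\<^sup>+u. f u \<partial>distr \<mu> ?B ?n)" by simp
  also have "\<dots> = (\<integral>\<^sup>+x. f (?n x) \<partial>\<mu>)"
    by (rule nn_integral_distr[OF n]) (simp add: measurable_restrict_space1)
  also have "\<dots> = (\<integral>\<^sup>+x. indicator ?G x * f (?n x) \<partial>hausdorff_measure s)"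
    unfolding \<mu>_def by (rule nn_integral_density) auto
  finally show ?thesis by (simp add: mult.commute)
qed

text \<open>
  By compactness, the points with a normal far from the normal at \<open>x0\<close> form a closed
  set, and \<open>x0\<close> does not belong to it.
\<close>

lemma normals_near_smooth_point:
  assumes x0: "x0 \<in> smooth_points V A" and e: "0 < e"
  obtains U where "open U" "x0 \<in> U"
    "\<And>x u. x \<in> U \<Longrightarrow> x \<in> A \<Longrightarrow> u \<in> unit_sphere V \<Longrightarrow> outer_normal A x u \<Longrightarrow> dist u (gauss_map V A x0) < e"
proof -
  let ?Q = "contact_set A (unit_sphere V - ball (gauss_map V A x0) e)"
  have "compact (unit_sphere V - ball (gauss_map V A x0) e)"
    by (intro compact_diff compact_unit_sphere V) simp
  then have "closed ?Q" using compact_contact_set[OF compact_A] compact_imp_closed by blast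
  moreover have "x0 \<notin> ?Q"
    using gauss_map_smooth(3)[OF x0] e by (auto simp: contact_set_def)
  ultimately show ?thesis
    by (intro that[of "- ?Q"]) (auto simp: contact_set_def dist_commute)
qed

text \<open>
  Each of the two points lies below a supporting hyperplane of \<open>A\<close> at the other one,
  and the normals of both hyperplanes differ from \<open>u0\<close> by less than \<open>e\<close>.
\<close>

lemma flat_near_smooth_point:
  assumes "\<And>x u. x \<in> U \<Longrightarrow> x \<in> A \<Longrightarrow> u \<in> unit_sphere V \<Longrightarrow> outer_normal A x u \<Longrightarrow> dist u u0 < e"
    and x: "x \<in> U" "x \<in> contact_set A (unit_sphere V)" and y: "y \<in> U" "y \<in> contact_set A (unit_sphere V)"
  shows "\<bar>(x - y) \<bullet> u0\<bar> \<le> e * dist x y"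
proof -
  have le: "(y - x) \<bullet> u0 \<le> e * dist x y"
    if x: "x \<in> U" "x \<in> contact_set A (unit_sphere V)" and y: "y \<in> A" for x y
  proof -
    obtain u where u: "x \<in> A" "u \<in> unit_sphere V" "outer_normal A x u" using x by (auto simp: contact_set_def)
    have "u \<bullet> y \<le> u \<bullet> x" using u(3) y by (auto simp: outer_normal_def)
    then have "(y - x) \<bullet> u0 \<le> (y - x) \<bullet> (u0 - u)" by (simp add: inner_diff_left inner_diff_right inner_commute)
    also have "\<dots> \<le> norm (y - x) * norm (u0 - u)" by (rule norm_cauchy_schwarz)
    also have "\<dots> \<le> norm (y - x) * e"
      using assms(1)[OF x(1) u] by (intro mult_left_mono) (auto simp: dist_norm norm_minus_commute)
    finally show ?thesis by (simp add: dist_norm norm_minus_commute mult.commute)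
  qed
  have "x \<in> A" "y \<in> A" using x y by (auto simp: contact_set_def)
  then have "(y - x) \<bullet> u0 \<le> e * dist x y" "(x - y) \<bullet> u0 \<le> e * dist x y"
    using le[OF x, of y] le[OF y, of x] by (simp_all add: dist_commute)
  then show ?thesis by (simp add: abs_le_iff inner_diff_left)
qed

end


section \<open>Linear images of convex bodies\<close>

lemma compact_image_linear:
  fixes g :: "'a::euclidean_space \<Rightarrow> 'b::euclidean_space"
  shows "linear g \<Longrightarrow> compact S \<Longrightarrow> compact (g ` S)"
  by (intro compact_continuous_image linear_continuous_on) (auto simp: linear_conv_bounded_linear)

text \<open>
  The hypothesis on the subsets of \<open>X\<close> compares the image under \<open>h\<close> of
  Hausdorff measure on \<open>g ` X\<close> with a multiple of Hausdorff measure on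
  \<open>X\<close>.
\<close>

lemma nn_integral_hausdorff_image_le:
  fixes g h :: "'a::euclidean_space \<Rightarrow> 'a"
  assumes h: "linear h" and X: "X \<in> sets borel" and gX: "g ` X \<in> sets borel"
    and hg: "\<And>x. x \<in> X \<Longrightarrow> h (g x) = x"
    and le: "\<And>Y. Y \<subseteq> X \<Longrightarrow> hausdorff_outer s (g ` Y) \<le> ennreal c * hausdorff_outer s Y"
    and f[measurable]: "f \<in> borel_measurable borel"
  shows "(\<integral>\<^sup>+y. f (h y) * indicator (g ` X) y \<partial>hausdorff_measure s)
     \<le> ennreal c * (\<integral>\<^sup>+x. f x * indicator X x \<partial>hausdorff_measure s)"
proof -
  note [measurable] = X gX borel_linear[OF h]
  let ?H = "hausdorff_measure s :: 'a measure"
  define M where "M = distr (density ?H (indicator (g ` X))) borel h"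
  define N where "N = density ?H (\<lambda>x. ennreal c * indicator X x)"
  have MN: "sets M = sets N" "space M = UNIV" "space N = UNIV" by (simp_all add: M_def N_def)
  have "emeasure M E \<le> emeasure N E" if "E \<in> sets M" for E
  proof -
    have E[measurable]: "E \<in> sets borel" using that by (simp add: M_def)
    have hE: "h -` E \<in> sets borel" using measurable_sets_borel[OF borel_linear[OF h] E] by simp
    have "emeasure M E = emeasure (density ?H (indicator (g ` X))) (h -` E)"
      unfolding M_def by (subst emeasure_distr) auto
    also have "\<dots> = (\<integral>\<^sup>+x. indicator (g ` X) x * indicator (h -` E) x \<partial>?H)"
      using hE by (subst emeasure_density) auto
    also have "\<dots> = (\<integral>\<^sup>+x. indicator (g ` X \<inter> h -` E) x \<partial>?H)"
      by (simp add: indicator_inter_arith)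
    also have "\<dots> = hausdorff_outer s (g ` X \<inter> h -` E)"
      using gX hE by (simp add: emeasure_hausdorff_measure)
    also have "g ` X \<inter> h -` E = g ` (X \<inter> E)" using hg by auto
    also have "hausdorff_outer s (g ` (X \<inter> E)) \<le> ennreal c * hausdorff_outer s (X \<inter> E)" by (rule le) simp
    also have "hausdorff_outer s (X \<inter> E) = emeasure ?H (X \<inter> E)" by (simp add: emeasure_hausdorff_measure)
    also have "ennreal c * emeasure ?H (X \<inter> E) = (\<integral>\<^sup>+x. ennreal c * indicator (X \<inter> E) x \<partial>?H)"
      by (simp add: nn_integral_cmult)
    also have "\<dots> = emeasure N E"
      unfolding N_def by (subst emeasure_density) (auto simp: indicator_inter_arith mult.assoc)
    finally show ?thesis .
  qed
  then have "M \<le> N" using MN by (intro le_measure[THEN iffD2] allI) (metis emeasure_notin_sets zero_le ballI)+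
  have "(\<integral>\<^sup>+y. f (h y) * indicator (g ` X) y \<partial>?H) = (\<integral>\<^sup>+x. f x \<partial>M)"
    unfolding M_def by (subst nn_integral_distr) (auto simp: nn_integral_density mult.commute)
  also have "\<dots> \<le> (\<integral>\<^sup>+x. f x \<partial>N)"
    by (rule nn_integral_mono_measure[OF MN(1) \<open>M \<le> N\<close>])
  also have "\<dots> = (\<integral>\<^sup>+x. (ennreal c * indicator X x) * f x \<partial>?H)"
    unfolding N_def by (subst nn_integral_density) auto
  also have "\<dots> = ennreal c * (\<integral>\<^sup>+x. f x * indicator X x \<partial>?H)"
    by (simp add: nn_integral_cmult[symmetric] mult_ac)
  finally show ?thesis .
qed

lemma ennreal_le_mult_square_limit:
  assumes "\<And>l::real. 1 < l \<Longrightarrow> a \<le> ennreal l * (ennreal l * b)"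
  shows "a \<le> (b::ennreal)"
proof (cases b)
  case (real \<beta>)
  have *: "a \<le> ennreal (l * (l * \<beta>))" if "1 < l" for l
    using assms[OF that] real that by (simp add: ennreal_mult)
  from *[of 2] obtain \<alpha> where \<alpha>: "0 \<le> \<alpha>" "a = ennreal \<alpha>" by (cases a) (auto simp: top_unique)
  have "\<alpha> \<le> \<beta>"
  proof (rule field_le_mult_one_interval)
    fix z :: real assume z: "0 < z" "z < 1"
    define l where "l = 1 / sqrt z"
    have l: "1 < l" "l * l = 1 / z" using z by (auto simp: l_def field_simps)
    have "\<alpha> \<le> l * (l * \<beta>)" using *[OF l(1)] \<alpha> real l(1) by (simp add: ennreal_le_iff)
    also have "\<dots> = \<beta> / z" using l(2) by (simp add: mult.assoc[symmetric])
    finally show "z * \<alpha> \<le> \<beta>" using z by (simp add: field_simps)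
  qed
  then show ?thesis using \<alpha> real by (simp add: ennreal_leI)
qed simp

text \<open>
  The inverse \<open>h\<close> of \<open>g\<close> on \<open>g ` V\<close> is a parameter so that
  the roles of \<open>g\<close> and \<open>h\<close> can be exchanged.
\<close>

locale linear_image_of_body = body_in_subspace V A r s
  for V A :: "'a::euclidean_space set" and r :: real and s :: nat +
  fixes g h :: "'a \<Rightarrow> 'a"
  assumes g: "linear g" and h: "linear h" and hg: "\<And>x. x \<in> V \<Longrightarrow> h (g x) = x"
begin

lemma inj_g: "inj_on g V"
  using hg by (rule inj_on_inverseI)

lemma gV: "subspace (g ` V)"
  by (rule linear_subspace_image[OF g V])

text \<open>
  The inverse transpose of \<open>g\<close> as a map from \<open>V\<close> to \<open>g ` V\<close>.
  It turns normals of \<open>A\<close> into normals of \<open>g ` A\<close>.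
\<close>

definition dual_map :: "'a \<Rightarrow> 'a" where
  "dual_map u = closest_point (g ` V) (adjoint h u)"

lemma dual_map_in: "dual_map u \<in> g ` V"
  unfolding dual_map_def by (rule closest_point_mem[OF gV])

lemma dual_map_inner: "y \<in> V \<Longrightarrow> dual_map u \<bullet> g y = u \<bullet> y"
  unfolding dual_map_def
  by (simp add: closest_point_inner[OF gV] adjoint_clauses[OF h] hg)

lemma linear_dual_map: "linear dual_map"
  using linear_compose[OF adjoint_linear[OF h] linear_closest_point[OF gV]]
  by (simp add: o_def dual_map_def[abs_def])

lemma dual_map_nonzero: "u \<in> V \<Longrightarrow> u \<noteq> 0 \<Longrightarrow> dual_map u \<noteq> 0"
  using dual_map_inner[of u u] by auto

lemma norm_dual_map_pos: "u \<in> unit_sphere V \<Longrightarrow> 0 < norm (dual_map u)"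
  using dual_map_nonzero[of u] by force

lemma outer_normal_image:
  assumes "x \<in> A" shows "outer_normal (g ` A) (g x) (dual_map u) \<longleftrightarrow> outer_normal A x u"
  using A_V assms by (auto simp: outer_normal_def dual_map_inner subset_iff)

lemma support_fun_image: "B \<subseteq> V \<Longrightarrow> support_fun (g ` B) (dual_map u) = support_fun B u"
  unfolding support_fun_def image_image by (intro arg_cong[where f=Sup] image_cong) (auto simp: dual_map_inner)

text \<open>
  The image of the hyperplane orthogonal to \<open>u\<close> is orthogonal to \<open>dual_map
  u\<close>, and the component of \<open>g u\<close> in the direction of \<open>dual_map u\<close>
  is \<open>1 / norm (dual_map u)\<close>.
\<close>

lemma vol_factor_hyperplane_dual:
  assumes u: "u \<in> unit_sphere V"
  shows "vol_factor {x\<in>V. x \<bullet> u = 0} g = vol_factor V g * norm (dual_map u)"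
proof -
  let ?u' = "dual_map u /\<^sub>R norm (dual_map u)"
  note n = norm_dual_map_pos[OF u]
  have "vol_factor V g = vol_factor {x\<in>V. x \<bullet> u = 0} g * \<bar>g u \<bullet> ?u'\<bar>"
  proof (rule vol_factor_hyperplane[OF g V inj_g])
    show "?u' \<in> g ` V" by (intro subspace_scale gV dual_map_in)
    show "g x \<bullet> ?u' = 0" if "x \<in> V" "x \<bullet> u = 0" for x
      using that dual_map_inner[of x u] by (simp add: inner_commute)
  qed (use u n in auto)
  moreover have "g u \<bullet> ?u' = 1 / norm (dual_map u)"
    using u dual_map_inner[of u u] by (simp add: inner_commute[of "g u"] dot_square_norm divide_inverse)
  ultimately show ?thesis using n by simp
qed

text \<open>
  The image contains a ball of \<open>g ` V\<close> because \<open>g\<close> is bounded below on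
  \<open>V\<close>; the choice operator turns the existence of its radius into a term.
\<close>

sublocale image: body_in_subspace "g ` V" "g ` A" "SOME r'. 0 < r' \<and> cball 0 r' \<inter> g ` V \<subseteq> g ` A" s
proof -
  obtain e where e: "e > 0" "\<And>x. x \<in> V \<Longrightarrow> e * norm x \<le> norm (g x)"
    using linear_inj_on_bounded_below[OF g V inj_g] by blast
  have "0 < e * r \<and> cball 0 (e * r) \<inter> g ` V \<subseteq> g ` A"
  proof (intro conjI subsetI)
    fix y assume "y \<in> cball 0 (e * r) \<inter> g ` V"
    then obtain x where x: "x \<in> V" "y = g x" "norm (g x) \<le> e * r" by auto
    then have "e * norm x \<le> e * r" using e(2)[of x] by simp
    then have "x \<in> A" using ball_A x(1) e(1) by auto
    then show "y \<in> g ` A" using x by simp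
  qed (use e r_pos in simp)
  then have r': "0 < (SOME r'. 0 < r' \<and> cball 0 r' \<inter> g ` V \<subseteq> g ` A) \<and>
     cball 0 (SOME r'. 0 < r' \<and> cball 0 r' \<inter> g ` V \<subseteq> g ` A) \<inter> g ` V \<subseteq> g ` A"
    by (rule someI)
  show "body_in_subspace (g ` V) (g ` A) (SOME r'. 0 < r' \<and> cball 0 r' \<inter> g ` V \<subseteq> g ` A) s"
  proof
    show "dim (g ` V) = Suc s" using g inj_g V dim_V by (metis dim_image_eq span_eq_iff)
    show "compact (g ` A)" by (rule compact_image_linear[OF g compact_A])
    show "convex (g ` A)" by (rule convex_linear_image[OF g convex_A])
  qed (use gV A_V r' in auto)
qed

text \<open>
  The adjoint of \<open>g\<close> pulls a normal of \<open>g ` A\<close> back to a normal of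
  \<open>A\<close>, and two different normals of \<open>A\<close> at \<open>x\<close> would be
  mapped to two different normals of \<open>g ` A\<close> at \<open>g x\<close>.
\<close>

lemma smooth_points_image:
  assumes "y \<in> smooth_points (g ` V) (g ` A)"
  obtains x where "x \<in> smooth_points V A" "y = g x"
    "gauss_map (g ` V) (g ` A) y = dual_map (gauss_map V A x) /\<^sub>R norm (dual_map (gauss_map V A x))"
proof -
  let ?n' = "gauss_map (g ` V) (g ` A) y"
  obtain x where x: "x \<in> A" "y = g x" using assms by (auto simp: smooth_points_def)
  note y = gauss_map_smooth[OF assms]
  have normal: "?n' = dual_map u /\<^sub>R norm (dual_map u)" if u: "u \<in> unit_sphere V" "outer_normal A x u" for u
  proof (rule y(3))
    note n = norm_dual_map_pos[OF u(1)]
    show "dual_map u /\<^sub>R norm (dual_map u) \<in> unit_sphere (g ` V)"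
      using n by (auto intro!: subspace_scale gV dual_map_in)
    show "outer_normal (g ` A) y (dual_map u /\<^sub>R norm (dual_map u))"
      using outer_normal_image[OF x(1), of u] u(2) n
      by (auto simp: outer_normal_def x(2) divide_right_mono)
  qed
  have uniq: "u = v" if u: "u \<in> unit_sphere V" "outer_normal A x u" and v: "v \<in> unit_sphere V" "outer_normal A x v" for u v
  proof -
    let ?a = "norm (dual_map u)" and ?b = "norm (dual_map v)"
    note n = norm_dual_map_pos[OF u(1)] norm_dual_map_pos[OF v(1)]
    have "dual_map (u /\<^sub>R ?a - v /\<^sub>R ?b) = 0"
      using normal[OF u] normal[OF v] by (simp add: linear_diff[OF linear_dual_map] linear_cmul[OF linear_dual_map])
    moreover have "u /\<^sub>R ?a - v /\<^sub>R ?b \<in> V" using u v V by (intro subspace_diff subspace_scale) auto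
    ultimately have eq: "u /\<^sub>R ?a = v /\<^sub>R ?b" using dual_map_nonzero by fastforce
    then have "norm (u /\<^sub>R ?a) = norm (v /\<^sub>R ?b)" by simp
    then have "?a = ?b" using u v n by simp
    then show "u = v" using eq n by simp
  qed
  define w where "w = closest_point V (adjoint g ?n')"
  have w: "w \<bullet> z = ?n' \<bullet> g z" if "z \<in> V" for z
    using that by (simp add: w_def closest_point_inner[OF V] inner_commute[of "adjoint g ?n'"] adjoint_works[OF g] inner_commute)
  have wV: "w \<in> V" unfolding w_def by (rule closest_point_mem[OF V])
  have w0: "w \<noteq> 0"
  proof
    assume "w = 0"
    obtain z where "z \<in> V" "?n' = g z" using y(1) by auto
    then have "?n' \<bullet> ?n' = 0" using w[of z] \<open>w = 0\<close> by simp
    then show False using y(1) by simp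
  qed
  have "outer_normal A x (w /\<^sub>R norm w)"
    using y(2) w A_V x(1) w0 by (auto simp: outer_normal_def x(2) subset_iff divide_right_mono)
  moreover have "w /\<^sub>R norm w \<in> unit_sphere V" using w0 wV V by (auto intro: subspace_scale)
  ultimately have sm: "x \<in> smooth_points V A" using uniq x(1) unfolding smooth_points_def by blast
  show ?thesis
    by (rule that[OF sm x(2)]) (rule normal[OF gauss_map_smooth(1,2)[OF sm]])
qed

text \<open>
  Near \<open>x0\<close> the boundary of \<open>A\<close> is so flat that distances in its image
  under \<open>g\<close> exceed those after projecting to the hyperplane orthogonal to the normal
  \<open>u0\<close> by a factor close to 1 at most. Therefore \<open>g\<close> increases Hausdorff
  measure near \<open>x0\<close> at most by a factor close to its volume factor on that hyperplane.
  The second estimate is the continuity at \<open>x0\<close> of the length of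
  \<open>dual_map\<close> along the Gauss map.
\<close>

lemma local_image_estimate:
  assumes x0: "x0 \<in> smooth_points V A" and l: "1 < l"
  obtains U where "open U" "x0 \<in> U"
    "\<And>X. X \<subseteq> U \<Longrightarrow> X \<subseteq> smooth_points V A \<Longrightarrow>
       hausdorff_outer s (g ` X) \<le> ennreal (l * (vol_factor V g * norm (dual_map (gauss_map V A x0)))) * hausdorff_outer s X"
    "\<And>x. x \<in> U \<Longrightarrow> x \<in> smooth_points V A \<Longrightarrow>
       norm (dual_map (gauss_map V A x0)) \<le> l * norm (dual_map (gauss_map V A x))"
proof -
  define u0 where "u0 = gauss_map V A x0"
  have u0: "u0 \<in> unit_sphere V" unfolding u0_def by (rule gauss_map_in)
  let ?M = "{x\<in>V. x \<bullet> u0 = 0}"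
  have u0V: "u0 \<in> V" "norm u0 = 1" using u0 by auto
  note hyp = hyperplane_in_subspace[OF V u0V]
  have dimM: "dim ?M = s" using hyp(3) dim_V by simp
  have injM: "inj_on g ?M" using inj_g by (rule inj_on_subset) auto
  obtain e where e: "e > 0" "\<And>x. x \<in> V \<Longrightarrow> e * norm x \<le> norm (g x)"
    using linear_inj_on_bounded_below[OF g V inj_g] by blast
  obtain K where K: "K > 0" "\<And>x. norm (g x) \<le> norm x * K"
    using g linear_conv_bounded_linear bounded_linear.pos_bounded by blast
  obtain K' where K': "K' > 0" "\<And>x. norm (dual_map x) \<le> norm x * K'"
    using linear_dual_map linear_conv_bounded_linear bounded_linear.pos_bounded by blast
  define a where "a = norm (dual_map u0)"
  have a: "0 < a" unfolding a_def by (rule norm_dual_map_pos[OF u0])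
  \<comment> \<open>a Lipschitz constant whose \<open>s\<close>-th power is at most \<open>l\<close>; the exponent
    is chosen so as to include \<open>s = 0\<close>\<close>
  define L where "L = l powr (1 / (real s + 1))"
  have L1: "1 < L" using l by (simp add: L_def)
  have "L ^ s = l powr (real s * (1 / (real s + 1)))"
    using l by (simp add: L_def powr_realpow[symmetric] powr_powr mult.commute)
  also have "\<dots> \<le> l powr 1" using l by (intro powr_mono) (auto simp: field_simps)
  finally have L: "1 < L" "L ^ s \<le> l" using L1 l by auto
  \<comment> \<open>the first bound on the deviation \<open>d\<close> of the normals gives the Lipschitz constant
    \<open>L\<close>, the second one the factor \<open>l\<close> between the lengths of
    \<open>dual_map\<close>\<close>
  define d where "d = min ((1 - 1 / L) * e / K) ((1 - 1 / l) * a / K')"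
  have d: "0 < d" "d * K \<le> (1 - 1 / L) * e" "d * K' \<le> (1 - 1 / l) * a"
    using L(1) l e(1) K(1) K'(1) a by (auto simp: d_def min_def field_simps)
  obtain U where U: "open U" "x0 \<in> U"
    "\<And>x u. x \<in> U \<Longrightarrow> x \<in> A \<Longrightarrow> u \<in> unit_sphere V \<Longrightarrow> outer_normal A x u \<Longrightarrow> dist u u0 < d"
    using normals_near_smooth_point[OF x0 d(1)] unfolding u0_def by blast
  show ?thesis
  proof (rule that[OF U(1,2)])
    fix x assume x: "x \<in> U" "x \<in> smooth_points V A"
    then have "x \<in> A" by (simp add: smooth_points_def)
    then have "dist (gauss_map V A x) u0 < d"
      by (rule U(3)[OF x(1) _ gauss_map_smooth(1,2)[OF x(2)]])
    then have "norm (dual_map (u0 - gauss_map V A x)) \<le> d * K'"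
      using K'(2)[of "u0 - gauss_map V A x"] K'(1)
      by (intro order_trans[OF K'(2)] mult_right_mono) (auto simp: dist_norm norm_minus_commute)
    then have "a - norm (dual_map (gauss_map V A x)) \<le> d * K'"
      unfolding a_def linear_diff[OF linear_dual_map] using norm_triangle_ineq2 order_trans by blast
    then have "a - norm (dual_map (gauss_map V A x)) \<le> (1 - 1 / l) * a" using d(3) by simp
    then have "a / l \<le> norm (dual_map (gauss_map V A x))" using l by (simp add: algebra_simps)
    then show "norm (dual_map (gauss_map V A x0)) \<le> l * norm (dual_map (gauss_map V A x))"
      using l by (simp add: a_def u0_def field_simps)
  next
    fix X assume X: "X \<subseteq> U" "X \<subseteq> smooth_points V A"
    then have XV: "X \<subseteq> V" using A_V by (auto simp: smooth_points_def)
    define p where "p x = x - (x \<bullet> u0) *\<^sub>R u0" for x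
    have pM: "p x \<in> ?M" if "x \<in> V" for x
      using that u0V V by (auto simp: p_def subspace_diff subspace_scale inner_diff_left dot_square_norm)
    have p_diff: "p x - p y = p (x - y)" for x y by (simp add: p_def inner_diff_left algebra_simps)
    have p_contr: "norm (p x) \<le> norm x" for x
    proof -
      have x: "x = p x + (x \<bullet> u0) *\<^sub>R u0" by (simp add: p_def)
      have "p x \<bullet> u0 = 0" using u0V by (simp add: p_def inner_diff_left dot_square_norm)
      then have "(norm (p x + (x \<bullet> u0) *\<^sub>R u0))\<^sup>2 = (norm (p x))\<^sup>2 + (norm ((x \<bullet> u0) *\<^sub>R u0))\<^sup>2"
        by (intro norm_add_Pythagorean) (simp add: orthogonal_def)
      then have "(norm (p x))\<^sup>2 \<le> (norm x)\<^sup>2" unfolding x[symmetric] by simp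
      then show ?thesis by (rule power2_le_imp_le) simp
    qed
    have flat: "\<bar>(x - y) \<bullet> u0\<bar> \<le> d * dist x y" if "x \<in> X" "y \<in> X" for x y
    proof -
      have "x \<in> U" "x \<in> contact_set A (unit_sphere V)" "y \<in> U" "y \<in> contact_set A (unit_sphere V)"
        using that X smooth_points_eq[of V A] by auto
      with flat_near_smooth_point[of U u0 d x y] U(3) show ?thesis by blast
    qed
    have lip: "norm (g x - g y) \<le> L * norm (g (p x) - g (p y))" if xy: "x \<in> X" "y \<in> X" for x y
    proof -
      let ?z = "x - y"
      have zV: "?z \<in> V" using xy XV V by (auto intro: subspace_diff)
      have "g ?z = g (p ?z) + (?z \<bullet> u0) *\<^sub>R g u0" by (simp add: p_def linear_diff[OF g] linear_cmul[OF g])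
      then have "norm (g ?z) \<le> norm (g (p ?z)) + norm ((?z \<bullet> u0) *\<^sub>R g u0)" by (metis norm_triangle_ineq)
      also have "norm ((?z \<bullet> u0) *\<^sub>R g u0) \<le> (d * norm ?z) * K"
        using flat[OF xy] K(2)[of u0] u0V by (simp add: dist_norm mult_mono')
      also have "\<dots> \<le> ((1 - 1 / L) * e) * norm ?z"
        using mult_right_mono[OF d(2), of "norm ?z"] by (simp add: mult_ac)
      also have "\<dots> \<le> (1 - 1 / L) * norm (g ?z)"
        using e(2)[OF zV] L(1) by (simp add: mult.assoc mult_left_mono)
      finally have "norm (g ?z) / L \<le> norm (g (p ?z))" by (simp add: algebra_simps)
      then show ?thesis using L(1) by (simp add: linear_diff[OF g, symmetric] p_diff field_simps)
    qed
    have inj_gp: "inj_on (\<lambda>x. g (p x)) X"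
    proof (rule inj_onI)
      fix x y assume xy: "x \<in> X" "y \<in> X" "g (p x) = g (p y)"
      then have "norm (g x - g y) \<le> 0" using lip[OF xy(1,2)] by simp
      then show "x = y" using inj_onD[OF inj_g] xy XV by auto
    qed
    define m where "m = inv_into X (\<lambda>x. g (p x))"
    have m: "m (g (p x)) = x" if "x \<in> X" for x
      unfolding m_def using inv_into_f_f[OF inj_gp that] by simp
    have "g ` X = (\<lambda>z. g (m z)) ` (g ` p ` X)" by (auto simp: image_image m)
    also have "hausdorff_outer s \<dots> \<le> ennreal (L ^ s) * hausdorff_outer s (g ` p ` X)"
      using L(1) lip m by (intro hausdorff_outer_lipschitz) (auto simp: dist_norm)
    also have "\<dots> \<le> ennreal (L ^ s) * (ennreal (vol_factor ?M g) * hausdorff_outer s (p ` X))"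
      using hausdorff_outer_linear_image_le[OF g hyp(1) injM, of "p ` X"] pM XV
      by (intro mult_left_mono) (auto simp: dimM)
    also have "\<dots> \<le> ennreal l * (ennreal (vol_factor ?M g) * hausdorff_outer s X)"
      using L(2) by (intro mult_mono ennreal_leI hausdorff_outer_contraction)
        (auto simp: dist_norm p_diff p_contr)
    also have "vol_factor ?M g = vol_factor V g * norm (dual_map u0)" by (rule vol_factor_hyperplane_dual[OF u0])
    finally show "hausdorff_outer s (g ` X)
       \<le> ennreal (l * (vol_factor V g * norm (dual_map (gauss_map V A x0)))) * hausdorff_outer s X"
      using l vol_factor_pos[OF g V inj_g] by (simp add: ennreal_mult u0_def mult.assoc)
  qed
qed

text \<open>
  The smooth points are covered by countably many neighbourhoods as in the local estimate. On a
  piece near \<open>c\<close>, the factor \<open>vol_factor V g * norm (dual_map u)\<close> for the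
  normal \<open>u\<close> at \<open>c\<close> cancels against the weight, up to the volume factor of
  \<open>g\<close> and a factor \<open>l\<^sup>2\<close>, and \<open>l > 1\<close> is arbitrary.
\<close>

lemma nn_integral_image_smooth_le:
  assumes f[measurable]: "f \<in> borel_measurable borel"
  shows "(\<integral>\<^sup>+y. f (h y) * ennreal (1 / norm (dual_map (gauss_map V A (h y)))) * indicator (g ` smooth_points V A) y
        \<partial>hausdorff_measure s)
     \<le> ennreal (vol_factor V g) * (\<integral>\<^sup>+x. f x * indicator (smooth_points V A) x \<partial>hausdorff_measure s)"
proof (rule ennreal_le_mult_square_limit)
  fix l :: real assume l: "1 < l"
  let ?G = "smooth_points V A" and ?H = "hausdorff_measure s :: 'a measure"
  define w where "w x = norm (dual_map (gauss_map V A x))" for x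
  have w_pos: "0 < w x" for x unfolding w_def by (rule norm_dual_map_pos[OF gauss_map_in])
  note [measurable] = borel_smooth_points gauss_map_measurable borel_linear[OF linear_dual_map] borel_linear[OF h]
  have [measurable]: "w \<in> borel_measurable borel" unfolding w_def by measurable
  have GV: "?G \<subseteq> V" using A_V by (auto simp: smooth_points_def)
  let ?P = "\<lambda>x0 U. open U \<and> x0 \<in> U \<and> (\<forall>X. X \<subseteq> U \<longrightarrow> X \<subseteq> ?G \<longrightarrow>
       hausdorff_outer s (g ` X) \<le> ennreal (l * (vol_factor V g * w x0)) * hausdorff_outer s X)
     \<and> (\<forall>x\<in>U \<inter> ?G. w x0 \<le> l * w x)"
  have "\<exists>U. ?P x0 U" if "x0 \<in> ?G" for x0
    by (rule local_image_estimate[OF that l]) (auto simp: w_def)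
  then obtain U where U: "\<And>x0. x0 \<in> ?G \<Longrightarrow> ?P x0 (U x0)" by metis
  obtain \<F> where \<F>: "\<F> \<subseteq> U ` ?G" "countable \<F>" "\<Union>\<F> = \<Union>(U ` ?G)"
    using Lindelof[of "U ` ?G"] U by blast
  have cov: "?G \<subseteq> \<Union>\<F>" using \<F>(3) U by blast
  show "(\<integral>\<^sup>+y. f (h y) * ennreal (1 / norm (dual_map (gauss_map V A (h y)))) * indicator (g ` ?G) y \<partial>?H)
     \<le> ennreal l * (ennreal l * (ennreal (vol_factor V g) * (\<integral>\<^sup>+x. f x * indicator ?G x \<partial>?H)))"
  proof (cases "?G = {}")
    case False
    then have F0: "\<F> \<noteq> {}" using cov by blast
    define Q where "Q = from_nat_into \<F>"
    have Q: "Q n \<in> \<F>" for n unfolding Q_def by (rule from_nat_into[OF F0])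
    then have "\<exists>c. c \<in> ?G \<and> Q n = U c" for n using \<F>(1) by blast
    then obtain c where c: "\<And>n. c n \<in> ?G" "\<And>n. Q n = U (c n)" by metis
    have covQ: "?G \<subseteq> (\<Union>n. Q n)"
      using cov range_from_nat_into[OF F0 \<F>(2)] by (simp add: Q_def)
    define X where "X n = ?G \<inter> disjointed Q n" for n
    have XU: "X n \<subseteq> U (c n)" "X n \<subseteq> ?G" for n
      using disjointed_subset[of Q n] c(2) by (auto simp: X_def)
    have Xm[measurable]: "X n \<in> sets borel" for n
    proof -
      have "Q n \<in> sets borel" for n using U[OF c(1)] c(2) by simp
      then have "range (disjointed Q) \<subseteq> sets borel" by (intro sets.range_disjointed_sets) auto
      then show ?thesis unfolding X_def using borel_smooth_points by auto
    qed
    have disj: "disjoint_family X" using disjoint_family_disjointed[of Q] by (auto simp: X_def disjoint_family_on_def)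
    have un: "(\<Union>n. X n) = ?G" using covQ UN_disjointed_eq[of Q] by (auto simp: X_def)
    have gXm[measurable]: "g ` X n \<in> sets borel" for n
    proof -
      have "g ` X n = g ` V \<inter> h -` X n" using hg XU(2)[of n] GV by force
      then show ?thesis
        using measurable_sets_borel[OF borel_linear[OF h] Xm[of n]] borel_subspace[OF gV] by auto
    qed
    have gdisj: "disjoint_family (\<lambda>n. g ` X n)"
      unfolding disjoint_family_on_def
    proof (intro ballI impI)
      fix m n :: nat assume "m \<noteq> n"
      then have "X m \<inter> X n = {}" using disj by (auto simp: disjoint_family_on_def)
      then show "g ` X m \<inter> g ` X n = {}"
        using inj_on_image_Int[OF inj_g, of "X m" "X n"] XU(2) GV by (metis image_empty order_trans)
    qed
    have ind1: "(\<Sum>n. indicator (X n) x) = (indicator ?G x :: ennreal)" for x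
      using suminf_indicator[OF disj, of x] un by simp
    have ind2: "(\<Sum>n. indicator (g ` X n) y) = (indicator (g ` ?G) y :: ennreal)" for y
      using suminf_indicator[OF gdisj, of y] un by (simp add: image_UN[symmetric])
    have piece: "(\<integral>\<^sup>+y. f (h y) * ennreal (1 / w (h y)) * indicator (g ` X n) y \<partial>?H)
        \<le> ennreal l * (ennreal l * (ennreal (vol_factor V g) * (\<integral>\<^sup>+x. f x * indicator (X n) x \<partial>?H)))" for n
    proof -
      note Un = U[OF c(1)[of n]]
      have "(\<integral>\<^sup>+y. (\<lambda>x. f x * ennreal (1 / w x)) (h y) * indicator (g ` X n) y \<partial>?H)
        \<le> ennreal (l * (vol_factor V g * w (c n))) * (\<integral>\<^sup>+x. (f x * ennreal (1 / w x)) * indicator (X n) x \<partial>?H)"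
      proof (rule nn_integral_hausdorff_image_le[OF h Xm gXm])
        show "h (g x) = x" if "x \<in> X n" for x using that XU(2) GV hg by blast
        show "hausdorff_outer s (g ` Y) \<le> ennreal (l * (vol_factor V g * w (c n))) * hausdorff_outer s Y"
          if "Y \<subseteq> X n" for Y using Un that XU by (meson order_trans)
      qed measurable
      also have "\<dots> = ennreal l * (ennreal (vol_factor V g) * (ennreal (w (c n)) * (\<integral>\<^sup>+x. (f x * ennreal (1 / w x)) * indicator (X n) x \<partial>?H)))"
        using l vol_factor_pos[OF g V inj_g] w_pos[of "c n"] by (simp add: ennreal_mult mult.assoc less_imp_le)
      also have "ennreal (w (c n)) * (\<integral>\<^sup>+x. (f x * ennreal (1 / w x)) * indicator (X n) x \<partial>?H)
          = (\<integral>\<^sup>+x. ennreal (w (c n)) * ((f x * ennreal (1 / w x)) * indicator (X n) x) \<partial>?H)"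
        by (rule nn_integral_cmult[symmetric]) measurable
      also have "\<dots> \<le> (\<integral>\<^sup>+x. ennreal l * (f x * indicator (X n) x) \<partial>?H)"
      proof (rule nn_integral_mono)
        fix x
        show "ennreal (w (c n)) * ((f x * ennreal (1 / w x)) * indicator (X n) x) \<le> ennreal l * (f x * indicator (X n) x)"
        proof (cases "x \<in> X n")
          case True
          then have "w (c n) \<le> l * w x" using Un XU by blast
          then have "w (c n) * (1 / w x) \<le> l" using w_pos[of x] by (simp add: field_simps)
          then have "ennreal (w (c n)) * ennreal (1 / w x) \<le> ennreal l"
            using w_pos[of "c n"] w_pos[of x] by (simp add: ennreal_mult[symmetric] less_imp_le ennreal_leI)
          then have "(ennreal (w (c n)) * ennreal (1 / w x)) * f x \<le> ennreal l * f x" by (rule mult_right_mono) simp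
          then show ?thesis using True by (simp add: mult_ac)
        qed simp
      qed
      also have "\<dots> = ennreal l * (\<integral>\<^sup>+x. f x * indicator (X n) x \<partial>?H)" by (rule nn_integral_cmult) measurable
      finally show ?thesis by (simp add: mult_left_mono mult.left_commute)
    qed
    have "(\<integral>\<^sup>+y. f (h y) * ennreal (1 / norm (dual_map (gauss_map V A (h y)))) * indicator (g ` ?G) y \<partial>?H)
        = (\<integral>\<^sup>+y. (\<Sum>n. f (h y) * ennreal (1 / w (h y)) * indicator (g ` X n) y) \<partial>?H)"
      by (simp add: ind2 w_def)
    also have "\<dots> = (\<Sum>n. \<integral>\<^sup>+y. f (h y) * ennreal (1 / w (h y)) * indicator (g ` X n) y \<partial>?H)"
      by (rule nn_integral_suminf) measurable
    also have "\<dots> \<le> (\<Sum>n. ennreal l * (ennreal l * (ennreal (vol_factor V g) * (\<integral>\<^sup>+x. f x * indicator (X n) x \<partial>?H))))"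
      by (intro suminf_le piece) auto
    also have "\<dots> = ennreal l * (ennreal l * (ennreal (vol_factor V g) * (\<Sum>n. \<integral>\<^sup>+x. f x * indicator (X n) x \<partial>?H)))"
      by simp
    also have "(\<Sum>n. \<integral>\<^sup>+x. f x * indicator (X n) x \<partial>?H) = (\<integral>\<^sup>+x. (\<Sum>n. f x * indicator (X n) x) \<partial>?H)"
      by (rule nn_integral_suminf[symmetric]) measurable
    also have "\<dots> = (\<integral>\<^sup>+x. f x * indicator ?G x \<partial>?H)" by (simp add: ind1)
    finally show ?thesis .
  qed simp
qed

text \<open>
  Under the passage from \<open>A\<close>, \<open>B\<close> and \<open>u\<close> to \<open>g `
  A\<close>, \<open>g ` B\<close> and \<open>dual_map u\<close> the support functions keep their
  values. Since the integrand of the mixed volume is homogeneous of degree 1 in the normal,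
  normalizing \<open>dual_map u\<close> produces exactly the weight in the preceding estimate.
\<close>

lemma orlicz_mixed_volume_image_le:
  assumes B: "compact B" "B \<subseteq> V" "0 \<in> B" and \<phi>: "\<phi> \<in> orlicz_functions"
  shows "orlicz_mixed_volume \<phi> (g ` V) (g ` A) (g ` B) \<le> ennreal (vol_factor V g) * orlicz_mixed_volume \<phi> V A B"
proof -
  let ?n = "gauss_map V A" and ?n' = "gauss_map (g ` V) (g ` A)"
  let ?G = "smooth_points V A" and ?G' = "smooth_points (g ` V) (g ` A)" and ?H = "hausdorff_measure s :: 'a measure"
  \<comment> \<open>quotients of support functions are nonnegative here; the maximum with 0 extends
    \<open>\<phi>\<close> to a monotone, hence Borel measurable function on the real line\<close>
  define \<psi> where "\<psi> A B u = ennreal (\<phi> (max 0 (support_fun B u / support_fun A u)) * support_fun A u)" for A B :: "'a set" and u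
  have mono: "mono (\<lambda>t. \<phi> (max 0 t))"
    using \<phi> by (auto simp: orlicz_functions_def intro!: monoI elim!: mono_onD)
  have \<phi>m[measurable]: "(\<lambda>t. \<phi> (max 0 t)) \<in> borel_measurable borel" by (rule borel_measurable_mono[OF mono])
  have \<phi>0: "0 \<le> \<phi> (max 0 t)" for t using \<phi> by (auto simp: orlicz_functions_def image_subset_iff)
  have \<psi>m: "\<psi> A' B' \<in> borel_measurable borel" if "compact A'" "A' \<noteq> {}" "compact B'" "B' \<noteq> {}" for A' B'
  proof -
    note [measurable] = borel_measurable_support_fun[OF that(1,2)] borel_measurable_support_fun[OF that(3,4)]
    have "(\<lambda>u. support_fun B' u / support_fun A' u) \<in> borel_measurable borel" by measurable
    from measurable_compose[OF this \<phi>m]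
    have [measurable]: "(\<lambda>u. \<phi> (max 0 (support_fun B' u / support_fun A' u))) \<in> borel_measurable borel" .
    then show ?thesis unfolding \<psi>_def by measurable
  qed
  have nonneg: "0 \<le> support_fun C u" if "compact C" "0 \<in> C" for C and u :: 'a
    using support_fun_ge[OF that, of u] by simp
  have omv: "orlicz_mixed_volume \<phi> W A' B' = ennreal (1 / real (Suc s)) *
      (\<integral>\<^sup>+x. \<psi> A' B' (gauss_map W A' x) * indicator (smooth_points W A') x \<partial>?H)"
    if body: "body_in_subspace W A' r' s" and B': "compact B'" "0 \<in> B'" for W A' B' r'
  proof -
    interpret b: body_in_subspace W A' r' s by (rule body)
    have "(\<integral>\<^sup>+u. ennreal (\<phi> (support_fun B' u / support_fun A' u) * support_fun A' u) \<partial>surface_area_measure W A')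
        = (\<integral>\<^sup>+u. \<psi> A' B' u \<partial>surface_area_measure W A')"
      using nonneg[OF B'] nonneg[OF b.compact_A b.zero_in_A] by (simp add: \<psi>_def max_def)
    also have "\<dots> = (\<integral>\<^sup>+x. \<psi> A' B' (gauss_map W A' x) * indicator (smooth_points W A') x \<partial>?H)"
      using \<psi>m[of A' B'] b.compact_A b.zero_in_A B' by (intro b.nn_integral_surface_area_measure) auto
    finally show ?thesis unfolding orlicz_mixed_volume_def b.dim_V by simp
  qed
  have \<psi>_scale: "\<psi> (g ` A) (g ` B) (dual_map u /\<^sub>R norm (dual_map u)) = \<psi> A B u * ennreal (1 / norm (dual_map u))"
    if u: "u \<in> unit_sphere V" for u
  proof -
    let ?c = "inverse (norm (dual_map u))"
    note n = norm_dual_map_pos[OF u]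
    have "compact (g ` A)" "compact (g ` B)" "g ` A \<noteq> {}" "g ` B \<noteq> {}"
      using compact_image_linear[OF g compact_A] compact_image_linear[OF g B(1)] zero_in_A B(3) by auto
    then have "support_fun (g ` A) (?c *\<^sub>R dual_map u) = ?c * support_fun A u"
      "support_fun (g ` B) (?c *\<^sub>R dual_map u) = ?c * support_fun B u"
      using n by (simp_all add: support_fun_scale support_fun_image A_V B(2))
    moreover have "(?c * support_fun B u) / (?c * support_fun A u) = support_fun B u / support_fun A u"
      using n by simp
    ultimately have "\<psi> (g ` A) (g ` B) (?c *\<^sub>R dual_map u)
       = ennreal ((\<phi> (max 0 (support_fun B u / support_fun A u)) * support_fun A u) * (1 / norm (dual_map u)))"
      unfolding \<psi>_def by (simp only: inverse_eq_divide mult_ac)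
    also have "\<dots> = \<psi> A B u * ennreal (1 / norm (dual_map u))"
      unfolding \<psi>_def using n \<phi>0 nonneg[OF compact_A zero_in_A] by (intro ennreal_mult) auto
    finally show ?thesis .
  qed
  have "(\<integral>\<^sup>+y. \<psi> (g ` A) (g ` B) (?n' y) * indicator ?G' y \<partial>?H)
     \<le> (\<integral>\<^sup>+y. \<psi> A B (?n (h y)) * ennreal (1 / norm (dual_map (?n (h y)))) * indicator (g ` ?G) y \<partial>?H)"
  proof (rule nn_integral_mono)
    fix y
    show "\<psi> (g ` A) (g ` B) (?n' y) * indicator ?G' y
       \<le> \<psi> A B (?n (h y)) * ennreal (1 / norm (dual_map (?n (h y)))) * indicator (g ` ?G) y"
    proof (cases "y \<in> ?G'")
      case True
      then obtain x where x: "x \<in> ?G" "y = g x" "?n' y = dual_map (?n x) /\<^sub>R norm (dual_map (?n x))"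
        by (rule smooth_points_image)
      have "h y = x" using x(1,2) hg A_V by (auto simp: smooth_points_def)
      then show ?thesis using True x \<psi>_scale[OF gauss_map_in] by simp
    qed simp
  qed
  also have "\<dots> \<le> ennreal (vol_factor V g) * (\<integral>\<^sup>+x. \<psi> A B (?n x) * indicator ?G x \<partial>?H)"
  proof -
    have "\<psi> A B \<in> borel_measurable borel" using compact_A zero_in_A B by (intro \<psi>m) auto
    then have "(\<lambda>x. \<psi> A B (?n x)) \<in> borel_measurable borel"
      using gauss_map_measurable by measurable
    from nn_integral_image_smooth_le[OF this] show ?thesis .
  qed
  finally have le: "(\<integral>\<^sup>+y. \<psi> (g ` A) (g ` B) (?n' y) * indicator ?G' y \<partial>?H)
     \<le> ennreal (vol_factor V g) * (\<integral>\<^sup>+x. \<psi> A B (?n x) * indicator ?G x \<partial>?H)" .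
  have "0 \<in> g ` B" using B(3) linear_0[OF g] by (metis imageI)
  note omv' = omv[OF image.body_in_subspace_axioms compact_image_linear[OF g B(1)] this]
  show ?thesis
    unfolding omv' omv[OF body_in_subspace_axioms B(1,3)]
    using mult_left_mono[OF le, of "ennreal (1 / real (Suc s))"] by (simp only: mult.left_commute zero_le simp_thms)
qed

end

text \<open>
  The inequality holds for \<open>g\<close> and for its inverse, and their volume factors are
  reciprocal.
\<close>

theorem orlicz_mixed_volume_linear_image:
  fixes g :: "'a::euclidean_space \<Rightarrow> 'a"
  assumes body: "body_in_subspace V A r s" and g: "linear g" "inj_on g V"
    and B: "compact B" "B \<subseteq> V" "0 \<in> B" and \<phi>: "\<phi> \<in> orlicz_functions"
  shows "orlicz_mixed_volume \<phi> (g ` V) (g ` A) (g ` B) = ennreal (vol_factor V g) * orlicz_mixed_volume \<phi> V A B"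
proof -
  interpret b: body_in_subspace V A r s by (rule body)
  obtain h where h: "linear h" "\<And>x. x \<in> V \<Longrightarrow> h (g x) = x"
    using linear_inj_on_left_inverse[OF g(1), of V] g(2) b.V by (metis span_eq_iff)
  interpret f: linear_image_of_body V A r s g h
    by (intro linear_image_of_body.intro linear_image_of_body_axioms.intro body g(1) h)
  have hg: "h ` g ` C = C" if C: "C \<subseteq> V" for C
  proof -
    have "h (g x) = x" if "x \<in> C" for x using that C h(2) by blast
    then show ?thesis by (simp add: image_image)
  qed
  have gh: "g (h y) = y" if "y \<in> g ` V" for y using that h(2) by auto
  interpret k: linear_image_of_body "g ` V" "g ` A" "SOME r'. 0 < r' \<and> cball 0 r' \<inter> g ` V \<subseteq> g ` A" s h g
    by (intro linear_image_of_body.intro linear_image_of_body_axioms.intro f.image.body_in_subspace_axioms g(1) h(1) gh)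
  have "vol_factor V (\<lambda>x. h (g x)) = vol_factor (g ` V) h * vol_factor V g"
    by (rule vol_factor_compose[OF g(1) h(1) b.V g(2) k.inj_g])
  moreover have "vol_factor V (\<lambda>x. h (g x)) = 1"
    using h(2) by (intro vol_factor_isometry b.V) simp
  ultimately have one: "vol_factor V g * vol_factor (g ` V) h = 1" by (simp add: mult.commute)
  have "orlicz_mixed_volume \<phi> V A B \<le> ennreal (vol_factor (g ` V) h) * orlicz_mixed_volume \<phi> (g ` V) (g ` A) (g ` B)"
  proof -
    have "0 \<in> g ` B" using B(3) linear_0[OF g(1)] by (metis imageI)
    from k.orlicz_mixed_volume_image_le[OF compact_image_linear[OF g(1) B(1)] image_mono[OF B(2)] this \<phi>]
    show ?thesis unfolding hg[OF order_refl] hg[OF b.A_V] hg[OF B(2)] .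
  qed
  from mult_left_mono[OF this, of "ennreal (vol_factor V g)"]
  have "ennreal (vol_factor V g) * orlicz_mixed_volume \<phi> V A B
     \<le> (ennreal (vol_factor V g) * ennreal (vol_factor (g ` V) h)) * orlicz_mixed_volume \<phi> (g ` V) (g ` A) (g ` B)"
    by (simp add: mult.assoc)
  also have "ennreal (vol_factor V g) * ennreal (vol_factor (g ` V) h) = 1"
    using one vol_factor_pos[OF g(1) b.V g(2)] vol_factor_pos[OF h(1) f.gV k.inj_g] by (simp add: ennreal_mult[symmetric])
  finally show ?thesis using f.orlicz_mixed_volume_image_le[OF B \<phi>] by (simp add: antisym)
qed


section \<open>Volume factors as Gram determinants\<close>

text \<open>
  An orthogonal map that takes \<open>V\<close> to \<open>g ` V\<close>, composed with an
  endomorphism \<open>B\<close> of \<open>V\<close>, represents \<open>g\<close>. Extended by the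
  identity to the orthogonal complement, \<open>B\<close> has a determinant.
\<close>

lemma isometric_factorization:
  fixes g :: "real^'n \<Rightarrow> real^'n"
  assumes g: "linear g" and V: "subspace V" and inj: "inj_on g V"
  obtains R B where "orthogonal_transformation R" "linear B" "inj_on B V" "\<And>x. x \<in> V \<Longrightarrow> B x \<in> V"
    "\<And>y. y \<in> orth_compl V \<Longrightarrow> B y = y" "\<And>x. x \<in> V \<Longrightarrow> g x = R (B x)"
    "vol_factor V g = \<bar>det (matrix B)\<bar>"
proof -
  define p where "p = closest_point V"
  have p: "linear p" unfolding p_def by (rule linear_closest_point[OF V])
  have pid: "p x = x" if "x \<in> V" for x unfolding p_def by (rule closest_point_id[OF V that])
  have gV: "subspace (g ` V)" by (rule linear_subspace_image[OF g V])
  have dim: "dim V = dim (g ` V)" using g inj V by (metis dim_image_eq span_eq_iff)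
  obtain R where R: "orthogonal_transformation R" "R ` V = g ` V" "R ` orth_compl V = orth_compl (g ` V)"
    by (rule orthogonal_transformation_between_subspaces[OF V gV dim])
  have linR: "linear R" and innR: "R x \<bullet> R y = x \<bullet> y" for x y
    using R(1) by (auto simp: orthogonal_transformation_def)
  define R' where "R' = adjoint R"
  have R': "linear R'" "R' (R x) = x" "R (R' x) = x" for x
  proof -
    show "linear R'" unfolding R'_def by (rule adjoint_linear[OF linR])
    have *: "R' (R x) = x" for x
    proof (rule vector_eq_ldot[THEN iffD1], rule allI)
      fix y show "y \<bullet> R' (R x) = y \<bullet> x"
        by (simp add: R'_def adjoint_clauses[OF linR] innR)
    qed
    then show "R' (R x) = x" .
    obtain y where "x = R y" using R(1) orthogonal_transformation_surj by (metis surjD)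
    then show "R (R' x) = x" using * by simp
  qed
  define B where "B x = R' (g (p x)) + (x - p x)" for x
  have B: "linear B"
    by (rule linearI) (simp_all add: B_def linear_add[OF p] linear_add[OF g] linear_add[OF R'(1)]
        linear_cmul[OF p] linear_cmul[OF g] linear_cmul[OF R'(1)] algebra_simps)
  have BV: "B x = R' (g x)" if "x \<in> V" for x using that by (simp add: B_def pid)
  have gB: "g x = R (B x)" if "x \<in> V" for x using BV[OF that] R'(3) by simp
  have BinV: "B x \<in> V" if "x \<in> V" for x
  proof -
    have "g x \<in> R ` V" using that R(2) by auto
    then show ?thesis using BV[OF that] R'(2) by auto
  qed
  have injB: "inj_on B V"
    using inj gB by (metis (no_types, lifting) inj_onD inj_onI)
  have idB: "B y = y" if "y \<in> orth_compl V" for y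
    using closest_point_orth_compl[OF V that] linear_0[OF g] linear_0[OF R'(1)] by (simp add: B_def p_def)
  have kB: "vol_factor V B = \<bar>det (matrix B)\<bar>"
    by (rule vol_factor_block[OF B V injB _ idB]) (use BinV in auto)
  have BV_img: "subspace (B ` V)" by (rule linear_subspace_image[OF B V])
  have "vol_factor V g = vol_factor V (\<lambda>x. R (B x))" using gB by (rule vol_factor_cong)
  also have "\<dots> = vol_factor (B ` V) R * vol_factor V B"
    using orthogonal_transformation_inj[OF R(1)]
    by (intro vol_factor_compose B linR V injB) (auto intro: inj_on_subset)
  also have "vol_factor (B ` V) R = 1"
    using R(1) by (intro vol_factor_isometry BV_img) (auto simp: orthogonal_transformation)
  finally have k: "vol_factor V g = \<bar>det (matrix B)\<bar>" by (simp add: kB)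
  show ?thesis by (rule that[OF R(1) B injB BinV idB gB k])
qed

text \<open>
  With \<open>g = R \<circ> B\<close> on \<open>V\<close> as in the factorization, the map on the
  left is \<open>adjoint B \<circ> B\<close>.
\<close>

lemma vol_factor_gram:
  fixes g :: "real^'n \<Rightarrow> real^'n"
  assumes g: "linear g" and V: "subspace V" and inj: "inj_on g V"
  defines "p \<equiv> closest_point V"
  shows "det (matrix (\<lambda>x. p (adjoint g (g (p x))) + (x - p x))) = (vol_factor V g)\<^sup>2"
proof -
  have p: "linear p" unfolding p_def by (rule linear_closest_point[OF V])
  have pV: "p x \<in> V" for x unfolding p_def by (rule closest_point_mem[OF V])
  have psa: "p x \<bullet> y = x \<bullet> p y" for x y unfolding p_def by (rule closest_point_self_adjoint[OF V])
  obtain R B where R: "orthogonal_transformation R" and B: "linear B" and BinV: "\<And>x. x \<in> V \<Longrightarrow> B x \<in> V"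
    and idB: "\<And>y. y \<in> orth_compl V \<Longrightarrow> B y = y" and gB: "\<And>x. x \<in> V \<Longrightarrow> g x = R (B x)"
    and k: "vol_factor V g = \<bar>det (matrix B)\<bar>"
    using isometric_factorization[OF g V inj] by metis
  have Bx: "B x = B (p x) + (x - p x)" for x
    using idB[OF minus_closest_point_orth_compl[OF V, of x]] linear_add[OF B, of "p x" "x - p x"] by (simp add: p_def)
  have "adjoint B (B x) = p (adjoint g (g (p x))) + (x - p x)" for x
  proof (rule vector_eq_ldot[THEN iffD1], rule allI)
    fix y
    have orth: "v \<bullet> (z - p z) = 0" "(z - p z) \<bullet> v = 0" if "v \<in> V" for v z
      using that closest_point_orthogonal[OF V that, of z] by (auto simp: p_def inner_commute)
    have "y \<bullet> adjoint B (B x) = B y \<bullet> B x" by (simp add: adjoint_clauses[OF B])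
    also have "\<dots> = B (p y) \<bullet> B (p x) + (y - p y) \<bullet> (x - p x)"
      by (subst Bx[of y], subst Bx[of x]) (simp add: inner_add_left inner_add_right orth BinV[OF pV])
    also have "B (p y) \<bullet> B (p x) = g (p y) \<bullet> g (p x)"
      using R by (simp add: gB pV orthogonal_transformation_def)
    also have "g (p y) \<bullet> g (p x) = y \<bullet> p (adjoint g (g (p x)))"
      by (simp add: adjoint_clauses[OF g] psa[symmetric])
    also have "(y - p y) \<bullet> (x - p x) = y \<bullet> (x - p x)"
      using orth(1)[OF pV[of y], of x] by (simp add: inner_diff_left)
    finally show "y \<bullet> adjoint B (B x) = y \<bullet> (p (adjoint g (g (p x))) + (x - p x))"
      by (simp add: inner_add_right)
  qed
  then have "matrix (\<lambda>x. p (adjoint g (g (p x))) + (x - p x)) = matrix (adjoint B \<circ> B)" by (simp add: o_def)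
  also have "\<dots> = transpose (matrix B) ** matrix B"
    using B adjoint_linear[OF B] by (simp add: matrix_compose matrix_adjoint)
  finally show ?thesis by (simp add: det_mul k power2_eq_square)
qed

text \<open>
  The map \<open>adjoint f\<close> from \<open>V\<close> to its image and the map \<open>?g\<close>
  back to \<open>V\<close> are adjoint to each other. Their composition is the Gram operator of
  \<open>adjoint f\<close> on \<open>V\<close>, whose determinant is the square of the volume factor
  of \<open>adjoint f\<close>.
\<close>

lemma vol_factor_projected_adjoint:
  fixes f :: "real^'n \<Rightarrow> real^'n"
  assumes f: "linear f" and V: "subspace V" and inj: "inj_on (adjoint f) V"
  shows "vol_factor (adjoint f ` V) (\<lambda>x. closest_point V (f x)) = vol_factor V (adjoint f)"
    and "(\<lambda>x. closest_point V (f x)) ` adjoint f ` V = V"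
    and "inj_on (\<lambda>x. closest_point V (f x)) (adjoint f ` V)"
proof -
  let ?p = "closest_point V" and ?a = "adjoint f" and ?g = "\<lambda>x. closest_point V (f x)"
  have a: "linear ?a" by (rule adjoint_linear[OF f])
  have p: "linear ?p" by (rule linear_closest_point[OF V])
  have g: "linear ?g" using linear_compose[OF f p] by (simp add: o_def)
  have aV: "subspace (?a ` V)" by (rule linear_subspace_image[OF a V])
  show injg: "inj_on ?g (?a ` V)"
    unfolding linear_inj_on_iff[OF g aV]
  proof (intro ballI impI)
    fix x assume x: "x \<in> ?a ` V" "?g x = 0"
    then obtain z where z: "z \<in> V" "x = ?a z" by auto
    have "x \<bullet> x = z \<bullet> f x" using z by (simp add: adjoint_clauses[OF f] inner_commute)
    also have "\<dots> = z \<bullet> ?g x" using closest_point_inner(2)[OF V z(1)] by simp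
    finally show "x = 0" using x(2) by simp
  qed
  have dimaV: "dim (?a ` V) = dim V" using a inj V by (metis dim_image_eq span_eq_iff)
  show gaV: "?g ` ?a ` V = V"
  proof (rule subspace_dim_equal[OF linear_subspace_image[OF g aV] V])
    show "?g ` ?a ` V \<subseteq> V" using closest_point_mem[OF V] by auto
    have "dim (?g ` ?a ` V) = dim (?a ` V)" using g injg aV by (metis dim_image_eq span_eq_iff)
    then show "dim V \<le> dim (?g ` ?a ` V)" by (simp add: dimaV)
  qed
  define B where "B x = ?p (f (?a (?p x))) + (x - ?p x)" for x
  have B: "linear B"
    by (rule linearI) (simp_all add: B_def linear_add[OF p] linear_add[OF a] linear_add[OF f]
        linear_cmul[OF p] linear_cmul[OF a] linear_cmul[OF f] algebra_simps)
  have BV: "B x = ?g (?a x)" if "x \<in> V" for x using that by (simp add: B_def closest_point_id[OF V])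
  have inj2: "inj_on (\<lambda>x. ?g (?a x)) V" using comp_inj_on[OF inj injg] by (simp add: o_def)
  have injB: "inj_on B V" using inj2 BV by (metis (no_types, lifting) inj_onD inj_onI)
  have idB: "B y = y" if "y \<in> orth_compl V" for y
    using closest_point_orth_compl[OF V that] linear_0[OF f] linear_0[OF a] linear_0[OF p] by (simp add: B_def)
  have detB: "det (matrix B) = (vol_factor V ?a)\<^sup>2"
    using vol_factor_gram[OF a V inj] unfolding B_def[abs_def] by (simp add: adjoint_adjoint[OF f])
  have "vol_factor (?a ` V) ?g * vol_factor V ?a = vol_factor V (\<lambda>x. ?g (?a x))"
    by (rule vol_factor_compose[OF a g V inj injg, symmetric])
  also have "\<dots> = vol_factor V B" using BV by (intro vol_factor_cong) simp
  also have "\<dots> = \<bar>det (matrix B)\<bar>"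
    by (rule vol_factor_block[OF B V injB _ idB]) (use BV closest_point_mem[OF V] in auto)
  also have "\<dots> = vol_factor V ?a * vol_factor V ?a" by (simp add: detB power2_eq_square)
  finally show "vol_factor (?a ` V) ?g = vol_factor V ?a"
    using vol_factor_pos[OF a V inj] by simp
qed

lemma matrix_mult_linear:
  fixes A B :: "real^'m^'n" and C D :: "real^'k^'m"
  shows "(A + B) ** C = A ** C + B ** C" "A ** (C + D) = A ** C + A ** D"
    "(A - B) ** C = A ** C - B ** C" "A ** (C - D) = A ** C - A ** D"
    "(t *\<^sub>R A) ** C = t *\<^sub>R (A ** C)" "A ** (t *\<^sub>R C) = t *\<^sub>R (A ** C)"
  by (simp_all add: vec_eq_iff matrix_matrix_mult_def algebra_simps sum.distrib sum_subtractf sum_distrib_left)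


section \<open>Measurability of matrix operations\<close>

lemma borel_measurable_matrixI:
  fixes f :: "'b \<Rightarrow> real^'m^'n"
  assumes "\<And>i k. (\<lambda>x. f x $ i $ k) \<in> borel_measurable M"
  shows "f \<in> borel_measurable M"
  using assms by (intro borel_measurable_vecI)

lemma borel_measurable_matrix_mult[measurable]:
  fixes f :: "'b \<Rightarrow> real^'m^'n" and g :: "'b \<Rightarrow> real^'k^'m"
  assumes [measurable]: "f \<in> borel_measurable M" "g \<in> borel_measurable M"
  shows "(\<lambda>x. f x ** g x) \<in> borel_measurable M"
  by (rule borel_measurable_matrixI) (simp add: matrix_matrix_mult_def)

lemma borel_measurable_transpose[measurable]:
  fixes f :: "'b \<Rightarrow> real^'m^'n"
  assumes [measurable]: "f \<in> borel_measurable M"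
  shows "(\<lambda>x. transpose (f x)) \<in> borel_measurable M"
  by (rule borel_measurable_matrixI) (simp add: transpose_def)

lemma borel_measurable_det[measurable]:
  fixes f :: "'b \<Rightarrow> real^'n^'n"
  assumes [measurable]: "f \<in> borel_measurable M"
  shows "(\<lambda>x. det (f x)) \<in> borel_measurable M"
  unfolding det_def by measurable

text \<open>
  Cramer's rule exhibits the inverse as a measurable function of the matrix.
\<close>

definition cramer_inverse :: "real^'n^'n \<Rightarrow> real^'n^'n" where
  "cramer_inverse A = (\<chi> k i. det (\<chi> a b. if b = k then (if a = i then 1 else 0) else A $ a $ b) / det A)"

lemma borel_measurable_cramer_inverse[measurable]:
  fixes f :: "'b \<Rightarrow> real^'n^'n"
  assumes [measurable]: "f \<in> borel_measurable M"
  shows "(\<lambda>x. cramer_inverse (f x)) \<in> borel_measurable M"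
proof (rule borel_measurable_matrixI)
  fix k i
  have "(\<lambda>x. (\<chi> a b. if b = k then (if a = i then 1 else 0) else f x $ a $ b) :: real^'n^'n) \<in> borel_measurable M"
    by (rule borel_measurable_matrixI) (simp, measurable)
  from borel_measurable_det[OF this]
  show "(\<lambda>x. cramer_inverse (f x) $ k $ i) \<in> borel_measurable M"
    unfolding cramer_inverse_def by simp
qed

lemma cramer_inverse_right:
  fixes A :: "real^'n^'n"
  assumes "det A \<noteq> 0"
  shows "A ** cramer_inverse A = mat 1"
proof -
  have "column i (A ** cramer_inverse A) = axis i 1" for i
  proof -
    have ax: "axis i (1::real) $ a = (if a = i then 1 else 0)" for a :: 'n by (simp add: axis_def)
    have "A *v column i (cramer_inverse A) = axis i 1"
      unfolding cramer[OF assms] by (simp add: vec_eq_iff column_def cramer_inverse_def ax cong: if_cong)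
    moreover have "column i (A ** cramer_inverse A) = A *v column i (cramer_inverse A)"
      by (simp add: vec_eq_iff column_def matrix_matrix_mult_def matrix_vector_mult_def)
    ultimately show ?thesis by simp
  qed
  then show ?thesis by (simp add: vec_eq_iff column_def mat_def axis_def)
qed


section \<open>The projection matrix of a subspace\<close>

definition proj_matrix :: "(real^'n) set \<Rightarrow> real^'n^'n" where
  "proj_matrix V = matrix (closest_point V)"

lemma proj_matrix_mult:
  assumes "subspace V" shows "proj_matrix V *v x = closest_point V x"
  unfolding proj_matrix_def by (simp add: matrix_works linear_closest_point[OF assms])

lemma matrix_eqI: "(\<And>x. A *v x = B *v x) \<Longrightarrow> A = B" for A B :: "real^'n^'m"
  by (simp add: matrix_eq)

lemma adjoint_matrix_mult: "adjoint ((*v) A) = (*v) (transpose A)" for A :: "real^'n^'m"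
  using adjoint_matrix by (metis)

lemma transpose_proj_matrix:
  assumes V: "subspace V" shows "transpose (proj_matrix V) = proj_matrix V"
proof (rule matrix_eqI, rule vector_eq_ldot[THEN iffD1], rule allI)
  fix x y
  have "y \<bullet> (transpose (proj_matrix V) *v x) = closest_point V y \<bullet> x"
    using adjoint_clauses(1)[of "(*v) (proj_matrix V)" y x] by (simp add: adjoint_matrix_mult proj_matrix_mult[OF V])
  then show "y \<bullet> (transpose (proj_matrix V) *v x) = y \<bullet> (proj_matrix V *v x)"
    by (simp add: proj_matrix_mult[OF V] closest_point_self_adjoint[OF V])
qed

text \<open>
  For the projection matrix \<open>P\<close> of a subspace this is the Gram operator of
  \<open>M\<close> on the subspace, extended by the identity to the orthogonal complement.
\<close>

definition gram_matrix :: "real^'n^'n \<Rightarrow> real^'n^'n \<Rightarrow> real^'n^'n" where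
  "gram_matrix P M = P ** transpose M ** M ** P + (mat 1 - P)"

lemma gram_matrix_mult:
  assumes V: "subspace V"
  shows "gram_matrix (proj_matrix V) M *v x
     = closest_point V (transpose M *v (M *v (closest_point V x))) + (x - closest_point V x)"
  by (simp add: gram_matrix_def matrix_vector_mult_add_rdistrib matrix_vector_mult_diff_rdistrib
    matrix_vector_mul_assoc[symmetric] proj_matrix_mult[OF V])

lemma det_gram_matrix:
  assumes V: "subspace V" and inj: "inj_on ((*v) M) V"
  shows "det (gram_matrix (proj_matrix V) M) = (vol_factor V ((*v) M))\<^sup>2"
proof -
  have "gram_matrix (proj_matrix V) M
     = matrix (\<lambda>x. closest_point V (adjoint ((*v) M) (M *v (closest_point V x))) + (x - closest_point V x))"
  proof -
    let ?F = "\<lambda>x. closest_point V (adjoint ((*v) M) (M *v (closest_point V x))) + (x - closest_point V x)"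
    have "?F = (*v) (gram_matrix (proj_matrix V) M)"
      by (simp add: fun_eq_iff gram_matrix_mult[OF V] adjoint_matrix_mult)
    then show ?thesis by simp
  qed
  then show ?thesis using vol_factor_gram[OF _ V inj] by simp
qed

lemma inj_on_iff_det_gram:
  assumes V: "subspace V"
  shows "inj_on ((*v) M) V \<longleftrightarrow> det (gram_matrix (proj_matrix V) M) \<noteq> 0"
proof
  assume inj: "inj_on ((*v) M) V"
  then show "det (gram_matrix (proj_matrix V) M) \<noteq> 0"
    using det_gram_matrix[OF V inj] vol_factor_pos[OF _ V inj] by simp
next
  assume d: "det (gram_matrix (proj_matrix V) M) \<noteq> 0"
  have "inj ((*v) (gram_matrix (proj_matrix V) M))"
    using d det_nz_iff_inj[of "(*v) (gram_matrix (proj_matrix V) M)"] by simp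
  then have 0: "x = 0" if "gram_matrix (proj_matrix V) M *v x = 0" for x
    using that by (metis injD matrix_vector_mult_0_right)
  show "inj_on ((*v) M) V"
    unfolding linear_inj_on_iff[OF matrix_vector_mul_linear V]
  proof (intro ballI impI)
    fix x assume "x \<in> V" "M *v x = 0"
    then have "gram_matrix (proj_matrix V) M *v x = 0"
      using closest_point_id[OF V] closest_point_id[OF V subspace_0[OF V]] by (simp add: gram_matrix_mult[OF V])
    then show "x = 0" by (rule 0)
  qed
qed

text \<open>
  The projection onto the image of \<open>V\<close> under \<open>M\<close>, as given by the normal
  equations of least squares, with \<open>P\<close> the projection matrix of \<open>V\<close>.
\<close>

definition image_proj :: "real^'n^'n \<Rightarrow> real^'n^'n \<Rightarrow> real^'n^'n" where
  "image_proj P M = M ** P ** cramer_inverse (gram_matrix P M) ** P ** transpose M"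

lemma proj_matrix_image:
  assumes V: "subspace V" and inj: "inj_on ((*v) M) V"
  shows "proj_matrix ((*v) M ` V) = image_proj (proj_matrix V) M"
proof (rule matrix_eqI)
  fix y
  let ?p = "closest_point V" and ?G = "gram_matrix (proj_matrix V) M"
  have MV: "subspace ((*v) M ` V)" by (rule linear_subspace_image[OF matrix_vector_mul_linear V])
  define w where "w = cramer_inverse ?G *v ?p (transpose M *v y)"
  have Gw: "?G *v w = ?p (transpose M *v y)"
    using cramer_inverse_right[of ?G] inj_on_iff_det_gram[OF V, of M] inj
    by (simp add: w_def matrix_vector_mul_assoc)
  have p: "linear ?p" by (rule linear_closest_point[OF V])
  have "?p (?G *v w) = ?G *v w" unfolding Gw by (intro closest_point_id V closest_point_mem)
  then have pw: "?p w = w"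
    using closest_point_id[OF V closest_point_mem[OF V]]
    by (simp add: gram_matrix_mult[OF V] linear_add[OF p] linear_diff[OF p])
  then have wV: "w \<in> V" using closest_point_mem[OF V] by metis
  have Gw': "?p (transpose M *v (M *v w)) = ?p (transpose M *v y)"
    using Gw pw by (simp add: gram_matrix_mult[OF V])
  have "closest_point ((*v) M ` V) y = M *v w"
  proof (rule closest_point_eqI[OF MV])
    fix z assume "z \<in> (*v) M ` V"
    then obtain x where x: "x \<in> V" "z = M *v x" by auto
    have "(y - M *v w) \<bullet> z = (transpose M *v (y - M *v w)) \<bullet> x"
      using adjoint_clauses(2)[of "(*v) M" "y - M *v w" x] by (simp add: adjoint_matrix_mult x(2))
    also have "\<dots> = ?p (transpose M *v (y - M *v w)) \<bullet> x" using closest_point_inner(1)[OF V x(1)] by simp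
    also have "?p (transpose M *v (y - M *v w)) = 0"
      using Gw' by (simp add: matrix_vector_mult_diff_distrib linear_diff[OF p])
    finally show "(y - M *v w) \<bullet> z = 0" by simp
  qed (use wV in auto)
  then show "proj_matrix ((*v) M ` V) *v y = image_proj (proj_matrix V) M *v y"
    using pw by (simp add: proj_matrix_mult[OF MV] image_proj_def matrix_vector_mul_assoc[symmetric] proj_matrix_mult[OF V] w_def)
qed

lemma borel_measurable_gram_matrix[measurable]:
  assumes [measurable]: "f \<in> borel_measurable M" "g \<in> borel_measurable M"
  shows "(\<lambda>x. gram_matrix (f x) (g x)) \<in> borel_measurable M"
  unfolding gram_matrix_def by measurable

lemma borel_measurable_image_proj[measurable]:
  assumes [measurable]: "f \<in> borel_measurable M" "g \<in> borel_measurable M"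
  shows "(\<lambda>x. image_proj (f x) (g x)) \<in> borel_measurable M"
  unfolding image_proj_def by measurable


section \<open>The Grassmannian as a measurable space\<close>

lemma space_grassmannian_borel[simp]: "space (grassmannian_borel j) = grassmannian j"
  by (simp add: grassmannian_borel_def)

lemma measurable_proj_matrix[measurable]: "proj_matrix \<in> borel_measurable (grassmannian_borel j)"
  unfolding grassmannian_borel_def proj_matrix_def[abs_def]
  by (rule measurable_vimage_algebra1) auto

lemma measurable_into_grassmannian:
  assumes "\<And>x. x \<in> space M \<Longrightarrow> f x \<in> grassmannian j" "(\<lambda>x. proj_matrix (f x)) \<in> borel_measurable M"
  shows "f \<in> measurable M (grassmannian_borel j)"
  unfolding grassmannian_borel_def
  by (rule measurable_vimage_algebra2) (use assms in \<open>auto simp: proj_matrix_def\<close>)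

lemma grassmannian_image:
  assumes "V \<in> grassmannian j" "linear g" "inj_on g V"
  shows "g ` V \<in> grassmannian j"
proof -
  have V: "subspace V" "dim V = j" using assms(1) by (auto simp: grassmannian_def)
  have "dim (g ` V) = dim V" using assms V by (metis dim_image_eq span_eq_iff)
  then show ?thesis using V linear_subspace_image[OF assms(2)] by (simp add: grassmannian_def)
qed

lemma measurable_grassmannian_image:
  fixes M :: "real^'n^'n"
  assumes inj: "inj ((*v) M)"
  shows "(`) ((*v) M) \<in> measurable (grassmannian_borel j) (grassmannian_borel j)"
proof (rule measurable_into_grassmannian)
  have inj': "inj_on ((*v) M) V" for V using inj by (rule inj_on_subset) simp
  show "(*v) M ` V \<in> grassmannian j" if "V \<in> space (grassmannian_borel j)" for V
    using that by (intro grassmannian_image inj') auto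
  have "(\<lambda>V. image_proj (proj_matrix V) M) \<in> borel_measurable (grassmannian_borel j)" by measurable
  also have "?this \<longleftrightarrow> (\<lambda>V. proj_matrix ((*v) M ` V)) \<in> borel_measurable (grassmannian_borel j)"
    by (rule measurable_cong) (simp add: proj_matrix_image[OF _ inj'] grassmannian_def)
  finally show "(\<lambda>V. proj_matrix ((*v) M ` V)) \<in> borel_measurable (grassmannian_borel j)" .
qed

lemma measurable_vol_factor:
  fixes M :: "real^'n^'n"
  assumes inj: "inj ((*v) M)"
  shows "(\<lambda>V. vol_factor V ((*v) M)) \<in> borel_measurable (grassmannian_borel j)"
proof -
  have inj': "inj_on ((*v) M) V" for V using inj by (rule inj_on_subset) simp
  have "(\<lambda>V. sqrt (det (gram_matrix (proj_matrix V) M))) \<in> borel_measurable (grassmannian_borel j)" by measurable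
  also have "?this \<longleftrightarrow> (\<lambda>V. vol_factor V ((*v) M)) \<in> borel_measurable (grassmannian_borel j)"
  proof (rule measurable_cong)
    fix V :: "(real^'n) set" assume "V \<in> space (grassmannian_borel j)"
    then have V: "subspace V" by (simp add: grassmannian_def)
    then show "sqrt (det (gram_matrix (proj_matrix V) M)) = vol_factor V ((*v) M)"
      using vol_factor_pos[OF _ V inj'] by (simp add: det_gram_matrix[OF V inj'] less_imp_le)
  qed
  finally show ?thesis .
qed


section \<open>Lebesgue measure on matrices\<close>

lemma vol_factor_UNIV_rows:
  fixes L :: "'n \<Rightarrow> real^'n \<Rightarrow> real^'n"
  assumes L: "\<And>i. linear (L i)" "\<And>i. inj (L i)"
  defines "F \<equiv> \<lambda>X::real^'n^'n. \<chi> i. L i (X $ i)"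
  shows "vol_factor UNIV F = (\<Prod>i\<in>UNIV. \<bar>det (matrix (L i))\<bar>)" "linear F" "inj F"
proof -
  show lin: "linear F"
    by (rule linearI) (simp_all add: F_def vec_eq_iff linear_add[OF L(1)] linear_cmul[OF L(1)])
  show inj: "inj F"
  proof (rule injI)
    fix X Y assume "F X = F Y"
    then have "F X $ i = F Y $ i" for i by simp
    then have "X $ i = Y $ i" for i using injD[OF L(2)[of i]] by (simp add: F_def)
    then show "X = Y" by (simp add: vec_eq_iff)
  qed
  let ?c = "cbox 0 (\<Sum>Basis) :: (real^'n) set"
  have c: "emeasure lborel ?c = 1" by (simp add: emeasure_lborel_cbox_eq)
  have Lc: "emeasure lborel (L i ` ?c) = ennreal \<bar>det (matrix (L i))\<bar>" "L i ` ?c \<in> sets borel" for i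
  proof -
    have "compact (L i ` ?c)"
      by (intro compact_continuous_image linear_continuous_on compact_cbox) (use L(1) in \<open>simp add: linear_conv_bounded_linear\<close>)
    then show m: "L i ` ?c \<in> sets borel" by (simp add: borel_closed compact_imp_closed)
    have "emeasure lborel (L i ` ?c) = (\<integral>\<^sup>+x. indicator (L i ` ?c) x \<partial>lborel)" using m by simp
    also have "\<dots> = ennreal (vol_factor UNIV (L i)) * (\<integral>\<^sup>+x. indicator (L i ` ?c) (L i x) \<partial>lborel)"
      by (rule nn_integral_lborel_linear[OF L]) (use m in simp)
    also have "(\<integral>\<^sup>+x. indicator (L i ` ?c) (L i x) \<partial>lborel) = (\<integral>\<^sup>+x. indicator ?c x \<partial>lborel)"
      using L(2) by (simp add: indicator_def inj_image_mem_iff)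
    also have "\<dots> = 1" using c by simp
    finally show "emeasure lborel (L i ` ?c) = ennreal \<bar>det (matrix (L i))\<bar>"
      by (simp add: vol_factor_UNIV_det[OF L])
  qed
  let ?Q = "{X::real^'n^'n. \<forall>i. X $ i \<in> ?c}"
  have img: "F ` ?Q = {Y. \<forall>i. Y $ i \<in> L i ` ?c}"
  proof (intro equalityI subsetI)
    fix Y assume "Y \<in> {Y. \<forall>i. Y $ i \<in> L i ` ?c}"
    then have "\<forall>i. \<exists>x. x \<in> ?c \<and> Y $ i = L i x" by blast
    then obtain x where x: "\<And>i. x i \<in> ?c" "\<And>i. Y $ i = L i (x i)" by metis
    then have "(\<chi> i. x i) \<in> ?Q" "Y = F (\<chi> i. x i)" by (simp_all add: F_def vec_eq_iff)
    then show "Y \<in> F ` ?Q" by blast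
  qed (auto simp: F_def)
  show "vol_factor UNIV F = (\<Prod>i\<in>UNIV. \<bar>det (matrix (L i))\<bar>)"
  proof (rule vol_factor_UNIV_eqI[OF lin inj, of ?Q 1])
    show "?Q \<in> sets borel" by (rule sets_vec_rectangle) simp
    show "emeasure lborel ?Q = ennreal 1"
      using emeasure_lborel_vec[of "\<lambda>_::'n. ?c"] c by simp
    show "emeasure lborel (F ` ?Q) = ennreal ((\<Prod>i\<in>UNIV. \<bar>det (matrix (L i))\<bar>) * 1)"
      unfolding img using emeasure_lborel_vec[of "\<lambda>i. L i ` ?c"] Lc by (simp add: prod_ennreal)
  qed (auto intro: prod_nonneg)
qed

lemma nn_integral_lborel_isometry:
  fixes f :: "'a::euclidean_space \<Rightarrow> 'a"
  assumes f: "linear f" "\<And>x. norm (f x) = norm x" and h: "h \<in> borel_measurable borel"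
  shows "(\<integral>\<^sup>+x. h (f x) \<partial>lborel) = (\<integral>\<^sup>+x. h x \<partial>lborel)"
proof -
  have "inj f"
    unfolding linear_injective_0[OF f(1)] using f(2) by (metis norm_eq_zero)
  from nn_integral_lborel_linear[OF f(1) this h] show ?thesis
    using vol_factor_isometry[OF subspace_UNIV, of f] f(2) by simp
qed

lemma norm_matrix: "norm (A :: real^'m^'n) = sqrt (\<Sum>i\<in>UNIV. \<Sum>k\<in>UNIV. (A $ i $ k)\<^sup>2)"
  by (simp add: norm_vec_def L2_set_def real_sqrt_pow2 sum_nonneg)

lemma norm_transpose: "norm (transpose A) = norm (A :: real^'m^'n)"
  unfolding norm_matrix by (subst sum.swap) (simp add: transpose_def)

lemma linear_transpose: "linear (transpose :: real^'m^'n \<Rightarrow> real^'n^'m)"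
  by (rule linearI) (simp_all add: transpose_def vec_eq_iff)

definition coord_subspace :: "'n set \<Rightarrow> (real^'n) set" where
  "coord_subspace J = {x. \<forall>i. i \<notin> J \<longrightarrow> x $ i = 0}"

definition coord_proj :: "'n set \<Rightarrow> real^'n^'n" where
  "coord_proj J = (\<chi> i k. if i = k \<and> i \<in> J then 1 else 0)"

lemma coord_proj_mult_vec: "coord_proj J *v x = (\<chi> i. if i \<in> J then x $ i else 0)"
proof -
  have "(\<Sum>k\<in>UNIV. (if i = k \<and> i \<in> J then 1 else 0) * x $ k) = (\<Sum>k\<in>UNIV. if k = i then (if i \<in> J then x $ i else 0) else 0)" for i
    by (rule sum.cong) auto
  then show ?thesis by (simp add: coord_proj_def matrix_vector_mult_def vec_eq_iff)
qed

lemma coord_proj_mult_left: "(coord_proj J ** A) $ i $ k = (if i \<in> J then A $ i $ k else 0)"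
proof -
  have "(\<Sum>l\<in>UNIV. (if i = l \<and> i \<in> J then 1 else 0) * A $ l $ k) = (\<Sum>l\<in>UNIV. if l = i then (if i \<in> J then A $ i $ k else 0) else 0)"
    by (rule sum.cong) auto
  then show ?thesis by (simp add: coord_proj_def matrix_matrix_mult_def)
qed

lemma coord_proj_mult_right: "(A ** coord_proj J) $ i $ k = (if k \<in> J then A $ i $ k else 0)"
proof -
  have "(\<Sum>l\<in>UNIV. A $ i $ l * (if l = k \<and> l \<in> J then 1 else 0)) = (\<Sum>l\<in>UNIV. if l = k then (if k \<in> J then A $ i $ k else 0) else 0)"
    by (rule sum.cong) auto
  then show ?thesis by (simp add: coord_proj_def matrix_matrix_mult_def)
qed

lemma subspace_coord_subspace: "subspace (coord_subspace J)"
  by (auto simp: coord_subspace_def subspace_def)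

lemma proj_matrix_coord_subspace: "proj_matrix (coord_subspace J) = coord_proj J"
proof (rule matrix_eqI)
  fix x
  show "proj_matrix (coord_subspace J) *v x = coord_proj J *v x"
    unfolding proj_matrix_mult[OF subspace_coord_subspace]
  proof (rule closest_point_eqI[OF subspace_coord_subspace])
    show "coord_proj J *v x \<in> coord_subspace J" by (simp add: coord_proj_mult_vec coord_subspace_def)
    fix y assume "y \<in> coord_subspace J"
    then show "(x - coord_proj J *v x) \<bullet> y = 0"
      by (auto simp: coord_proj_mult_vec inner_vec_def coord_subspace_def intro!: sum.neutral)
  qed
qed

lemma dim_coord_subspace: "dim (coord_subspace J) = card J"
proof -
  have B: "orthonormal_basis_of (coord_subspace J) ((\<lambda>i. axis i 1) ` J)"
    unfolding orthonormal_basis_of_def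
  proof (intro conjI ballI)
    show "(\<lambda>i. axis i 1) ` J \<subseteq> coord_subspace J" by (auto simp: coord_subspace_def axis_def)
    show "pairwise orthogonal ((\<lambda>i. axis i (1::real)) ` J)"
      by (auto simp: pairwise_def orthogonal_def inner_axis_axis)
    show "span ((\<lambda>i. axis i 1) ` J) = coord_subspace J"
    proof (intro equalityI span_minimal subspace_coord_subspace subsetI)
      fix x assume "x \<in> coord_subspace J"
      then have "x = (\<Sum>i\<in>J. x $ i *\<^sub>R axis i 1)"
        by (simp add: vec_eq_iff axis_def coord_subspace_def sum.delta if_distrib cong: if_cong)
      also have "\<dots> \<in> span ((\<lambda>i. axis i 1) ` J)"
        by (intro span_sum span_scale span_base) auto
      finally show "x \<in> span ((\<lambda>i. axis i 1) ` J)" .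
    qed (auto simp: coord_subspace_def axis_def)
  qed auto
  have "inj_on (\<lambda>i. axis i (1::real)) J" by (auto simp: inj_on_def axis_eq_axis)
  then show ?thesis using orthonormal_basis_ofD(3)[OF B] by (simp add: card_image)
qed

text \<open>
  Right multiplication by \<open>A\<close> acts on each of the rows with index outside
  \<open>J\<close> as the transpose of \<open>A\<close>.
\<close>

lemma nn_integral_row_scaling:
  fixes A :: "real^'n^'n" and J :: "'n set" and h :: "real^'n^'n \<Rightarrow> ennreal"
  assumes A: "det A \<noteq> 0" and h: "h \<in> borel_measurable borel"
  shows "(\<integral>\<^sup>+Y. h Y \<partial>lborel) = ennreal (\<bar>det A\<bar> ^ card (- J)) *
     (\<integral>\<^sup>+Y. h (coord_proj J ** Y + (mat 1 - coord_proj J) ** Y ** A) \<partial>lborel)"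
proof -
  define L where "L i = (if i \<in> J then (\<lambda>v. v) else (\<lambda>v. transpose A *v v))" for i
  have dA: "det (transpose A) \<noteq> 0" using A by simp
  have "inj ((*v) (transpose A))" using det_nz_iff_inj[of "(*v) (transpose A)"] dA by simp
  then have L: "linear (L i)" "inj (L i)" for i by (auto simp: L_def linear_id[unfolded id_def] simp del: transpose_matrix_vector)
  let ?F = "\<lambda>X::real^'n^'n. \<chi> i. L i (X $ i)"
  have F: "?F Y = coord_proj J ** Y + (mat 1 - coord_proj J) ** Y ** A" for Y
  proof -
    have row: "((mat 1 - coord_proj J) ** Y ** A) $ i = (if i \<in> J then 0 else transpose A *v (Y $ i))" for i
    proof -
      have "(mat 1 - coord_proj J) ** Y = Y - coord_proj J ** Y" by (simp add: matrix_mult_linear)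
      then have "((mat 1 - coord_proj J) ** Y) $ i $ k = (if i \<in> J then 0 else Y $ i $ k)" for k
        by (simp add: coord_proj_mult_left)
      then show ?thesis
        by (auto simp: vec_eq_iff matrix_matrix_mult_def[of _ A] vector_matrix_mult_def mult.commute)
    qed
    show ?thesis
    proof (subst vec_eq_iff, intro allI)
      fix i show "?F Y $ i = (coord_proj J ** Y + (mat 1 - coord_proj J) ** Y ** A) $ i"
        unfolding vector_add_component row
        by (simp add: L_def vec_eq_iff coord_proj_mult_left del: transpose_matrix_vector)
    qed
  qed
  have "(\<Prod>i\<in>UNIV. \<bar>det (matrix (L i))\<bar>) = (\<Prod>i\<in>UNIV. if i \<in> J then 1 else \<bar>det A\<bar>)"
    by (rule prod.cong) (auto simp: L_def matrix_id[unfolded id_def] simp del: transpose_matrix_vector)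
  also have "\<dots> = \<bar>det A\<bar> ^ card (- J)"
    by (simp add: prod.If_cases Compl_eq)
  finally have c: "vol_factor UNIV ?F = \<bar>det A\<bar> ^ card (- J)"
    using vol_factor_UNIV_rows(1)[OF L] by simp
  show ?thesis
    using nn_integral_lborel_linear[OF vol_factor_UNIV_rows(2)[OF L, of "\<lambda>i. i"] vol_factor_UNIV_rows(3)[OF L, of "\<lambda>i. i"] h]
    unfolding F c[unfolded F] .
qed

text \<open>
  Transposition is an isometry of the space of matrices and exchanges rows and columns.
\<close>

lemma nn_integral_column_scaling:
  fixes A :: "real^'n^'n" and J :: "'n set" and h :: "real^'n^'n \<Rightarrow> ennreal"
  assumes A: "det A \<noteq> 0" and h[measurable]: "h \<in> borel_measurable borel"
  shows "(\<integral>\<^sup>+Y. h Y \<partial>lborel) = ennreal (\<bar>det A\<bar> ^ card J) *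
     (\<integral>\<^sup>+Y. h (A ** Y ** coord_proj J + Y ** (mat 1 - coord_proj J)) \<partial>lborel)"
proof -
  have tP: "transpose (coord_proj J) = coord_proj J"
    using transpose_proj_matrix[OF subspace_coord_subspace[of J]] by (simp add: proj_matrix_coord_subspace)
  have compl: "coord_proj (- J) = mat 1 - coord_proj J"
    by (simp add: vec_eq_iff coord_proj_def mat_def)
  have iso: "(\<integral>\<^sup>+Y. k (transpose Y) \<partial>lborel) = (\<integral>\<^sup>+Y. k Y \<partial>lborel)"
    if "k \<in> borel_measurable borel" for k :: "real^'n^'n \<Rightarrow> ennreal"
    by (rule nn_integral_lborel_isometry[OF linear_transpose norm_transpose that])
  have tr: "transpose (X + Y) = transpose X + transpose Y" for X Y :: "real^'n^'n"
    by (rule linear_add[OF linear_transpose])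
  have "(\<integral>\<^sup>+Y. h Y \<partial>lborel) = (\<integral>\<^sup>+Y. h (transpose Y) \<partial>lborel)" by (rule iso[OF h, symmetric])
  also have "\<dots> = ennreal (\<bar>det (transpose A)\<bar> ^ card (- (- J))) *
     (\<integral>\<^sup>+Y. h (transpose (coord_proj (- J) ** Y + (mat 1 - coord_proj (- J)) ** Y ** transpose A)) \<partial>lborel)"
    by (rule nn_integral_row_scaling) (use A in auto)
  also have "\<dots> = ennreal (\<bar>det A\<bar> ^ card J) * (\<integral>\<^sup>+Y. h (A ** transpose Y ** coord_proj J + transpose Y ** (mat 1 - coord_proj J)) \<partial>lborel)"
  proof -
    have "transpose (coord_proj (- J) ** Y + (mat 1 - coord_proj (- J)) ** Y ** transpose A)
       = A ** transpose Y ** coord_proj J + transpose Y ** (mat 1 - coord_proj J)" for Y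
      unfolding compl tr matrix_transpose_mul transpose_transpose
      by (simp add: linear_diff[OF linear_transpose] tP matrix_mul_assoc add.commute transpose_mat)
    then show ?thesis by simp
  qed
  also have "\<dots> = ennreal (\<bar>det A\<bar> ^ card J) * (\<integral>\<^sup>+Y. h (A ** Y ** coord_proj J + Y ** (mat 1 - coord_proj J)) \<partial>lborel)"
    by (subst iso[of "\<lambda>Y. h (A ** Y ** coord_proj J + Y ** (mat 1 - coord_proj J))", symmetric]) auto
  finally show ?thesis .
qed

text \<open>
  The rows of \<open>X\<close> with index in \<open>J\<close> and the other rows become separate
  variables of integration. So that both variables range over the whole space of matrices, the
  unused rows of \<open>A\<close> and \<open>Y\<close> are put together to a second matrix, which is
  integrated over the unit ball. The exchange of rows is then an isometry of pairs of matrices.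
\<close>

lemma nn_integral_row_splitting:
  fixes J :: "'n::finite set" and F :: "real^'n^'n \<Rightarrow> ennreal"
  assumes F[measurable]: "F \<in> borel_measurable borel"
  defines "P \<equiv> coord_proj J" and "Q \<equiv> mat 1 - coord_proj J"
  shows "emeasure lborel (cball (0 :: real^'n^'n) 1) * (\<integral>\<^sup>+X. F X \<partial>lborel)
     = (\<integral>\<^sup>+A. (\<integral>\<^sup>+Y. F (P ** A + Q ** Y) * indicator (cball 0 1) (P ** Y + Q ** A) \<partial>lborel) \<partial>lborel)"
proof -
  define q :: "real^'n^'n \<Rightarrow> ennreal" where "q = indicator (cball 0 1)"
  have q[measurable]: "q \<in> borel_measurable borel" unfolding q_def by (rule borel_measurable_indicator_cball)
  define swap :: "(real^'n^'n) \<times> (real^'n^'n) \<Rightarrow> (real^'n^'n) \<times> (real^'n^'n)" where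
    "swap p = (P ** fst p + Q ** snd p, P ** snd p + Q ** fst p)" for p
  have Q_entry: "(Q ** A) $ i $ k = (if i \<in> J then 0 else A $ i $ k)" for A :: "real^'n^'n" and i k
  proof -
    have "Q ** A = A - coord_proj J ** A" by (simp add: Q_def matrix_mult_linear)
    then show ?thesis by (simp add: coord_proj_mult_left)
  qed
  have lin: "linear swap"
    by (rule linearI)
      (simp_all add: swap_def matrix_mult_linear algebra_simps)
  have norm: "norm (swap p) = norm p" for p
  proof -
    have "(norm (P ** A + Q ** Y))\<^sup>2 + (norm (P ** Y + Q ** A))\<^sup>2 = (norm A)\<^sup>2 + (norm Y)\<^sup>2" for A Y :: "real^'n^'n"
    proof -
      have "(norm (P ** A + Q ** Y))\<^sup>2 + (norm (P ** Y + Q ** A))\<^sup>2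
         = (\<Sum>i\<in>UNIV. \<Sum>k\<in>UNIV. ((if i \<in> J then A $ i $ k else Y $ i $ k)\<^sup>2 + (if i \<in> J then Y $ i $ k else A $ i $ k)\<^sup>2))"
        unfolding norm_matrix
        by (simp add: sum_nonneg sum.distrib P_def coord_proj_mult_left Q_entry if_distrib[of "\<lambda>x. x + _"] if_distrib[of "\<lambda>x. _ + x"] cong: if_cong)
      also have "\<dots> = (\<Sum>i\<in>UNIV. \<Sum>k\<in>UNIV. ((A $ i $ k)\<^sup>2 + (Y $ i $ k)\<^sup>2))"
        by (intro sum.cong refl) auto
      also have "\<dots> = (norm A)\<^sup>2 + (norm Y)\<^sup>2"
        unfolding norm_matrix by (simp add: sum_nonneg sum.distrib)
      finally show ?thesis .
    qed
    then show ?thesis by (cases p) (simp add: swap_def norm_prod_def)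
  qed
  have m: "(\<lambda>p. F (fst p) * q (snd p)) \<in> borel_measurable (borel \<Otimes>\<^sub>M borel)" by measurable
  then have m': "(\<lambda>p. F (fst p) * q (snd p)) \<in> borel_measurable borel" by (simp add: borel_prod)
  have "emeasure lborel (cball (0 :: real^'n^'n) 1) * (\<integral>\<^sup>+X. F X \<partial>lborel) = (\<integral>\<^sup>+X. (\<integral>\<^sup>+Z. F X * q Z \<partial>lborel) \<partial>lborel)"
    by (simp add: nn_integral_cmult nn_integral_multc q_def mult.commute)
  also have "\<dots> = (\<integral>\<^sup>+p. F (fst p) * q (snd p) \<partial>(lborel \<Otimes>\<^sub>M lborel))"
    by (subst lborel.nn_integral_fst[symmetric]) auto
  also have "\<dots> = (\<integral>\<^sup>+p. F (fst p) * q (snd p) \<partial>lborel)" by (simp add: lborel_prod)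
  also have "\<dots> = (\<integral>\<^sup>+p. F (fst (swap p)) * q (snd (swap p)) \<partial>lborel)"
    by (rule nn_integral_lborel_isometry[OF lin norm m', symmetric])
  also have "\<dots> = (\<integral>\<^sup>+p. F (fst (swap p)) * q (snd (swap p)) \<partial>(lborel \<Otimes>\<^sub>M lborel))" by (simp add: lborel_prod)
  also have "\<dots> = (\<integral>\<^sup>+A. (\<integral>\<^sup>+Y. F (P ** A + Q ** Y) * q (P ** Y + Q ** A) \<partial>lborel) \<partial>lborel)"
    by (subst lborel.nn_integral_fst[symmetric]) (auto simp: swap_def)
  finally show ?thesis by (simp add: q_def)
qed


section \<open>Almost every square block is invertible\<close>

lemma poly_det:
  fixes M :: "real poly^'n^'n"
  shows "poly (det M) t = det (\<chi> i k. poly (M $ i $ k) t)"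
  by (simp add: det_def poly_sum poly_prod)

text \<open>
  The determinant is a polynomial in \<open>t\<close> whose value at 0 is 1.
\<close>

lemma finite_singular_parameters:
  fixes M :: "real^'n^'n"
  shows "finite {t. det (mat 1 + t *\<^sub>R M) = 0}"
proof -
  define p where "p = det (\<chi> i k. [:(mat 1 :: real^'n^'n) $ i $ k, M $ i $ k:])"
  have p: "poly p t = det (mat 1 + t *\<^sub>R M)" for t
    unfolding p_def poly_det by (intro arg_cong[where f=det]) (simp add: vec_eq_iff)
  have "poly p 0 = 1" by (simp add: p)
  then have "p \<noteq> 0" by auto
  then show ?thesis using poly_roots_finite[of p] by (simp add: p)
qed

text \<open>
  The square block of \<open>A\<close> with rows and columns in \<open>J\<close>, extended by the
  identity.
\<close>

definition block :: "'n set \<Rightarrow> real^'n^'n \<Rightarrow> real^'n^'n" where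
  "block J A = coord_proj J ** A ** coord_proj J + (mat 1 - coord_proj J)"

lemma borel_measurable_block[measurable]: "block J \<in> borel_measurable borel"
  unfolding block_def[abs_def] by measurable

lemma coord_proj_idem: "coord_proj J ** coord_proj J = coord_proj J"
  by (simp add: vec_eq_iff coord_proj_mult_left) (simp add: coord_proj_def)

text \<open>
  For every \<open>A\<close> the matrix \<open>mat 1 + t *\<^sub>R (P ** A ** P)\<close> is singular
  for finitely many \<open>t\<close> only. By Fubini's theorem there is a \<open>t > 0\<close> for
  which it is singular only on a null set of \<open>A\<close>. Up to an invertible diagonal factor
  this matrix is the block of a translate of \<open>A\<close>, and translations preserve null sets.
\<close>

lemma AE_det_block_nonzero:
  fixes J :: "'n::finite set"
  shows "AE A :: real^'n^'n in lborel. det (block J A) \<noteq> 0"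
proof -
  let ?P = "coord_proj J" and ?Z = "{A :: real^'n^'n. det (block J A) = 0}"
  have Z[measurable]: "?Z \<in> sets borel" by measurable
  define Z' where "Z' t = {A :: real^'n^'n. det (mat 1 + t *\<^sub>R (?P ** A ** ?P)) = 0}" for t :: real
  have m: "(\<lambda>p::real \<times> (real^'n^'n). mat 1 + fst p *\<^sub>R (?P ** snd p ** ?P)) \<in> borel_measurable (borel \<Otimes>\<^sub>M borel)"
    by measurable
  have m2[measurable]: "(\<lambda>(t, A). indicator (Z' t) A :: ennreal) \<in> borel_measurable (borel \<Otimes>\<^sub>M borel)"
  proof -
    have "{p \<in> space (borel \<Otimes>\<^sub>M borel). det (mat 1 + fst p *\<^sub>R (?P ** snd p ** ?P)) = 0} \<in> sets (borel \<Otimes>\<^sub>M borel)"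
      using borel_measurable_det[OF m] by measurable
    then have "indicator {p. det (mat 1 + fst p *\<^sub>R (?P ** snd p ** ?P)) = 0} \<in> borel_measurable (borel \<Otimes>\<^sub>M (borel :: (real^'n^'n) measure))"
      by (intro borel_measurable_indicator) (simp add: space_pair_measure)
    also have "indicator {p. det (mat 1 + fst p *\<^sub>R (?P ** snd p ** ?P)) = 0} = (\<lambda>(t, A). indicator (Z' t) A)"
      by (auto simp: fun_eq_iff Z'_def indicator_def)
    finally show ?thesis .
  qed
  have "(\<integral>\<^sup>+t. (\<integral>\<^sup>+A. indicator (Z' t) A \<partial>lborel) \<partial>lborel) = (\<integral>\<^sup>+A. (\<integral>\<^sup>+t. indicator (Z' t) A \<partial>lborel) \<partial>(lborel :: (real^'n^'n) measure))"
    by (rule pair_sigma_finite.Fubini'[symmetric])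
      (auto simp: pair_sigma_finite_def lborel.sigma_finite_measure_axioms split_beta' intro: m2[unfolded split_beta'])
  also have "\<dots> = (\<integral>\<^sup>+A. 0 \<partial>(lborel :: (real^'n^'n) measure))"
  proof (rule nn_integral_cong)
    fix A :: "real^'n^'n"
    let ?T = "{t. det (mat 1 + t *\<^sub>R (?P ** A ** ?P)) = 0}"
    have f: "finite ?T" by (rule finite_singular_parameters)
    have "(\<integral>\<^sup>+t. indicator (Z' t) A \<partial>lborel) = (\<integral>\<^sup>+t. indicator ?T t \<partial>lborel)"
      by (intro nn_integral_cong) (auto simp: Z'_def indicator_def)
    also have "\<dots> = emeasure lborel ?T" using f by (intro nn_integral_indicator) (simp add: borel_closed finite_imp_closed)
    also have "\<dots> = 0" using f by (simp add: emeasure_lborel_countable countable_finite)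
    finally show "(\<integral>\<^sup>+t. indicator (Z' t) A \<partial>lborel) = 0" .
  qed
  finally have "(\<integral>\<^sup>+t. (\<integral>\<^sup>+A. indicator (Z' t) A \<partial>(lborel :: (real^'n^'n) measure)) \<partial>lborel) = 0" by simp
  moreover have "(\<lambda>t. \<integral>\<^sup>+A. indicator (Z' t) A \<partial>(lborel :: (real^'n^'n) measure)) \<in> borel_measurable lborel"
    by (rule lborel.borel_measurable_nn_integral) (use m2 in \<open>simp add: split_beta'\<close>)
  ultimately have ae: "AE t in lborel. (\<integral>\<^sup>+A. indicator (Z' t) A \<partial>(lborel :: (real^'n^'n) measure)) = 0"
    by (subst (asm) nn_integral_0_iff_AE) auto
  obtain t :: real where t: "0 < t" "(\<integral>\<^sup>+A. indicator (Z' t) A \<partial>(lborel :: (real^'n^'n) measure)) = 0"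
  proof -
    have "\<not> (AE t in lborel. \<not> (0 < t \<and> t < (1::real)))"
    proof
      assume "AE t in lborel. \<not> (0 < t \<and> t < (1::real))"
      then have "emeasure lborel {0<..<1::real} = 0"
        by (subst (asm) AE_iff_measurable[of "{0<..<1}"]) auto
      then show False by simp
    qed
    then show ?thesis using that ae by (metis (mono_tags, lifting) eventually_mono)
  qed
  define S where "S = (1 / t) *\<^sub>R (mat 1 :: real^'n^'n)"
  have eq: "A \<in> Z' t \<longleftrightarrow> S + A \<in> ?Z" for A
  proof -
    let ?D = "t *\<^sub>R ?P + (mat 1 - ?P)"
    have PP: "?P ** ?P = ?P" by (rule coord_proj_idem)
    have B: "block J (S + A) = (1 / t) *\<^sub>R ?P + ?P ** A ** ?P + (mat 1 - ?P)"
    proof -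
      have "?P ** S ** ?P = (1 / t) *\<^sub>R ?P"
        by (simp add: S_def matrix_mult_linear PP)
      then show ?thesis by (simp add: block_def matrix_mult_linear)
    qed
    have "?D ** block J (S + A) = mat 1 + t *\<^sub>R (?P ** A ** ?P)"
      unfolding B using t(1)
      by (simp add: matrix_mult_linear PP matrix_mul_assoc scaleR_diff_right scaleR_add_right)
    then have "det ?D * det (block J (S + A)) = det (mat 1 + t *\<^sub>R (?P ** A ** ?P))" by (metis det_mul)
    moreover have "det ?D \<noteq> 0"
    proof -
      have "det ?D = (\<Prod>i\<in>UNIV. ?D $ i $ i)"
        by (rule det_diagonal) (auto simp: coord_proj_def mat_def)
      also have "\<dots> \<noteq> 0" using t(1) by (auto simp: coord_proj_def mat_def)
      finally show ?thesis .
    qed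
    ultimately show ?thesis by (auto simp: Z'_def)
  qed
  have "emeasure lborel ?Z = (\<integral>\<^sup>+A. indicator ?Z A \<partial>lborel)" using Z by simp
  also have "\<dots> = (\<integral>\<^sup>+A. indicator ?Z (S + A) \<partial>lborel)"
    using invariant_onD(4)[OF invariant_on_lborel_on[OF subspace_UNIV], of S "indicator ?Z"] Z by (simp add: lborel_on_UNIV)
  also have "\<dots> = (\<integral>\<^sup>+A. indicator (Z' t) A \<partial>lborel)"
    by (intro nn_integral_cong) (simp add: eq indicator_def)
  finally have "emeasure lborel ?Z = 0" using t(2) by simp
  then show ?thesis using Z by (intro AE_I[of _ _ ?Z]) auto
qed


section \<open>Uniqueness of uniformly distributed measures\<close>

lemma borel_dist_less:
  "{p :: 'a::{metric_space, second_countable_topology} \<times> 'a. dist (fst p) (snd p) < r} \<in> sets (borel \<Otimes>\<^sub>M borel)"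
  unfolding borel_prod by (intro borel_open open_Collect_less continuous_intros)

lemma borel_measurable_emeasure_ball:
  fixes m :: "'a::{metric_space, second_countable_topology} measure"
  assumes m: "sigma_finite_measure m" and s: "sets m = sets borel"
  shows "(\<lambda>x. emeasure m (ball x r)) \<in> borel_measurable borel"
proof -
  note [measurable_cong] = s
  note [measurable] = borel_dist_less
  have "(\<lambda>x. \<integral>\<^sup>+y. indicator {p. dist (fst p) (snd p) < r} (x, y) \<partial>m) \<in> borel_measurable borel"
    by (rule sigma_finite_measure.borel_measurable_nn_integral[OF m]) measurable
  also have "(\<lambda>x. \<integral>\<^sup>+y. indicator {p. dist (fst p) (snd p) < r} (x, y) \<partial>m) = (\<lambda>x. emeasure m (ball x r))"
  proof
    fix x
    have "(\<integral>\<^sup>+y. indicator {p. dist (fst p) (snd p) < r} (x, y) \<partial>m) = (\<integral>\<^sup>+y. indicator (ball x r) y \<partial>m)"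
      by (intro nn_integral_cong) (simp add: indicator_def)
    then show "(\<integral>\<^sup>+y. indicator {p. dist (fst p) (snd p) < r} (x, y) \<partial>m) = emeasure m (ball x r)" using s by simp
  qed
  finally show ?thesis .
qed

text \<open>
  The first half of Christensen's proof that two measures coincide if balls of the same radius have
  the same mass. The mass of the pairs \<open>(x, y)\<close> with \<open>x \<in> D k\<close> and
  \<open>dist x y < r\<close> is \<open>h r\<close> times the mass of \<open>D k\<close> under
  \<open>m1\<close>; as such \<open>y\<close> lie in \<open>U\<close>, it is at most \<open>h
  r\<close> times the mass of \<open>U\<close> under \<open>m2\<close>.
\<close>

lemma uniformly_distributed_open_le:
  fixes m1 m2 :: "'a::{metric_space, second_countable_topology} measure"
  assumes p: "prob_space m1" "prob_space m2" and s: "sets m1 = sets borel" "sets m2 = sets borel"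
    and h: "\<And>r. 0 < r \<Longrightarrow> 0 < h r"
    and b2: "\<And>r. 0 < r \<Longrightarrow> AE x in m1. emeasure m2 (ball x r) = h r"
    and b1: "\<And>r. 0 < r \<Longrightarrow> AE y in m2. emeasure m1 (ball y r) = h r"
    and U: "open U"
  shows "emeasure m1 U \<le> emeasure m2 U"
proof (cases "U = UNIV")
  case True
  then show ?thesis
    using prob_space.emeasure_space_1[OF p(1)] prob_space.emeasure_space_1[OF p(2)]
      sets_eq_imp_space_eq[OF s(1)] sets_eq_imp_space_eq[OF s(2)] by simp
next
  case False
  then have ne: "- U \<noteq> {}" by auto
  note [measurable_cong] = s
  interpret m1: prob_space m1 by fact
  interpret m2: prob_space m2 by fact
  interpret m12: pair_sigma_finite m1 m2 ..
  define D where "D k = {x. 1 / real (Suc k) \<le> infdist x (- U)}" for k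
  have D: "closed (D k)" for k
    unfolding D_def by (intro closed_Collect_le continuous_intros)
  have le: "emeasure m1 (D k) \<le> emeasure m2 U" for k
  proof -
    define r where "r = 1 / real (Suc k)"
    have r: "0 < r" by (simp add: r_def)
    define K where "K x y = (indicator {p. dist (fst p) (snd p) < r} (x, y) :: ennreal)" for x y :: 'a
    have Km: "(\<lambda>(x, y). K x y) \<in> borel_measurable (borel \<Otimes>\<^sub>M borel)"
      using borel_measurable_indicator[OF borel_dist_less] by (simp add: K_def)
    note [measurable] = Km borel_closed[OF D[of k]] borel_open[OF U]
    have K1: "(\<integral>\<^sup>+y. K x y \<partial>m) = emeasure m (ball x r)" if "sets m = sets borel" for x m
    proof -
      have "K x y = indicator (ball x r) y" for y by (simp add: K_def indicator_def)
      then show ?thesis using that by simp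
    qed
    have K2: "(\<integral>\<^sup>+x. K x y \<partial>m) = emeasure m (ball y r)" if "sets m = sets borel" for y m
    proof -
      have "K x y = indicator (ball y r) x" for x by (simp add: K_def indicator_def dist_commute)
      then show ?thesis using that by simp
    qed
    have "h r * emeasure m1 (D k) = (\<integral>\<^sup>+x. h r * indicator (D k) x \<partial>m1)"
      by (simp add: nn_integral_cmult)
    also have "\<dots> = (\<integral>\<^sup>+x. (\<integral>\<^sup>+y. indicator (D k) x * K x y \<partial>m2) \<partial>m1)"
    proof (rule nn_integral_cong_AE, use b2[OF r] in eventually_elim)
      fix x assume "emeasure m2 (ball x r) = h r"
      then show "h r * indicator (D k) x = (\<integral>\<^sup>+y. indicator (D k) x * K x y \<partial>m2)"
        using K1[OF s(2), of x] by (subst nn_integral_cmult) (auto simp: mult.commute)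
    qed
    also have "\<dots> \<le> (\<integral>\<^sup>+x. (\<integral>\<^sup>+y. indicator U y * K x y \<partial>m2) \<partial>m1)"
    proof (intro nn_integral_mono)
      fix x y
      show "indicator (D k) x * K x y \<le> indicator U y * K x y"
      proof (cases "x \<in> D k \<and> dist x y < r")
        case True
        have "y \<in> U"
        proof (rule ccontr)
          assume "y \<notin> U"
          then have "infdist x (- U) \<le> dist x y" by (intro infdist_le) auto
          then show False using True by (simp add: D_def r_def)
        qed
        then show ?thesis by (simp add: indicator_def)
      qed (auto simp: K_def indicator_def)
    qed
    also have "\<dots> = (\<integral>\<^sup>+y. (\<integral>\<^sup>+x. indicator U y * K x y \<partial>m1) \<partial>m2)"
      by (rule m12.Fubini'[symmetric]) (use s in measurable)
    also have "\<dots> = (\<integral>\<^sup>+y. h r * indicator U y \<partial>m2)"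
    proof (rule nn_integral_cong_AE, use b1[OF r] in eventually_elim)
      fix y assume "emeasure m1 (ball y r) = h r"
      then show "(\<integral>\<^sup>+x. indicator U y * K x y \<partial>m1) = h r * indicator U y"
        using K2[OF s(1), of y] by (subst nn_integral_cmult) (auto simp: mult.commute)
    qed
    also have "\<dots> = h r * emeasure m2 U" by (simp add: nn_integral_cmult)
    finally have *: "h r * emeasure m1 (D k) \<le> h r * emeasure m2 U" .
    have "h r \<noteq> top"
    proof
      assume "h r = top"
      then have "AE x in m1. False" using b2[OF r] m2.emeasure_finite by simp
      then show False by (simp add: m1.AE_False)
    qed
    then show ?thesis using * h[OF r] by (simp add: ennreal_mult_le_mult_iff)
  qed
  have "U = (\<Union>k. D k)"
  proof (intro equalityI subsetI)
    fix x assume "x \<in> U"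
    then have "0 < infdist x (- U)"
      using in_closed_iff_infdist_zero[of "- U" x] U ne infdist_nonneg[of x "- U"] by (auto simp: less_le closed_Compl)
    then obtain k where "inverse (real (Suc k)) < infdist x (- U)" using reals_Archimedean by blast
    then show "x \<in> (\<Union>k. D k)" by (auto simp: D_def inverse_eq_divide intro: less_imp_le)
  next
    fix x assume "x \<in> (\<Union>k. D k)"
    then obtain k where "1 / real (Suc k) \<le> infdist x (- U)" by (auto simp: D_def)
    moreover have "0 < 1 / real (Suc k)" by simp
    ultimately show "x \<in> U" by (metis ComplI infdist_zero not_less)
  qed
  moreover have "(SUP k. emeasure m1 (D k)) = emeasure m1 (\<Union>k. D k)"
  proof (rule SUP_emeasure_incseq)
    show "incseq D"
      unfolding incseq_def D_def
    proof (intro allI impI subsetI)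
      fix k l :: nat and x assume "k \<le> l" "x \<in> {x. 1 / real (Suc k) \<le> infdist x (- U)}"
      moreover have "1 / real (Suc l) \<le> 1 / real (Suc k)" using \<open>k \<le> l\<close> by (intro divide_left_mono) auto
      ultimately show "x \<in> {x. 1 / real (Suc l) \<le> infdist x (- U)}" by simp
    qed
  qed (use D s in auto)
  ultimately show ?thesis using le by (metis SUP_least)
qed

text \<open>
  Computing the mass of the pairs with \<open>dist x y < r\<close> in both orders shows that the two
  measures give the same mass to balls of radius \<open>r\<close>.
\<close>

lemma uniformly_distributed_unique:
  fixes m1 m2 :: "'a::{metric_space, second_countable_topology} measure"
  assumes p: "prob_space m1" "prob_space m2" and s: "sets m1 = sets borel" "sets m2 = sets borel"
    and h: "\<And>r. 0 < r \<Longrightarrow> 0 < h1 r"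
    and b2: "\<And>r. 0 < r \<Longrightarrow> AE x in m1. emeasure m2 (ball x r) = h2 r"
    and b1: "\<And>r. 0 < r \<Longrightarrow> AE y in m2. emeasure m1 (ball y r) = h1 r"
  shows "m1 = m2"
proof -
  note [measurable_cong] = s
  interpret m1: prob_space m1 by fact
  interpret m2: prob_space m2 by fact
  interpret m12: pair_sigma_finite m1 m2 ..
  have h12: "h1 r = h2 r" if r: "0 < r" for r
  proof -
    define K where "K x y = (indicator {p. dist (fst p) (snd p) < r} (x, y) :: ennreal)" for x y :: 'a
    have Km: "(\<lambda>(x, y). K x y) \<in> borel_measurable (borel \<Otimes>\<^sub>M borel)"
      using borel_measurable_indicator[OF borel_dist_less] by (simp add: K_def)
    note [measurable] = Km
    have K: "K x y = indicator (ball x r) y" "K x y = indicator (ball y r) x" for x y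
      by (simp_all add: K_def indicator_def dist_commute)
    have "h2 r = (\<integral>\<^sup>+x. h2 r \<partial>m1)" by (simp add: m1.emeasure_space_1)
    also have "\<dots> = (\<integral>\<^sup>+x. (\<integral>\<^sup>+y. K x y \<partial>m2) \<partial>m1)"
    proof (rule nn_integral_cong_AE, use b2[OF r] in eventually_elim)
      fix x assume "emeasure m2 (ball x r) = h2 r"
      then show "h2 r = (\<integral>\<^sup>+y. K x y \<partial>m2)" using s(2) by (simp add: K(1))
    qed
    also have "\<dots> = (\<integral>\<^sup>+y. (\<integral>\<^sup>+x. K x y \<partial>m1) \<partial>m2)"
      by (rule m12.Fubini'[symmetric]) (use s in measurable)
    also have "\<dots> = (\<integral>\<^sup>+y. h1 r \<partial>m2)"
    proof (rule nn_integral_cong_AE, use b1[OF r] in eventually_elim)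
      fix y assume "emeasure m1 (ball y r) = h1 r"
      then show "(\<integral>\<^sup>+x. K x y \<partial>m1) = h1 r" using s(1) by (simp add: K(2))
    qed
    also have "\<dots> = h1 r" by (simp add: m2.emeasure_space_1)
    finally show ?thesis by simp
  qed
  have eq: "emeasure m1 U = emeasure m2 U" if "open U" for U
  proof (rule antisym)
    show "emeasure m1 U \<le> emeasure m2 U"
      by (rule uniformly_distributed_open_le[OF p s h _ b1 that]) (use b2 h12 in auto)
    show "emeasure m2 U \<le> emeasure m1 U"
      by (rule uniformly_distributed_open_le[OF p(2,1) s(2,1) h b1 _ that]) (use b2 h12 in auto)
  qed
  show ?thesis
  proof (rule measure_eqI_generator_eq[of "Collect open" UNIV _ _ "\<lambda>_. UNIV"])
    show "Int_stable (Collect open :: 'a set set)" by (auto simp: Int_stable_def)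
    show "sets m1 = sigma_sets UNIV (Collect open)" "sets m2 = sigma_sets UNIV (Collect open)"
      using s by (simp_all add: borel_def)
    show "emeasure m1 UNIV \<noteq> \<infinity>" by simp
  qed (use eq in auto)
qed


section \<open>Rotation-invariant measures on the Grassmannian\<close>

lemma inner_transpose: "z \<bullet> (transpose M *v w) = (M *v z) \<bullet> w" for M :: "real^'n^'n"
  using adjoint_clauses(1)[of "(*v) M" z w] by (simp add: adjoint_matrix_mult del: transpose_matrix_vector)

lemma norm_orthogonal_matrix_mult:
  fixes R :: "real^'n^'n"
  assumes R: "\<And>x. norm (R *v x) = norm x"
  shows "norm (R ** A) = norm A" "norm (A ** transpose R) = norm A"
proof -
  have row: "(A ** transpose R) $ i = R *v (A $ i)" for A :: "real^'n^'n" and i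
    by (simp add: vec_eq_iff matrix_matrix_mult_def matrix_vector_mult_def transpose_def mult.commute)
  have *: "norm (A ** transpose R) = norm A" for A :: "real^'n^'n"
    by (simp add: norm_vec_def[of "A ** transpose R"] norm_vec_def[of A] row R)
  then show "norm (A ** transpose R) = norm A" .
  have "norm (R ** A) = norm (transpose (R ** A))" by (simp add: norm_transpose)
  also have "\<dots> = norm (transpose A ** transpose R)" by (simp add: matrix_transpose_mul)
  finally show "norm (R ** A) = norm A" by (simp add: * norm_transpose)
qed

lemma rotationsD:
  assumes "\<rho> \<in> rotations"
  shows "linear \<rho>" "inj \<rho>" "orthogonal_transformation \<rho>" "\<rho> = (*v) (matrix \<rho>)"
    "\<And>x. norm (matrix \<rho> *v x) = norm x"
proof -
  show o: "orthogonal_transformation \<rho>" using assms by (simp add: rotations_def)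
  then show lin: "linear \<rho>" by (simp add: orthogonal_transformation_def)
  show "inj \<rho>" using o by (rule orthogonal_transformation_inj)
  show "\<rho> = (*v) (matrix \<rho>)" using lin by (simp add: fun_eq_iff matrix_works)
  show "norm (matrix \<rho> *v x) = norm x" for x using o lin by (simp add: matrix_works orthogonal_transformation)
qed

lemma proj_matrix_rotation:
  assumes \<rho>: "\<rho> \<in> rotations" and V: "subspace V"
  shows "proj_matrix (\<rho> ` V) = matrix \<rho> ** proj_matrix V ** transpose (matrix \<rho>)"
proof (rule matrix_eqI)
  fix x
  note r = rotationsD[OF \<rho>]
  have "subspace (\<rho> ` V)" by (rule linear_subspace_image[OF r(1) V])
  obtain y where y: "x = \<rho> y" using orthogonal_transformation_surj[OF r(3)] by (metis surjD)
  have "transpose (matrix \<rho>) *v \<rho> y = y"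
  proof (rule vector_eq_ldot[THEN iffD1], rule allI)
    fix z
    have "z \<bullet> (transpose (matrix \<rho>) *v \<rho> y) = \<rho> z \<bullet> \<rho> y"
      using inner_transpose[of z "matrix \<rho>" "\<rho> y"] r(4) by metis
    then show "z \<bullet> (transpose (matrix \<rho>) *v \<rho> y) = z \<bullet> y" using r(3) by (simp add: orthogonal_transformation_def)
  qed
  then show "proj_matrix (\<rho> ` V) *v x = matrix \<rho> ** proj_matrix V ** transpose (matrix \<rho>) *v x"
    using closest_point_orthogonal_transformation[OF r(3) V, of y]
    by (simp add: y proj_matrix_mult[OF \<open>subspace (\<rho> ` V)\<close>] matrix_vector_mul_assoc[symmetric] proj_matrix_mult[OF V]
        r(1) del: transpose_matrix_vector)
qed

lemma measurable_rotation:
  assumes "\<rho> \<in> rotations"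
  shows "(`) \<rho> \<in> measurable (grassmannian_borel j) (grassmannian_borel j)"
  using measurable_grassmannian_image[of "matrix \<rho>" j] rotationsD(2,4)[OF assms] by metis

text \<open>
  An orthogonal map of determinant \<open>-1\<close> is corrected by the reflection in a coordinate
  with index in \<open>J\<close>, which preserves the coordinate subspace.
\<close>

lemma rotation_from_coord_subspace:
  fixes V :: "(real^'n) set"
  assumes V: "V \<in> grassmannian (card J)" and J: "J \<noteq> {}"
  obtains \<rho> where "\<rho> \<in> rotations" "\<rho> ` coord_subspace J = V"
proof -
  have sV: "subspace V" "dim (coord_subspace J) = dim V"
    using V by (auto simp: grassmannian_def dim_coord_subspace)
  obtain R where R: "orthogonal_transformation R" "R ` coord_subspace J = V"
    using orthogonal_transformation_between_subspaces[OF subspace_coord_subspace sV] by metis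
  show ?thesis
  proof (cases "det (matrix R) = 1")
    case True
    then show ?thesis using R by (intro that[of R]) (auto simp: rotations_def)
  next
    case False
    then have dR: "det (matrix R) = - 1" using orthogonal_transformation_det[OF R(1)] by linarith
    obtain k where k: "k \<in> J" using J by blast
    let ?c = "\<lambda>x::real^'n. \<chi> i. (if i = k then - 1 else 1) * x $ i"
    have lin: "linear ?c" by (rule linearI) (auto simp: vec_eq_iff algebra_simps)
    have c2: "?c (?c x) = x" for x by (simp add: vec_eq_iff)
    have "norm (?c x) = norm x" for x
      unfolding norm_vec_def by (intro L2_set_cong refl) (simp add: if_distrib)
    then have o: "orthogonal_transformation ?c" using lin by (simp add: orthogonal_transformation)
    have "det (matrix ?c) = (\<Prod>i\<in>UNIV. if i = k then - 1 else 1)"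
      by (subst det_diagonal) (auto simp: matrix_def axis_def)
    then have dc: "det (matrix ?c) = - 1" by (simp add: prod.delta)
    have "?c ` coord_subspace J = coord_subspace J"
    proof (intro equalityI subsetI)
      fix x assume "x \<in> coord_subspace J"
      then have "?c x \<in> coord_subspace J" using k by (auto simp: coord_subspace_def)
      then show "x \<in> ?c ` coord_subspace J" using c2[of x] by (intro image_eqI[of x ?c "?c x"]) simp_all
    next
      fix x assume "x \<in> ?c ` coord_subspace J"
      then obtain y where "y \<in> coord_subspace J" "x = ?c y" by blast
      then show "x \<in> coord_subspace J" by (simp add: coord_subspace_def)
    qed
    then have "(R \<circ> ?c) ` coord_subspace J = V" using R(2) by (metis image_comp)
    moreover have "det (matrix (R \<circ> ?c)) = 1"
      using R(1) lin by (simp add: matrix_compose det_mul dR dc orthogonal_transformation_def)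
    moreover have "orthogonal_transformation (R \<circ> ?c)"
      using R(1) o by (rule orthogonal_transformation_compose)
    ultimately show ?thesis by (intro that[of "R \<circ> ?c"]) (auto simp: rotations_def)
  qed
qed

definition rotation_invariant :: "nat \<Rightarrow> (real^'n) set measure \<Rightarrow> bool" where
  "rotation_invariant j \<nu> \<longleftrightarrow> prob_space \<nu> \<and> sets \<nu> = sets (grassmannian_borel j) \<and>
     (\<forall>\<rho>\<in>rotations. distr \<nu> \<nu> ((`) \<rho>) = \<nu>)"

text \<open>
  Rotations act transitively on the subspaces of a given dimension, and they act on projection
  matrices by conjugation, which is an isometry.
\<close>

lemma rotation_invariant_ball:
  fixes \<nu> :: "(real^'n) set measure" and J :: "'n set"
  assumes \<nu>: "rotation_invariant (card J) \<nu>" and V: "V \<in> grassmannian (card J)" and J: "J \<noteq> {}"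
  shows "emeasure (distr \<nu> borel proj_matrix) (ball (proj_matrix V) r)
     = emeasure (distr \<nu> borel proj_matrix) (ball (proj_matrix (coord_subspace J)) r)"
proof -
  let ?E = "coord_subspace J"
  have s: "sets \<nu> = sets (grassmannian_borel (card J))" using \<nu> by (simp add: rotation_invariant_def)
  have sp: "space \<nu> = grassmannian (card J)" using sets_eq_imp_space_eq[OF s] by simp
  note [measurable_cong] = s
  obtain \<rho> where \<rho>: "\<rho> \<in> rotations" "\<rho> ` ?E = V" by (rule rotation_from_coord_subspace[OF V J])
  have m: "(`) \<rho> \<in> measurable \<nu> \<nu>"
    using measurable_rotation[OF \<rho>(1), of "card J"] by (simp add: measurable_cong_sets[OF s s])
  have pm: "proj_matrix \<in> borel_measurable \<nu>" by measurable
  have "emeasure (distr \<nu> borel proj_matrix) (ball (proj_matrix V) r) = emeasure \<nu> (proj_matrix -` ball (proj_matrix V) r \<inter> space \<nu>)"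
    by (rule emeasure_distr[OF pm]) simp
  also have "\<dots> = emeasure (distr \<nu> \<nu> ((`) \<rho>)) (proj_matrix -` ball (proj_matrix V) r \<inter> space \<nu>)"
    using \<nu> \<rho>(1) by (simp add: rotation_invariant_def)
  also have "\<dots> = emeasure \<nu> ((`) \<rho> -` (proj_matrix -` ball (proj_matrix V) r \<inter> space \<nu>) \<inter> space \<nu>)"
    using measurable_sets[OF pm, of "ball (proj_matrix V) r"] by (intro emeasure_distr m) simp
  also have "(`) \<rho> -` (proj_matrix -` ball (proj_matrix V) r \<inter> space \<nu>) \<inter> space \<nu> = proj_matrix -` ball (proj_matrix ?E) r \<inter> space \<nu>"
  proof -
    have "dist (proj_matrix V) (proj_matrix (\<rho> ` W)) = dist (proj_matrix ?E) (proj_matrix W)" if "subspace W" for W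
    proof -
      have "proj_matrix V - proj_matrix (\<rho> ` W) = matrix \<rho> ** (proj_matrix ?E - proj_matrix W) ** transpose (matrix \<rho>)"
        unfolding \<rho>(2)[symmetric] proj_matrix_rotation[OF \<rho>(1) that] proj_matrix_rotation[OF \<rho>(1) subspace_coord_subspace]
        by (simp add: matrix_mult_linear)
      then show ?thesis
        using norm_orthogonal_matrix_mult[OF rotationsD(5)[OF \<rho>(1)]] by (simp add: dist_norm)
    qed
    moreover have "\<rho> ` W \<in> space \<nu>" if "W \<in> space \<nu>" for W using measurable_space[OF m that] .
    ultimately show ?thesis by (auto simp: sp grassmannian_def)
  qed
  also have "emeasure \<nu> (proj_matrix -` ball (proj_matrix ?E) r \<inter> space \<nu>)
      = emeasure (distr \<nu> borel proj_matrix) (ball (proj_matrix ?E) r)"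
    by (rule emeasure_distr[OF pm, symmetric]) simp
  finally show ?thesis .
qed

text \<open>
  In the space of matrices the images of both measures under \<open>proj_matrix\<close> are
  uniformly distributed over the projection matrices.
\<close>

lemma rotation_invariant_unique:
  fixes \<nu> \<nu>' :: "(real^'n) set measure" and J :: "'n set"
  assumes J: "J \<noteq> {}" and \<nu>: "rotation_invariant (card J) \<nu>" and \<nu>': "rotation_invariant (card J) \<nu>'"
  shows "\<nu> = \<nu>'"
proof -
  let ?G = "grassmannian (card J) :: (real^'n) set set" and ?E = "coord_subspace J"
  have s: "sets \<nu> = sets (grassmannian_borel (card J))" "sets \<nu>' = sets (grassmannian_borel (card J))"
    using \<nu> \<nu>' by (simp_all add: rotation_invariant_def)
  have sp: "space \<nu> = ?G" "space \<nu>' = ?G" using sets_eq_imp_space_eq[OF s(1)] sets_eq_imp_space_eq[OF s(2)] by simp_all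
  note [measurable_cong] = s
  have p: "prob_space \<nu>" "prob_space \<nu>'" using \<nu> \<nu>' by (simp_all add: rotation_invariant_def)
  let ?m = "distr \<nu> borel proj_matrix" and ?m' = "distr \<nu>' borel proj_matrix"
  have p': "prob_space ?m" "prob_space ?m'" using p by (auto intro!: prob_space.prob_space_distr)
  have ball: "emeasure (distr \<mu> borel proj_matrix) (ball x r) = emeasure (distr \<mu> borel proj_matrix) (ball (proj_matrix ?E) r)"
    if "rotation_invariant (card J) \<mu>" "x \<in> proj_matrix ` ?G" for \<mu> :: "(real^'n) set measure" and x r
    using that rotation_invariant_ball[OF that(1) _ J] by auto
  \<comment> \<open>otherwise countably many null balls would cover all projection matrices\<close>
  have pos: "0 < emeasure ?m (ball (proj_matrix ?E) r)" if r: "0 < r" for r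
  proof (rule ccontr)
    assume "\<not> 0 < emeasure ?m (ball (proj_matrix ?E) r)"
    then have 0: "emeasure ?m (ball x r) = 0" if "x \<in> proj_matrix ` ?G" for x
      using ball[OF \<nu> that, of r] by simp
    obtain \<F> where \<F>: "\<F> \<subseteq> (\<lambda>x. ball x r) ` (proj_matrix ` ?G)" "countable \<F>" "\<Union>\<F> = (\<Union>x\<in>proj_matrix ` ?G. ball x r)"
      using Lindelof[of "(\<lambda>x. ball x r) ` (proj_matrix ` ?G)"] by blast
    have cov: "proj_matrix ` ?G \<subseteq> \<Union>\<F>" unfolding \<F>(3) using r by force
    have "AE x in ?m. x \<notin> \<Union>\<F>"
    proof -
      have "AE x in ?m. \<forall>B\<in>\<F>. x \<notin> B"
        unfolding AE_ball_countable[OF \<F>(2)]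
      proof
        fix B assume "B \<in> \<F>"
        then obtain x where "x \<in> proj_matrix ` ?G" "B = ball x r" using \<F>(1) by blast
        then show "AE x in ?m. x \<notin> B" using 0 by (intro AE_not_in) (simp add: null_sets_def)
      qed
      then show ?thesis by eventually_elim blast
    qed
    then have "AE V in \<nu>. proj_matrix V \<notin> \<Union>\<F>"
      by (rule AE_distrD[rotated]) measurable
    then have "AE V in \<nu>. False"
      using AE_space by eventually_elim (use cov sp in blast)
    then show False using prob_space.AE_False[OF p(1)] by simp
  qed
  have AE_ball: "AE x in distr \<mu> borel proj_matrix. emeasure (distr \<mu>' borel proj_matrix) (ball x r)
        = emeasure (distr \<mu>' borel proj_matrix) (ball (proj_matrix ?E) r)"
    if "rotation_invariant (card J) \<mu>" "rotation_invariant (card J) \<mu>'" for \<mu> \<mu>' :: "(real^'n) set measure" and r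
  proof -
    have s: "sets \<mu> = sets (grassmannian_borel (card J))" "sets \<mu>' = sets (grassmannian_borel (card J))"
      and p: "prob_space \<mu>'"
      using that by (simp_all add: rotation_invariant_def)
    note [measurable_cong] = s
    have sp: "space \<mu> = ?G" using sets_eq_imp_space_eq[OF s(1)] by simp
    let ?m' = "distr \<mu>' borel proj_matrix"
    have "prob_space ?m'" by (rule prob_space.prob_space_distr[OF p]) measurable
    then have "sigma_finite_measure ?m'"
      using prob_space_imp_sigma_finite by blast
    from borel_measurable_emeasure_ball[OF this, of r]
    have [measurable]: "(\<lambda>x. emeasure ?m' (ball x r)) \<in> borel_measurable borel" by simp
    have "{x \<in> space borel. emeasure ?m' (ball x r) = emeasure ?m' (ball (proj_matrix ?E) r)} \<in> sets borel" by measurable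
    then show ?thesis
      using ball[OF that(2)] by (subst AE_distr_iff) (auto intro!: AE_I2 simp: sp)
  qed
  have "?m = ?m'"
    by (rule uniformly_distributed_unique[OF p' _ _ pos AE_ball[OF \<nu> \<nu>'] AE_ball[OF \<nu>' \<nu>]]) auto
  show ?thesis
  proof (rule measure_eqI)
    show "sets \<nu> = sets \<nu>'" by (simp add: s)
    fix X assume "X \<in> sets \<nu>"
    then have "X \<in> sets (grassmannian_borel (card J))" using s by simp
    then obtain Y where Y: "Y \<in> sets borel" "X = proj_matrix -` Y \<inter> ?G"
      unfolding grassmannian_borel_def by (subst (asm) sets_vimage_algebra2) (auto simp: proj_matrix_def[abs_def])
    have "emeasure \<nu> X = emeasure ?m Y" using Y by (subst emeasure_distr) (auto simp: sp)
    also have "\<dots> = emeasure ?m' Y" by (simp add: \<open>?m = ?m'\<close>)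
    also have "\<dots> = emeasure \<nu>' X" using Y by (subst emeasure_distr) (auto simp: sp)
    finally show "emeasure \<nu> X = emeasure \<nu>' X" .
  qed
qed


section \<open>The invariant measure as the distribution of the span of a random frame\<close>

lemma coord_proj_simps:
  fixes J :: "'n::finite set"
  shows "coord_proj J ** coord_proj J = coord_proj J" "(mat 1 - coord_proj J) ** coord_proj J = 0"
    "coord_proj J ** (mat 1 - coord_proj J) = 0"
    "(mat 1 - coord_proj J) ** (mat 1 - coord_proj J) = mat 1 - coord_proj J"
    "transpose (coord_proj J) = coord_proj J" "coord_proj (- J) = mat 1 - coord_proj J"
  using coord_proj_idem[of J] transpose_proj_matrix[OF subspace_coord_subspace[of J]]
  by (simp_all add: matrix_mult_linear proj_matrix_coord_subspace)
    (simp add: vec_eq_iff coord_proj_def mat_def)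

text \<open>
  A frame is encoded by the columns with index in \<open>J\<close> of a square matrix. The Gram
  determinant detects their linear independence.
\<close>

definition is_frame :: "'n set \<Rightarrow> real^'n^'n \<Rightarrow> bool" where
  "is_frame J N \<longleftrightarrow> det (gram_matrix (coord_proj J) N) \<noteq> 0"

definition frame_vol :: "'n set \<Rightarrow> real^'n^'n \<Rightarrow> real" where
  "frame_vol J N = sqrt (det (gram_matrix (coord_proj J) N))"

text \<open>
  The default value is a subspace of the same dimension.
\<close>

definition frame_span :: "'n set \<Rightarrow> real^'n^'n \<Rightarrow> (real^'n) set" where
  "frame_span J N = (if is_frame J N then (*v) N ` coord_subspace J else coord_subspace J)"

text \<open>
  The bound on the columns that do not belong to the frame gives the set a finite volume, so that it
  carries a uniform distribution.
\<close>

definition bounded_frames :: "'n set \<Rightarrow> (real^'n^'n) set" where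
  "bounded_frames J = {N. is_frame J N \<and> norm (N ** coord_proj J) \<le> 1 \<and> norm (N ** (mat 1 - coord_proj J)) \<le> 1}"

definition frame_measure :: "'n set \<Rightarrow> (real^'n) set measure" where
  "frame_measure J = distr (uniform_measure lborel (bounded_frames J)) (grassmannian_borel (card J)) (frame_span J)"

lemma is_frame_iff: "is_frame J N \<longleftrightarrow> inj_on ((*v) N) (coord_subspace J)"
  using inj_on_iff_det_gram[OF subspace_coord_subspace[of J], of N] by (simp add: is_frame_def proj_matrix_coord_subspace)

lemma frame_vol_eq: "is_frame J N \<Longrightarrow> frame_vol J N = vol_factor (coord_subspace J) ((*v) N)"
  using det_gram_matrix[OF subspace_coord_subspace[of J], of N]
    vol_factor_pos[OF _ subspace_coord_subspace[of J], of "(*v) N"]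
  by (simp add: is_frame_iff frame_vol_def proj_matrix_coord_subspace less_imp_le)

lemma frame_vol_pos: "is_frame J N \<Longrightarrow> 0 < frame_vol J N"
  using vol_factor_pos[OF _ subspace_coord_subspace[of J], of "(*v) N"] by (simp add: frame_vol_eq is_frame_iff)

lemma frame_span_grassmannian: "frame_span J N \<in> grassmannian (card J)"
proof -
  have E: "coord_subspace J \<in> grassmannian (card J)"
    by (simp add: grassmannian_def subspace_coord_subspace dim_coord_subspace)
  show ?thesis
  proof (cases "is_frame J N")
    case True
    then have "inj_on ((*v) N) (coord_subspace J)" by (simp add: is_frame_iff)
    from grassmannian_image[OF E matrix_vector_mul_linear this] True show ?thesis by (simp add: frame_span_def)
  next
    case False
    then show ?thesis using E by (simp add: frame_span_def)
  qed
qed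

lemma pred_is_frame[measurable]: "{N. is_frame J N} \<in> sets borel"
  unfolding is_frame_def by measurable

lemma borel_measurable_frame_vol[measurable]: "frame_vol J \<in> borel_measurable borel"
  unfolding frame_vol_def[abs_def] by measurable

lemma measurable_frame_span[measurable]: "frame_span J \<in> measurable borel (grassmannian_borel (card J))"
proof (rule measurable_into_grassmannian[OF frame_span_grassmannian])
  have "(\<lambda>N. if N \<in> {N. is_frame J N} then image_proj (coord_proj J) N else coord_proj J) \<in> borel_measurable borel"
    by measurable
  also have "(\<lambda>N. if N \<in> {N. is_frame J N} then image_proj (coord_proj J) N else coord_proj J) = (\<lambda>N. proj_matrix (frame_span J N))"
    using proj_matrix_image[OF subspace_coord_subspace[of J]]
    by (auto simp: fun_eq_iff frame_span_def is_frame_iff proj_matrix_coord_subspace)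
  finally show "(\<lambda>N. proj_matrix (frame_span J N)) \<in> borel_measurable borel" .
qed

lemma borel_bounded_frames[measurable]: "bounded_frames J \<in> sets borel"
proof -
  have "bounded_frames J = {N. is_frame J N} \<inter> {N. norm (N ** coord_proj J) \<le> 1 \<and> norm (N ** (mat 1 - coord_proj J)) \<le> 1}"
    by (auto simp: bounded_frames_def)
  also have "\<dots> \<in> sets borel" by measurable
  finally show ?thesis .
qed

lemma norm_mult_coord_proj_le: "norm (N ** coord_proj J) \<le> norm (N :: real^'n^'n)"
  unfolding norm_matrix by (intro real_sqrt_le_mono sum_mono) (simp add: coord_proj_mult_right)

lemma coord_proj_apply: "x \<in> coord_subspace J \<Longrightarrow> coord_proj J *v x = x"
  using closest_point_id[OF subspace_coord_subspace[of J], of x] proj_matrix_mult[OF subspace_coord_subspace[of J], of x]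
  by (simp add: proj_matrix_coord_subspace)

lemma coord_proj_in: "coord_proj J *v x \<in> coord_subspace J"
  using closest_point_mem[OF subspace_coord_subspace[of J], of x] proj_matrix_mult[OF subspace_coord_subspace[of J], of x]
  by (simp add: proj_matrix_coord_subspace)

lemma coord_proj_orth_compl: "y \<in> orth_compl (coord_subspace J) \<Longrightarrow> coord_proj J *v y = 0"
  using closest_point_orth_compl[OF subspace_coord_subspace[of J], of y] proj_matrix_mult[OF subspace_coord_subspace[of J], of y]
  by (simp add: proj_matrix_coord_subspace)

lemma det_nz_kernel: "det A \<noteq> 0 \<Longrightarrow> A *v x = 0 \<Longrightarrow> x = 0" for A :: "real^'n^'n"
  using det_nz_iff_inj[of "(*v) A"] by (metis injD matrix_of_matrix_vector_mul matrix_vector_mul_linear matrix_vector_mult_0_right)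

lemma is_frame_block_invertible:
  assumes "det (block J N) \<noteq> 0" shows "is_frame J N"
  unfolding is_frame_iff linear_inj_on_iff[OF matrix_vector_mul_linear subspace_coord_subspace]
proof (intro ballI impI)
  fix x assume x: "x \<in> coord_subspace J" "N *v x = 0"
  have "block J N *v x = 0"
    using x by (simp add: block_def matrix_vector_mult_add_rdistrib matrix_vector_mult_diff_rdistrib
      matrix_vector_mul_assoc[symmetric] coord_proj_apply)
  then show "x = 0" using det_nz_kernel[OF assms] by blast
qed

lemma emeasure_bounded_frames:
  fixes J :: "'n::finite set"
  shows "0 < emeasure lborel (bounded_frames J)" "emeasure lborel (bounded_frames J) < \<infinity>"
proof -
  have "emeasure lborel (cball (0 :: real^'n^'n) 1) = unit_ball_vol (DIM(real^'n^'n))"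
    by (simp add: emeasure_cball)
  also have "\<dots> > 0" using unit_ball_vol_pos[of "DIM(real^'n^'n)"] by simp
  finally have "0 < emeasure lborel (cball (0 :: real^'n^'n) 1)" .
  also have "emeasure lborel (cball (0 :: real^'n^'n) 1) \<le> emeasure lborel (bounded_frames J)"
  proof (rule emeasure_mono_AE)
    show "AE N in lborel. N \<in> cball 0 1 \<longrightarrow> N \<in> bounded_frames J"
      using AE_det_block_nonzero[of J]
    proof eventually_elim
      fix N :: "real^'n^'n" assume "det (block J N) \<noteq> 0"
      then show "N \<in> cball 0 1 \<longrightarrow> N \<in> bounded_frames J"
        using norm_mult_coord_proj_le[of N J] norm_mult_coord_proj_le[of N "- J"] is_frame_block_invertible[of J N]
        by (auto simp: bounded_frames_def coord_proj_simps)
    qed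
  qed simp
  finally show "0 < emeasure lborel (bounded_frames J)" .
  have "bounded_frames J \<subseteq> cball 0 2"
  proof
    fix N assume N: "N \<in> bounded_frames J"
    have "N = N ** coord_proj J + N ** (mat 1 - coord_proj J)" by (simp add: matrix_mult_linear)
    then have "norm N \<le> norm (N ** coord_proj J) + norm (N ** (mat 1 - coord_proj J))" by (metis norm_triangle_ineq)
    then show "N \<in> cball 0 2" using N by (simp add: bounded_frames_def)
  qed
  then have "emeasure lborel (bounded_frames J) \<le> emeasure lborel (cball (0 :: real^'n^'n) 2)"
    by (intro emeasure_mono) auto
  also have "\<dots> < \<infinity>" by (rule emeasure_lborel_cball_finite)
  finally show "emeasure lborel (bounded_frames J) < \<infinity>" .
qed

lemma sets_frame_measure[simp, measurable_cong]: "sets (frame_measure J) = sets (grassmannian_borel (card J))"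
  by (simp add: frame_measure_def)

lemma space_frame_measure[simp]: "space (frame_measure J) = grassmannian (card J)"
  by (simp add: frame_measure_def)

lemma measurable_frame_span_uniform:
  "frame_span J \<in> measurable (uniform_measure lborel (bounded_frames J)) (grassmannian_borel (card J))"
  using measurable_frame_span[of J] by (simp cong: measurable_cong_sets)

lemma nn_integral_frame_measure:
  assumes [measurable]: "f \<in> borel_measurable (grassmannian_borel (card J))"
  shows "(\<integral>\<^sup>+V. f V \<partial>frame_measure J)
     = (\<integral>\<^sup>+N. f (frame_span J N) * indicator (bounded_frames J) N \<partial>lborel) / emeasure lborel (bounded_frames J)"
proof -
  have "(\<lambda>N. f (frame_span J N)) \<in> borel_measurable lborel"
    using measurable_compose[OF measurable_frame_span assms] by simp
  then show ?thesis
    unfolding frame_measure_def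
    by (subst nn_integral_distr[OF measurable_frame_span_uniform]) (simp_all add: nn_integral_uniform_measure)
qed

lemma is_frame_mult:
  assumes "inj ((*v) R)" shows "is_frame J (R ** N) \<longleftrightarrow> is_frame J N"
proof -
  have "(*v) (R ** N) = (*v) R \<circ> (*v) N" by (simp add: fun_eq_iff matrix_vector_mul_assoc)
  then show ?thesis
    unfolding is_frame_iff using assms by (metis comp_inj_on inj_on_imageI2 inj_on_subset subset_UNIV)
qed

lemma frame_span_mult:
  assumes "inj ((*v) R)" "is_frame J N" shows "frame_span J (R ** N) = (*v) R ` frame_span J N"
  using assms by (simp add: frame_span_def is_frame_mult image_image matrix_vector_mul_assoc)

text \<open>
  Left multiplication by a rotation is an isometry of the space of matrices, preserves the norms of
  both groups of columns, and rotates the span of the frame.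
\<close>

lemma frame_measure_rotation_invariant:
  fixes J :: "'n::finite set"
  shows "rotation_invariant (card J) (frame_measure J)"
  unfolding rotation_invariant_def
proof (intro conjI ballI)
  show "prob_space (frame_measure J)"
    unfolding frame_measure_def
  proof (rule prob_space.prob_space_distr)
    show "prob_space (uniform_measure lborel (bounded_frames J))"
      using emeasure_bounded_frames[of J] by (intro prob_space_uniform_measure) auto
    show "frame_span J \<in> measurable (uniform_measure lborel (bounded_frames J)) (grassmannian_borel (card J))"
      by (rule measurable_frame_span_uniform)
  qed
  show "sets (frame_measure J) = sets (grassmannian_borel (card J))" by simp
  fix \<rho> :: "real^'n \<Rightarrow> real^'n" assume \<rho>: "\<rho> \<in> rotations"
  let ?R = "matrix \<rho>" and ?F = "frame_measure J"
  note r = rotationsD[OF \<rho>]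
  have injR: "inj ((*v) ?R)" using r(2,4) by metis
  have m: "(`) \<rho> \<in> measurable ?F ?F"
    using measurable_rotation[OF \<rho>, of "card J"] by (simp cong: measurable_cong_sets)
  have m': "(`) \<rho> \<in> measurable (grassmannian_borel (card J)) (grassmannian_borel (card J))"
    by (rule measurable_rotation[OF \<rho>])
  show "distr ?F ?F ((`) \<rho>) = ?F"
  proof (rule measure_eqI)
    fix X assume "X \<in> sets (distr ?F ?F ((`) \<rho>))"
    then have X[measurable]: "X \<in> sets (grassmannian_borel (card J))" by simp
    have "emeasure (distr ?F ?F ((`) \<rho>)) X = (\<integral>\<^sup>+V. indicator X V \<partial>distr ?F ?F ((`) \<rho>))" by simp
    also have "\<dots> = (\<integral>\<^sup>+V. indicator X (\<rho> ` V) \<partial>?F)"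
      by (rule nn_integral_distr[OF m]) simp
    also have "\<dots> = (\<integral>\<^sup>+N. indicator X (\<rho> ` frame_span J N) * indicator (bounded_frames J) N \<partial>lborel) / emeasure lborel (bounded_frames J)"
      by (rule nn_integral_frame_measure) (use measurable_compose[OF m', of "indicator X" borel] in simp)
    also have "(\<integral>\<^sup>+N. indicator X (\<rho> ` frame_span J N) * indicator (bounded_frames J) N \<partial>lborel)
       = (\<integral>\<^sup>+N. indicator X (frame_span J (?R ** N)) * indicator (bounded_frames J) (?R ** N) \<partial>lborel)"
    proof (rule nn_integral_cong)
      fix N :: "real^'n^'n"
      have "?R ** N \<in> bounded_frames J \<longleftrightarrow> N \<in> bounded_frames J"
        using norm_orthogonal_matrix_mult(1)[OF r(5)]
        by (simp add: bounded_frames_def is_frame_mult[OF injR] matrix_mul_assoc[symmetric])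
      moreover have "frame_span J (?R ** N) = \<rho> ` frame_span J N" if "N \<in> bounded_frames J"
        using that frame_span_mult[OF injR, of J N] r(4) by (auto simp: bounded_frames_def)
      ultimately show "indicator X (\<rho> ` frame_span J N) * indicator (bounded_frames J) N
         = (indicator X (frame_span J (?R ** N)) * indicator (bounded_frames J) (?R ** N) :: ennreal)"
        by (simp add: indicator_def)
    qed
    also have "\<dots> = (\<integral>\<^sup>+N. indicator X (frame_span J N) * indicator (bounded_frames J) N \<partial>lborel)"
    proof (rule nn_integral_lborel_isometry[of "\<lambda>N. ?R ** N" "\<lambda>N. indicator X (frame_span J N) * indicator (bounded_frames J) N"])
      show "linear (\<lambda>N. ?R ** N)" by (rule linearI) (simp_all add: matrix_mult_linear)
      show "norm (?R ** N) = norm N" for N :: "real^'n^'n" by (rule norm_orthogonal_matrix_mult(1)[OF r(5)])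
    qed measurable
    also have "\<dots> / emeasure lborel (bounded_frames J) = (\<integral>\<^sup>+V. indicator X V \<partial>?F)"
      by (rule nn_integral_frame_measure[symmetric]) simp
    finally show "emeasure (distr ?F ?F ((`) \<rho>)) X = emeasure ?F X" by simp
  qed simp
qed

theorem grassmannian_haar_eq:
  assumes "J \<noteq> {}" shows "grassmannian_haar (card J) = frame_measure J"
  unfolding grassmannian_haar_def rotation_invariant_def[symmetric]
  using frame_measure_rotation_invariant rotation_invariant_unique[OF assms]
  by (intro the_equality) blast+


section \<open>Change of variables on the Grassmannian\<close>

text \<open>
  Let \<open>S\<close> be the inverse of \<open>M\<close>. The integrand over bounded frames for the
  function \<open>\<lambda>V. (1 / vol_factor V M) ^ n * f (M ` V)\<close> becomes this function
  when \<open>S ** N\<close> is substituted for \<open>N\<close> in the columns of the frame.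
\<close>

definition frame_integrand :: "'n set \<Rightarrow> ((real^'n) set \<Rightarrow> ennreal) \<Rightarrow> real^'n^'n \<Rightarrow> real^'n^'n \<Rightarrow> ennreal" where
  "frame_integrand J f S N = f (frame_span J N) * ennreal ((frame_vol J (S ** N) / frame_vol J N) ^ CARD('n)) *
     indicator {N. is_frame J N \<and> norm (S ** N ** coord_proj J) \<le> 1 \<and> norm (N ** (mat 1 - coord_proj J)) \<le> 1} N"

lemma measurable_frame_integrand:
  assumes [measurable]: "f \<in> borel_measurable (grassmannian_borel (card J))"
  shows "frame_integrand J f S \<in> borel_measurable borel"
proof -
  have "{N. is_frame J N \<and> norm (S ** N ** coord_proj J) \<le> 1 \<and> norm (N ** (mat 1 - coord_proj J)) \<le> 1}
     = {N. is_frame J N} \<inter> {N. norm (S ** N ** coord_proj J) \<le> 1 \<and> norm (N ** (mat 1 - coord_proj J)) \<le> 1}" by auto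
  also have "\<dots> \<in> sets borel" by measurable
  finally have [measurable]: "{N. is_frame J N \<and> norm (S ** N ** coord_proj J) \<le> 1 \<and> norm (N ** (mat 1 - coord_proj J)) \<le> 1} \<in> sets borel" .
  have [measurable]: "(\<lambda>N. frame_vol J (S ** N)) \<in> borel_measurable borel"
    by (rule measurable_compose[OF _ borel_measurable_frame_vol]) measurable
  show ?thesis unfolding frame_integrand_def[abs_def] by measurable
qed

text \<open>
  Frames whose rows with index in \<open>J\<close> form the identity matrix. A frame whose block
  \<open>A\<close> with rows in \<open>J\<close> is invertible is the product of such a frame and
  \<open>A\<close>.
\<close>

definition affine_frame :: "'n set \<Rightarrow> real^'n^'n \<Rightarrow> real^'n^'n" where
  "affine_frame J Y = coord_proj J + (mat 1 - coord_proj J) ** Y ** coord_proj J"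

text \<open>
  The conditions on the entries that do not belong to the frame: the other columns, and the unused
  rows from the row splitting.
\<close>

definition filler :: "'n set \<Rightarrow> real^'n^'n \<Rightarrow> real^'n^'n \<Rightarrow> ennreal" where
  "filler J A Y = indicator {M. norm M \<le> 1} (coord_proj J ** A ** (mat 1 - coord_proj J) + (mat 1 - coord_proj J) ** Y ** (mat 1 - coord_proj J))
     * indicator (cball 0 1) (coord_proj J ** Y + (mat 1 - coord_proj J) ** A)"

lemma block_coord_proj:
  "block J A ** coord_proj J = coord_proj J ** A ** coord_proj J"
  "block J A ** (mat 1 - coord_proj J) = mat 1 - coord_proj J"
  "coord_proj J ** (block J A ** coord_proj J) = block J A ** coord_proj J"
proof -
  note c = coord_proj_simps[of J]
  show 1: "block J A ** coord_proj J = coord_proj J ** A ** coord_proj J"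
    by (simp add: block_def matrix_mult_linear(1) matrix_mul_assoc[symmetric] c)
  show "block J A ** (mat 1 - coord_proj J) = mat 1 - coord_proj J"
    by (simp add: block_def matrix_mult_linear(1) matrix_mul_assoc[symmetric] c)
  show "coord_proj J ** (block J A ** coord_proj J) = block J A ** coord_proj J"
    unfolding 1 by (simp add: matrix_mul_assoc c)
qed

lemma block_on_coord_subspace:
  assumes d: "det (block J A) \<noteq> 0"
  shows "inj_on ((*v) (block J A)) (coord_subspace J)" "(*v) (block J A) ` coord_subspace J = coord_subspace J"
    "vol_factor (coord_subspace J) ((*v) (block J A)) = \<bar>det (block J A)\<bar>"
proof -
  let ?E = "coord_subspace J"
  show inj: "inj_on ((*v) (block J A)) ?E"
    unfolding linear_inj_on_iff[OF matrix_vector_mul_linear subspace_coord_subspace]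
    using det_nz_kernel[OF d] by blast
  have in_E: "block J A *v x \<in> ?E" if "x \<in> ?E" for x
  proof -
    have "block J A *v x = coord_proj J *v (A *v x)"
      using that by (simp add: block_def matrix_vector_mult_add_rdistrib matrix_vector_mult_diff_rdistrib
        matrix_vector_mul_assoc[symmetric] coord_proj_apply)
    then show ?thesis by (simp add: coord_proj_in)
  qed
  show "(*v) (block J A) ` ?E = ?E"
  proof (rule subspace_dim_equal[OF linear_subspace_image[OF matrix_vector_mul_linear subspace_coord_subspace] subspace_coord_subspace])
    show "(*v) (block J A) ` ?E \<subseteq> ?E" using in_E by auto
    show "dim ?E \<le> dim ((*v) (block J A) ` ?E)"
      using inj subspace_coord_subspace[of J] by (metis dim_image_eq matrix_vector_mul_linear order_refl span_eq_iff)
  qed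
  have "vol_factor ?E ((*v) (block J A)) = \<bar>det (matrix ((*v) (block J A)))\<bar>"
  proof (rule vol_factor_block[OF matrix_vector_mul_linear subspace_coord_subspace inj])
    show "block J A *v y = y" if "y \<in> orth_compl ?E" for y
      using coord_proj_orth_compl[OF that] by (simp add: block_def matrix_vector_mult_add_rdistrib matrix_vector_mult_diff_rdistrib
        matrix_vector_mul_assoc[symmetric])
  qed (use in_E in auto)
  then show "vol_factor ?E ((*v) (block J A)) = \<bar>det (block J A)\<bar>" by simp
qed

lemma frame_eqI:
  assumes "N ** coord_proj J = M ** coord_proj J"
  shows "is_frame J N = is_frame J M" "frame_span J N = frame_span J M" "frame_vol J N = frame_vol J M"
proof -
  have eq: "N *v x = M *v x" if "x \<in> coord_subspace J" for x
    using arg_cong[OF assms, of "\<lambda>A. A *v x"] that by (simp add: matrix_vector_mul_assoc[symmetric] coord_proj_apply)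
  show f: "is_frame J N = is_frame J M" unfolding is_frame_iff using eq by (simp cong: inj_on_cong)
  show "frame_span J N = frame_span J M" using f eq by (auto simp: frame_span_def intro!: image_cong)
  have "gram_matrix (coord_proj J) N = gram_matrix (coord_proj J) M"
  proof -
    have *: "gram_matrix (coord_proj J) N = transpose (N ** coord_proj J) ** (N ** coord_proj J) + (mat 1 - coord_proj J)" for N
      by (simp add: gram_matrix_def matrix_transpose_mul coord_proj_simps matrix_mul_assoc)
    show ?thesis unfolding * assms ..
  qed
  then show "frame_vol J N = frame_vol J M" by (simp add: frame_vol_def)
qed

lemma is_frame_affine_frame: "is_frame J (affine_frame J Y)"
  unfolding is_frame_iff linear_inj_on_iff[OF matrix_vector_mul_linear subspace_coord_subspace]
proof (intro ballI impI)
  fix x assume x: "x \<in> coord_subspace J" "affine_frame J Y *v x = 0"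
  have "coord_proj J ** affine_frame J Y = coord_proj J"
    by (simp add: affine_frame_def matrix_mult_linear(2) matrix_mul_assoc coord_proj_simps)
  then have "coord_proj J *v (affine_frame J Y *v x) = x"
    using x(1) by (simp add: matrix_vector_mul_assoc coord_proj_apply)
  then show "x = 0" using x(2) by simp
qed

lemma frame_times_block:
  assumes d: "det (block J A) \<noteq> 0" and G: "is_frame J G"
  shows "is_frame J (G ** block J A)" "frame_span J (G ** block J A) = frame_span J G"
    "frame_vol J (G ** block J A) = frame_vol J G * \<bar>det (block J A)\<bar>"
proof -
  let ?E = "coord_subspace J" and ?A = "block J A"
  note b = block_on_coord_subspace[OF d]
  have comp: "(*v) (G ** ?A) = (\<lambda>x. G *v (?A *v x))" by (simp add: fun_eq_iff matrix_vector_mul_assoc)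
  have injG: "inj_on ((*v) G) ((*v) ?A ` ?E)" using G b(2) by (simp add: is_frame_iff)
  show f: "is_frame J (G ** ?A)"
    unfolding is_frame_iff comp using comp_inj_on[OF b(1) injG] by (simp add: o_def)
  show "frame_span J (G ** ?A) = frame_span J G"
  proof -
    have "(*v) (G ** ?A) ` ?E = (*v) G ` ((*v) ?A ` ?E)" unfolding comp by (simp add: image_image)
    then show ?thesis using f G b(2) by (simp add: frame_span_def)
  qed
  have "vol_factor ?E ((*v) (G ** ?A)) = vol_factor ((*v) ?A ` ?E) ((*v) G) * vol_factor ?E ((*v) ?A)"
    unfolding comp by (rule vol_factor_compose[OF _ _ subspace_coord_subspace b(1) injG]) auto
  then show "frame_vol J (G ** ?A) = frame_vol J G * \<bar>det ?A\<bar>"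
    using f G b by (simp add: frame_vol_eq)
qed

text \<open>
  The crux of the change of variables: the right-hand side does not contain \<open>S\<close>. Almost
  every frame is a product \<open>G ** A\<close> of an affine frame \<open>G\<close> and an
  invertible block \<open>A\<close>, and both the span and the quotient of the volumes depend on
  \<open>G\<close> only. On the coordinate subspace \<open>S ** G\<close> is \<open>R ** b\<close>
  with \<open>R\<close> orthogonal and \<open>\<bar>det b\<bar> = frame_vol J (S ** G)\<close>, so
  that the bound on the norm concerns \<open>b ** A\<close>. Replacing \<open>b ** A\<close> by
  \<open>A\<close> costs the factor \<open>\<bar>det b\<bar> ^ n\<close>: one part comes from the
  columns of \<open>A\<close>, the other one from the determinant of \<open>A\<close> that the
  substitution for \<open>Y\<close> has produced. This cancels the factor \<open>frame_vol J (S **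
  G) ^ n\<close> of the integrand.
\<close>

lemma frame_integrand_integral:
  fixes S :: "real^'n^'n" and J :: "'n set"
  assumes S: "det S \<noteq> 0" and f[measurable]: "f \<in> borel_measurable (grassmannian_borel (card J))"
  shows "emeasure lborel (cball (0 :: real^'n^'n) 1) * (\<integral>\<^sup>+N. frame_integrand J f S N \<partial>lborel)
    = (\<integral>\<^sup>+Y. f (frame_span J (affine_frame J Y)) * ennreal ((1 / frame_vol J (affine_frame J Y)) ^ CARD('n)) *
        (\<integral>\<^sup>+A. ennreal (\<bar>det (block J A)\<bar> ^ card (- J)) * indicator {M. norm M \<le> 1} (block J A ** coord_proj J)
           * filler J A Y \<partial>lborel) \<partial>lborel)"
proof -
  let ?P = "coord_proj J" and ?Q = "mat 1 - coord_proj J" and ?n = "CARD('n)"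
  note c = coord_proj_simps[of J]
  have injS: "inj ((*v) S)" using S det_nz_iff_inj[of "(*v) S"] by simp
  define ball1 :: "real^'n^'n \<Rightarrow> ennreal" where "ball1 = indicator {M. norm M \<le> 1}"
  have [measurable]: "ball1 \<in> borel_measurable borel" unfolding ball1_def by measurable
  have [measurable]: "(\<lambda>Y. affine_frame J Y) \<in> borel_measurable borel" unfolding affine_frame_def by measurable
  have fm[measurable]: "(\<lambda>p. filler J (fst p) (snd p)) \<in> borel_measurable (borel \<Otimes>\<^sub>M borel)"
  proof -
    have "(\<lambda>p. ?P ** fst p ** ?Q + ?Q ** snd p ** ?Q) \<in> borel_measurable (borel \<Otimes>\<^sub>M borel)" by measurable
    moreover have "ball1 \<in> borel_measurable borel" by measurable
    ultimately have 1: "(\<lambda>p. ball1 (?P ** fst p ** ?Q + ?Q ** snd p ** ?Q)) \<in> borel_measurable (borel \<Otimes>\<^sub>M borel)"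
      by (rule measurable_compose)
    have "(\<lambda>p. ?P ** snd p + ?Q ** fst p) \<in> borel_measurable (borel \<Otimes>\<^sub>M borel)" by measurable
    then have 2: "(\<lambda>p. indicator (cball 0 1) (?P ** snd p + ?Q ** fst p) :: ennreal) \<in> borel_measurable (borel \<Otimes>\<^sub>M borel)"
      by (rule measurable_compose[OF _ borel_measurable_indicator_cball])
    show ?thesis unfolding filler_def ball1_def[symmetric] by (rule borel_measurable_times_ennreal[OF 1 2])
  qed
  define coeff where "coeff Y = f (frame_span J (affine_frame J Y)) *
     ennreal ((frame_vol J (S ** affine_frame J Y) / frame_vol J (affine_frame J Y)) ^ ?n)" for Y
  have [measurable]: "(\<lambda>Y. frame_vol J (S ** affine_frame J Y)) \<in> borel_measurable borel"
    by (rule measurable_compose[OF _ borel_measurable_frame_vol]) measurable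
  have [measurable]: "(\<lambda>Y. frame_vol J (affine_frame J Y)) \<in> borel_measurable borel"
    by (rule measurable_compose[OF _ borel_measurable_frame_vol]) measurable
  have [measurable]: "(\<lambda>Y. f (frame_span J (affine_frame J Y))) \<in> borel_measurable borel"
    by (rule measurable_compose[OF measurable_compose[OF _ measurable_frame_span] f]) measurable
  have coeff_m[measurable]: "coeff \<in> borel_measurable borel" unfolding coeff_def by measurable
  define \<Xi> where "\<Xi> A Y = ennreal (\<bar>det (block J A)\<bar> ^ card (- J)) *
     (coeff Y * ball1 (S ** affine_frame J Y ** (block J A ** ?P)) * filler J A Y)" for A Y
  have \<Xi>_m: "(\<lambda>(A, Y). \<Xi> A Y) \<in> borel_measurable (borel \<Otimes>\<^sub>M borel)"
  proof -
    have [measurable]: "(\<lambda>p. block J (fst p)) \<in> borel_measurable (borel \<Otimes>\<^sub>M (borel :: (real^'n^'n) measure))"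
      by (rule measurable_compose[OF measurable_fst borel_measurable_block])
    have [measurable]: "(\<lambda>p. affine_frame J (snd p)) \<in> borel_measurable ((borel :: (real^'n^'n) measure) \<Otimes>\<^sub>M borel)"
      unfolding affine_frame_def by measurable
    show ?thesis unfolding \<Xi>_def split_beta' by measurable
  qed
  let ?F = "frame_integrand J f S"
  have F_m[measurable]: "?F \<in> borel_measurable borel" by (rule measurable_frame_integrand[OF f])
  have "emeasure lborel (cball (0 :: real^'n^'n) 1) * (\<integral>\<^sup>+N. ?F N \<partial>lborel)
     = (\<integral>\<^sup>+A. (\<integral>\<^sup>+Y. ?F (?P ** A + ?Q ** Y) * indicator (cball 0 1) (?P ** Y + ?Q ** A) \<partial>lborel) \<partial>lborel)"
    by (rule nn_integral_row_splitting[OF F_m])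
  \<comment> \<open>the substitution of \<open>Y ** A\<close> for \<open>Y\<close> in the rows outside
    \<open>J\<close> turns the frame into the product of the affine frame of \<open>Y\<close> and
    the block of \<open>A\<close>\<close>
  also have "\<dots> = (\<integral>\<^sup>+A. (\<integral>\<^sup>+Y. \<Xi> A Y \<partial>lborel) \<partial>lborel)"
  proof (rule nn_integral_cong_AE, use AE_det_block_nonzero[of J] in eventually_elim)
    fix A :: "real^'n^'n" assume d: "det (block J A) \<noteq> 0"
    let ?A = "block J A"
    have hm: "(\<lambda>Y. ?F (?P ** A + ?Q ** Y) * indicator (cball 0 1) (?P ** Y + ?Q ** A)) \<in> borel_measurable borel"
      by (intro borel_measurable_times_ennreal measurable_compose[OF _ F_m] measurable_compose[OF _ borel_measurable_indicator_cball]) measurable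
    have "(\<integral>\<^sup>+Y. ?F (?P ** A + ?Q ** Y) * indicator (cball 0 1) (?P ** Y + ?Q ** A) \<partial>lborel)
       = ennreal (\<bar>det ?A\<bar> ^ card (- J)) * (\<integral>\<^sup>+Y. ?F (?P ** A + ?Q ** (?P ** Y + ?Q ** Y ** ?A))
            * indicator (cball 0 1) (?P ** (?P ** Y + ?Q ** Y ** ?A) + ?Q ** A) \<partial>lborel)"
      by (rule nn_integral_row_scaling[OF d hm])
    also have "\<dots> = (\<integral>\<^sup>+Y. ennreal (\<bar>det ?A\<bar> ^ card (- J)) * (?F (?P ** A + ?Q ** (?P ** Y + ?Q ** Y ** ?A))
            * indicator (cball 0 1) (?P ** (?P ** Y + ?Q ** Y ** ?A) + ?Q ** A)) \<partial>lborel)"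
      by (rule nn_integral_cmult[symmetric], rule measurable_compose[OF _ hm, unfolded o_def]) measurable
    also have "\<dots> = (\<integral>\<^sup>+Y. \<Xi> A Y \<partial>lborel)"
    proof (rule nn_integral_cong)
      fix Y :: "real^'n^'n"
      let ?G = "affine_frame J Y" and ?N = "?P ** A + ?Q ** Y ** ?A"
      have N: "?P ** A + ?Q ** (?P ** Y + ?Q ** Y ** ?A) = ?N"
        by (simp add: matrix_mult_linear(2) matrix_mul_assoc c)
      have PY: "?P ** (?P ** Y + ?Q ** Y ** ?A) + ?Q ** A = ?P ** Y + ?Q ** A"
        by (simp add: matrix_mult_linear(2) matrix_mul_assoc c)
      have NP: "?N ** ?P = (?G ** ?A) ** ?P"
        using arg_cong[OF c(1), of "\<lambda>X. X ** (A ** ?P)"]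
        by (simp add: affine_frame_def matrix_mult_linear(1) matrix_mul_assoc[symmetric] block_coord_proj)
      have NQ: "?N ** ?Q = ?P ** A ** ?Q + ?Q ** Y ** ?Q"
        by (simp add: matrix_mult_linear(1) matrix_mul_assoc[symmetric] block_coord_proj)
      have SNP: "(S ** ?N) ** ?P = ((S ** ?G) ** ?A) ** ?P"
        using arg_cong[OF NP, of "\<lambda>X. S ** X"] by (simp add: matrix_mul_assoc)
      have SG: "is_frame J (S ** ?G)" by (simp add: is_frame_mult[OF injS] is_frame_affine_frame)
      note fG = frame_times_block[OF d is_frame_affine_frame[of J Y]] and fSG = frame_times_block[OF d SG]
      note eN = frame_eqI[OF NP] and eSN = frame_eqI[OF SNP]
      have vol: "frame_vol J (S ** ?N) / frame_vol J ?N = frame_vol J (S ** ?G) / frame_vol J ?G"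
        using d by (simp add: eN eSN fG fSG)
      have "?F ?N = coeff Y * ball1 (S ** ?G ** (?A ** ?P)) * indicator {M. norm M \<le> 1} (?P ** A ** ?Q + ?Q ** Y ** ?Q)"
        unfolding frame_integrand_def coeff_def ball1_def vol eN(2) fG(2)
        using SNP NQ eN(1) fG(1) by (simp add: indicator_def matrix_mul_assoc)
      then show "ennreal (\<bar>det ?A\<bar> ^ card (- J)) * (?F (?P ** A + ?Q ** (?P ** Y + ?Q ** Y ** ?A))
            * indicator (cball 0 1) (?P ** (?P ** Y + ?Q ** Y ** ?A) + ?Q ** A)) = \<Xi> A Y"
        unfolding N PY \<Xi>_def filler_def by (simp add: mult.assoc)
    qed
    finally show "(\<integral>\<^sup>+Y. ?F (?P ** A + ?Q ** Y) * indicator (cball 0 1) (?P ** Y + ?Q ** A) \<partial>lborel) = (\<integral>\<^sup>+Y. \<Xi> A Y \<partial>lborel)" .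
  qed
  also have "\<dots> = (\<integral>\<^sup>+Y. (\<integral>\<^sup>+A. \<Xi> A Y \<partial>lborel) \<partial>lborel)"
    by (rule lborel_pair.Fubini') (use \<Xi>_m in simp)
  also have "\<dots> = (\<integral>\<^sup>+Y. f (frame_span J (affine_frame J Y)) * ennreal ((1 / frame_vol J (affine_frame J Y)) ^ ?n) *
        (\<integral>\<^sup>+A. ennreal (\<bar>det (block J A)\<bar> ^ card (- J)) * ball1 (block J A ** ?P) * filler J A Y \<partial>lborel) \<partial>lborel)"
  proof (rule nn_integral_cong)
    fix Y :: "real^'n^'n"
    let ?G = "affine_frame J Y" and ?E = "coord_subspace J"
    have SG: "is_frame J (S ** ?G)" by (simp add: is_frame_mult[OF injS] is_frame_affine_frame)
    \<comment> \<open>the map \<open>S ** ?G\<close> is isometric to an endomorphism \<open>b\<close> of the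
      coordinate subspace\<close>
    obtain R B where R: "orthogonal_transformation R" and B: "linear B" and BE: "\<And>x. x \<in> ?E \<Longrightarrow> B x \<in> ?E"
      and idB: "\<And>y. y \<in> orth_compl ?E \<Longrightarrow> B y = y" and RB: "\<And>x. x \<in> ?E \<Longrightarrow> (S ** ?G) *v x = R (B x)"
      and k: "vol_factor ?E ((*v) (S ** ?G)) = \<bar>det (matrix B)\<bar>"
      by (rule isometric_factorization[OF _ subspace_coord_subspace, of "(*v) (S ** ?G)" J])
        (use SG in \<open>auto simp: is_frame_iff\<close>)
    define b where "b = matrix B"
    have b: "b *v x = B x" for x unfolding b_def using B by (simp add: matrix_works)
    have linR: "linear R" using R by (simp add: orthogonal_transformation_def)
    have dB: "\<bar>det b\<bar> = frame_vol J (S ** ?G)" using k by (simp add: b_def frame_vol_eq[OF SG])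
    then have det_b: "det b \<noteq> 0" using frame_vol_pos[OF SG] by auto
    have bP: "?P ** (b ** ?P) = b ** ?P"
      by (rule matrix_eqI) (simp add: matrix_vector_mul_assoc[symmetric] b coord_proj_apply BE coord_proj_in)
    have bQ: "b ** ?Q = ?Q"
    proof (rule matrix_eqI)
      fix x
      have "?Q *v x \<in> orth_compl ?E"
        using minus_closest_point_orth_compl[OF subspace_coord_subspace[of J], of x]
        by (simp add: matrix_vector_mult_diff_rdistrib proj_matrix_mult[OF subspace_coord_subspace, symmetric] proj_matrix_coord_subspace)
      then show "b ** ?Q *v x = ?Q *v x" using idB by (simp add: matrix_vector_mul_assoc[symmetric] b)
    qed
    have "b = b ** ?P + b ** ?Q" by (simp add: matrix_mult_linear)
    then have b_eq: "b = b ** ?P + ?Q" by (simp add: bQ)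
    have Pb: "?P ** b = b ** ?P"
    proof -
      have "?P ** b = ?P ** (b ** ?P + ?Q)" using b_eq by simp
      then show ?thesis by (simp add: matrix_mult_linear(2) bP c)
    qed
    have Qb: "?Q ** b = ?Q"
      using Pb by (simp add: matrix_mult_linear(3) matrix_mult_linear(4)) (metis (no_types) b_eq add_diff_cancel_left')
    have norm_eq: "norm (S ** ?G ** (block J A ** ?P)) = norm (b ** (block J A ** ?P))" for A
    proof -
      have "S ** ?G ** (block J A ** ?P) = matrix R ** (b ** (block J A ** ?P))"
      proof (rule matrix_eqI)
        fix x
        have "block J A *v (?P *v x) \<in> ?E"
          using arg_cong[OF block_coord_proj(3)[of J A], of "\<lambda>M. M *v x"] coord_proj_in[of J]
          by (metis matrix_vector_mul_assoc)
        then have "(S ** ?G) *v (block J A *v (?P *v x)) = R (B (block J A *v (?P *v x)))" by (rule RB)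
        then show "S ** ?G ** (block J A ** ?P) *v x = matrix R ** (b ** (block J A ** ?P)) *v x"
          using linR by (simp add: matrix_vector_mul_assoc[symmetric] b matrix_works)
      qed
      then show ?thesis
        using norm_orthogonal_matrix_mult(1)[of "matrix R"] R linR by (simp add: matrix_works orthogonal_transformation)
    qed
    let ?H = "\<lambda>A. ennreal (\<bar>det (block J A)\<bar> ^ card (- J)) * ball1 (block J A ** ?P) * filler J A Y"
    let ?H' = "\<lambda>A. ennreal (\<bar>det (block J A)\<bar> ^ card (- J)) * ball1 (b ** (block J A ** ?P)) * filler J A Y"
    have fY: "(\<lambda>A. filler J A Y) \<in> borel_measurable borel"
      using measurable_compose[OF measurable_Pair[OF measurable_ident_sets[OF refl] measurable_const[of Y borel]] fm] by simp
    note [measurable] = fY borel_measurable_block[of J]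
    have Hm: "?H \<in> borel_measurable borel" "?H' \<in> borel_measurable borel" by measurable
    have "(\<integral>\<^sup>+A. ?H A \<partial>lborel) = ennreal (\<bar>det b\<bar> ^ card J) * (\<integral>\<^sup>+A. ?H (b ** A ** ?P + A ** ?Q) \<partial>lborel)"
      by (rule nn_integral_column_scaling[OF det_b Hm(1)])
    also have "(\<integral>\<^sup>+A. ?H (b ** A ** ?P + A ** ?Q) \<partial>lborel) = (\<integral>\<^sup>+A. ennreal (\<bar>det b\<bar> ^ card (- J)) * ?H' A \<partial>lborel)"
    proof (rule nn_integral_cong)
      fix A :: "real^'n^'n"
      let ?A' = "b ** A ** ?P + A ** ?Q"
      have A'P: "?A' ** ?P = b ** A ** ?P" by (simp add: matrix_mult_linear(1) matrix_mul_assoc[symmetric] c)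
      have "block J ?A' = ?P ** (b ** A ** ?P) + ?Q"
        unfolding block_def using arg_cong[OF A'P, of "\<lambda>X. ?P ** X + ?Q"] by (simp only: matrix_mul_assoc)
      also have "\<dots> = b ** (?P ** A ** ?P) + b ** ?Q"
        by (simp add: matrix_mul_assoc Pb bQ)
      also have "\<dots> = b ** block J A" by (simp add: block_def matrix_mult_linear(2))
      finally have blk: "block J ?A' = b ** block J A" .
      have "?P ** ?A' ** ?Q = ?P ** A ** ?Q" "?Q ** ?A' = ?Q ** A"
      proof -
        have "?A' ** ?Q = A ** ?Q" by (simp add: matrix_mult_linear(1) matrix_mul_assoc[symmetric] c)
        then show "?P ** ?A' ** ?Q = ?P ** A ** ?Q" by (metis matrix_mul_assoc)
        have "?Q ** ?A' = ?Q ** A ** ?P + ?Q ** A ** ?Q" by (simp add: matrix_mult_linear(2) matrix_mul_assoc Qb)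
        also have "\<dots> = ?Q ** A ** (?P + ?Q)" by (simp only: matrix_mult_linear(2))
        finally show "?Q ** ?A' = ?Q ** A" by simp
      qed
      then have "filler J ?A' Y = filler J A Y" by (simp add: filler_def)
      then show "?H ?A' = ennreal (\<bar>det b\<bar> ^ card (- J)) * ?H' A"
        by (simp add: blk det_mul abs_mult power_mult_distrib ennreal_mult mult.assoc matrix_mul_assoc)
    qed
    also have "\<dots> = ennreal (\<bar>det b\<bar> ^ card (- J)) * (\<integral>\<^sup>+A. ?H' A \<partial>lborel)"
      by (rule nn_integral_cmult) (use Hm in simp)
    finally have HH0: "(\<integral>\<^sup>+A. ?H A \<partial>lborel)
        = ennreal (\<bar>det b\<bar> ^ card J) * (ennreal (\<bar>det b\<bar> ^ card (- J)) * (\<integral>\<^sup>+A. ?H' A \<partial>lborel))" .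
    have HH: "(\<integral>\<^sup>+A. ?H A \<partial>lborel) = ennreal (frame_vol J (S ** ?G) ^ ?n) * (\<integral>\<^sup>+A. ?H' A \<partial>lborel)"
    proof -
      have "card J + card (- J) = ?n" by (metis card_Un_disjoint Compl_disjoint Compl_partition finite)
      then have "\<bar>det b\<bar> ^ card J * \<bar>det b\<bar> ^ card (- J) = frame_vol J (S ** ?G) ^ ?n"
        by (simp add: power_add[symmetric] dB)
      then have "ennreal (\<bar>det b\<bar> ^ card J) * ennreal (\<bar>det b\<bar> ^ card (- J)) = ennreal (frame_vol J (S ** ?G) ^ ?n)"
        by (simp add: ennreal_mult[symmetric])
      then show ?thesis unfolding HH0 mult.assoc[symmetric] by (rule arg_cong)
    qed
    have "(\<integral>\<^sup>+A. \<Xi> A Y \<partial>lborel) = (\<integral>\<^sup>+A. coeff Y * ?H' A \<partial>lborel)"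
      by (intro nn_integral_cong) (simp add: \<Xi>_def ball1_def indicator_def norm_eq mult_ac)
    also have "\<dots> = coeff Y * (\<integral>\<^sup>+A. ?H' A \<partial>lborel)" by (rule nn_integral_cmult) (use Hm in simp)
    also have "coeff Y = f (frame_span J ?G) * ennreal ((1 / frame_vol J ?G) ^ ?n) * ennreal (frame_vol J (S ** ?G) ^ ?n)"
      using frame_vol_pos[OF SG] frame_vol_pos[OF is_frame_affine_frame[of J Y]]
      by (simp add: coeff_def power_divide ennreal_mult[symmetric] mult.assoc less_imp_le)
    finally show "(\<integral>\<^sup>+A. \<Xi> A Y \<partial>lborel) = f (frame_span J ?G) * ennreal ((1 / frame_vol J ?G) ^ ?n) * (\<integral>\<^sup>+A. ?H A \<partial>lborel)"
      unfolding HH by (simp only: mult.assoc)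
  qed
  finally show ?thesis by (simp add: ball1_def)
qed

text \<open>
  The two sides are the integrals of \<open>frame_integrand\<close> for the inverse of
  \<open>M\<close> and for the identity matrix, up to the same normalization.
\<close>

theorem grassmannian_change_of_variables:
  fixes M :: "real^'n^'n" and J :: "'n set"
  assumes J: "J \<noteq> {}" and M: "\<bar>det M\<bar> = 1" and f[measurable]: "f \<in> borel_measurable (grassmannian_borel (card J))"
  shows "(\<integral>\<^sup>+V. ennreal ((1 / vol_factor V ((*v) M)) ^ CARD('n)) * f ((*v) M ` V) \<partial>grassmannian_haar (card J))
    = (\<integral>\<^sup>+V. f V \<partial>grassmannian_haar (card J))"
proof -
  let ?P = "coord_proj J" and ?Q = "mat 1 - coord_proj J" and ?n = "CARD('n)" and ?W = "bounded_frames J"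
  note c = coord_proj_simps[of J]
  have dM: "det M \<noteq> 0" using M by auto
  have injM: "inj ((*v) M)" using dM det_nz_iff_inj[of "(*v) M"] by simp
  define S where "S = cramer_inverse M"
  have MS: "M ** S = mat 1" unfolding S_def by (rule cramer_inverse_right[OF dM])
  have "det M * det S = 1" using MS by (metis det_I det_mul)
  then have dS: "\<bar>det S\<bar> = 1" using M by (metis abs_mult abs_one mult_1)
  then have dS0: "det S \<noteq> 0" by auto
  have injS: "inj ((*v) S)" using dS0 det_nz_iff_inj[of "(*v) S"] by simp
  let ?f = "\<lambda>V. ennreal ((1 / vol_factor V ((*v) M)) ^ ?n) * f ((*v) M ` V)"
  have fm: "?f \<in> borel_measurable (grassmannian_borel (card J))"
  proof -
    note [measurable] = measurable_vol_factor[OF injM, of "card J"] measurable_compose[OF measurable_grassmannian_image[OF injM, of "card J"] f]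
    show ?thesis by measurable
  qed
  define H where "H N = ?f (frame_span J N) * indicator ?W N" for N
  have Hm: "H \<in> borel_measurable borel"
    unfolding H_def using measurable_compose[OF measurable_frame_span fm] by measurable
  have "(\<integral>\<^sup>+N. H N \<partial>lborel) = ennreal (\<bar>det S\<bar> ^ card J) * (\<integral>\<^sup>+N. H (S ** N ** ?P + N ** ?Q) \<partial>lborel)"
    by (rule nn_integral_column_scaling[OF dS0 Hm])
  also have "\<dots> = (\<integral>\<^sup>+N. H (S ** N ** ?P + N ** ?Q) \<partial>lborel)" by (simp add: dS)
  also have "\<dots> = (\<integral>\<^sup>+N. frame_integrand J f S N \<partial>lborel)"
  proof (rule nn_integral_cong)
    fix N :: "real^'n^'n"
    let ?N = "S ** N ** ?P + N ** ?Q"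
    have NP: "?N ** ?P = (S ** N) ** ?P" and NQ: "?N ** ?Q = N ** ?Q"
      by (simp_all add: matrix_mult_linear(1) matrix_mul_assoc[symmetric] c)
    note e = frame_eqI[OF NP]
    show "H ?N = frame_integrand J f S N"
    proof (cases "is_frame J N")
      case True
      then have SN: "is_frame J (S ** N)" by (simp add: is_frame_mult[OF injS])
      have span: "(*v) M ` frame_span J (S ** N) = frame_span J N"
        using frame_span_mult[OF injM SN] by (simp add: matrix_mul_assoc MS)
      have "frame_vol J N = vol_factor (frame_span J (S ** N)) ((*v) M) * frame_vol J (S ** N)"
      proof -
        have "vol_factor (coord_subspace J) (\<lambda>x. M *v ((S ** N) *v x))
          = vol_factor ((*v) (S ** N) ` coord_subspace J) ((*v) M) * vol_factor (coord_subspace J) ((*v) (S ** N))"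
          by (rule vol_factor_compose[OF _ _ subspace_coord_subspace])
            (use SN injM in \<open>auto simp: is_frame_iff intro: inj_on_subset\<close>)
        moreover have "(\<lambda>x. M *v ((S ** N) *v x)) = (*v) N"
          by (simp add: fun_eq_iff matrix_vector_mul_assoc matrix_mul_assoc MS)
        ultimately show ?thesis using SN True by (simp add: frame_vol_eq frame_span_def)
      qed
      then have "1 / vol_factor (frame_span J (S ** N)) ((*v) M) = frame_vol J (S ** N) / frame_vol J N"
        using frame_vol_pos[OF SN] frame_vol_pos[OF True] by (simp add: field_simps)
      then show ?thesis
        using True SN by (simp add: H_def e span frame_integrand_def bounded_frames_def indicator_def NP NQ mult.commute)
    next
      case False
      then have "\<not> is_frame J (S ** N)" by (simp add: is_frame_mult[OF injS])
      then show ?thesis using False by (simp add: H_def frame_integrand_def bounded_frames_def e)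
    qed
  qed
  finally have 1: "(\<integral>\<^sup>+N. H N \<partial>lborel) = (\<integral>\<^sup>+N. frame_integrand J f S N \<partial>lborel)" .
  have 2: "(\<integral>\<^sup>+N. f (frame_span J N) * indicator ?W N \<partial>lborel) = (\<integral>\<^sup>+N. frame_integrand J f (mat 1) N \<partial>lborel)"
  proof (rule nn_integral_cong)
    fix N :: "real^'n^'n"
    show "f (frame_span J N) * indicator ?W N = frame_integrand J f (mat 1) N"
      using frame_vol_pos[of J N] by (auto simp: frame_integrand_def bounded_frames_def indicator_def)
  qed
  let ?q = "emeasure lborel (cball (0 :: real^'n^'n) 1)"
  have "?q * (\<integral>\<^sup>+N. frame_integrand J f S N \<partial>lborel) = ?q * (\<integral>\<^sup>+N. frame_integrand J f (mat 1) N \<partial>lborel)"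
    using frame_integrand_integral[OF dS0 f] frame_integrand_integral[of "mat 1" f J] f by simp
  moreover have "?q = ennreal (unit_ball_vol (DIM(real^'n^'n)))" by (simp add: emeasure_cball)
  ultimately have "(\<integral>\<^sup>+N. frame_integrand J f S N \<partial>lborel) = (\<integral>\<^sup>+N. frame_integrand J f (mat 1) N \<partial>lborel)"
    using ennreal_cancel_pos[of "unit_ball_vol (DIM(real^'n^'n))"] unit_ball_vol_pos[of "DIM(real^'n^'n)"] by simp
  then show ?thesis
    unfolding grassmannian_haar_eq[OF J] nn_integral_frame_measure[OF fm] nn_integral_frame_measure[OF f]
    using 1 2 by (simp add: H_def)
qed


section \<open>Projections of linear images\<close>

text \<open>
  The difference between a point and its projection onto \<open>adjoint f ` V\<close> is orthogonal
  to \<open>adjoint f ` V\<close>, so \<open>f\<close> maps it to a vector orthogonal to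
  \<open>V\<close>.
\<close>

lemma body_proj_linear_image:
  fixes f :: "'a::euclidean_space \<Rightarrow> 'a"
  assumes f: "linear f" and V: "subspace V"
  shows "body_proj (f ` K) V = (\<lambda>x. closest_point V (f x)) ` body_proj K (adjoint f ` V)"
proof -
  let ?W = "adjoint f ` V"
  have W: "subspace ?W" by (rule linear_subspace_image[OF adjoint_linear[OF f] V])
  have "closest_point V (f x) = closest_point V (f (closest_point ?W x))" for x
  proof (rule closest_point_eqI[OF V closest_point_mem[OF V]])
    fix y assume y: "y \<in> V"
    have "f x \<bullet> y = x \<bullet> adjoint f y" by (simp add: adjoint_works[OF f])
    also have "\<dots> = closest_point ?W x \<bullet> adjoint f y" using y by (subst closest_point_inner[OF W]) auto
    also have "\<dots> = f (closest_point ?W x) \<bullet> y" by (simp add: adjoint_works[OF f])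
    also have "\<dots> = closest_point V (f (closest_point ?W x)) \<bullet> y" by (simp add: closest_point_inner[OF V y])
    finally show "(f x - closest_point V (f (closest_point ?W x))) \<bullet> y = 0" by (simp add: inner_diff_left)
  qed
  then show ?thesis by (simp add: body_proj_def image_image)
qed

lemma body_proj_properties:
  assumes V: "subspace V" and K: "K \<in> origin_bodies"
  shows compact_body_proj: "compact (body_proj K V)" and body_proj_subset: "body_proj K V \<subseteq> V"
    and zero_in_body_proj: "0 \<in> body_proj K V"
proof -
  have K': "compact K" "0 \<in> K" using K interior_subset by (auto simp: origin_bodies_def)
  show "compact (body_proj K V)"
    unfolding body_proj_def by (rule compact_image_linear[OF linear_closest_point[OF V] K'(1)])
  show "body_proj K V \<subseteq> V" using closest_point_mem[OF V] by (auto simp: body_proj_def)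
  show "0 \<in> body_proj K V"
    using K'(2) closest_point_id[OF V subspace_0[OF V]] by (force simp: body_proj_def)
qed

lemma body_in_subspace_body_proj:
  assumes V: "subspace V" "dim V = Suc s" and K: "K \<in> origin_bodies"
  obtains r where "body_in_subspace V (body_proj K V) r s"
proof -
  obtain r where r: "0 < r" "cball 0 r \<subseteq> K"
    using K by (auto simp: origin_bodies_def mem_interior_cball)
  have "convex (body_proj K V)"
    unfolding body_proj_def
    by (rule convex_linear_image[OF linear_closest_point[OF V(1)]]) (use K in \<open>simp add: origin_bodies_def\<close>)
  moreover have "cball 0 r \<inter> V \<subseteq> body_proj K V"
    using r(2) closest_point_id[OF V(1)] by (force simp: body_proj_def)
  ultimately have "body_in_subspace V (body_proj K V) r s"
    using V r(1) body_proj_properties[OF V(1) K] by unfold_locales auto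
  then show ?thesis by (rule that)
qed

lemma measure_lborel_on_linear_image:
  fixes g :: "'a::euclidean_space \<Rightarrow> 'b::euclidean_space"
  assumes g: "linear g" and V: "subspace V" and inj: "inj_on g V" and A: "compact A" "A \<subseteq> V"
  shows "measure (lborel_on (g ` V)) (g ` A) = vol_factor V g * measure (lborel_on V) A"
proof -
  have gA: "g ` A \<in> sets borel" by (rule borel_compact[OF compact_image_linear[OF g A(1)]])
  have "emeasure (lborel_on (g ` V)) (g ` A) = (\<integral>\<^sup>+y. indicator (g ` A) y \<partial>lborel_on (g ` V))"
    using gA by simp
  also have "\<dots> = ennreal (vol_factor V g) * (\<integral>\<^sup>+x. indicator (g ` A) (g x) \<partial>lborel_on V)"
    by (rule nn_integral_vol_factor[OF g V inj]) (use gA in simp)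
  also have "(\<integral>\<^sup>+x. indicator (g ` A) (g x) \<partial>lborel_on V) = (\<integral>\<^sup>+x. indicator A x \<partial>lborel_on V)"
    by (rule nn_integral_cong_AE, use AE_lborel_on[OF V] in eventually_elim)
      (use inj A(2) in \<open>auto simp: indicator_def inj_on_def\<close>)
  also have "\<dots> = emeasure (lborel_on V) A" using borel_compact[OF A(1)] by simp
  finally show ?thesis
    using vol_factor_pos[OF g V inj] by (simp add: measure_def enn2real_mult less_imp_le)
qed

definition quermass_integrand :: "(real \<Rightarrow> real) \<Rightarrow> (real^'n) set \<Rightarrow> (real^'n) set \<Rightarrow> (real^'n) set \<Rightarrow> ennreal" where
  "quermass_integrand \<phi> K L V = orlicz_mixed_volume \<phi> V (body_proj K V) (body_proj L V) *
     ennreal (measure (lborel_on V) (body_proj K V) powr (- real CARD('n) - 1))"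

text \<open>
  By the preceding lemma, the projections onto \<open>V\<close> are images of projections onto
  \<open>adjoint f ` V\<close> under a map with volume factor \<open>D = vol_factor V (adjoint
  f)\<close>. The mixed volume contributes \<open>D\<close>, the power of the volume contributes
  \<open>D powr (- n - 1)\<close>.
\<close>

lemma quermass_integrand_linear_image:
  fixes K L V :: "(real^'n) set" and f :: "real^'n \<Rightarrow> real^'n"
  assumes \<phi>: "\<phi> \<in> orlicz_functions" and K: "K \<in> origin_bodies" and L: "L \<in> origin_bodies"
    and f: "linear f" and V: "subspace V" "V \<noteq> {0}" and inj: "inj_on (adjoint f) V"
  shows "quermass_integrand \<phi> (f ` K) (f ` L) V
    = ennreal ((1 / vol_factor V (adjoint f)) ^ CARD('n)) * quermass_integrand \<phi> K L (adjoint f ` V)"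
proof -
  let ?W = "adjoint f ` V" and ?g = "\<lambda>x. closest_point V (f x)" and ?n = "CARD('n)"
  define D where "D = vol_factor V (adjoint f)"
  have af: "linear (adjoint f)" by (rule adjoint_linear[OF f])
  have W: "subspace ?W" by (rule linear_subspace_image[OF af V(1)])
  have g: "linear ?g" using linear_compose[OF f linear_closest_point[OF V(1)]] by (simp add: o_def)
  note pa = vol_factor_projected_adjoint[OF f V(1) inj]
  have D: "0 < D" unfolding D_def by (rule vol_factor_pos[OF af V(1) inj])
  have "dim ?W = dim V" using af inj V by (metis dim_image_eq span_eq_iff)
  moreover have "dim V \<noteq> 0" using V subspace_0 by (auto simp: dim_eq_0)
  ultimately obtain s where s: "dim ?W = Suc s" by (metis not0_implies_Suc)
  obtain r where body: "body_in_subspace ?W (body_proj K ?W) r s"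
    by (rule body_in_subspace_body_proj[OF W s K])
  note pK = body_proj_linear_image[OF f V(1), of K] and pL = body_proj_linear_image[OF f V(1), of L]
  have vol: "orlicz_mixed_volume \<phi> V (body_proj (f ` K) V) (body_proj (f ` L) V)
      = ennreal D * orlicz_mixed_volume \<phi> ?W (body_proj K ?W) (body_proj L ?W)"
    using orlicz_mixed_volume_linear_image[OF body g pa(3) body_proj_properties[OF W L] \<phi>]
    unfolding pa(1,2) pK pL D_def .
  have v: "measure (lborel_on V) (body_proj (f ` K) V) = D * measure (lborel_on ?W) (body_proj K ?W)"
    using measure_lborel_on_linear_image[OF g W pa(3) body_proj_properties(1,2)[OF W K]]
    unfolding pa(1,2) pK D_def .
  have powr: "D * (D * m) powr (- real ?n - 1) = (1 / D) ^ ?n * m powr (- real ?n - 1)" if "0 \<le> m" for m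
  proof -
    have "D * D powr (- real ?n - 1) = D powr (- real ?n)"
      using D powr_add[of D 1 "- real ?n - 1"] by simp
    also have "\<dots> = (1 / D) ^ ?n" using D by (simp add: powr_minus powr_realpow inverse_eq_divide power_divide)
    finally show ?thesis using D that by (simp add: powr_mult mult.assoc[symmetric])
  qed
  have rearrange: "ennreal D * X * ennreal ((D * measure (lborel_on ?W) (body_proj K ?W)) powr (- real ?n - 1))
      = ennreal ((1 / D) ^ ?n) * (X * ennreal (measure (lborel_on ?W) (body_proj K ?W) powr (- real ?n - 1)))" for X
  proof -
    have "ennreal D * ennreal ((D * measure (lborel_on ?W) (body_proj K ?W)) powr (- real ?n - 1))
        = ennreal ((1 / D) ^ ?n) * ennreal (measure (lborel_on ?W) (body_proj K ?W) powr (- real ?n - 1))"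
      using D by (simp only: powr[OF measure_nonneg] ennreal_mult''[symmetric] powr_ge_zero)
    from arg_cong[OF this, of "\<lambda>Y. X * Y"] show ?thesis by (simp only: mult_ac)
  qed
  show ?thesis
    unfolding quermass_integrand_def vol v D_def[symmetric]
    by (rule rearrange)
qed


section \<open>Invariance of the Orlicz mixed affine quermassintegrals\<close>

lemma linear_image_origin_bodies:
  fixes f :: "'a::euclidean_space \<Rightarrow> 'a"
  assumes "linear f" "inj f" "K \<in> origin_bodies"
  shows "f ` K \<in> origin_bodies"
  using assms compact_image_linear[of f K] convex_linear_image[of f K] interior_injective_linear_image[of f K]
    linear_0[of f] by (force simp: origin_bodies_def)

text \<open>
  The integral on the left is the supremum of the integrals of the simple functions below the
  integrand. Simple functions are measurable, so the change of variables on the Grassmannian applies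
  to them, and its Jacobian is the factor in \<open>quermass_integrand_linear_image\<close>.
\<close>

lemma quermass_integral_linear_image_le:
  fixes T :: "real^'n \<Rightarrow> real^'n" and J :: "'n set"
  assumes \<phi>: "\<phi> \<in> orlicz_functions" and K: "K \<in> origin_bodies" and L: "L \<in> origin_bodies"
    and J: "J \<noteq> {}" and T: "T \<in> special_linear"
  shows "(\<integral>\<^sup>+V. quermass_integrand \<phi> K L V \<partial>grassmannian_haar (card J))
    \<le> (\<integral>\<^sup>+V. quermass_integrand \<phi> (T ` K) (T ` L) V \<partial>grassmannian_haar (card J))"
proof -
  let ?\<nu> = "grassmannian_haar (card J) :: (real^'n) set measure" and ?M = "transpose (matrix T)"
  have T': "linear T" "det (matrix T) = 1" using T by (auto simp: special_linear_def)
  have detM: "det ?M = 1" by (simp add: det_transpose T')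
  have adj: "adjoint T = (*v) ?M"
    using adjoint_matrix_mult[of "matrix T"] T'(1) by (simp add: matrix_vector_mul)
  have inj: "inj ((*v) ?M)" using detM det_nz_iff_inj[of "(*v) ?M"] by simp
  have haar: "sets ?\<nu> = sets (grassmannian_borel (card J))" "space ?\<nu> = grassmannian (card J)"
    by (simp_all add: grassmannian_haar_eq[OF J])
  have "integral\<^sup>S ?\<nu> g \<le> (\<integral>\<^sup>+V. quermass_integrand \<phi> (T ` K) (T ` L) V \<partial>?\<nu>)"
    if g: "simple_function ?\<nu> g" "g \<le> quermass_integrand \<phi> K L" for g
  proof -
    have gm: "g \<in> borel_measurable (grassmannian_borel (card J))"
      using borel_measurable_simple_function[OF g(1)] haar(1) by (simp cong: measurable_cong_sets)
    have "integral\<^sup>S ?\<nu> g = (\<integral>\<^sup>+V. g V \<partial>?\<nu>)" by (simp add: nn_integral_eq_simple_integral[OF g(1)])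
    also have "\<dots> = (\<integral>\<^sup>+V. ennreal ((1 / vol_factor V ((*v) ?M)) ^ CARD('n)) * g ((*v) ?M ` V) \<partial>?\<nu>)"
      by (rule grassmannian_change_of_variables[OF J _ gm, symmetric]) (simp add: det_transpose T')
    also have "\<dots> \<le> (\<integral>\<^sup>+V. quermass_integrand \<phi> (T ` K) (T ` L) V \<partial>?\<nu>)"
    proof (rule nn_integral_mono)
      fix V :: "(real^'n) set" assume "V \<in> space ?\<nu>"
      then have V: "subspace V" "dim V = card J" using haar(2) by (auto simp: grassmannian_def)
      have "V \<noteq> {0}" using V(2) J by auto
      from quermass_integrand_linear_image[OF \<phi> K L T'(1) V(1) this] inj g(2)
      show "ennreal ((1 / vol_factor V ((*v) ?M)) ^ CARD('n)) * g ((*v) ?M ` V) \<le> quermass_integrand \<phi> (T ` K) (T ` L) V"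
        by (auto simp: adj le_fun_def inj_on_subset intro!: mult_left_mono)
    qed
    finally show ?thesis .
  qed
  then show ?thesis
    unfolding nn_integral_def[of ?\<nu> "\<lambda>V. quermass_integrand \<phi> K L V"] by (intro SUP_least) auto
qed

theorem proposition2p6:
  fixes \<phi> :: "real \<Rightarrow> real" and K L :: "(real^'n) set" and T :: "real^'n \<Rightarrow> real^'n" and j :: nat
  assumes "\<phi> \<in> orlicz_functions"
    and "K \<in> origin_bodies" and "L \<in> origin_bodies"
    and "1 \<le> j" and "j \<le> CARD('n)"
    and "T \<in> special_linear"
  shows "orlicz_affine_quermass \<phi> j (T ` K) (T ` L) = orlicz_affine_quermass \<phi> j K L"
proof -
  obtain J :: "'n set" where J: "card J = j"
    using \<open>j \<le> CARD('n)\<close> by (metis obtain_subset_with_card_n)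
  then have J_ne: "J \<noteq> {}" using \<open>1 \<le> j\<close> by auto
  have T: "linear T" "det (matrix T) = 1" using \<open>T \<in> special_linear\<close> by (auto simp: special_linear_def)
  have injT: "inj T" using T det_nz_iff_inj[of T] by simp
  obtain S where S: "linear S" and ST: "\<And>x. S (T x) = x"
    using linear_injective_isomorphism[OF T(1) injT] by blast
  have S_T: "S ` T ` X = X" for X by (simp add: image_image ST)
  have "det (matrix S) * det (matrix T) = det (matrix (S \<circ> T))"
    using S T(1) by (simp only: matrix_compose det_mul)
  also have "S \<circ> T = id" using ST by (simp add: fun_eq_iff)
  finally have "S \<in> special_linear" using S T(2) by (simp only: special_linear_def mem_Collect_eq det_I matrix_id_mat_1 mult_1_right)
  \<comment> \<open>the inequality for \<open>S\<close> and the images of the bodies is the converse of the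
    inequality for \<open>T\<close>\<close>
  from quermass_integral_linear_image_le[OF \<open>\<phi> \<in> orlicz_functions\<close> linear_image_origin_bodies[OF T(1) injT]
      linear_image_origin_bodies[OF T(1) injT] J_ne this, of K L]
    quermass_integral_linear_image_le[OF \<open>\<phi> \<in> orlicz_functions\<close> _ _ J_ne \<open>T \<in> special_linear\<close>, of K L]
  have "(\<integral>\<^sup>+V. quermass_integrand \<phi> (T ` K) (T ` L) V \<partial>grassmannian_haar j)
      = (\<integral>\<^sup>+V. quermass_integrand \<phi> K L V \<partial>grassmannian_haar j)"
    using \<open>K \<in> origin_bodies\<close> \<open>L \<in> origin_bodies\<close> by (simp add: J S_T)
  then show ?thesis unfolding orlicz_affine_quermass_def quermass_integrand_def Let_def by (simp only:)
qed

end
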